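(* Let $X\subseteq\mathbb R^2$ be a compact 2-dimensional $C^2$ submanifold with boundary, let $\mathbb L$ be a stationary isotropic random lattice, and let $w=(w_1,\dots,w_6)$ with $w_1=w_6=0$. For $\hat V_0(X)=\sum_jw_jN_j(X\cap a\mathbb L)$: (i) $\lim_{a\to0}\big(E\hat V_0(X)-a^{-1}\lim_{b\to0}bE\hat V_0(X)\big)=c_4V_0(X)$, where $\lim_{b\to0}bE\hat V_0(X)=\frac1\pi c_3V_1(X)$. (ii) Consequently $\lim_{a\to0}E\hat V_0(X)$ exists (for all such $X$) iff $(2-\sqrt2)w_2+(-2+2\sqrt2)w_3+(2-\sqrt2)w_5=0$, and then $\hat V_0$ is asymptotically unbiased (for all such $X$) iff $2w_2-2w_5=1$. (iii) If both these equations hold, then $\lim_{a\to0}E\hat V_0(\mathbb R^2\setminus X)=-V_0(X)$, where $\hat V_0(\mathbb R^2\setminus X):=w_2N_5+w_3N_3+w_4N_4+w_5N_2$ with $N_j=N_j(X\cap a\mathbb L)$. (iv) For $\hat V_1(X)=a\sum_jw_jN_j(X\cap a\mathbb L)$, one has $E\hat V_1(X)-\frac1\pi c_3V_1(X)=O(a)$ as $a\to0$, and if $w_2=w_5$ then $E\hat V_1(X)-\frac1\pi c_3V_1(X)=o(a)$.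
   Context: $C=[0,1]^2$, $C_0=\{x_0,x_1,x_2,x_3\}$ with $x_0=(0,0)$, $x_1=(1,0)$, $x_2=(0,1)$, $x_3=(1,1)$. Configuration classes: $\eta_1=\{\emptyset\}$; $\eta_2$ = one-point subsets of $C_0$; $\eta_3$ = adjacent pairs $\{x_0,x_1\},\{x_0,x_2\},\{x_1,x_3\},\{x_2,x_3\}$; $\eta_4=\{\{x_0,x_3\},\{x_1,x_2\}\}$; $\eta_5$ = three-point subsets; $\eta_6=\{C_0\}$. Stationary isotropic random lattice: $\mathbb L=R_v(\mathbb Z^2+c)$ with $c$ uniform on $C$ and $v$ uniform on $[0,2\pi]$ independent, $R_v$ rotation by angle $v$. $N_j(X\cap a\mathbb L)$ is the number of $z\in a\mathbb L$ such that $\{x\in C_0: z+aR_vx\in X\}\in\eta_j$ (terms with weight $0$ are omitted even if the count is infinite). $c_3=4\big((2-\sqrt2)w_2+(-2+2\sqrt2)w_3+(2-\sqrt2)w_5\big)$, $c_4=2w_2-2w_5$. $V_0$ is Euler characteristic, $V_1(X)=\frac12\mathcal H^1(\partial X)$. Asymptotically unbiased means $\lim_{a\to0}E\hat V_0(X)=V_0(X)$. *)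

theory Defs
  imports "HOL-Probability.Probability" "HOL-Library.Landau_Symbols"
begin

text \<open>The plane R^2 is modelled by the type complex: (x,y) corresponds to x + i y.
  Rotation by angle v is multiplication by cis v.\<close>

definition C2_on :: "(complex \<Rightarrow> real) \<Rightarrow> complex set \<Rightarrow> bool" where
  "C2_on f U \<longleftrightarrow>
     (\<exists>Df :: complex \<Rightarrow> (complex \<Rightarrow>\<^sub>L real).
      \<exists>D2f :: complex \<Rightarrow> (complex \<Rightarrow>\<^sub>L (complex \<Rightarrow>\<^sub>L real)).
        (\<forall>x\<in>U. (f has_derivative blinfun_apply (Df x)) (at x)
              \<and> (Df has_derivative blinfun_apply (D2f x)) (at x))
        \<and> continuous_on U D2f)"

text \<open>Compact 2-dimensional C^2 submanifold with boundary of R^2 (equivalently, a compact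
  regular domain with C^2 boundary): near every boundary point, X is the sublevel set
  of a C^2 function with nonvanishing derivative.\<close>

definition C2_domain :: "complex set \<Rightarrow> bool" where
  "C2_domain X \<longleftrightarrow> compact X \<and>
     (\<forall>p\<in>frontier X. \<exists>U f. open U \<and> p \<in> U \<and> C2_on f U \<and>
        (\<forall>x\<in>U. \<exists>D. (f has_derivative D) (at x) \<and> D \<noteq> (\<lambda>_. 0)) \<and>
        X \<inter> U = {x\<in>U. f x \<le> 0})"

text \<open>One-dimensional Hausdorff measure (normalised so that it is length).\<close>

definition hausdorff1 :: "complex set \<Rightarrow> ennreal" where
  "hausdorff1 A = (SUP \<delta>\<in>{0<..}. INF U \<in> {U :: nat \<Rightarrow> complex set.
       A \<subseteq> (\<Union>i. U i) \<and> (\<forall>i. bounded (U i) \<and> diameter (U i) \<le> \<delta>)}.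
         (\<Sum>i. ennreal (diameter (U i))))"

text \<open>Intrinsic volumes: V1 = half the boundary length, V0 = Euler characteristic, taken for
  compact planar sets as number of connected components minus number of holes (bounded
  components of the complement).\<close>

definition V1 :: "complex set \<Rightarrow> real" where
  "V1 X = enn2real (hausdorff1 (frontier X)) / 2"

definition V0 :: "complex set \<Rightarrow> real" where
  "V0 X = real (card (components X)) - real (card {C\<in>components (- X). bounded C})"

definition C0 :: "complex set" where
  "C0 = {0, 1, \<i>, 1 + \<i>}"

definition eta :: "nat \<Rightarrow> complex set set" where
  "eta j = (if j = 1 then {{}}
     else if j = 2 then {{p} | p. p \<in> C0}
     else if j = 3 then {{0, 1}, {0, \<i>}, {1, 1 + \<i>}, {\<i>, 1 + \<i>}}
     else if j = 4 then {{0, 1 + \<i>}, {1, \<i>}}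
     else if j = 5 then {S. S \<subseteq> C0 \<and> card S = 3}
     else if j = 6 then {C0}
     else {})"

definition scaled_lattice :: "real \<Rightarrow> complex \<Rightarrow> real \<Rightarrow> complex set" where
  "scaled_lattice a c v = {of_real a * cis v * (of_int m + \<i> * of_int n + c) | m n. True}"

definition config :: "complex set \<Rightarrow> real \<Rightarrow> real \<Rightarrow> complex \<Rightarrow> complex set" where
  "config X a v z = {x\<in>C0. z + of_real a * cis v * x \<in> X}"

definition Ncount :: "nat \<Rightarrow> complex set \<Rightarrow> real \<Rightarrow> complex \<Rightarrow> real \<Rightarrow> real" where
  "Ncount j X a c v = real (card {z\<in>scaled_lattice a c v. config X a v z \<in> eta j})"

definition lattice_measure :: "(complex \<times> real) measure" where
  "lattice_measure = uniform_measure lborel (cbox 0 (1 + \<i>)) \<Otimes>\<^sub>M uniform_measure lborel {0..2*pi}"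

definition lattice_expect :: "(complex \<Rightarrow> real \<Rightarrow> real) \<Rightarrow> real" where
  "lattice_expect f = integral\<^sup>L lattice_measure (\<lambda>(c, v). f c v)"

text \<open>E hat V_0(X) = E sum_j w_j N_j(X \<inter> aL). Since w_1 = w_6 = 0 is assumed, the
  (possibly infinite) count N_1 contributes nothing.\<close>

definition EV0hat :: "(nat \<Rightarrow> real) \<Rightarrow> complex set \<Rightarrow> real \<Rightarrow> real" where
  "EV0hat w X a = lattice_expect (\<lambda>c v. \<Sum>j\<in>{1..6}. w j * Ncount j X a c v)"

definition c3 :: "(nat \<Rightarrow> real) \<Rightarrow> real" where
  "c3 w = 4 * ((2 - sqrt 2) * w 2 + (-2 + 2 * sqrt 2) * w 3 + (2 - sqrt 2) * w 5)"

definition c4 :: "(nat \<Rightarrow> real) \<Rightarrow> real" where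
  "c4 w = 2 * w 2 - 2 * w 5"

end

theory Submission
  imports Defs
begin

text \<open>The boundary of \<open>X\<close> admits inner and outer tangent balls of a fixed radius \<open>r\<close>. Hence for small
  \<open>a\<close>, whatever the position of the lattice, no cell has a configuration in \<open>\<eta>\<^sub>4\<close>, and the components
  of \<open>X\<close> and of its complement correspond to the components of the set \<open>S\<close> of lattice points in \<open>X\<close>
  and of its complement in the lattice. Euler's formula for \<open>S\<close> in the two triangulations of
  the grid (one for each direction of the diagonals) then expresses \<open>N\<^sub>2\<close>, \<open>N\<^sub>3\<close>, \<open>N\<^sub>5\<close> exactly through
  \<open>V\<^sub>0(X)\<close> and the numbers of pairs in \<open>S\<close> at displacement \<open>0\<close>, along the axes or along the diagonals;
  \<open>V\<^sub>0(X)\<close> enters with opposite signs in \<open>N\<^sub>2\<close> and \<open>N\<^sub>5\<close> and not at all in \<open>N\<^sub>3\<close>.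

  The expected pair counts are rotation averages of the covariogram of \<open>X\<close>, so it remains to expand
  \<open>G(t)\<close>, the area of \<open>{z \<in> X. z + t u \<notin> X}\<close> integrated over all directions \<open>u\<close>. Covering the
  boundary by flat charts gives \<open>G(t) / t \<longrightarrow> 2 L\<close>, where \<open>L\<close> is the boundary length. The error is
  improved to \<open>G(t) = 2 L t + o(t\<^sup>2)\<close> by doubling: \<open>2 G(t) - G(2t)\<close> is the average area of the
  points \<open>z\<close> for which \<open>z, z + t u, z + 2 t u\<close> are alternately inside and outside \<open>X\<close>. Such points
  lie within \<open>O(t\<^sup>2)\<close> of the boundary and force \<open>u\<close> to be within \<open>O(t)\<close> of a tangent direction, so
  that this area is \<open>o(t\<^sup>2)\<close>, and telescoping over \<open>t, t/2, t/4, \<dots>\<close> yields the claim.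

  The disk shows that the conditions in (ii) are necessary.\<close>

section \<open>Tangent balls\<close>

text \<open>Pair counts carry the factor \<open>1 / a\<^sup>2\<close>, so an expansion of
  \<open>G(t)\<close> with error \<open>o(t)\<close> settles only the \<open>1 / a\<close> term, and
  even \<open>O(t\<^sup>2)\<close> would leave an undetermined bounded term beside
  \<open>V0 X\<close>. Flat charts alone give a relative error \<epsilon>. Doubling avoids any
  computation with curvature: what it leaves is an area that the tangent balls control directly.

  On the discrete side, the six-neighbour adjacency of a triangulation serves \<open>X\<close> and
  its complement alike, so holes need no dual adjacency. Besides pair counts, the configuration
  counts involve the triples and quadruples of corners of a cell; the vanishing of \<open>N4\<close>
  and the two Euler relations are just enough to eliminate them. The irrational weights in
  \<open>c3\<close> have one source: the diagonal of a cell has length \<open>sqrt 2\<close>, so its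
  pair count involves \<open>G\<close> at \<open>sqrt 2 * a\<close>.\<close>

definition tball :: "real \<Rightarrow> complex set \<Rightarrow> complex \<Rightarrow> complex \<Rightarrow> bool" where
  "tball r X p n \<longleftrightarrow> norm n = 1 \<and>
     (\<forall>q. (norm (q - p))\<^sup>2 < - (2 * r * (n \<bullet> (q - p))) \<longrightarrow> q \<in> X) \<and>
     (\<forall>q. (norm (q - p))\<^sup>2 < 2 * r * (n \<bullet> (q - p)) \<longrightarrow> q \<notin> X)"

lemma tball_mono:
  assumes "tball r X p n" "0 < r'" "r' \<le> r"
  shows "tball r' X p n"
proof -
  have "r' * t \<le> r * t" if "0 < r' * t" for t :: real
    using that assms(2,3) by (intro mult_right_mono) (auto simp: zero_less_mult_iff)
  moreover have "0 < r' * t" if "y\<^sup>2 < 2 * r' * t" for t y :: real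
    using zero_le_power2[of y] that by linarith
  ultimately have *: "y\<^sup>2 < 2 * r * t" if "y\<^sup>2 < 2 * r' * t" for t y :: real
    using that by fastforce
  show ?thesis unfolding tball_def
  proof (intro conjI allI impI)
    show "norm n = 1" using assms(1) by (simp add: tball_def)
    show "q \<in> X" if "(norm (q - p))\<^sup>2 < - (2 * r' * (n \<bullet> (q - p)))" for q
      using assms(1) *[of "norm (q - p)" "- (n \<bullet> (q - p))"] that by (simp add: tball_def)
    show "q \<notin> X" if "(norm (q - p))\<^sup>2 < 2 * r' * (n \<bullet> (q - p))" for q
      using assms(1) *[of "norm (q - p)" "n \<bullet> (q - p)"] that by (simp add: tball_def)
  qed
qed

lemma linear_complex_inner:
  fixes f :: "complex \<Rightarrow> real"
  assumes "linear f"
  shows "f w = Complex (f 1) (f \<i>) \<bullet> w"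
proof -
  have "w = Re w *\<^sub>R 1 + Im w *\<^sub>R \<i>"
    by (simp add: complex_eq_iff)
  then have "f w = f (Re w *\<^sub>R 1 + Im w *\<^sub>R \<i>)" by simp
  also have "\<dots> = Re w * f 1 + Im w * f \<i>"
    using assms by (simp only: linear_add linear_scale real_scaleR_def)
  finally show ?thesis by (simp add: inner_complex_def mult.commute)
qed

text \<open>\<open>Df\<close> is Lipschitz since \<open>D2f\<close> is bounded on a compact ball.\<close>

lemma C2_on_taylor:
  assumes f: "C2_on f U" and U: "open U" "p \<in> U"
  obtains \<rho> K N where "\<rho> > 0" "K > 0" "cball p \<rho> \<subseteq> U"
    "\<forall>x\<in>cball p \<rho>. (f has_derivative (\<lambda>w. N x \<bullet> w)) (at x)"
    "\<forall>x\<in>cball p \<rho>. \<forall>y\<in>cball p \<rho>. norm (N x - N y) \<le> K * norm (x - y)"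
    "\<forall>x\<in>cball p \<rho>. \<forall>y\<in>cball p \<rho>. \<bar>f y - f x - N x \<bullet> (y - x)\<bar> \<le> K * (norm (y - x))\<^sup>2"
proof -
  obtain Df :: "complex \<Rightarrow> (complex \<Rightarrow>\<^sub>L real)"
    and D2f :: "complex \<Rightarrow> (complex \<Rightarrow>\<^sub>L (complex \<Rightarrow>\<^sub>L real))" where
    DD: "\<forall>x\<in>U. (f has_derivative blinfun_apply (Df x)) (at x) \<and>
        (Df has_derivative blinfun_apply (D2f x)) (at x)"
    and cont: "continuous_on U D2f"
    using f unfolding C2_on_def by (elim exE conjE) (rule that)
  have D: "(f has_derivative blinfun_apply (Df x)) (at x)"
    and D2: "(Df has_derivative blinfun_apply (D2f x)) (at x)" if "x \<in> U" for x
    using DD that by auto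
  obtain \<rho> where \<rho>: "\<rho> > 0" "cball p \<rho> \<subseteq> U"
    using U open_contains_cball by blast
  have "compact (D2f ` cball p \<rho>)"
    using cont \<rho> by (intro compact_continuous_image) (auto intro: continuous_on_subset)
  then obtain K0 where K0: "K0 > 0" "\<And>x. x \<in> cball p \<rho> \<Longrightarrow> norm (D2f x) \<le> K0"
    using compact_imp_bounded bounded_pos by (metis image_eqI)
  have lip: "norm (Df x - Df y) \<le> K0 * norm (x - y)" if "x \<in> cball p \<rho>" "y \<in> cball p \<rho>" for x y
  proof (rule differentiable_bound[of "cball p \<rho>" Df "\<lambda>x. blinfun_apply (D2f x)"])
    show "(Df has_derivative blinfun_apply (D2f x)) (at x within cball p \<rho>)" if "x \<in> cball p \<rho>" for x
      using D2 that \<rho> has_derivative_at_withinI by blast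
    show "onorm (blinfun_apply (D2f x)) \<le> K0" if "x \<in> cball p \<rho>" for x
      using K0(2)[OF that] by (simp add: norm_blinfun.rep_eq)
  qed (use that in auto)
  define N where "N x = Complex (Df x 1) (Df x \<i>)" for x
  have N: "blinfun_apply (Df x) w = N x \<bullet> w" for x w
    unfolding N_def
    by (rule linear_complex_inner) (rule bounded_linear.linear[OF blinfun.bounded_linear_right])
  \<comment> \<open>The norm is bounded by the sum of the two coordinates of
    \<open>N x - N y\<close>; this is the origin of the factor 2.\<close>
  have NL: "norm (N x - N y) \<le> 2 * K0 * norm (x - y)" if "x \<in> cball p \<rho>" "y \<in> cball p \<rho>" for x y
  proof -
    have a: "\<bar>Df x w - Df y w\<bar> \<le> K0 * norm (x - y)" if w: "norm w = 1" for w
    proof -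
      have "norm (Df x w - Df y w) \<le> norm (Df x - Df y) * norm w"
        using norm_blinfun[of "Df x - Df y" w] by (simp add: minus_blinfun.rep_eq)
      then show ?thesis using lip[OF \<open>x \<in> _\<close> \<open>y \<in> _\<close>] w by simp
    qed
    have "norm (N x - N y) \<le> \<bar>Df x 1 - Df y 1\<bar> + \<bar>Df x \<i> - Df y \<i>\<bar>"
      using cmod_le[of "N x - N y"] by (simp add: N_def)
    then show ?thesis using a[of 1] a[of \<i>] by simp
  qed
  have T: "\<bar>f y - f x - N x \<bullet> (y - x)\<bar> \<le> 2 * K0 * (norm (y - x))\<^sup>2"
    if "x \<in> cball p \<rho>" "y \<in> cball p \<rho>" for x y
  proof -
    have seg: "closed_segment x y \<subseteq> cball p \<rho>"
      using that by (intro closed_segment_subset) auto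
    have "norm (f y - f x - Df x (y - x)) \<le> norm (y - x) * (K0 * norm (y - x))"
    proof (rule differentiable_bound_linearization[where S = "closed_segment x y" and f' = "\<lambda>x. blinfun_apply (Df x)"])
      show "x + t *\<^sub>R (y - x) \<in> closed_segment x y" if "t \<in> {0..1}" for t
        using that by (auto simp: closed_segment_def algebra_simps intro!: exI[of _ t])
      show "(f has_derivative blinfun_apply (Df z)) (at z within closed_segment x y)"
        if "z \<in> closed_segment x y" for z
        using D that seg \<rho> has_derivative_at_withinI by blast
      show "onorm (blinfun_apply (Df z) - blinfun_apply (Df x)) \<le> K0 * norm (y - x)"
        if "z \<in> closed_segment x y" for z
      proof -
        have "onorm (blinfun_apply (Df z) - blinfun_apply (Df x)) = norm (Df z - Df x)"
          by (simp add: norm_blinfun.rep_eq minus_blinfun.rep_eq fun_diff_def)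
        also have "\<dots> \<le> K0 * norm (z - x)"
          using lip[of z x] seg that \<open>x \<in> cball p \<rho>\<close> by blast
        also have "\<dots> \<le> K0 * norm (y - x)"
          using K0(1) segment_bound1[OF that] by (intro mult_left_mono) auto
        finally show ?thesis .
      qed
    qed auto
    also have "\<dots> \<le> 2 * K0 * (norm (y - x))\<^sup>2"
      using K0(1) by (simp add: power2_eq_square algebra_simps)
    finally show ?thesis by (simp add: N)
  qed
  show thesis
    by (rule that[of \<rho> "2 * K0" N]) (use \<rho> K0 NL T D in \<open>auto simp flip: N simp: subset_iff\<close>)
qed

text \<open>In a tangent ball at \<open>q\<close> the quadratic Taylor error is at most
  \<open>2 * K * r\<close> times the normal height of the point, while the gradient contributes at
  least \<open>m\<close> times that height. For \<open>r\<close> small against \<open>m / K\<close>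
  the linear term decides the sign of \<open>f\<close>. The constants depend on \<open>p\<close>
  only, so one radius serves all boundary points near \<open>p\<close>.\<close>

lemma C2_local_tball:
  assumes "closed X" and p: "p \<in> U" "open U" "p \<in> frontier X" and f: "C2_on f U"
    and D0: "\<And>x. x \<in> U \<Longrightarrow> \<exists>D. (f has_derivative D) (at x) \<and> D \<noteq> (\<lambda>_. 0)"
    and X: "X \<inter> U = {x\<in>U. f x \<le> 0}"
  shows "\<exists>e>0. \<exists>r>0. \<forall>q\<in>ball p e \<inter> frontier X. \<exists>n. tball r X q n"
proof -
  obtain \<rho> K N where \<rho>: "\<rho> > 0" "K > 0" "cball p \<rho> \<subseteq> U"
    and D': "\<forall>x\<in>cball p \<rho>. (f has_derivative (\<lambda>w. N x \<bullet> w)) (at x)"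
    and NL': "\<forall>x\<in>cball p \<rho>. \<forall>y\<in>cball p \<rho>. norm (N x - N y) \<le> K * norm (x - y)"
    and T': "\<forall>x\<in>cball p \<rho>. \<forall>y\<in>cball p \<rho>. \<bar>f y - f x - N x \<bullet> (y - x)\<bar> \<le> K * (norm (y - x))\<^sup>2"
    by (rule C2_on_taylor[OF f p(2,1)]) (rule that)
  note D = D'[rule_format] and NL = NL'[rule_format] and T = T'[rule_format]
  have Np: "N p \<noteq> 0"
  proof
    assume "N p = 0"
    then have "(\<lambda>w. N p \<bullet> w) = (\<lambda>_. 0)" by auto
    then have "(f has_derivative (\<lambda>_. 0)) (at p)"
      using D[of p] \<rho> by (metis centre_in_cball less_imp_le)
    then show False
      using D0[OF p(1)] has_derivative_unique by blast
  qed
  \<comment> \<open>Half of the gradient at \<open>p\<close> survives as a lower bound on all of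
    \<open>ball p e\<close>. Moreover \<open>e + 2 * r\<close> is below \<rho>, so tangent balls at
    points of \<open>ball p e\<close> stay where the Taylor estimate holds.\<close>
  define m where "m = norm (N p) / 2"
  have m: "m > 0" using Np by (simp add: m_def)
  define e where "e = min (\<rho> / 2) (m / K)"
  have e: "e > 0" "e \<le> \<rho> / 2" "K * e \<le> m" using \<rho> m by (auto simp: e_def field_simps min_def)
  define r where "r = min (\<rho> / 8) (m / (4 * K))"
  have r: "r > 0" "r \<le> \<rho> / 8" "4 * K * r \<le> m" using \<rho> m by (auto simp: r_def field_simps min_def)
  have "\<exists>n. tball r X q n" if q: "q \<in> ball p e" "q \<in> frontier X" for q
  proof -
    have qc: "q \<in> cball p \<rho>" "q \<in> U" using q e \<rho> by auto
    have NQ: "norm (N q) \<ge> m"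
    proof -
      have "norm (N p - N q) \<le> K * norm (p - q)" using NL[OF _ qc(1)] \<rho> by simp
      also have "\<dots> \<le> K * e" using q \<rho> by (intro mult_left_mono) (auto simp: dist_norm)
      finally have "norm (N p - N q) \<le> m" using e by simp
      moreover have "norm (N p) \<le> norm (N q) + norm (N p - N q)"
        by (metis add.commute norm_triangle_sub)
      ultimately show ?thesis by (simp add: m_def)
    qed
    have fq: "f q = 0"
    proof (rule ccontr)
      assume "f q \<noteq> 0"
      have "q \<in> X" using q \<open>closed X\<close> by (simp add: frontier_def)
      then have neg: "f q < 0" using X qc \<open>f q \<noteq> 0\<close> by force
      have "isCont f q" using D[OF qc(1)] has_derivative_continuous by blast
      then have "\<forall>\<^sub>F y in at q. f y < 0"
        using neg by (simp add: continuous_at order_tendsto_iff)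
      then have "\<forall>\<^sub>F y in nhds q. f y < 0" using neg by (simp add: eventually_nhds_conv_at)
      moreover have "\<forall>\<^sub>F y in nhds q. y \<in> U" using p(2) qc by (simp add: eventually_nhds_in_open)
      ultimately have "\<forall>\<^sub>F y in nhds q. y \<in> X"
        by eventually_elim (use X in force)
      then have "q \<in> interior X" unfolding eventually_nhds interior_def by blast
      then show False using q by (simp add: frontier_def)
    qed
    define n where "n = N q /\<^sub>R norm (N q)"
    have N0: "N q \<noteq> 0" using NQ m by auto
    have nn: "norm n = 1" using N0 by (simp add: n_def)
    have Nn: "N q \<bullet> w = norm (N q) * (n \<bullet> w)" for w
      using N0 by (simp add: n_def)
    have near: "y \<in> cball p \<rho>" if "(norm (y - q))\<^sup>2 < 2 * r * \<bar>n \<bullet> (y - q)\<bar>" for y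
    proof -
      have "\<bar>n \<bullet> (y - q)\<bar> \<le> norm (y - q)" using Cauchy_Schwarz_ineq2[of n "y - q"] nn by simp
      then have "2 * r * \<bar>n \<bullet> (y - q)\<bar> \<le> 2 * r * norm (y - q)" using r by simp
      then have "norm (y - q) * norm (y - q) < 2 * r * norm (y - q)"
        using that by (simp add: power2_eq_square)
      then have "norm (y - q) < 2 * r"
        by (metis mult_less_cancel_right norm_ge_zero not_less)
      then have "dist p y < e + 2 * r" using q dist_triangle[of p y q] by (simp add: dist_norm norm_minus_commute)
      then show ?thesis using e r by simp
    qed
    have "tball r X q n" unfolding tball_def
    proof (intro conjI allI impI)
      fix y assume y: "(norm (y - q))\<^sup>2 < - (2 * r * (n \<bullet> (y - q)))"
      let ?t = "- (n \<bullet> (y - q))"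
      have y2: "(norm (y - q))\<^sup>2 < 2 * r * ?t" using y by simp
      then have tp: "?t > 0" using r zero_le_power2[of "norm (y - q)"]
        by (smt (verit, best) mult_nonneg_nonpos)
      have yc: "y \<in> cball p \<rho>" using near[of y] y2 tp by simp
      have "f y \<le> N q \<bullet> (y - q) + K * (norm (y - q))\<^sup>2" using T[OF qc(1) yc] fq by linarith
      also have "\<dots> \<le> - (m * ?t) + K * (2 * r * ?t)"
        using y2 \<rho>(2) mult_right_mono[OF NQ, of ?t] tp Nn[of "y - q"]
          mult_left_mono[of "(norm (y - q))\<^sup>2" "2 * r * ?t" K] by (auto simp: algebra_simps)
      also have "\<dots> = (2 * K * r - m) * ?t" by (simp add: algebra_simps)
      also have "\<dots> \<le> 0" using r tp m by (intro mult_nonpos_nonneg) (auto simp: algebra_simps)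
      finally show "y \<in> X" using X yc \<rho> by blast
    next
      fix y assume y2: "(norm (y - q))\<^sup>2 < 2 * r * (n \<bullet> (y - q))"
      let ?t = "n \<bullet> (y - q)"
      have tp: "?t > 0" using y2 r zero_le_power2[of "norm (y - q)"]
        by (smt (verit, best) mult_nonneg_nonpos)
      have yc: "y \<in> cball p \<rho>" using near[of y] y2 tp by simp
      have "0 < (m - 2 * K * r) * ?t" using r tp m by (intro mult_pos_pos) (auto simp: algebra_simps)
      also have "\<dots> = m * ?t - K * (2 * r * ?t)" by (simp add: algebra_simps)
      also have "\<dots> \<le> N q \<bullet> (y - q) - K * (norm (y - q))\<^sup>2"
        using y2 \<rho>(2) mult_right_mono[OF NQ, of ?t] tp Nn[of "y - q"]
          mult_left_mono[of "(norm (y - q))\<^sup>2" "2 * r * ?t" K] by (auto simp: algebra_simps)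
      also have "\<dots> \<le> f y" using T[OF qc(1) yc] fq by linarith
      finally have "f y > 0" .
      then show "y \<notin> X" using X yc \<rho> by force
    qed (use nn in auto)
    then show ?thesis by blast
  qed
  then show ?thesis using e r by blast
qed

lemma C2_domain_tball:
  assumes "C2_domain X"
  obtains r where "r > 0" "\<And>p. p \<in> frontier X \<Longrightarrow> \<exists>n. tball r X p n"
proof -
  have X: "compact X" using assms by (simp add: C2_domain_def)
  have "\<forall>p\<in>frontier X. \<exists>e r. e > 0 \<and> r > 0 \<and> (\<forall>q\<in>ball p e \<inter> frontier X. \<exists>n. tball r X q n)"
  proof
    fix p assume p: "p \<in> frontier X"
    then have "\<exists>U f. open U \<and> p \<in> U \<and> C2_on f U \<and>
        (\<forall>x\<in>U. \<exists>D. (f has_derivative D) (at x) \<and> D \<noteq> (\<lambda>_. 0)) \<and> X \<inter> U = {x\<in>U. f x \<le> 0}"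
      using assms by (simp add: C2_domain_def)
    then obtain U f where U: "open U" "p \<in> U" "C2_on f U"
      "\<forall>x\<in>U. \<exists>D. (f has_derivative D) (at x) \<and> D \<noteq> (\<lambda>_. 0)" "X \<inter> U = {x\<in>U. f x \<le> 0}"
      by (elim exE conjE) (rule that)
    show "\<exists>e r. e > 0 \<and> r > 0 \<and> (\<forall>q\<in>ball p e \<inter> frontier X. \<exists>n. tball r X q n)"
      using C2_local_tball[OF compact_imp_closed[OF X] U(2,1) p U(3) _ U(5)] U(4) by auto
  qed
  then obtain E R where ER: "\<And>p. p \<in> frontier X \<Longrightarrow> E p > 0 \<and> R p > 0 \<and>
      (\<forall>q\<in>ball p (E p) \<inter> frontier X. \<exists>n. tball (R p) X q n)" by metis
  have "compact (frontier X)" using X by (rule compact_frontier)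
  then obtain P where P: "P \<subseteq> frontier X" "finite P" "frontier X \<subseteq> (\<Union>p\<in>P. ball p (E p))"
  proof (rule compactE_image)
    show "frontier X \<subseteq> (\<Union>p\<in>frontier X. ball p (E p))" using ER by force
  qed (auto intro: that)
  \<comment> \<open>The entry 1 keeps \<open>Min\<close> meaningful when the frontier, and with it
    \<open>P\<close>, is empty.\<close>
  define r where "r = Min (insert 1 (R ` P))"
  have r: "r > 0" "\<And>p. p \<in> P \<Longrightarrow> r \<le> R p"
    using P ER by (auto simp: r_def subset_iff)
  show thesis
  proof (rule that[OF r(1)])
    fix q assume q: "q \<in> frontier X"
    then obtain p where p: "p \<in> P" "q \<in> ball p (E p)" using P by blast
    then obtain n where "tball (R p) X q n" using ER[of p] P q by blast
    then show "\<exists>n. tball r X q n" using tball_mono r p by blast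
  qed
qed

text \<open>Completing the square: the inequalities in \<open>tball\<close> describe the open balls
  of radius \<open>r\<close> touching at \<open>p\<close>, centred at
  \<open>p + r *\<^sub>R n\<close> (outside \<open>X\<close>) and at
  \<open>p - r *\<^sub>R n\<close> (inside).\<close>

lemma tball_ineq_iff:
  fixes d n :: complex
  assumes "norm n = 1" "0 < r"
  shows "(norm d)\<^sup>2 < 2 * r * (n \<bullet> d) \<longleftrightarrow> norm (d - r *\<^sub>R n) < r"
proof -
  have "(norm (d - r *\<^sub>R n))\<^sup>2 = (norm d)\<^sup>2 - 2 * r * (n \<bullet> d) + r\<^sup>2 * (norm n)\<^sup>2"
    by (simp only: power2_norm_eq_inner) (simp add: algebra_simps inner_commute power2_eq_square)
  then have eq: "(norm d)\<^sup>2 < 2 * r * (n \<bullet> d) \<longleftrightarrow> (norm (d - r *\<^sub>R n))\<^sup>2 < r\<^sup>2"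
    using assms by auto
  show ?thesis unfolding eq
    using assms by (metis norm_ge_zero power2_less_imp_less less_imp_le power_strict_mono pos2)
qed

text \<open>The two balls on the inside at \<open>p\<close> and on the outside at \<open>q\<close> are disjoint, which bounds
  the distance of their centres from below; add this to the bound with \<open>p\<close> and \<open>q\<close> exchanged.\<close>

lemma tball_normal_lipschitz:
  assumes p: "tball r X p n" and q: "tball r X q m" and r: "r > 0"
  shows "norm (n - m) \<le> norm (p - q) / r"
proof -
  have *: "2 * r \<le> norm ((q - p) + r *\<^sub>R (n + m))" if p: "tball r X p n" and q: "tball r X q m" for p q n m
  proof (rule ccontr)
    assume less: "\<not> ?thesis"
    \<comment> \<open>The midpoint of the two centres lies in both balls as soon as these centres
      are closer than \<open>2 * r\<close>.\<close>
    define x where "x = (1/2) *\<^sub>R ((p - r *\<^sub>R n) + (q + r *\<^sub>R m))"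
    have n: "norm n = 1" "norm m = 1" using p q by (auto simp: tball_def)
    have "(x - p) - r *\<^sub>R (- n) = (1/2) *\<^sub>R ((q - p) + r *\<^sub>R (n + m))"
      "(x - q) - r *\<^sub>R m = - ((1/2) *\<^sub>R ((q - p) + r *\<^sub>R (n + m)))"
      by (auto simp: x_def algebra_simps scaleR_2[symmetric] complex_eq_iff)
    then have "norm ((x - p) - r *\<^sub>R (- n)) < r" "norm ((x - q) - r *\<^sub>R m) < r"
      using less by (auto simp only: norm_minus_cancel norm_scaleR)
    then have "(norm (x - p))\<^sup>2 < 2 * r * ((- n) \<bullet> (x - p))" "(norm (x - q))\<^sup>2 < 2 * r * (m \<bullet> (x - q))"
      using tball_ineq_iff[of "- n" r "x - p"] tball_ineq_iff[of m r "x - q"] n r by auto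
    then show False using p q by (auto simp: tball_def)
  qed
  have n: "norm n = 1" "norm m = 1" using p q by (auto simp: tball_def)
  have a: "2 * r \<le> norm ((q - p) + r *\<^sub>R (n + m))" using *[OF p q] .
  have b: "2 * r \<le> norm ((p - q) + r *\<^sub>R (n + m))" using *[OF q p] by (simp add: add.commute)
  \<comment> \<open>Parallelogram law, used twice: terms mixing \<open>q - p\<close> with
    \<open>n + m\<close> cancel in the sum, and \<open>norm (n + m)\<close> is then traded for
    \<open>norm (n - m)\<close>.\<close>
  have "2 * (2 * r)\<^sup>2 \<le> (norm ((q - p) + r *\<^sub>R (n + m)))\<^sup>2 + (norm ((p - q) + r *\<^sub>R (n + m)))\<^sup>2"
    using power_mono[OF a, of 2] power_mono[OF b, of 2] r by simp
  also have "\<dots> = 2 * (norm (p - q))\<^sup>2 + 2 * r\<^sup>2 * (norm (n + m))\<^sup>2"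
    by (simp only: power2_norm_eq_inner) (simp add: algebra_simps inner_commute power2_eq_square)
  also have "(norm (n + m))\<^sup>2 = 2 * (norm n)\<^sup>2 + 2 * (norm m)\<^sup>2 - (norm (n - m))\<^sup>2"
    by (simp only: power2_norm_eq_inner) (simp add: algebra_simps inner_commute)
  finally have "r\<^sup>2 * (norm (n - m))\<^sup>2 \<le> (norm (p - q))\<^sup>2"
    using n by (simp add: algebra_simps power2_eq_square)
  then have "(r * norm (n - m))\<^sup>2 \<le> (norm (p - q))\<^sup>2" by (simp add: power_mult_distrib)
  then have "r * norm (n - m) \<le> norm (p - q)" by (rule power2_le_imp_le) simp
  then show ?thesis using r by (simp add: field_simps)
qed

text \<open>The two-sided ball condition with a single radius is the form in which C2 regularity
  enters all geometric estimates.\<close>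

locale smooth_domain =
  fixes X :: "complex set" and r :: real
  assumes closed: "closed X" and bounded: "bounded X" and r: "r > 0"
    and tball: "\<And>p. p \<in> frontier X \<Longrightarrow> \<exists>n. tball r X p n"
begin

lemma compact_frontier_X: "compact (frontier X)"
  by (intro compact_frontier) (simp add: compact_eq_bounded_closed closed bounded)

lemma frontier_in: "p \<in> frontier X \<Longrightarrow> p \<in> X"
  using closed by (simp add: frontier_def)

text \<open>A path from \<open>z\<close> in direction \<open>w\<close> that leaves \<open>X\<close>
  has a first exit point \<open>q\<close> on the frontier. The normal at \<open>q\<close> differs
  from \<open>n\<close> by at most \<open>2 * \<eta> / r\<close>, hence by at most
  \<open>\<epsilon> / 2\<close>, so \<open>w\<close> still points inwards at \<open>q\<close> with
  half of the margin, and the inner ball at \<open>q\<close> contains the path just after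
  \<open>q\<close>.\<close>

lemma down_cone:
  assumes p: "tball r X p n" "0 < \<epsilon>" "4 * \<eta> \<le> \<epsilon> * r"
    and z: "z \<in> X" "norm (z - p) \<le> \<eta>" and w: "norm w \<le> \<eta>" "n \<bullet> w \<le> - (\<epsilon> * norm w)"
  shows "z + w \<in> X"
proof (rule ccontr)
  assume out: "z + w \<notin> X"
  then have w0: "w \<noteq> 0" using z by auto
  \<comment> \<open>\<open>T\<close> collects the times outside \<open>X\<close>. Its infimum
    \<open>t\<close> is not attained, because the complement of \<open>X\<close> is open; the
    contradiction is that \<open>X\<close> is not left immediately after \<open>t\<close>
    either.\<close>
  define T where "T = {\<tau>. 0 \<le> \<tau> \<and> z + \<tau> *\<^sub>R w \<notin> X}"
  define t where "t = Inf T"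
  have T1: "1 \<in> T" "bdd_below T" using out by (auto simp: T_def bdd_below_def)
  have t: "0 \<le> t" unfolding t_def by (rule cInf_greatest) (use T1(1) in blast, simp add: T_def)
  have t1: "t \<le> 1" unfolding t_def by (rule cInf_lower[OF T1])
  have lower: "\<tau> \<in> T \<Longrightarrow> t \<le> \<tau>" for \<tau> using T1 by (simp add: t_def cInf_lower)
  define q where "q = z + t *\<^sub>R w"
  have qX: "q \<in> X"
  proof (rule ccontr)
    assume qX: "q \<notin> X"
    then have tp: "t > 0" using t z by (cases "t = 0") (auto simp: q_def)
    have "open (- X)" using closed by auto
    then obtain e where e: "e > 0" "ball q e \<subseteq> - X" using qX open_contains_ball by blast
    define d where "d = min t (e / (2 * norm w))"
    have d: "0 < d" "d \<le> t" "d * norm w < e"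
      using tp e w0 by (auto simp: d_def min_def field_simps)
    have "dist q (z + (t - d) *\<^sub>R w) = d * norm w"
      using d by (simp add: q_def dist_norm algebra_simps)
    then have "z + (t - d) *\<^sub>R w \<in> ball q e" using d by simp
    then have "z + (t - d) *\<^sub>R w \<notin> X" using e by blast
    then show False using lower[of "t - d"] d by (auto simp: T_def)
  qed
  have "\<exists>\<delta>>0. \<forall>\<tau>\<in>{t..<t + \<delta>}. z + \<tau> *\<^sub>R w \<in> X"
  proof (cases "q \<in> interior X")
    case True
    then obtain e where e: "e > 0" "ball q e \<subseteq> X" by (meson mem_interior)
    have "z + \<tau> *\<^sub>R w \<in> X" if "\<tau> \<in> {t..<t + e / norm w}" for \<tau>
    proof -
      have "q - (z + \<tau> *\<^sub>R w) = (t - \<tau>) *\<^sub>R w" by (simp add: q_def algebra_simps)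
      then have "dist q (z + \<tau> *\<^sub>R w) = (\<tau> - t) * norm w" using that by (simp add: dist_norm)
      also have "\<dots> < e" using that w0 by (simp add: field_simps)
      finally have "z + \<tau> *\<^sub>R w \<in> ball q e" by simp
      then show ?thesis using e by blast
    qed
    then show ?thesis using e w0 by (intro exI[of _ "e / norm w"]) simp
  next
    case False
    then have "q \<in> frontier X" using qX closed by (simp add: frontier_def)
    then obtain m where m: "tball r X q m" using tball by blast
    have qp: "norm (p - q) \<le> 2 * \<eta>"
    proof -
      have "norm (t *\<^sub>R w) \<le> norm w" using t t1 by (simp add: mult_left_le_one_le)
      then show ?thesis using z w norm_triangle_ineq[of "z - p" "t *\<^sub>R w"]
        by (simp add: q_def norm_minus_commute algebra_simps)
    qed
    have "m \<bullet> w = n \<bullet> w - (n - m) \<bullet> w" by (simp add: inner_diff_left)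
    also have "\<dots> \<le> - (\<epsilon> * norm w) + norm (n - m) * norm w"
      using w Cauchy_Schwarz_ineq2[of "n - m" w] by linarith
    also have "norm (n - m) * norm w \<le> (\<epsilon> / 2) * norm w"
    proof (rule mult_right_mono)
      have "norm (n - m) \<le> norm (p - q) / r" by (rule tball_normal_lipschitz[OF p(1) m r])
      also have "\<dots> \<le> \<epsilon> / 2" using qp p r by (simp add: field_simps)
      finally show "norm (n - m) \<le> \<epsilon> / 2" .
    qed simp
    finally have mw: "m \<bullet> w \<le> - (\<epsilon> / 2 * norm w)" by simp
    \<comment> \<open>Up to this time the squared distance from \<open>q\<close>, quadratic in
      elapsed time, stays below the linear term \<open>2 * r * (\<epsilon> / 2)\<close> times the
      length travelled.\<close>
    define \<delta> where "\<delta> = r * \<epsilon> / norm w"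
    have \<delta>: "\<delta> > 0" using r p w0 by (simp add: \<delta>_def)
    have "z + \<tau> *\<^sub>R w \<in> X" if "\<tau> \<in> {t..<t + \<delta>}" for \<tau>
    proof (cases "\<tau> = t")
      case True then show ?thesis using qX by (simp add: q_def)
    next
      case False
      then have s: "0 < \<tau> - t" "(\<tau> - t) * norm w < r * \<epsilon>"
        using that w0 by (auto simp: \<delta>_def field_simps)
      have d: "z + \<tau> *\<^sub>R w - q = (\<tau> - t) *\<^sub>R w" by (simp add: q_def algebra_simps)
      have "(norm (z + \<tau> *\<^sub>R w - q))\<^sup>2 = ((\<tau> - t) * norm w) * ((\<tau> - t) * norm w)"
        using s unfolding d by (simp add: power2_eq_square)
      also have "\<dots> < (r * \<epsilon>) * ((\<tau> - t) * norm w)"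
        using s w0 by (intro mult_strict_right_mono) auto
      also have "\<dots> = 2 * r * (\<tau> - t) * (\<epsilon> / 2 * norm w)" by simp
      also have "\<dots> \<le> 2 * r * (\<tau> - t) * (- (m \<bullet> w))"
        using mw s r by (intro mult_left_mono) auto
      also have "\<dots> = - (2 * r * (m \<bullet> (z + \<tau> *\<^sub>R w - q)))" unfolding d by simp
      finally show ?thesis using m unfolding tball_def by blast
    qed
    then show ?thesis using \<delta> by blast
  qed
  then obtain \<delta> where \<delta>: "\<delta> > 0" "\<And>\<tau>. \<tau> \<in> {t..<t + \<delta>} \<Longrightarrow> z + \<tau> *\<^sub>R w \<in> X" by blast
  have "t + \<delta> \<le> t" unfolding t_def
  proof (rule cInf_greatest)
    fix \<tau> assume "\<tau> \<in> T"
    then have "t \<le> \<tau>" "z + \<tau> *\<^sub>R w \<notin> X" using lower by (auto simp: T_def)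
    then show "Inf T + \<delta> \<le> \<tau>" using \<delta>(2)[of \<tau>] by (force simp: t_def[symmetric])
  qed (use T1 in auto)
  then show False using \<delta> by simp
qed

end

text \<open>Stated for an arbitrary set so that it applies to the compact \<open>X\<close> and to
  its unbounded open complement alike; from here on the two are treated symmetrically.\<close>

definition cone_cond :: "real \<Rightarrow> complex set \<Rightarrow> bool" where
  "cone_cond \<eta> Y \<longleftrightarrow> (\<forall>p\<in>frontier Y. \<exists>n. norm n = 1 \<and>
     (\<forall>z w. z \<in> Y \<longrightarrow> norm (z - p) \<le> \<eta> \<longrightarrow> norm w \<le> \<eta> \<longrightarrow> n \<bullet> w \<le> - (norm w / 2) \<longrightarrow> z + w \<in> Y))"

text \<open>The value \<open>r / 8\<close> is the largest one allowed by \<open>down_cone\<close>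
  with opening \<open>1/2\<close>. For the complement the normal is reversed: if
  \<open>z + w\<close> were in \<open>X\<close>, going back by \<open>- w\<close> would put
  \<open>z\<close> in \<open>X\<close>. The base point is then up to twice as far from
  \<open>p\<close>, which costs another factor 2.\<close>

lemma (in smooth_domain) cone_cond: "cone_cond (r / 16) X" "cone_cond (r / 16) (- X)"
proof -
  have A: "\<exists>n. norm n = 1 \<and> (\<forall>z w. z \<in> X \<longrightarrow> norm (z - p) \<le> r / 8 \<longrightarrow> norm w \<le> r / 8 \<longrightarrow>
       n \<bullet> w \<le> - (norm w / 2) \<longrightarrow> z + w \<in> X)" if p: "p \<in> frontier X" for p
  proof -
    obtain n where n: "tball r X p n" using tball p by blast
    show ?thesis
      using n down_cone[OF n, of "1/2" "r/8"] r by (intro exI[of _ n]) (auto simp: tball_def)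
  qed
  show "cone_cond (r / 16) X"
    unfolding cone_cond_def
  proof
    fix p assume "p \<in> frontier X"
    from A[OF this] obtain n where n: "norm n = 1" "\<And>z w. z \<in> X \<Longrightarrow> norm (z - p) \<le> r / 8 \<Longrightarrow> norm w \<le> r / 8 \<Longrightarrow>
       n \<bullet> w \<le> - (norm w / 2) \<Longrightarrow> z + w \<in> X" by metis
    show "\<exists>n. norm n = 1 \<and> (\<forall>z w. z \<in> X \<longrightarrow> norm (z - p) \<le> r / 16 \<longrightarrow> norm w \<le> r / 16 \<longrightarrow>
         n \<bullet> w \<le> - (norm w / 2) \<longrightarrow> z + w \<in> X)"
      using n r by (intro exI[of _ n]) force
  qed
  show "cone_cond (r / 16) (- X)"
    unfolding cone_cond_def
  proof
    fix p assume "p \<in> frontier (- X)"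
    then have "p \<in> frontier X" by (simp add: frontier_complement)
    from A[OF this] obtain n where n: "norm n = 1" "\<And>z w. z \<in> X \<Longrightarrow> norm (z - p) \<le> r / 8 \<Longrightarrow> norm w \<le> r / 8 \<Longrightarrow>
       n \<bullet> w \<le> - (norm w / 2) \<Longrightarrow> z + w \<in> X" by metis
    have "z + w \<in> - X" if "z \<in> - X" "norm (z - p) \<le> r / 16" "norm w \<le> r / 16" "(- n) \<bullet> w \<le> - (norm w / 2)" for z w
    proof
      assume "z + w \<in> X"
      moreover have "norm (z + w - p) \<le> r / 8"
        using that norm_triangle_ineq[of "z - p" w] by (simp add: algebra_simps)
      ultimately have "(z + w) + (- w) \<in> X"
        using n(2)[of "z + w" "- w"] that r by simp
      then show False using that by simp
    qed
    then show "\<exists>n. norm n = 1 \<and> (\<forall>z w. z \<in> - X \<longrightarrow> norm (z - p) \<le> r / 16 \<longrightarrow> norm w \<le> r / 16 \<longrightarrow>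
         n \<bullet> w \<le> - (norm w / 2) \<longrightarrow> z + w \<in> - X)"
      using n(1) by (intro exI[of _ "- n"]) auto
  qed
qed

section \<open>Boundary charts with small slope\<close>

lemma inner_rotated:
  assumes "norm e = 1"
  shows "(\<i> * e) \<bullet> (e * Complex x y) = y" "norm (e * Complex x y) \<le> \<bar>x\<bar> + \<bar>y\<bar>"
    "norm (e * Complex x y) = sqrt (x\<^sup>2 + y\<^sup>2)"
proof -
  have "(Re e)\<^sup>2 + (Im e)\<^sup>2 = 1" using assms by (metis cmod_power2 one_power2)
  then have *: "y = y * ((Re e)\<^sup>2 + (Im e)\<^sup>2)" by simp
  show "(\<i> * e) \<bullet> (e * Complex x y) = y"
    by (subst (2) *) (simp add: inner_complex_def power2_eq_square algebra_simps)
  show "norm (e * Complex x y) \<le> \<bar>x\<bar> + \<bar>y\<bar>"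
    using cmod_le[of "Complex x y"] assms by (simp add: norm_mult)
  show "norm (e * Complex x y) = sqrt (x\<^sup>2 + y\<^sup>2)" using assms by (simp add: norm_mult complex_norm)
qed

text \<open>Coordinates with origin \<open>p\<close>, first axis \<open>e\<close> and second axis
  \<open>\<i> * e\<close>, in which \<open>X\<close> is the region below the graph of
  \<open>g\<close> on a square of half side \<open>s\<close>. The function \<open>g\<close> is
  total, Lipschitz and bounded on the whole line, which keeps measurability and continuity simple;
  only its values on \<open>\<bar>x\<bar> \<le> s\<close> describe \<open>X\<close>. The bound
  \<open>s / 2\<close> keeps the graph away from the top and bottom of the square.\<close>

definition chart :: "real \<Rightarrow> real \<Rightarrow> complex set \<Rightarrow> complex \<Rightarrow> complex \<Rightarrow> (real \<Rightarrow> real) \<Rightarrow> bool" where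
  "chart \<epsilon> s X p e g \<longleftrightarrow> norm e = 1 \<and> (\<forall>x. \<bar>g x\<bar> \<le> s / 2) \<and> (\<forall>x x'. \<bar>g x - g x'\<bar> \<le> \<epsilon> * \<bar>x - x'\<bar>) \<and>
     (\<forall>x y. \<bar>x\<bar> \<le> s \<longrightarrow> \<bar>y\<bar> \<le> s \<longrightarrow> (p + e * Complex x y \<in> X \<longleftrightarrow> y \<le> g x))"

lemma (in smooth_domain) chart_exists:
  assumes \<epsilon>: "0 < \<epsilon>" "\<epsilon> \<le> 1/8"
  obtains s where "s > 0" "\<And>p. p \<in> frontier X \<Longrightarrow> \<exists>e g. chart \<epsilon> s X p e g"
proof -
  \<comment> \<open>Chosen so that \<open>down_cone\<close> applies with opening
    \<open>\<epsilon> / 2\<close> and radius \<open>4 * s\<close>, which covers all moves within the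
    square.\<close>
  define s where "s = \<epsilon> * r / 32"
  have s: "s > 0" "4 * (4 * s) = \<epsilon> / 2 * r" "s \<le> r / 256"
    using \<epsilon> r by (auto simp: s_def field_simps)
  have "\<exists>e g. chart \<epsilon> s X p e g" if pf: "p \<in> frontier X" for p
  proof -
    obtain n where n: "tball r X p n" using tball pf by blast
    define e where "e = n / \<i>"
    have ne: "n = \<i> * e" by (simp add: e_def)
    have e1: "norm e = 1" using n by (simp add: e_def norm_mult tball_def)
    define P where "P x y \<longleftrightarrow> p + e * Complex x y \<in> X" for x y
    have cone: "P (x + x') (y + y')" if "P x y" "\<bar>x\<bar> \<le> s" "\<bar>y\<bar> \<le> s" "\<bar>x'\<bar> + \<bar>y'\<bar> \<le> 4 * s"
      "y' \<le> - (\<epsilon> / 2 * (\<bar>x'\<bar> + \<bar>y'\<bar>))" for x y x' y'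
    proof -
      have "(p + e * Complex x y) + e * Complex x' y' \<in> X"
      proof (rule down_cone[OF n, of "\<epsilon> / 2" "4 * s"])
        have "n \<bullet> (e * Complex x' y') = y'" unfolding ne by (rule inner_rotated[OF e1])
        also have "\<dots> \<le> - (\<epsilon> / 2 * (\<bar>x'\<bar> + \<bar>y'\<bar>))" by fact
        also have "\<dots> \<le> - (\<epsilon> / 2 * norm (e * Complex x' y'))"
          using \<epsilon> inner_rotated(2)[OF e1, of x' y'] by auto
        finally show "n \<bullet> (e * Complex x' y') \<le> - (\<epsilon> / 2 * norm (e * Complex x' y'))" .
        show "norm (e * Complex x' y') \<le> 4 * s"
          using that inner_rotated(2)[OF e1, of x' y'] by linarith
        show "norm (p + e * Complex x y - p) \<le> 4 * s"
          using that s inner_rotated(2)[OF e1, of x y] by simp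
      qed (use s \<epsilon> that in \<open>auto simp: P_def\<close>)
      moreover have "Complex x y + Complex x' y' = Complex (x + x') (y + y')" by (simp add: complex_eq_iff)
      ultimately show ?thesis unfolding P_def by (metis add.assoc distrib_left)
    qed
    have down: "P x y'" if "P x y" "y' \<le> y" "\<bar>x\<bar> \<le> s" "\<bar>y\<bar> \<le> s" "\<bar>y'\<bar> \<le> s" for x y y'
    proof -
      have "\<epsilon> / 2 * \<bar>y' - y\<bar> \<le> 1 * \<bar>y' - y\<bar>" using \<epsilon> by (intro mult_right_mono) auto
      then show ?thesis using cone[of x y 0 "y' - y"] that by auto
    qed
    have P0: "P 0 0" using frontier_in[OF pf] by (simp add: P_def Complex_eq)
    have low: "P x (- s / 2)" if "\<bar>x\<bar> \<le> s" for x
    proof -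
      have "\<epsilon> / 2 * (\<bar>x\<bar> + s / 2) \<le> 1/16 * (s + s / 2)"
        using that \<epsilon> s by (intro mult_mono) auto
      then show ?thesis using cone[of 0 0 x "- s / 2"] P0 that s by auto
    qed
    \<comment> \<open>The point lies in the outer tangent ball at \<open>p\<close>: its squared norm
      is at most \<open>5 / 4 * s\<^sup>2\<close>, less than \<open>r * s\<close>.\<close>
    have high: "\<not> P x (s / 2)" if "\<bar>x\<bar> \<le> s" for x
    proof -
      let ?d = "e * Complex x (s / 2)"
      have "x\<^sup>2 \<le> s\<^sup>2" using that by (rule power2_le_iff_abs_le[THEN iffD2, rotated]) (use s in simp)
      then have "(norm ?d)\<^sup>2 \<le> s\<^sup>2 + (s / 2)\<^sup>2" using inner_rotated(3)[OF e1] by simp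
      also have "\<dots> = (5 / 4 * s) * s" by (simp add: power2_eq_square)
      also have "\<dots> < r * s" using s r by (intro mult_strict_right_mono) auto
      also have "\<dots> = 2 * r * (n \<bullet> ?d)" unfolding ne inner_rotated(1)[OF e1] by simp
      finally have "(norm ?d)\<^sup>2 < 2 * r * (n \<bullet> ?d)" .
      then show ?thesis using n unfolding tball_def P_def by (metis add_diff_cancel_left')
    qed
    define A where "A x = {y \<in> {- s / 2..s / 2}. P x y}" for x
    define h where "h x = Sup (A x)" for x
    have clA: "closed (A x)" for x
    proof -
      have "closed ((\<lambda>y. p + e * Complex x y) -` X)"
        unfolding Complex_eq by (intro closed_vimage closed continuous_intros)
      moreover have "A x = {- s / 2..s / 2} \<inter> ((\<lambda>y. p + e * Complex x y) -` X)"
        by (auto simp: A_def P_def)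
      ultimately show ?thesis by (metis closed_Int closed_atLeastAtMost)
    qed
    have bA: "bdd_above (A x)" for x
      by (rule bdd_above_mono[of "{- s / 2..s / 2}"]) (auto simp: A_def)
    have hA: "h x \<in> A x" if "\<bar>x\<bar> \<le> s" for x
      unfolding h_def
    proof (rule closed_contains_Sup)
      show "A x \<noteq> {}" using low[OF that] s by (auto simp: A_def intro!: exI[of _ "- s / 2"])
    qed (rule bA clA)+
    have h: "P x y \<longleftrightarrow> y \<le> h x" if "\<bar>x\<bar> \<le> s" "\<bar>y\<bar> \<le> s" for x y
    proof
      assume Pxy: "P x y"
      have "y \<le> s / 2"
        using down[OF Pxy _ that, of "s / 2"] high[OF that(1)] s by (cases "y \<le> s / 2") auto
      then show "y \<le> h x"
      proof (cases "- s / 2 \<le> y")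
        case True
        then have "y \<in> A x" using \<open>y \<le> s / 2\<close> Pxy by (simp add: A_def)
        then show ?thesis unfolding h_def by (rule cSup_upper[OF _ bA])
      next
        case False
        then show ?thesis using hA[OF that(1)] by (auto simp: A_def)
      qed
    next
      assume "y \<le> h x"
      then show "P x y" using down[of x "h x" y] hA[OF that(1)] that s by (auto simp: A_def)
    qed
    have lip: "h x - \<epsilon> * \<bar>x' - x\<bar> \<le> h x'" if x: "\<bar>x\<bar> \<le> s" "\<bar>x'\<bar> \<le> s" for x x'
    proof -
      have hx: "P x (h x)" "\<bar>h x\<bar> \<le> s / 2" using hA[OF x(1)] by (auto simp: A_def)
      define d where "d = \<bar>x' - x\<bar>"
      have d: "0 \<le> d" "d \<le> 2 * s" using x by (auto simp: d_def)
      have ed: "\<epsilon> * d \<le> 1/8 * d" "0 \<le> \<epsilon> * d" "\<epsilon> * (\<epsilon> * d) \<le> 1 * (\<epsilon> * d)" "\<epsilon> * d \<le> s / 4"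
        using d \<epsilon> mult_mono[of \<epsilon> "1/8" d "2 * s"] s mult_right_mono[of \<epsilon> "1/8" d]
          mult_right_mono[of \<epsilon> 1 "\<epsilon> * d"] by auto
      \<comment> \<open>Descending by \<open>\<epsilon> * d\<close> over a horizontal distance
        \<open>d\<close> is steep enough for the cone of opening \<open>\<epsilon> / 2\<close>,
        because \<open>\<epsilon> \<le> 1\<close> gives
        \<open>d + \<epsilon> * d \<le> 2 * d\<close>.\<close>
      have "P (x + (x' - x)) (h x + - (\<epsilon> * d))"
      proof (rule cone)
        show "- (\<epsilon> * d) \<le> - (\<epsilon> / 2 * (\<bar>x' - x\<bar> + \<bar>- (\<epsilon> * d)\<bar>))"
          using ed d unfolding d_def[symmetric] by (simp add: algebra_simps)
      qed (use hx x ed d s in \<open>auto simp: d_def[symmetric]\<close>)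
      then have "P x' (h x - \<epsilon> * d)" by simp
      then show ?thesis using h[of x' "h x - \<epsilon> * d"] x hx ed s unfolding d_def[symmetric] by auto
    qed
    \<comment> \<open>Clamping the argument to \<open>[-s, s]\<close> extends \<open>h\<close> to
      the line without spoiling its Lipschitz constant or its bound.\<close>
    define g where "g x = h (max (- s) (min s x))" for x
    have cl: "\<bar>max (- s) (min s x)\<bar> \<le> s" for x using s by auto
    have "chart \<epsilon> s X p e g" unfolding chart_def
    proof (intro conjI allI impI)
      show "\<bar>g x\<bar> \<le> s / 2" for x using hA[OF cl, of x] by (auto simp: g_def A_def)
      show "\<bar>g x - g x'\<bar> \<le> \<epsilon> * \<bar>x - x'\<bar>" for x x'
      proof -
        let ?c = "\<lambda>x. max (- s) (min s x)"
        have "\<epsilon> * \<bar>?c x - ?c x'\<bar> \<le> \<epsilon> * \<bar>x - x'\<bar>" using \<epsilon> by (intro mult_left_mono) auto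
        moreover have "h (?c x) - \<epsilon> * \<bar>?c x - ?c x'\<bar> \<le> h (?c x')"
          using lip[OF cl[of x] cl[of x']] by (simp only: abs_minus_commute)
        moreover have "h (?c x') - \<epsilon> * \<bar>?c x - ?c x'\<bar> \<le> h (?c x)"
          using lip[OF cl[of x'] cl[of x]] .
        moreover have "\<bar>A - B\<bar> \<le> C" if "C' \<le> C" "A - C' \<le> B" "B - C' \<le> A" for A B C C' :: real
          using that by linarith
        ultimately show ?thesis unfolding g_def by metis
      qed
      show "(p + e * Complex x y \<in> X) = (y \<le> g x)" if "\<bar>x\<bar> \<le> s" "\<bar>y\<bar> \<le> s" for x y
      proof -
        have "max (- s) (min s x) = x" using that by auto
        then show ?thesis using h[OF that] by (simp add: P_def g_def)
      qed
    qed (rule e1)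
    then show ?thesis by blast
  qed
  then show thesis using that s by blast
qed

section \<open>Digitisation and connected components\<close>

text \<open>What the comparison of components asks of an adjacency: axis steps must be available for
  building paths, and adjacent points must be close enough to be joined inside the continuous
  set.\<close>

locale grid_adj =
  fixes A :: "(int \<times> int) rel"
  assumes sym: "sym A"
    and axis: "\<And>m n. ((m, n), (m + 1, n)) \<in> A" "\<And>m n. ((m, n), (m, n + 1)) \<in> A"
    and box: "\<And>m n m' n'. ((m, n), (m', n')) \<in> A \<Longrightarrow> \<bar>m - m'\<bar> \<le> 1 \<and> \<bar>n - n'\<bar> \<le> 1"

definition restr :: "'a rel \<Rightarrow> 'a set \<Rightarrow> 'a rel" where
  "restr A T = A \<inter> T \<times> T"

text \<open>Membership in \<open>T\<close> is demanded explicitly because the reflexive closure also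
  relates points outside \<open>T\<close> to themselves.\<close>

definition reach :: "'a rel \<Rightarrow> 'a set \<Rightarrow> 'a rel" where
  "reach A T = {(x, y). x \<in> T \<and> y \<in> T \<and> (x, y) \<in> (restr A T)\<^sup>*}"

lemma reach_equiv:
  assumes "sym A"
  shows "equiv T (reach A T)"
proof (rule equivI)
  have "sym ((restr A T)\<^sup>*)"
    by (intro sym_rtrancl) (use assms in \<open>auto simp: restr_def sym_def\<close>)
  then show "sym (reach A T)" by (auto simp: reach_def sym_def)
qed (auto simp: reach_def refl_on_def trans_def intro: rtrancl_trans)

lemma reach_refl: "x \<in> T \<Longrightarrow> (x, x) \<in> reach A T"
  by (simp add: reach_def)

lemma reach_trans: "(x, y) \<in> reach A T \<Longrightarrow> (y, z) \<in> reach A T \<Longrightarrow> (x, z) \<in> reach A T"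
  by (auto simp: reach_def intro: rtrancl_trans)

lemma reach_sym: "sym A \<Longrightarrow> (x, y) \<in> reach A T \<Longrightarrow> (y, x) \<in> reach A T"
  using reach_equiv[of A T] by (meson equiv_def symE)

lemma reach_step: "(x, y) \<in> A \<Longrightarrow> x \<in> T \<Longrightarrow> y \<in> T \<Longrightarrow> (x, y) \<in> reach A T"
  by (auto simp: reach_def restr_def)

context grid_adj
begin

lemma axis_step:
  assumes "s \<in> {(1, 0), (-1, 0), (0, 1), (0, -1)}"
  shows "((m, n), (m + fst s, n + snd s)) \<in> A"
  using assms axis(1)[of m n] axis(1)[of "m - 1" n] axis(2)[of m n] axis(2)[of m "n - 1"] sym
  by (auto simp: sym_def)

lemma reach_line:
  assumes s: "s \<in> {(1, 0), (-1, 0), (0, 1), (0, -1)}"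
    and T: "\<And>k::nat. k \<le> K \<Longrightarrow> (m + int k * fst s, n + int k * snd s) \<in> T"
  shows "((m, n), (m + int K * fst s, n + int K * snd s)) \<in> reach A T"
  using T
proof (induction K)
  case 0
  then show ?case using reach_refl[of "(m, n)" T] 0[of 0] by simp
next
  case (Suc K)
  have "((m + int K * fst s, n + int K * snd s), (m + int (Suc K) * fst s, n + int (Suc K) * snd s)) \<in> reach A T"
    using axis_step[OF s, of "m + int K * fst s" "n + int K * snd s"] Suc.prems[of K] Suc.prems[of "Suc K"]
    by (intro reach_step) (auto simp: algebra_simps)
  moreover have "((m, n), (m + int K * fst s, n + int K * snd s)) \<in> reach A T"
    using Suc by auto
  ultimately show ?case by (rule reach_trans[rotated])
qed

text \<open>An L-shaped path: first along the row, then along the column. The hypothesis on the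
  whole rectangle covers both legs.\<close>

lemma reach_staircase:
  assumes T: "\<And>i j. \<bar>i\<bar> \<le> \<bar>k\<bar> \<Longrightarrow> \<bar>j\<bar> \<le> \<bar>l\<bar> \<Longrightarrow> (m + i, n + j) \<in> T"
  shows "((m, n), (m + k, n + l)) \<in> reach A T"
proof -
  have "((m, n), (m + int (nat \<bar>k\<bar>) * fst (sgn k, 0::int), n + int (nat \<bar>k\<bar>) * snd (sgn k, 0::int))) \<in> reach A T"
  proof (cases "k = 0")
    case False
    show ?thesis
      by (rule reach_line) (use False T[of "int _ * sgn k" 0] in \<open>auto simp: sgn_if abs_mult\<close>)
  qed (use T[of 0 0] reach_refl in auto)
  moreover have "((m + k, n), (m + k + int (nat \<bar>l\<bar>) * fst (0::int, sgn l), n + int (nat \<bar>l\<bar>) * snd (0::int, sgn l))) \<in> reach A T"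
  proof (cases "l = 0")
    case False
    show ?thesis
      by (rule reach_line) (use False T[of k "int _ * sgn l"] in \<open>auto simp: sgn_if abs_mult\<close>)
  qed (use T[of k 0] reach_refl in auto)
  ultimately show ?thesis
    by (simp add: abs_mult_sgn mult.commute sgn_mult_abs reach_trans)
qed

end

section \<open>Scaled, rotated and translated lattices\<close>

locale grid =
  fixes a :: real and u c :: complex
  assumes a: "a > 0" and u: "norm u = 1"
begin

definition lat :: "int \<times> int \<Rightarrow> complex" where
  "lat x = of_real a * u * (of_int (fst x) + \<i> * of_int (snd x) + c)"

lemma lat_add: "lat (m + k, n + l) = lat (m, n) + of_real a * u * (of_int k + \<i> * of_int l)"
  by (simp add: lat_def algebra_simps)

lemma norm_off: "norm (of_real a * u * z) = a * norm z"
  using a u by (simp add: norm_mult)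

lemma norm_lat_diff: "norm (lat (m + k, n + l) - lat (m, n)) = a * norm (Complex (of_int k) (of_int l))"
  unfolding lat_add add_diff_cancel_left' norm_off by (simp add: Complex_eq)

lemma inj_lat: "inj lat"
proof (rule injI)
  fix x y assume "lat x = lat y"
  moreover have "lat x - lat y = of_real a * u * Complex (of_int (fst x - fst y)) (of_int (snd x - snd y))"
    by (simp add: lat_def Complex_eq algebra_simps)
  ultimately have "of_real a * u * Complex (of_int (fst x - fst y)) (of_int (snd x - snd y)) = 0" by simp
  moreover have "u \<noteq> 0" using u by auto
  ultimately have "Complex (of_int (fst x - fst y)) (of_int (snd x - snd y)) = 0" using a by simp
  then show "x = y" by (simp add: complex_eq_iff prod_eq_iff)
qed

lemma near_lat: obtains x where "norm (lat x - z) \<le> a"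
proof -
  define w where "w = z / (of_real a * u) - c"
  have nz: "of_real a * u \<noteq> 0" using a u by auto
  have z: "z = of_real a * u * (w + c)" using nz by (simp add: w_def)
  define x where "x = (round (Re w), round (Im w))"
  have "lat x - z = of_real a * u * Complex (of_int (fst x) - Re w) (of_int (snd x) - Im w)"
    unfolding z lat_def by (simp add: algebra_simps complex_eq_iff)
  then have "norm (lat x - z) = a * norm (Complex (of_int (fst x) - Re w) (of_int (snd x) - Im w))"
    by (simp only: norm_off)
  also have "\<dots> \<le> a * 1"
  proof (rule mult_left_mono)
    have "norm (Complex (of_int (fst x) - Re w) (of_int (snd x) - Im w)) \<le> \<bar>of_int (fst x) - Re w\<bar> + \<bar>of_int (snd x) - Im w\<bar>"
      using cmod_le[of "Complex (of_int (fst x) - Re w) (of_int (snd x) - Im w)"] by simp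
    also have "\<dots> \<le> 1/2 + 1/2" unfolding x_def fst_conv snd_conv by (intro add_mono of_int_round_abs_le)
    finally show "norm (Complex (of_int (fst x) - Re w) (of_int (snd x) - Im w)) \<le> 1" by simp
  qed (use a in simp)
  finally show thesis using that by simp
qed

lemma finite_lat_bounded:
  assumes "bounded B"
  shows "finite {x. lat x \<in> B}"
proof -
  obtain R where R: "\<And>z. z \<in> B \<Longrightarrow> norm z \<le> R" using assms bounded_iff by blast
  define M where "M = \<lceil>R / a + norm c\<rceil>"
  have "{x. lat x \<in> B} \<subseteq> {-M..M} \<times> {-M..M}"
  proof
    fix x assume "x \<in> {x. lat x \<in> B}"
    then have "norm (lat x) \<le> R" using R by auto
    then have "a * norm (of_int (fst x) + \<i> * of_int (snd x) + c) \<le> R"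
      using norm_off by (simp add: lat_def)
    then have "norm (of_int (fst x) + \<i> * of_int (snd x) + c) \<le> R / a" using a by (simp add: field_simps)
    then have "norm (Complex (of_int (fst x)) (of_int (snd x))) \<le> R / a + norm c"
      using norm_triangle_ineq4[of "of_int (fst x) + \<i> * of_int (snd x) + c" c] by (simp add: Complex_eq)
    then have "\<bar>of_int (fst x)\<bar> \<le> R / a + norm c" "\<bar>of_int (snd x)\<bar> \<le> R / a + norm c"
      using abs_Re_le_cmod[of "Complex (of_int (fst x)) (of_int (snd x))"]
        abs_Im_le_cmod[of "Complex (of_int (fst x)) (of_int (snd x))"] by auto
    then have "\<bar>fst x\<bar> \<le> M" "\<bar>snd x\<bar> \<le> M" unfolding M_def by linarith+
    then show "x \<in> {-M..M} \<times> {-M..M}" by (cases x) auto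
  qed
  then show ?thesis by (rule finite_subset) auto
qed

end

text \<open>The digitisation \<open>T\<close> of a set \<open>Y\<close> satisfying a uniform cone condition at a scale
  much larger than the lattice distance.\<close>

locale digit = grid + grid_adj +
  fixes Y :: "complex set" and \<eta> :: real
  assumes cone: "cone_cond \<eta> Y" and \<eta>: "100 * a \<le> \<eta>"
begin

definition T where "T = {x. lat x \<in> Y}"

text \<open>The dichotomy behind all local arguments below: far from the frontier any short path
  stays in \<open>Y\<close>; near it there is a boundary point whose cone gives a common inward
  direction.\<close>

lemma deep_or_near:
  assumes "z \<in> Y"
  obtains "cball z \<rho> \<subseteq> Y" | p where "p \<in> frontier Y" "norm (z - p) \<le> \<rho>" "\<rho> \<ge> 0"
proof (cases "cball z \<rho> \<subseteq> Y")
  case False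
  then have "cball z \<rho> \<noteq> {}" by auto
  then have \<rho>: "\<rho> \<ge> 0" by (simp add: cball_eq_empty)
  have "cball z \<rho> \<inter> frontier Y \<noteq> {}"
  proof (rule connected_Int_frontier)
    have "z \<in> cball z \<rho> \<inter> Y" using assms \<rho> by simp
    then show "cball z \<rho> \<inter> Y \<noteq> {}" by blast
  qed (use False in auto)
  then show ?thesis using that(2) \<rho> by (auto simp: dist_norm)
qed (use that in blast)

lemma seg_component: "closed_segment z w \<subseteq> Y \<Longrightarrow> connected_component Y z w"
  unfolding connected_component_def by (metis connected_segment ends_in_segment)

text \<open>Near the frontier the segment from \<open>z\<close> to \<open>z'\<close> may leave
  \<open>Y\<close>, so both points first move by \<open>3 * d\<close> against the normal. A lateral
  offset of norm at most \<open>d\<close> on top of this has norm at most \<open>4 * d\<close> and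
  normal part at most \<open>- 2 * d\<close>, hence stays in the cone.\<close>

lemma near_same_component:
  assumes z: "z \<in> Y" "z' \<in> Y" and d: "norm (z - z') \<le> d" "4 * d \<le> \<eta>"
  shows "connected_component Y z z'"
  using z(1)
proof (cases rule: deep_or_near[of z d])
  case 1
  have "closed_segment z z' \<subseteq> cball z d"
    using d by (intro closed_segment_subset) (auto simp: dist_norm intro: order_trans[OF norm_ge_zero])
  then show ?thesis using 1 seg_component by blast
next
  case (2 p)
  obtain n where n: "norm n = 1" "\<And>z w. z \<in> Y \<Longrightarrow> norm (z - p) \<le> \<eta> \<Longrightarrow> norm w \<le> \<eta> \<Longrightarrow>
      n \<bullet> w \<le> - (norm w / 2) \<Longrightarrow> z + w \<in> Y"
    using cone 2(1) unfolding cone_cond_def by metis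
  have nn: "n \<bullet> n = 1" using n(1) by (simp add: dot_square_norm)
  have down: "connected_component Y y (y - (3 * d) *\<^sub>R n)" if y: "y \<in> Y" "norm (y - p) \<le> \<eta>" for y
  proof (rule seg_component)
    show "closed_segment y (y - (3 * d) *\<^sub>R n) \<subseteq> Y"
    proof
      fix x assume "x \<in> closed_segment y (y - (3 * d) *\<^sub>R n)"
      then obtain t where t: "0 \<le> t" "t \<le> 1" "x = (1 - t) *\<^sub>R y + t *\<^sub>R (y - (3 * d) *\<^sub>R n)"
        by (auto simp: closed_segment_def)
      have x: "x = y + - ((t * (3 * d)) *\<^sub>R n)" using t(3) by (simp add: algebra_simps)
      have td: "0 \<le> t * (3 * d)" "t * (3 * d) \<le> 3 * d"
        using t 2 mult_right_mono[of t 1 "3 * d"] by auto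
      have "norm (- ((t * (3 * d)) *\<^sub>R n)) = t * (3 * d)" using td(1) n(1) by simp
      moreover have "n \<bullet> (- ((t * (3 * d)) *\<^sub>R n)) = - (t * (3 * d))" using nn by simp
      ultimately show "x \<in> Y" unfolding x
        using td d 2 by (intro n(2)[OF y]) auto
    qed
  qed
  have zp: "norm (z' - p) \<le> 2 * d" using 2(2) d norm_triangle_ineq[of "z' - z" "z - p"]
    by (simp add: norm_minus_commute)
  have across: "connected_component Y (z - (3 * d) *\<^sub>R n) (z' - (3 * d) *\<^sub>R n)"
  proof (rule seg_component)
    show "closed_segment (z - (3 * d) *\<^sub>R n) (z' - (3 * d) *\<^sub>R n) \<subseteq> Y"
    proof
      fix x assume "x \<in> closed_segment (z - (3 * d) *\<^sub>R n) (z' - (3 * d) *\<^sub>R n)"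
      then obtain t where t: "0 \<le> t" "t \<le> 1" "x = (1 - t) *\<^sub>R (z - (3 * d) *\<^sub>R n) + t *\<^sub>R (z' - (3 * d) *\<^sub>R n)"
        by (auto simp: closed_segment_def)
      define v where "v = t *\<^sub>R (z' - z)"
      have x: "x = z + (v - (3 * d) *\<^sub>R n)" using t(3) by (simp add: v_def algebra_simps)
      have v: "norm v \<le> d" using t d mult_left_le_one_le[of "norm (z' - z)" t]
        by (simp add: v_def norm_minus_commute)
      have "norm (v - (3 * d) *\<^sub>R n) \<le> 4 * d"
        using norm_triangle_ineq4[of v "(3 * d) *\<^sub>R n"] v n(1) 2 by simp
      moreover have "n \<bullet> (v - (3 * d) *\<^sub>R n) \<le> - 2 * d"
        using Cauchy_Schwarz_ineq2[of n v] v n(1) nn by (simp add: inner_diff_right)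
      ultimately show "x \<in> Y" unfolding x
        using 2 z d by (intro n(2)) auto
    qed
  qed
  have d0: "0 \<le> d" by (rule 2(3))
  have "connected_component Y z (z - (3 * d) *\<^sub>R n)" "connected_component Y z' (z' - (3 * d) *\<^sub>R n)"
    using down[of z] down[of z'] z zp 2(2) d d0 by auto
  then show ?thesis using across by (meson connected_component_sym connected_component_trans)
qed

text \<open>The nearest lattice point to \<open>z\<close> may lie outside \<open>Y\<close>; aiming
  at the point \<open>3 * a\<close> further inwards tolerates the rounding error \<open>a\<close> by
  the same count as before.\<close>

lemma near_lat_in:
  assumes "z \<in> Y"
  obtains x where "x \<in> T" "norm (lat x - z) \<le> 4 * a"
  using assms
proof (cases rule: deep_or_near[of z a])
  case 1
  obtain x where "norm (lat x - z) \<le> a" using near_lat by blast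
  moreover from this have "lat x \<in> Y" using 1 by (auto simp: dist_norm norm_minus_commute)
  ultimately show ?thesis using that[of x] a by (simp add: T_def)
next
  case (2 p)
  obtain n where n: "norm n = 1" "\<And>z w. z \<in> Y \<Longrightarrow> norm (z - p) \<le> \<eta> \<Longrightarrow> norm w \<le> \<eta> \<Longrightarrow>
      n \<bullet> w \<le> - (norm w / 2) \<Longrightarrow> z + w \<in> Y"
    using cone 2(1) unfolding cone_cond_def by metis
  have nn: "n \<bullet> n = 1" using n(1) by (simp add: dot_square_norm)
  obtain x where x: "norm (lat x - (z - (3 * a) *\<^sub>R n)) \<le> a" using near_lat by blast
  define v where "v = lat x - (z - (3 * a) *\<^sub>R n)"
  have e: "lat x - z = v - (3 * a) *\<^sub>R n" by (simp add: v_def)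
  have le: "norm (lat x - z) \<le> 4 * a"
    unfolding e using norm_triangle_ineq4[of v "(3 * a) *\<^sub>R n"] x n(1) a by (simp add: v_def)
  have "n \<bullet> (lat x - z) \<le> - 2 * a"
    unfolding e using Cauchy_Schwarz_ineq2[of n v] x n(1) nn by (simp add: inner_diff_right v_def)
  then have "z + (lat x - z) \<in> Y"
    using le a \<eta> 2 assms by (intro n(2)) auto
  then show ?thesis using that[of x] le by (simp add: T_def)
qed

text \<open>One of the two coordinates of a unit vector has absolute value at least
  \<open>1 / sqrt 2\<close>, which exceeds \<open>7 / 10\<close>. This is more than the slope
  \<open>1 / 2\<close> of the cone, so repeated steps in one lattice direction stay inside and gain
  room for sideways moves.\<close>

lemma steep_axis_direction:
  assumes "norm n = 1"
  obtains s where "s \<in> {(1, 0), (-1, 0), (0, 1), (0, -1)}"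
    "n \<bullet> (of_real a * u * (of_int (fst s) + \<i> * of_int (snd s))) \<le> - (7 / 10 * a)"
proof -
  define x where "x = n \<bullet> u"
  define y where "y = n \<bullet> (\<i> * u)"
  have "x\<^sup>2 + y\<^sup>2 = ((Re n)\<^sup>2 + (Im n)\<^sup>2) * ((Re u)\<^sup>2 + (Im u)\<^sup>2)"
    unfolding x_def y_def by (simp add: inner_complex_def power2_eq_square algebra_simps)
  also have "\<dots> = 1" using assms u by (metis cmod_power2 one_power2 mult_1)
  finally have xy: "x\<^sup>2 + y\<^sup>2 = 1" .
  have "\<bar>x\<bar> \<ge> 7 / 10 \<or> \<bar>y\<bar> \<ge> 7 / 10"
  proof (rule ccontr)
    assume "\<not> ?thesis"
    then have "\<bar>x\<bar> \<le> 7 / 10" "\<bar>y\<bar> \<le> 7 / 10" by auto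
    then have "\<bar>x\<bar>\<^sup>2 \<le> (7/10)\<^sup>2" "\<bar>y\<bar>\<^sup>2 \<le> (7/10)\<^sup>2" by (intro power_mono; simp)+
    then show False using xy by (simp add: power2_eq_square)
  qed
  then consider "x \<le> - (7/10)" | "- x \<le> - (7/10)" | "y \<le> - (7/10)" | "- y \<le> - (7/10)" by linarith
  moreover have ax: "n \<bullet> (of_real a * u * (of_int i + \<i> * of_int j)) = a * (of_int i * x + of_int j * y)" for i j
    by (simp add: x_def y_def inner_complex_def algebra_simps)
  moreover have le: "a * v \<le> - (7 / 10 * a)" if "v \<le> - (7 / 10)" for v :: real
    using mult_left_mono[OF that, of a] a by simp
  ultimately show thesis
  proof cases
    case 1 show thesis by (rule that[of "(1, 0)"], simp, unfold ax, use le[OF 1] in simp)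
  next
    case 2 show thesis by (rule that[of "(-1, 0)"], simp, unfold ax, use le[OF 2] in simp)
  next
    case 3 show thesis by (rule that[of "(0, 1)"], simp, unfold ax, use le[OF 3] in simp)
  next
    case 4 show thesis by (rule that[of "(0, -1)"], simp, unfold ax, use le[OF 4] in simp)
  qed
qed

text \<open>Deep inside \<open>Y\<close> an L-shaped path works directly, since it never leaves the
  ball through its end point. Near the frontier both points descend along the same steep lattice
  direction, and the L-shaped path is laid between the two lower points.\<close>

lemma near_reach:
  assumes x: "x \<in> T" "y \<in> T" and d: "norm (lat x - lat y) \<le> 10 * a"
  shows "(x, y) \<in> reach A T"
proof -
  obtain m n where mn: "x = (m, n)" by (cases x)
  obtain k l where kl: "y = (m + k, n + l)"
    using that[of "fst y - m" "snd y - n"] by simp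
  have small: "norm (of_real a * u * (of_int i + \<i> * of_int j)) \<le> 10 * a" if "\<bar>i\<bar> \<le> \<bar>k\<bar>" "\<bar>j\<bar> \<le> \<bar>l\<bar>" for i j
  proof -
    have "i\<^sup>2 \<le> k\<^sup>2" "j\<^sup>2 \<le> l\<^sup>2" using that by (auto simp: abs_le_square_iff)
    then have "real_of_int (i\<^sup>2 + j\<^sup>2) \<le> real_of_int (k\<^sup>2 + l\<^sup>2)" by linarith
    then have "norm (Complex (of_int i) (of_int j)) \<le> norm (Complex (of_int k) (of_int l))"
      by (simp add: complex_norm)
    moreover have "a * norm (Complex (of_int k) (of_int l)) \<le> 10 * a"
      using d norm_lat_diff[of m k n l] by (simp add: mn kl norm_minus_commute)
    ultimately have "a * norm (Complex (of_int i) (of_int j)) \<le> 10 * a"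
      using a by (meson mult_left_mono less_imp_le order_trans)
    then show ?thesis unfolding norm_off by (simp add: Complex_eq)
  qed
  have xY: "lat x \<in> Y" using x by (simp add: T_def)
  then show ?thesis
  proof (cases rule: deep_or_near[of "lat x" "10 * a"])
    case 1
    show ?thesis unfolding mn kl
    proof (rule reach_staircase)
      fix i j assume "\<bar>i\<bar> \<le> \<bar>k\<bar>" "\<bar>j\<bar> \<le> \<bar>l\<bar>"
      from small[OF this] have "lat (m + i, n + j) \<in> cball (lat x) (10 * a)"
        by (simp add: lat_add mn dist_norm norm_minus_commute)
      then show "(m + i, n + j) \<in> T" using 1 by (auto simp: T_def)
    qed
  next
    case (2 p)
    obtain N where N: "norm N = 1" "\<And>z w. z \<in> Y \<Longrightarrow> norm (z - p) \<le> \<eta> \<Longrightarrow> norm w \<le> \<eta> \<Longrightarrow>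
        N \<bullet> w \<le> - (norm w / 2) \<Longrightarrow> z + w \<in> Y"
      using cone 2(1) unfolding cone_cond_def by metis
    obtain s where s: "s \<in> {(1, 0), (-1, 0), (0, 1), (0, -1)}"
      "N \<bullet> (of_real a * u * (of_int (fst s) + \<i> * of_int (snd s))) \<le> - (7 / 10 * a)"
      using steep_axis_direction[OF N(1)] by blast
    define S where "S = of_real a * u * (of_int (fst s) + \<i> * of_int (snd s))"
    have nS: "norm S = a" unfolding S_def norm_off using s(1) by auto
    have NS: "N \<bullet> S \<le> - (7 / 10 * a)" using s(2) by (simp add: S_def)
    have latS: "lat (i + int q * fst s, j + int q * snd s) = lat (i, j) + of_nat q * S" for i j q
      unfolding lat_add S_def by (simp add: algebra_simps)
    \<comment> \<open>With descent \<open>7 / 10 * a\<close> per step and a lateral offset of at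
      most \<open>10 * a\<close>, the cone condition after \<open>K\<close> steps reads
      \<open>7 / 10 * K - 10 \<ge> (K + 10) / 2\<close>; 75 is the least solution. The total
      displacement is at most \<open>85 * a\<close>, within the \<open>100 * a\<close> granted by
      \<eta>.\<close>
    have descend: "((i, j), (i + int 75 * fst s, j + int 75 * snd s)) \<in> reach A T"
      if ij: "(i, j) \<in> T" "norm (lat (i, j) - p) \<le> \<eta>" for i j
    proof (rule reach_line[OF s(1)])
      fix q :: nat assume q: "q \<le> 75"
      have "lat (i, j) + of_nat q * S \<in> Y"
      proof (rule N(2))
        have "real q * a \<le> 75 * a" using q a by (intro mult_right_mono) auto
        moreover have "norm (of_nat q * S) = real q * a" by (simp add: norm_mult nS)
        ultimately show "norm (of_nat q * S) \<le> \<eta>" using \<eta> a by linarith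
        have "N \<bullet> (of_nat q * S) = real q * (N \<bullet> S)"
          by (simp add: inner_complex_def algebra_simps)
        also have "\<dots> \<le> real q * (- (7 / 10 * a))" using NS by (intro mult_left_mono) auto
        also have "\<dots> \<le> - (norm (of_nat q * S) / 2)" using a by (simp add: norm_mult nS)
        finally show "N \<bullet> (of_nat q * S) \<le> - (norm (of_nat q * S) / 2)" .
      qed (use ij in \<open>auto simp: T_def\<close>)
      then show "(i + int q * fst s, j + int q * snd s) \<in> T" by (simp add: T_def latS)
    qed
    have 1: "norm (lat (m, n) - p) \<le> \<eta>" "norm (lat (m + k, n + l) - p) \<le> \<eta>"
      using 2 d \<eta> a norm_triangle_ineq[of "lat y - lat x" "lat x - p"]
      by (auto simp: mn kl norm_minus_commute)
    have "((m + int 75 * fst s, n + int 75 * snd s), (m + int 75 * fst s + k, n + int 75 * snd s + l)) \<in> reach A T"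
    proof (rule reach_staircase)
      fix i j assume ij: "\<bar>i\<bar> \<le> \<bar>k\<bar>" "\<bar>j\<bar> \<le> \<bar>l\<bar>"
      define v where "v = of_real a * u * (of_int i + \<i> * of_int j)"
      have v: "norm v \<le> 10 * a" unfolding v_def by (rule small[OF ij])
      have "lat (m, n) + (of_nat 75 * S + v) \<in> Y"
      proof (rule N(2))
        have le: "norm (of_nat 75 * S + v) \<le> 85 * a"
          using norm_triangle_ineq[of "of_nat 75 * S" v] v by (simp add: norm_mult nS)
        then show "norm (of_nat 75 * S + v) \<le> \<eta>" using \<eta> a by simp
        have "N \<bullet> (of_nat 75 * S + v) = 75 * (N \<bullet> S) + N \<bullet> v"
          by (simp add: inner_complex_def algebra_simps)
        also have "\<dots> \<le> 75 * (- (7 / 10 * a)) + 10 * a"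
          using NS v Cauchy_Schwarz_ineq2[of N v] N(1) by (intro add_mono) auto
        also have "\<dots> \<le> - (norm (of_nat 75 * S + v) / 2)" using le a by simp
        finally show "N \<bullet> (of_nat 75 * S + v) \<le> - (norm (of_nat 75 * S + v) / 2)" .
      qed (use x 1 in \<open>auto simp: T_def mn\<close>)
      moreover have "lat (m + int 75 * fst s + i, n + int 75 * snd s + j) = lat (m, n) + (of_nat 75 * S + v)"
        unfolding lat_add[of "m + int 75 * fst s" i "n + int 75 * snd s" j] latS v_def[symmetric] by simp
      ultimately show "(m + int 75 * fst s + i, n + int 75 * snd s + j) \<in> T"
        by (simp add: T_def)
    qed
    moreover have "((m, n), (m + int 75 * fst s, n + int 75 * snd s)) \<in> reach A T"
      using descend[of m n] 1 x by (simp add: mn)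
    moreover have "((m + k, n + l), (m + int 75 * fst s + k, n + int 75 * snd s + l)) \<in> reach A T"
      using descend[of "m + k" "n + l"] 1 x by (simp add: kl algebra_simps)
    ultimately show ?thesis unfolding mn kl
      by (meson reach_trans reach_sym[OF sym])
  qed
qed

text \<open>No discretisation of a path is needed: connectedness is applied to the relation that two
  points of \<open>Y\<close> have nearby points of \<open>T\<close> in the same discrete class. It
  is locally constant because \<open>4 * a + a + 4 * a\<close> is within the reach of
  \<open>near_reach\<close>.\<close>

lemma component_imp_reach:
  assumes xy: "x \<in> T" "y \<in> T" "connected_component Y (lat x) (lat y)"
  shows "(x, y) \<in> reach A T"
proof -
  define R where "R w w' \<longleftrightarrow> (\<exists>x\<in>T. \<exists>y\<in>T. norm (lat x - w) \<le> 4 * a \<and> norm (lat y - w') \<le> 4 * a \<and> (x, y) \<in> reach A T)" for w w'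
  have close: "(x, y) \<in> reach A T" if "x \<in> T" "y \<in> T" "norm (lat x - w) \<le> 4 * a" "norm (lat y - w') \<le> 4 * a" "norm (w - w') \<le> a"
    for x y w w'
  proof (rule near_reach[OF that(1,2)])
    have "norm ((lat x - w) + (w - w') - (lat y - w')) \<le> norm (lat x - w) + norm (w - w') + norm (lat y - w')"
      using norm_triangle_ineq4[of "(lat x - w) + (w - w')" "lat y - w'"]
        norm_triangle_ineq[of "lat x - w" "w - w'"] by linarith
    then show "norm (lat x - lat y) \<le> 10 * a" using that a by simp
  qed
  let ?C = "connected_component_set Y (lat x)"
  have "R (lat x) (lat y)"
  proof (rule connected_equivalence_relation[of ?C])
    show "lat x \<in> ?C" using xy by (auto simp: T_def)
    show "lat y \<in> ?C" using xy by auto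
    show "R w w'" if "R w' w" for w w'
      using that reach_sym[OF sym] unfolding R_def by meson
    show "R w w''" if R: "R w w'" "R w' w''" for w w' w''
    proof -
      obtain x y where 1: "x \<in> T" "y \<in> T" "norm (lat x - w) \<le> 4 * a" "norm (lat y - w') \<le> 4 * a" "(x, y) \<in> reach A T"
        using R(1) unfolding R_def by blast
      obtain x' y' where 2: "x' \<in> T" "y' \<in> T" "norm (lat x' - w') \<le> 4 * a" "norm (lat y' - w'') \<le> 4 * a" "(x', y') \<in> reach A T"
        using R(2) unfolding R_def by blast
      have "(y, x') \<in> reach A T" using close[of y x' w' w'] 1 2 a by simp
      then show ?thesis using 1 2 unfolding R_def by (meson reach_trans)
    qed
    show "\<exists>U. openin (top_of_set ?C) U \<and> w \<in> U \<and> (\<forall>w'\<in>U. R w w')" if w: "w \<in> ?C" for w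
    proof (intro exI conjI ballI)
      show "openin (top_of_set ?C) (?C \<inter> ball w a)" by (simp add: openin_open_Int)
      show "w \<in> ?C \<inter> ball w a" using w a by simp
      fix w' assume w': "w' \<in> ?C \<inter> ball w a"
      have Y: "w \<in> Y" "w' \<in> Y" using w w' connected_component_in by auto
      obtain x where x: "x \<in> T" "norm (lat x - w) \<le> 4 * a" using near_lat_in[OF Y(1)] by blast
      obtain y where y: "y \<in> T" "norm (lat y - w') \<le> 4 * a" using near_lat_in[OF Y(2)] by blast
      have "(x, y) \<in> reach A T" using close[of x y w w'] x y w' by (auto simp: dist_norm)
      then show "R w w'" using x y unfolding R_def by blast
    qed
  qed simp
  then obtain x' y' where *: "x' \<in> T" "y' \<in> T" "norm (lat x' - lat x) \<le> 4 * a" "norm (lat y' - lat y) \<le> 4 * a" "(x', y') \<in> reach A T"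
    unfolding R_def by blast
  have "(x, x') \<in> reach A T" "(y', y) \<in> reach A T"
    using close[of x x' "lat x" "lat x"] close[of y' y "lat y" "lat y"] * xy a by auto
  then show ?thesis using * by (meson reach_trans)
qed

lemma reach_imp_component:
  assumes "(x, y) \<in> reach A T"
  shows "connected_component Y (lat x) (lat y)"
proof -
  have "(x, y) \<in> (restr A T)\<^sup>*" "x \<in> T" using assms by (auto simp: reach_def)
  then show ?thesis
  proof (induction rule: rtrancl_induct)
    case base
    then show ?case by (simp add: T_def)
  next
    case (step y z)
    then have yz: "(y, z) \<in> A" "y \<in> T" "z \<in> T" by (auto simp: restr_def)
    obtain k l where z: "z = (fst y + k, snd y + l)" "\<bar>k\<bar> \<le> 1" "\<bar>l\<bar> \<le> 1"
      using box[of "fst y" "snd y" "fst z" "snd z"] yz(1) that[of "fst z - fst y" "snd z - snd y"] by auto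
    have "norm (Complex (of_int k) (of_int l)) \<le> \<bar>of_int k\<bar> + \<bar>of_int l\<bar>"
      using cmod_le[of "Complex (of_int k) (of_int l)"] by simp
    also have "\<dots> \<le> 2" using z by linarith
    finally have "norm (lat z - lat y) \<le> a * 2"
      using norm_lat_diff[of "fst y" k "snd y" l] a z by simp
    then have "connected_component Y (lat y) (lat z)"
      using yz a \<eta> by (intro near_same_component[where d = "2 * a"]) (auto simp: T_def norm_minus_commute)
    then show ?case using step by (meson connected_component_trans)
  qed
qed

text \<open>Every point of a component has a lattice point of the same component within
  \<open>4 * a\<close>. Thus components are determined by their lattice points, and a component with
  finitely many of them is covered by finitely many balls. The second claim identifies the
  holes.\<close>

lemma bij_components:
  "bij_betw (\<lambda>K. {x. lat x \<in> K}) (components Y) (T // reach A T)"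
  and bounded_iff_finite: "K \<in> components Y \<Longrightarrow> bounded K \<longleftrightarrow> finite {x. lat x \<in> K}"
proof -
  have cls: "{x'. lat x' \<in> connected_component_set Y (lat x)} = reach A T `` {x}" if "x \<in> T" for x
  proof -
    have "connected_component Y (lat x) (lat y) \<Longrightarrow> y \<in> T" for y
      using connected_component_in[of Y "lat x" "lat y"] by (simp add: T_def)
    then have "connected_component Y (lat x) (lat y) \<longleftrightarrow> (x, y) \<in> reach A T" for y
      using component_imp_reach[OF that] reach_imp_component by blast
    then show ?thesis by simp blast
  qed
  have ex: "\<exists>x\<in>T. norm (lat x - z) \<le> 4 * a \<and> connected_component_set Y (lat x) = K"
    if K: "K \<in> components Y" "z \<in> K" for K z
  proof -
    have z: "z \<in> Y" using K in_components_subset by blast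
    obtain x where x: "x \<in> T" "norm (lat x - z) \<le> 4 * a" using near_lat_in[OF z] by blast
    have "connected_component Y (lat x) z"
      using x z a \<eta> by (intro near_same_component[where d = "4 * a"]) (auto simp: T_def)
    then have "connected_component_set Y (lat x) = connected_component_set Y z"
      by (simp add: connected_component_eq)
    also have "\<dots> = K" using K by (metis components_iff connected_component_eq)
    finally show ?thesis using x by blast
  qed
  show "bij_betw (\<lambda>K. {x. lat x \<in> K}) (components Y) (T // reach A T)"
    unfolding bij_betw_def
  proof
    show "inj_on (\<lambda>K. {x. lat x \<in> K}) (components Y)"
    proof (rule inj_onI)
      fix K K' assume K: "K \<in> components Y" "K' \<in> components Y" "{x. lat x \<in> K} = {x. lat x \<in> K'}"
      obtain z where "z \<in> K" using K in_components_nonempty by blast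
      then obtain x where x: "x \<in> T" "connected_component_set Y (lat x) = K" using ex K by blast
      then have "lat x \<in> K" by (auto simp: T_def)
      then have "lat x \<in> K'" using K by blast
      then show "K = K'" using \<open>lat x \<in> K\<close> K by (metis components_nonoverlap disjoint_iff)
    qed
    show "(\<lambda>K. {x. lat x \<in> K}) ` components Y = T // reach A T"
    proof (intro equalityI subsetI)
      fix S assume "S \<in> (\<lambda>K. {x. lat x \<in> K}) ` components Y"
      then obtain K where K: "K \<in> components Y" "S = {x. lat x \<in> K}" by blast
      obtain z where "z \<in> K" using K in_components_nonempty by blast
      then obtain x where x: "x \<in> T" "connected_component_set Y (lat x) = K" using ex K by blast
      then show "S \<in> T // reach A T" using cls[of x] K by (auto simp: quotient_def)
    next
      fix S assume "S \<in> T // reach A T"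
      then obtain x where x: "x \<in> T" "S = reach A T `` {x}" by (auto simp: quotient_def)
      then have "connected_component_set Y (lat x) \<in> components Y"
        by (simp add: T_def componentsI)
      then show "S \<in> (\<lambda>K. {x. lat x \<in> K}) ` components Y" using cls x by blast
    qed
  qed
  show "bounded K \<longleftrightarrow> finite {x. lat x \<in> K}" if K: "K \<in> components Y"
  proof
    assume fin: "finite {x. lat x \<in> K}"
    have "K \<subseteq> (\<Union>x\<in>{x. lat x \<in> K}. cball (lat x) (4 * a))"
    proof
      fix z assume "z \<in> K"
      then obtain x where x: "x \<in> T" "norm (lat x - z) \<le> 4 * a" "connected_component_set Y (lat x) = K"
        using ex K by blast
      then have "lat x \<in> K" by (auto simp: T_def)
      then show "z \<in> (\<Union>x\<in>{x. lat x \<in> K}. cball (lat x) (4 * a))"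
        using x(2) by (intro UN_I[of x]) (auto simp: dist_norm)
    qed
    moreover have "bounded (\<Union>x\<in>{x. lat x \<in> K}. cball (lat x) (4 * a))" using fin by blast
    ultimately show "bounded K" using bounded_subset by blast
  qed (rule finite_lat_bounded)
qed

end

section \<open>Euler's formula on the triangulated grid\<close>

text \<open>Orthogonality of characters on the group of subsets: the sum factors into terms
  \<open>1 + (-1) ^ k a\<close>, and one odd exponent makes it vanish.\<close>

lemma sum_Pow_signs:
  fixes k :: "'a \<Rightarrow> nat"
  assumes "finite A"
  shows "(\<Sum>S\<in>Pow A. \<Prod>a\<in>S. (-1::int) ^ k a) = (if \<forall>a\<in>A. even (k a) then 2 ^ card A else 0)"
proof -
  have "(\<Sum>S\<in>Pow A. \<Prod>a\<in>S. (-1::int) ^ k a) = (\<Prod>a\<in>A. (-1) ^ k a + 1)"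
    by (subst prod_add[OF assms]) simp
  also have "\<dots> = (if \<forall>a\<in>A. even (k a) then 2 ^ card A else 0)"
  proof (cases "\<forall>a\<in>A. even (k a)")
    case False
    then obtain a where "a \<in> A" "odd (k a)" by blast
    then have "(\<Prod>a\<in>A. (-1::int) ^ k a + 1) = 0" by (intro prod_zero assms bexI[of _ a]) auto
    then show ?thesis using False by simp
  qed simp
  finally show ?thesis .
qed

text \<open>Rank equals rank of the transpose, for the incidence matrix of a hypergraph over the field
  with two elements: evaluate the sum of \<open>(-1)\<^bsup>|incidences between f and z|\<^esup>\<close> over all
  \<open>f \<subseteq> V\<close> and \<open>z \<subseteq> E\<close> in both orders.\<close>

lemma cycles_cuts:
  fixes V :: "'v set" and E :: "'e set" and inc :: "'v \<Rightarrow> 'e \<Rightarrow> bool"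
  assumes "finite V" "finite E"
  shows "card {z \<in> Pow E. \<forall>v\<in>V. even (card {e\<in>z. inc v e})} * 2 ^ card V =
         2 ^ card E * card {f \<in> Pow V. \<forall>e\<in>E. even (card {v\<in>f. inc v e})}"
proof -
  define \<tau> :: "'v \<Rightarrow> 'e \<Rightarrow> int" where "\<tau> v e = (if inc v e then -1 else 1)" for v e
  have P: "(\<Prod>x\<in>A. if Q x then -1 else 1::int) = (-1) ^ card {x\<in>A. Q x}" if "finite A" for A :: "'x set" and Q
    using that by (simp add: prod.If_cases Collect_conj_eq Int_commute)
  have "(\<Sum>f\<in>Pow V. \<Sum>z\<in>Pow E. \<Prod>e\<in>z. \<Prod>v\<in>f. \<tau> v e) =
      (\<Sum>f\<in>Pow V. if \<forall>e\<in>E. even (card {v\<in>f. inc v e}) then 2 ^ card E else 0)"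
  proof (rule sum.cong[OF refl])
    fix f assume "f \<in> Pow V"
    then have "finite f" using assms finite_subset by blast
    then have "(\<Prod>v\<in>f. \<tau> v e) = (-1) ^ card {v\<in>f. inc v e}" for e
      unfolding \<tau>_def by (rule P)
    then show "(\<Sum>z\<in>Pow E. \<Prod>e\<in>z. \<Prod>v\<in>f. \<tau> v e) =
        (if \<forall>e\<in>E. even (card {v\<in>f. inc v e}) then 2 ^ card E else 0)"
      using sum_Pow_signs[OF assms(2)] by simp
  qed
  also have "\<dots> = 2 ^ card E * int (card {f \<in> Pow V. \<forall>e\<in>E. even (card {v\<in>f. inc v e})})"
    using assms by (simp add: sum.If_cases Collect_conj_eq[symmetric] Int_def)
  finally have 1: "(\<Sum>f\<in>Pow V. \<Sum>z\<in>Pow E. \<Prod>e\<in>z. \<Prod>v\<in>f. \<tau> v e) = \<dots>" .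
  have "(\<Sum>f\<in>Pow V. \<Sum>z\<in>Pow E. \<Prod>e\<in>z. \<Prod>v\<in>f. \<tau> v e) =
      (\<Sum>z\<in>Pow E. \<Sum>f\<in>Pow V. \<Prod>e\<in>z. \<Prod>v\<in>f. \<tau> v e)" by (rule sum.swap)
  also have "\<dots> = (\<Sum>z\<in>Pow E. \<Sum>f\<in>Pow V. \<Prod>v\<in>f. \<Prod>e\<in>z. \<tau> v e)"
    by (subst prod.swap) simp
  also have "\<dots> = (\<Sum>z\<in>Pow E. if \<forall>v\<in>V. even (card {e\<in>z. inc v e}) then 2 ^ card V else 0)"
  proof (rule sum.cong[OF refl])
    fix z assume "z \<in> Pow E"
    then have "finite z" using assms finite_subset by blast
    then have "(\<Prod>e\<in>z. \<tau> v e) = (-1) ^ card {e\<in>z. inc v e}" for v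
      unfolding \<tau>_def by (rule P)
    then show "(\<Sum>f\<in>Pow V. \<Prod>v\<in>f. \<Prod>e\<in>z. \<tau> v e) =
        (if \<forall>v\<in>V. even (card {e\<in>z. inc v e}) then 2 ^ card V else 0)"
      using sum_Pow_signs[OF assms(1)] by simp
  qed
  also have "\<dots> = int (card {z \<in> Pow E. \<forall>v\<in>V. even (card {e\<in>z. inc v e})}) * 2 ^ card V"
    using assms by (simp add: sum.If_cases Collect_conj_eq[symmetric] Int_def)
  finally have "int (card {z \<in> Pow E. \<forall>v\<in>V. even (card {e\<in>z. inc v e})} * 2 ^ card V) =
      int (2 ^ card E * card {f \<in> Pow V. \<forall>e\<in>E. even (card {v\<in>f. inc v e})})"
    using 1 by simp
  then show ?thesis by (simp only: of_nat_eq_iff)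
qed

text \<open>A finite saturated set is a union of finite classes, so the finite classes form a basis
  of the space of such sets. Applied to \<open>S\<close> it counts all components, applied to
  \<open>- S\<close> only the holes.\<close>

lemma card_saturated:
  assumes r: "equiv V r" and fin: "finite {\<kappa> \<in> V // r. finite \<kappa>}"
  shows "card {f. finite f \<and> f \<subseteq> V \<and> (\<forall>x\<in>f. \<forall>y. (x, y) \<in> r \<longrightarrow> y \<in> f)} = 2 ^ card {\<kappa> \<in> V // r. finite \<kappa>}"
proof -
  let ?Q = "{\<kappa> \<in> V // r. finite \<kappa>}"
  let ?S = "{f. finite f \<and> f \<subseteq> V \<and> (\<forall>x\<in>f. \<forall>y. (x, y) \<in> r \<longrightarrow> y \<in> f)}"
  have disj: "\<kappa> = \<kappa>'" if "\<kappa> \<in> ?Q" "\<kappa>' \<in> ?Q" "x \<in> \<kappa>" "x \<in> \<kappa>'" for \<kappa> \<kappa>' x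
    using quotient_disj[OF r, of \<kappa> \<kappa>'] that by blast
  have ne: "\<kappa> \<noteq> {}" if "\<kappa> \<in> ?Q" for \<kappa> using that in_quotient_imp_non_empty[OF r] by blast
  have "bij_betw Union (Pow ?Q) ?S"
    unfolding bij_betw_def
  proof
    show "inj_on Union (Pow ?Q)"
    proof (rule inj_onI)
      have "P \<subseteq> P'" if PP: "P \<subseteq> ?Q" "P' \<subseteq> ?Q" "\<Union>P = \<Union>P'" for P P'
      proof
        fix \<kappa> assume \<kappa>: "\<kappa> \<in> P"
        then obtain x where x: "x \<in> \<kappa>" using ne PP by blast
        then obtain \<kappa>' where "\<kappa>' \<in> P'" "x \<in> \<kappa>'" using PP \<kappa> by blast
        then show "\<kappa> \<in> P'" using disj[of \<kappa> \<kappa>' x] x \<kappa> PP by blast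
      qed
      then show "P = P'" if "P \<in> Pow ?Q" "P' \<in> Pow ?Q" "\<Union>P = \<Union>P'" for P P'
        using that by (metis Pow_iff subset_antisym)
    qed
    show "Union ` Pow ?Q = ?S"
    proof (intro equalityI subsetI)
      fix f assume "f \<in> Union ` Pow ?Q"
      then obtain P where P: "P \<subseteq> ?Q" "f = \<Union>P" by blast
      have "finite f" using P fin finite_subset by (metis (no_types, lifting) finite_Union mem_Collect_eq subsetD)
      moreover have "f \<subseteq> V" using P in_quotient_imp_subset[OF r] by blast
      moreover have "y \<in> f" if "x \<in> f" "(x, y) \<in> r" for x y
        using that P in_quotient_imp_closed[OF r] by blast
      ultimately show "f \<in> ?S" by blast
    next
      fix f assume f: "f \<in> ?S"
      let ?P = "{r `` {x} | x. x \<in> f}"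
      have sub: "r `` {x} \<subseteq> f" if "x \<in> f" for x using f that by blast
      have "?P \<subseteq> ?Q" using f sub by (auto simp: quotient_def intro: finite_subset)
      moreover have "\<Union>?P = f"
      proof
        show "\<Union>?P \<subseteq> f" using sub by blast
        show "f \<subseteq> \<Union>?P"
        proof
          fix x assume x: "x \<in> f"
          then have "x \<in> r `` {x}" using f by (intro equiv_class_self[OF r]) blast
          then show "x \<in> \<Union>?P" using x by blast
        qed
      qed
      ultimately show "f \<in> Union ` Pow ?Q" by (metis (no_types, lifting) PowI image_eqI)
    qed
  qed
  then have "card (Pow ?Q) = card ?S" by (rule bij_betw_same_card)
  then show ?thesis using card_Pow[OF fin] by simp
qed

text \<open>The edge graph of the triangulation introduced below. Any two corners of a triangle are
  adjacent, which makes this one adjacency right for a set of lattice points and for its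
  complement.\<close>

definition hexadj :: "(int \<times> int) rel" where
  "hexadj = {((m, n), (m', n')). (m' - m, n' - n) \<in> {(1, 0), (-1, 0), (0, 1), (0, -1), (1, -1), (-1, 1)}}"

lemma sym_hexadj: "sym hexadj"
  unfolding sym_def hexadj_def by auto

interpretation hexadj: grid_adj hexadj
  by standard (rule sym_hexadj, auto simp: hexadj_def)

text \<open>The triangulation of the plane by the unit cells with the diagonals from \<open>(i+1,j)\<close> to
  \<open>(i,j+1)\<close>. In cell \<open>(i,j)\<close>: edges \<open>(0,i,j)\<close> (bottom), \<open>(1,i,j)\<close> (left), \<open>(2,i,j)\<close> (diagonal);
  triangles \<open>(0,i,j)\<close> (lower left) and \<open>(1,i,j)\<close> (upper right).\<close>

type_synonym face = "nat \<times> int \<times> int"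

fun ends :: "face \<Rightarrow> (int \<times> int) set" where
  "ends (k, i, j) = (if k = 0 then {(i, j), (i + 1, j)} else if k = 1 then {(i, j), (i, j + 1)}
     else {(i + 1, j), (i, j + 1)})"

fun verts :: "face \<Rightarrow> (int \<times> int) set" where
  "verts (k, i, j) = (if k = 0 then {(i, j), (i + 1, j), (i, j + 1)}
     else {(i + 1, j), (i, j + 1), (i + 1, j + 1)})"

definition edges :: "(int \<times> int) set \<Rightarrow> face set" where
  "edges S = {e. fst e < 3 \<and> ends e \<subseteq> S}"

definition triangles :: "(int \<times> int) set \<Rightarrow> face set" where
  "triangles S = {t. fst t < 2 \<and> verts t \<subseteq> S}"

text \<open>Edges are indexed so that the lower left triangle of the same cell always contains them;
  \<open>side\<close> is the other triangle at the edge. An edge therefore lies in the boundary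
  modulo 2 of a set of triangles iff exactly one of these two belongs to it.\<close>

fun side :: "face \<Rightarrow> face" where
  "side (k, i, j) = (if k = 0 then (1, i, j - 1) else if k = 1 then (1, i - 1, j) else (1, i, j))"

definition bdry :: "face set \<Rightarrow> face set" where
  "bdry c = {e. fst e < 3 \<and> ((0, snd e) \<in> c) \<noteq> (side e \<in> c)}"

lemma less_3_cases: "(k::nat) < 3 \<longleftrightarrow> k = 0 \<or> k = 1 \<or> k = 2" by auto
lemma less_2_cases: "(k::nat) < 2 \<longleftrightarrow> k = 0 \<or> k = 1" by auto

lemma bdry_iff:
  "(0, i, j) \<in> bdry c \<longleftrightarrow> ((0, i, j) \<in> c) \<noteq> ((1, i, j - 1) \<in> c)"
  "(Suc 0, i, j) \<in> bdry c \<longleftrightarrow> ((0, i, j) \<in> c) \<noteq> ((1, i - 1, j) \<in> c)"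
  "(2, i, j) \<in> bdry c \<longleftrightarrow> ((0, i, j) \<in> c) \<noteq> ((1, i, j) \<in> c)"
  by (auto simp: bdry_def)

lemma finite_faces:
  assumes "finite S"
  shows "finite (edges S)" "finite (triangles S)"
proof -
  define B where "B = (\<lambda>(i, j). (i - 1, j)) ` S \<union> S"
  have "finite B" using assms by (simp add: B_def)
  have "edges S \<subseteq> {..<3} \<times> B"
    by (force simp: edges_def B_def less_3_cases split: if_splits)
  then show "finite (edges S)" using \<open>finite B\<close> finite_subset by blast
  have "triangles S \<subseteq> {..<2} \<times> B"
    by (force simp: triangles_def B_def less_2_cases split: if_splits)
  then show "finite (triangles S)" using \<open>finite B\<close> finite_subset by blast
qed

text \<open>Six edges meet at a vertex. Parity of their number in \<open>z\<close> is expressed as a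
  nested equality of truth values, which turns the later parity arguments into propositional
  logic.\<close>

lemma even_degree_iff:
  assumes "z \<subseteq> {e. fst e < 3}"
  shows "even (card {e\<in>z. (i, j) \<in> ends e}) \<longleftrightarrow>
    (((0, i, j) \<in> z) = (((0, i - 1, j) \<in> z) = (((1, i, j) \<in> z) = (((1, i, j - 1) \<in> z) = (((2, i - 1, j) \<in> z) = ((2, i, j - 1) \<in> z))))))"
proof -
  let ?D = "{(0, i, j), (0, i - 1, j), (1, i, j), (1, i, j - 1), (2, i - 1, j), (2, i, j - 1)} :: face set"
  have mem: "(i, j) \<in> ends e \<longleftrightarrow> e \<in> ?D" if "fst e < 3" for e
  proof -
    obtain k i' j' where e: "e = (k, i', j')" by (cases e)
    have "k = 0 \<or> k = 1 \<or> k = 2" using that e by (simp add: less_3_cases)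
    then show ?thesis unfolding e by (elim disjE) (simp, linarith)+
  qed
  have "{e\<in>z. (i, j) \<in> ends e} = {e\<in>?D. e \<in> z}"
    using assms mem by blast
  then have "card {e\<in>z. (i, j) \<in> ends e} = (\<Sum>e\<in>?D. if e \<in> z then 1 else 0)"
    by (simp only: card_eq_sum sum.inter_filter[symmetric] finite.intros)
  also have "\<dots> = (if (0, i, j) \<in> z then 1 else 0) + ((if (0, i - 1, j) \<in> z then 1 else 0) +
     ((if (1, i, j) \<in> z then 1 else 0) + ((if (1, i, j - 1) \<in> z then 1 else 0) +
     ((if (2, i - 1, j) \<in> z then 1 else 0) + (if (2, i, j - 1) \<in> z then 1 else 0)))))"
    by simp
  finally have c: "card {e\<in>z. (i, j) \<in> ends e} = \<dots>" .
  have p: "even (if P then 1 else 0 :: nat) \<longleftrightarrow> \<not> P" for P by simp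
  show ?thesis unfolding c even_add p by blast
qed

lemma even_degree_bdry: "even (card {e\<in>bdry c. (i, j) \<in> ends e})"
  by (subst even_degree_iff) (auto simp: bdry_def)

lemma adj_in_triangle:
  assumes "fst t < 2" "q \<in> verts t" "q' \<in> verts t" "q \<noteq> q'"
  shows "(q, q') \<in> hexadj"
proof -
  obtain k i j where t: "t = (k, i, j)" by (cases t)
  have "\<forall>q\<in>{(i, j), (i + 1, j), (i, j + 1)}. \<forall>q'\<in>{(i, j), (i + 1, j), (i, j + 1)}. q \<noteq> q' \<longrightarrow> (q, q') \<in> hexadj"
    "\<forall>q\<in>{(i + 1, j), (i, j + 1), (i + 1, j + 1)}. \<forall>q'\<in>{(i + 1, j), (i, j + 1), (i + 1, j + 1)}. q \<noteq> q' \<longrightarrow> (q, q') \<in> hexadj"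
    by (simp_all add: hexadj_def)
  then show ?thesis using assms unfolding t verts.simps by metis
qed

lemma ends_in_sides:
  assumes "fst e < 3" "q \<in> ends e"
  shows "q \<in> verts (0, snd e)" "q \<in> verts (side e)"
proof -
  obtain k i j where e: "e = (k, i, j)" by (cases e)
  have "k = 0 \<or> k = 1 \<or> k = 2" using assms e by (simp add: less_3_cases)
  then show "q \<in> verts (0, snd e)" using assms(2) unfolding e by (elim disjE) auto
  from \<open>k = 0 \<or> k = 1 \<or> k = 2\<close> show "q \<in> verts (side e)"
    using assms(2) unfolding e by (elim disjE) auto
qed

lemma adj_common_triangle:
  assumes "(q, q') \<in> hexadj"
  obtains t where "fst t < 2" "q \<in> verts t" "q' \<in> verts t"
proof -
  obtain i j i' j' where q: "q = (i, j)" "q' = (i', j')" by (metis surj_pair)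
  have "(i', j') \<in> {(i+1,j), (i-1,j), (i,j+1), (i,j-1), (i+1,j-1), (i-1,j+1)}"
    using assms q by (auto simp: hexadj_def)
  then show thesis
    using that[of "(0, i, j)"] that[of "(0, i - 1, j)"] that[of "(0, i, j - 1)"] q by auto
qed

text \<open>Around a vertex outside \<open>S\<close> no edge belongs to \<open>edges S\<close>.\<close>

lemma around_vertex:
  assumes c: "bdry c \<subseteq> edges S" and q: "q \<notin> S" and t: "fst t < 2" "q \<in> verts t"
  shows "t \<in> c \<longleftrightarrow> (0, q) \<in> c"
proof -
  obtain i j where qij: "q = (i, j)" by (cases q)
  have n: "e \<notin> bdry c" if "q \<in> ends e" for e using c q that by (auto simp: edges_def)
  have "(1, i, j) \<notin> bdry c" "(2, i - 1, j) \<notin> bdry c" "(0, i - 1, j) \<notin> bdry c"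
    "(1, i, j - 1) \<notin> bdry c" "(2, i, j - 1) \<notin> bdry c" "(0, i, j) \<notin> bdry c"
    by (rule n; simp add: qij)+
  then have eq: "(1, i - 1, j) \<in> c \<longleftrightarrow> (0, i, j) \<in> c" "(0, i - 1, j) \<in> c \<longleftrightarrow> (0, i, j) \<in> c"
    "(1, i - 1, j - 1) \<in> c \<longleftrightarrow> (0, i, j) \<in> c" "(0, i, j - 1) \<in> c \<longleftrightarrow> (0, i, j) \<in> c"
    "(1, i, j - 1) \<in> c \<longleftrightarrow> (0, i, j) \<in> c"
    by (auto simp: bdry_iff)
  obtain k i' j' where tt: "t = (k, i', j')" by (cases t)
  then have "t \<in> {(0, i, j), (0, i - 1, j), (0, i, j - 1), (1, i - 1, j), (1, i, j - 1), (1, i - 1, j - 1)}"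
    using t qij by (auto simp: less_2_cases split: if_splits)
  then show ?thesis using eq qij by auto
qed

text \<open>The symmetric difference \<open>D\<close> has empty boundary, so membership in
  \<open>D\<close> passes across vertical and diagonal edges from cell to cell along a row. A
  nonempty \<open>D\<close> would contain an infinite half row.\<close>

lemma bdry_inj:
  assumes "finite c" "finite c'" "c \<subseteq> {t. fst t < 2}" "c' \<subseteq> {t. fst t < 2}" "bdry c = bdry c'"
  shows "c = c'"
proof -
  define D where "D = {t. (t \<in> c) \<noteq> (t \<in> c')}"
  have fin: "finite D" by (rule finite_subset[of _ "c \<union> c'"]) (use assms in \<open>auto simp: D_def\<close>)
  have eq: "(0, i, j) \<in> D \<longleftrightarrow> (1, i - 1, j) \<in> D" "(0, i, j) \<in> D \<longleftrightarrow> (1, i, j) \<in> D" for i j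
    using bdry_iff(2)[of i j c] bdry_iff(2)[of i j c'] bdry_iff(3)[of i j c] bdry_iff(3)[of i j c'] assms(5)
    by (auto simp: D_def)
  have no: "(0, i, j) \<notin> D" for i j
  proof
    assume 0: "(0, i, j) \<in> D"
    have "(0, i + int n, j) \<in> D" for n
    proof (induction n)
      case (Suc n)
      then show ?case using eq(2)[of "i + int n" j] eq(1)[of "i + int (Suc n)" j] by simp
    qed (use 0 in simp)
    then have "range (\<lambda>n. (0, i + int n, j)) \<subseteq> D" by blast
    moreover have "infinite (range (\<lambda>n. (0::nat, i + int n, j)))"
      by (intro range_inj_infinite) (auto simp: inj_def)
    ultimately show False using fin finite_subset by blast
  qed
  have "D = {}"
  proof (rule ccontr)
    assume "D \<noteq> {}"
    then obtain k i j where t: "(k, i, j) \<in> D" by (metis ex_in_conv surj_pair)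
    then have "k = 0 \<or> k = 1" using assms by (auto simp: D_def)
    then show False using t no eq(2) by auto
  qed
  then show ?thesis by (auto simp: D_def)
qed

text \<open>Crossing parity of a ray coming from minus infinity. It is used with finite
  \<open>Q\<close>; \<open>card\<close> would be 0 on an infinite set.\<close>

definition par :: "(int \<Rightarrow> bool) \<Rightarrow> int \<Rightarrow> bool" where
  "par Q i = odd (card {i'. i' \<le> i \<and> Q i'})"

lemma par_step:
  assumes "finite {i. Q i}"
  shows "par Q i \<longleftrightarrow> (par Q (i - 1) \<noteq> Q i)"
proof -
  have fin: "finite {i'. i' \<le> i - 1 \<and> Q i'}" using assms by (rule rev_finite_subset) auto
  have "{i'. i' \<le> i \<and> Q i'} = (if Q i then insert i {i'. i' \<le> i - 1 \<and> Q i'} else {i'. i' \<le> i - 1 \<and> Q i'})"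
    by (auto simp: order_le_less)
  then show ?thesis using fin by (simp add: par_def)
qed

lemma par_low: "(\<And>i'. i' \<le> i \<Longrightarrow> \<not> Q i') \<Longrightarrow> \<not> par Q i"
proof -
  assume "\<And>i'. i' \<le> i \<Longrightarrow> \<not> Q i'"
  then have e: "{i'. i' \<le> i \<and> Q i'} = {}" by auto
  show ?thesis unfolding par_def e by simp
qed

text \<open>The interior of a cycle by ray casting: a triangle belongs to \<open>c\<close> iff the
  path to it along its row from the far left crosses an odd number of left and diagonal edges of
  \<open>z\<close>. For these two kinds of edges the boundary is right by construction.\<close>

lemma cycle_is_bdry:
  assumes z: "finite z" "z \<subseteq> {e. fst e < 3}" and ev: "\<And>i j. even (card {e\<in>z. (i, j) \<in> ends e})"
  obtains c where "finite c" "c \<subseteq> {t. fst t < 2}" "bdry c = z"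
proof -
  define L where "L i j \<longleftrightarrow> (par (\<lambda>i. (1, i, j) \<in> z) i \<noteq> par (\<lambda>i. (2, i, j) \<in> z) (i - 1))" for i j
  define U where "U i j \<longleftrightarrow> (par (\<lambda>i. (1, i, j) \<in> z) i \<noteq> par (\<lambda>i. (2, i, j) \<in> z) i)" for i j
  define c :: "face set" where "c = {(0, i, j) |i j. L i j} \<union> {(1, i, j) |i j. U i j}"
  have c_iff: "(0, i, j) \<in> c \<longleftrightarrow> L i j" "(Suc 0, i, j) \<in> c \<longleftrightarrow> U i j" for i j by (auto simp: c_def)
  have fin: "finite {i. (k, i, j) \<in> z}" for k j
    by (rule finite_surj[OF z(1), of _ "\<lambda>e. fst (snd e)"]) force
  have LU: "(L i j \<noteq> U i j) \<longleftrightarrow> (2, i, j) \<in> z" for i j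
    unfolding L_def U_def using par_step[OF fin[of 2 j], of i] by auto
  have LU1: "(L i j \<noteq> U (i - 1) j) \<longleftrightarrow> (1, i, j) \<in> z" for i j
    unfolding L_def U_def using par_step[OF fin[of 1 j], of i] by auto
  obtain N :: int where N: "\<And>k i j. (k, i, j) \<in> z \<Longrightarrow> \<bar>i\<bar> < N \<and> \<bar>j\<bar> < N"
  proof -
    have "finite ((\<lambda>(k, i, j). max \<bar>i\<bar> \<bar>j\<bar>) ` z)" using z by simp
    then obtain M where M: "\<And>x. x \<in> (\<lambda>(k, i, j). max \<bar>i\<bar> \<bar>j\<bar>) ` z \<Longrightarrow> x \<le> M"
      by (meson bdd_above_def bdd_above_finite)
    have "\<bar>i\<bar> < M + 1 \<and> \<bar>j\<bar> < M + 1" if "(k, i, j) \<in> z" for k i j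
      using M[of "max \<bar>i\<bar> \<bar>j\<bar>"] that by force
    then show thesis using that by blast
  qed
  have low: "\<not> L i j" "\<not> U i j" if "i \<le> - N" for i j
  proof -
    have "\<not> par (\<lambda>i. (k, i, j) \<in> z) i'" if "i' \<le> i" for k i'
      by (rule par_low) (use N that \<open>i \<le> - N\<close> in \<open>meson abs_less_iff not_less order_trans minus_less_iff\<close>)
    then show "\<not> L i j" "\<not> U i j" by (auto simp: L_def U_def)
  qed
  have row: "\<not> L i j" "\<not> U i j" if "N \<le> \<bar>j\<bar>" for i j
  proof -
    have "\<not> par (\<lambda>i. (k, i, j) \<in> z) i'" for k i'
      by (rule par_low) (use N that in \<open>meson not_less\<close>)
    then show "\<not> L i j" "\<not> U i j" by (auto simp: L_def U_def)
  qed
  \<comment> \<open>Horizontal edges are where even degree enters: the claim is carried along the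
    row from the far left, and at each vertex the parity of the other five edges determines the
    sixth.\<close>
  have hor: "(L i j \<noteq> U i (j - 1)) \<longleftrightarrow> (0, i, j) \<in> z" for i j
  proof (cases "i \<le> - N")
    case True
    then show ?thesis using low N[of 0 i j] by auto
  next
    case False
    then have "- N \<le> i" by simp
    then show ?thesis
    proof (induction i rule: int_ge_induct)
      case base
      then show ?case using low[of "- N"] N[of 0 "- N" j] by auto
    next
      case (step i)
      show ?case
        using ev[of "i + 1" j] step LU[of i j] LU1[of "i + 1" j] LU1[of "i + 1" "j - 1"] LU[of "i + 1" "j - 1"]
        unfolding even_degree_iff[OF z(2)] by auto
    qed
  qed
  have high0: "L i j = L N j \<and> U i j = L N j" if "N \<le> i" for i j
    using that
  proof (induction i rule: int_ge_induct)
    case base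
    then show ?case using LU[of N j] N[of 2 N j] by auto
  next
    case (step i)
    then show ?case using LU[of "i + 1" j] LU1[of "i + 1" j] N[of 2 "i + 1" j] N[of 1 "i + 1" j] by auto
  qed
  \<comment> \<open>Finiteness of \<open>c\<close> to the right: beyond \<open>N\<close> membership
    is constant along each row, neighbouring rows agree there since \<open>z\<close> has no
    horizontal edge, and the rows far below are empty.\<close>
  have LN: "\<not> L N j" for j
  proof (cases "j \<le> - N")
    case True
    then show ?thesis using row by auto
  next
    case False
    then have "- N \<le> j" by simp
    then show ?thesis
    proof (induction j rule: int_ge_induct)
      case base
      then show ?case using row[of "- N" N] by auto
    next
      case (step j)
      then show ?case using hor[of N "j + 1"] high0[of N j] N[of 0 N "j + 1"] by auto
    qed
  qed
  have "c \<subseteq> {0, 1} \<times> {- N..N} \<times> {- N..N}"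
  proof -
    have B: "- N \<le> i \<and> i \<le> N \<and> - N \<le> j \<and> j \<le> N" if "L i j \<or> U i j" for i j
      using that low[of i j] row[of j i] high0[of i j] LN[of j] by (smt (verit))
    show ?thesis
    proof
      fix t assume "t \<in> c"
      then obtain i j where t: "t = (0, i, j) \<or> t = (1, i, j)" "L i j \<or> U i j" unfolding c_def by blast
      then show "t \<in> {0, 1} \<times> {- N..N} \<times> {- N..N}" using B[OF t(2)] by auto
    qed
  qed
  then have "finite c" by (rule finite_subset) auto
  moreover have "c \<subseteq> {t. fst t < 2}" by (auto simp: c_def)
  moreover have "bdry c = z"
  proof -
    have "(k, i, j) \<in> bdry c \<longleftrightarrow> (k, i, j) \<in> z" if "k < 3" for k i j
      using that LU[of i j] LU1[of i j] hor[of i j] by (auto simp: less_3_cases bdry_iff c_iff)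
    then have "e \<in> bdry c \<longleftrightarrow> e \<in> z" if "fst e < 3" for e
      using that by (metis prod.collapse)
    moreover have "bdry c \<subseteq> {e. fst e < 3}" by (auto simp: bdry_def)
    ultimately show ?thesis using z(2) by blast
  qed
  ultimately show thesis using that by blast
qed

text \<open>A cycle in \<open>S\<close> bounds a unique finite set of triangles. Its triangles
  inside \<open>S\<close> are arbitrary; those with a corner outside \<open>S\<close> depend only on
  that corner, since no edge of the cycle ends there, and this dependence is constant on components
  of the complement. Finiteness leaves only the finite components.\<close>

lemma card_cycles:
  assumes S: "finite S"
  shows "card {z \<in> Pow (edges S). \<forall>v\<in>S. even (card {e\<in>z. v \<in> ends e})} =
     2 ^ card (triangles S) * 2 ^ card {\<kappa> \<in> (- S) // reach hexadj (- S). finite \<kappa>}"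
proof -
  let ?r = "reach hexadj (- S)"
  let ?Z = "{z \<in> Pow (edges S). \<forall>v\<in>S. even (card {e\<in>z. v \<in> ends e})}"
  let ?G = "{f. finite f \<and> f \<subseteq> - S \<and> (\<forall>x\<in>f. \<forall>y. (x, y) \<in> ?r \<longrightarrow> y \<in> f)}"
  \<comment> \<open>A free choice \<open>F0\<close> of triangles inside \<open>S\<close> together
    with all triangles that touch the saturated set \<open>f\<close> of complement points.\<close>
  define \<Phi> where "\<Phi> = (\<lambda>(F0, f). F0 \<union> {t. fst t < 2 \<and> verts t \<inter> f \<noteq> {}})"
  have \<Phi>_iff: "t \<in> \<Phi> (F0, f) \<longleftrightarrow> q \<in> f"
    if "F0 \<subseteq> triangles S" "f \<in> ?G" "fst t < 2" "q \<in> verts t" "q \<notin> S" for t q F0 f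
  proof -
    have "q \<in> f" if "q' \<in> verts t" "q' \<in> f" for q'
    proof (cases "q' = q")
      case False
      then have "(q', q) \<in> hexadj" using adj_in_triangle that \<open>fst t < 2\<close> \<open>q \<in> verts t\<close> by blast
      moreover have "q' \<in> - S" using that \<open>f \<in> ?G\<close> by blast
      ultimately have "(q', q) \<in> ?r" using \<open>q \<notin> S\<close> by (intro reach_step) auto
      then show ?thesis using \<open>f \<in> ?G\<close> that by blast
    qed (use that in simp)
    then show ?thesis using that unfolding \<Phi>_def triangles_def by blast
  qed
  have \<Phi>_tri: "\<Phi> (F0, f) \<inter> triangles S = F0" if "F0 \<subseteq> triangles S" "f \<in> ?G" for F0 f
    using that unfolding \<Phi>_def triangles_def by blast
  have \<Phi>_f: "{q. q \<notin> S \<and> (0, q) \<in> \<Phi> (F0, f)} = f" if "F0 \<subseteq> triangles S" "f \<in> ?G" for F0 f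
  proof -
    have "(0, q) \<in> \<Phi> (F0, f) \<longleftrightarrow> q \<in> f" if "q \<notin> S" for q
      by (rule \<Phi>_iff) (use that \<open>F0 \<subseteq> triangles S\<close> \<open>f \<in> ?G\<close> in \<open>cases q; auto\<close>)+
    then show ?thesis using that by blast
  qed
  have \<Phi>_fin: "finite (\<Phi> (F0, f))" "\<Phi> (F0, f) \<subseteq> {t. fst t < 2}" if "F0 \<subseteq> triangles S" "f \<in> ?G" for F0 f
  proof -
    define B where "B = f \<union> (\<lambda>(i, j). (i - 1, j)) ` f \<union> (\<lambda>(i, j). (i, j - 1)) ` f \<union> (\<lambda>(i, j). (i - 1, j - 1)) ` f"
    have "finite B" using that by (simp add: B_def)
    moreover have "{t. fst t < 2 \<and> verts t \<inter> f \<noteq> {}} \<subseteq> {..<2} \<times> B"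
      by (force simp: B_def less_2_cases split: if_splits)
    ultimately have "finite {t. fst t < 2 \<and> verts t \<inter> f \<noteq> {}}"
      by (meson finite_SigmaI finite_lessThan finite_subset)
    then show "finite (\<Phi> (F0, f))"
      using that finite_faces(2)[OF S] finite_subset unfolding \<Phi>_def by auto
    show "\<Phi> (F0, f) \<subseteq> {t. fst t < 2}" using that unfolding \<Phi>_def triangles_def by auto
  qed
  have inj: "inj_on (bdry \<circ> \<Phi>) (Pow (triangles S) \<times> ?G)"
  proof (rule inj_onI)
    fix x y assume xy: "x \<in> Pow (triangles S) \<times> ?G" "y \<in> Pow (triangles S) \<times> ?G" "(bdry \<circ> \<Phi>) x = (bdry \<circ> \<Phi>) y"
    obtain F0 f F1 g where x: "x = (F0, f)" and y: "y = (F1, g)" by (metis surj_pair)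
    have 1: "F0 \<subseteq> triangles S" "f \<in> ?G" and 2: "F1 \<subseteq> triangles S" "g \<in> ?G" using xy x y by blast+
    have "\<Phi> (F0, f) = \<Phi> (F1, g)"
      using bdry_inj[OF \<Phi>_fin(1)[OF 1] \<Phi>_fin(1)[OF 2] \<Phi>_fin(2)[OF 1] \<Phi>_fin(2)[OF 2]] xy x y by simp
    then show "x = y"
      using \<Phi>_tri[OF 1] \<Phi>_tri[OF 2] \<Phi>_f[OF 1] \<Phi>_f[OF 2] x y by simp
  qed
  have img: "(bdry \<circ> \<Phi>) ` (Pow (triangles S) \<times> ?G) = ?Z"
  proof (intro equalityI subsetI)
    fix z assume "z \<in> (bdry \<circ> \<Phi>) ` (Pow (triangles S) \<times> ?G)"
    then obtain F0 f where Ff: "F0 \<subseteq> triangles S" "f \<in> ?G" "z = bdry (\<Phi> (F0, f))" by auto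
    have "e \<in> edges S" if e: "e \<in> z" for e
    proof (rule ccontr)
      assume ne: "e \<notin> edges S"
      have e3: "fst e < 3" using e Ff by (simp add: bdry_def)
      then obtain q where q: "q \<in> ends e" "q \<notin> S" using ne by (auto simp: edges_def)
      have "fst (side e) < 2" by (cases e) auto
      then have "(0, snd e) \<in> \<Phi> (F0, f) \<longleftrightarrow> side e \<in> \<Phi> (F0, f)"
        using \<Phi>_iff[OF Ff(1,2) _ ends_in_sides(1)[OF e3 q(1)] q(2)]
          \<Phi>_iff[OF Ff(1,2) _ ends_in_sides(2)[OF e3 q(1)] q(2)] by simp
      then show False using e Ff by (simp add: bdry_def)
    qed
    then show "z \<in> ?Z" using even_degree_bdry Ff by auto
  next
    fix z assume z: "z \<in> ?Z"
    have fz: "finite z" using z finite_faces(1)[OF S] finite_subset by blast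
    have z3: "z \<subseteq> {e. fst e < 3}" using z by (auto simp: edges_def)
    have "even (card {e\<in>z. (i, j) \<in> ends e})" for i j
    proof (cases "(i, j) \<in> S")
      case False
      then have e: "{e\<in>z. (i, j) \<in> ends e} = {}" using z unfolding edges_def by blast
      show ?thesis unfolding e by simp
    qed (use z in blast)
    then obtain c where c: "finite c" "c \<subseteq> {t. fst t < 2}" "bdry c = z"
      using cycle_is_bdry[OF fz z3] by blast
    have bc: "bdry c \<subseteq> edges S" using c z by blast
    define f where "f = {q. q \<notin> S \<and> (0, q) \<in> c}"
    have "finite f"
      by (rule finite_surj[OF c(1), of _ snd]) (force simp: f_def)
    moreover have "y \<in> f" if x: "x \<in> f" and xy: "(x, y) \<in> ?r" for x y
    proof -
      have "(x, y) \<in> (restr hexadj (- S))\<^sup>*" using xy by (simp add: reach_def)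
      then show ?thesis
      proof (induction rule: rtrancl_induct)
        case (step y y')
        then have yy: "(y, y') \<in> hexadj" "y \<notin> S" "y' \<notin> S" by (auto simp: restr_def)
        then obtain t where "fst t < 2" "y \<in> verts t" "y' \<in> verts t" using adj_common_triangle by blast
        then have "(0, y) \<in> c \<longleftrightarrow> (0, y') \<in> c"
          using around_vertex[OF bc yy(2)] around_vertex[OF bc yy(3)] by blast
        then show ?case using step yy by (simp add: f_def)
      qed (rule x)
    qed
    moreover have "f \<subseteq> - S" by (auto simp: f_def)
    ultimately have fG: "f \<in> ?G" by blast
    have "\<Phi> (c \<inter> triangles S, f) = c"
    proof (intro set_eqI)
      fix t
      show "t \<in> \<Phi> (c \<inter> triangles S, f) \<longleftrightarrow> t \<in> c"
      proof (cases "fst t < 2 \<and> t \<notin> triangles S")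
        case True
        then obtain q where q: "q \<in> verts t" "q \<notin> S" by (auto simp: triangles_def)
        have "t \<in> \<Phi> (c \<inter> triangles S, f) \<longleftrightarrow> q \<in> f"
          by (rule \<Phi>_iff) (use True q fG in auto)
        also have "\<dots> \<longleftrightarrow> t \<in> c" using around_vertex[OF bc q(2) _ q(1)] True q by (simp add: f_def)
        finally show ?thesis .
      next
        case False
        then show ?thesis
          using \<Phi>_tri[of "c \<inter> triangles S" f] \<Phi>_fin(2)[of "c \<inter> triangles S" f] fG c(2) by blast
      qed
    qed
    then show "z \<in> (bdry \<circ> \<Phi>) ` (Pow (triangles S) \<times> ?G)"
      using fG c by (intro image_eqI[of _ _ "(c \<inter> triangles S, f)"]) auto
  qed
  have finZ: "finite ?Z" using finite_faces(1)[OF S] by simp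
  \<comment> \<open>Finiteness of the set of holes comes for free here:
    \<open>bdry \<circ> \<Phi>\<close> embeds the product into the finite set
    \<open>?Z\<close>.\<close>
  have "finite (Pow (triangles S) \<times> ?G)"
    by (rule finite_imageD[OF _ inj]) (simp only: img finZ)
  then have finG: "finite ?G"
    by (rule finite_cartesian_productD2) blast
  have eq: "equiv (- S) ?r" by (rule reach_equiv[OF sym_hexadj])
  have "{\<kappa> \<in> (- S) // ?r. finite \<kappa>} \<subseteq> ?G"
    using in_quotient_imp_subset[OF eq] in_quotient_imp_closed[OF eq] by blast
  then have "finite {\<kappa> \<in> (- S) // ?r. finite \<kappa>}" using finG finite_subset by blast
  from card_saturated[OF eq this] have G: "card ?G = 2 ^ card {\<kappa> \<in> (- S) // ?r. finite \<kappa>}" .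
  have "card ?Z = card (Pow (triangles S) \<times> ?G)"
    using card_image[OF inj] unfolding img .
  then show ?thesis
    unfolding card_cartesian_product card_Pow[OF finite_faces(2)[OF S]] G .
qed

text \<open>An edge meets \<open>f\<close> evenly iff both or none of its two ends lie in
  \<open>f\<close>, so these sets are the unions of components of \<open>S\<close>.\<close>

lemma card_cuts:
  assumes S: "finite S"
  shows "card {f \<in> Pow S. \<forall>e\<in>edges S. even (card {v\<in>f. v \<in> ends e})} = 2 ^ card (S // reach hexadj S)"
proof -
  let ?r = "reach hexadj S"
  have eq: "equiv S ?r" by (rule reach_equiv[OF sym_hexadj])
  have fin: "finite \<kappa>" if "\<kappa> \<in> S // ?r" for \<kappa>
    using in_quotient_imp_subset[OF eq that] S finite_subset by blast
  have Q: "{\<kappa> \<in> S // ?r. finite \<kappa>} = S // ?r" using fin by blast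
  have "finite (S // ?r)" by (rule finite_quotient[OF S]) (auto simp: reach_def)
  then have "card {f. finite f \<and> f \<subseteq> S \<and> (\<forall>x\<in>f. \<forall>y. (x, y) \<in> ?r \<longrightarrow> y \<in> f)} = 2 ^ card (S // ?r)"
    using card_saturated[OF eq] Q by simp
  moreover have "{f. finite f \<and> f \<subseteq> S \<and> (\<forall>x\<in>f. \<forall>y. (x, y) \<in> ?r \<longrightarrow> y \<in> f)} =
      {f \<in> Pow S. \<forall>e\<in>edges S. even (card {v\<in>f. v \<in> ends e})}"
  proof -
    have par: "even (card {v\<in>f. v \<in> ends e}) \<longleftrightarrow> (\<forall>x\<in>ends e. \<forall>y\<in>ends e. x \<in> f \<longleftrightarrow> y \<in> f)" for f e
    proof -
      obtain k i j where "e = (k, i, j)" by (cases e)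
      then have "ends e = {if k = 0 \<or> k = 1 then (i, j) else (i + 1, j), if k = 0 then (i + 1, j) else (i, j + 1)}"
        "(if k = 0 \<or> k = 1 then (i, j) else (i + 1, j)) \<noteq> (if k = 0 then (i + 1, j) else (i, j + 1))"
        by auto
      then obtain x y where xy: "ends e = {x, y}" "x \<noteq> y" by blast
      have "{v\<in>f. v \<in> ends e} = (if x \<in> f then {x} else {}) \<union> (if y \<in> f then {y} else {})"
        using xy by auto
      then show ?thesis using xy by auto
    qed
    have adj: "(x, y) \<in> hexadj \<longleftrightarrow> (\<exists>e. fst e < 3 \<and> ends e = {x, y})" for x y
    proof
      obtain i j i' j' where q: "x = (i, j)" "y = (i', j')" by (metis surj_pair)
      assume "(x, y) \<in> hexadj"
      then have "(i', j') \<in> {(i+1,j), (i-1,j), (i,j+1), (i,j-1), (i+1,j-1), (i-1,j+1)}"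
        using q by (auto simp: hexadj_def)
      then have "ends (0, i, j) = {x, y} \<or> ends (0, i - 1, j) = {x, y} \<or> ends (1, i, j) = {x, y} \<or>
          ends (1, i, j - 1) = {x, y} \<or> ends (2, i, j - 1) = {x, y} \<or> ends (2, i - 1, j) = {x, y}"
        using q by (auto simp: doubleton_eq_iff)
      then show "\<exists>e. fst e < 3 \<and> ends e = {x, y}"
        by (elim disjE) (rule exI, rule conjI[rotated], assumption, simp)+
    next
      assume "\<exists>e. fst e < 3 \<and> ends e = {x, y}"
      then obtain e where e: "fst e < 3" "ends e = {x, y}" by blast
      obtain k i j where k: "e = (k, i, j)" by (cases e)
      have "k = 0 \<or> k = 1 \<or> k = 2" using e k by (simp add: less_3_cases)
      then show "(x, y) \<in> hexadj"
        using e(2) unfolding k by (elim disjE) (auto simp: doubleton_eq_iff hexadj_def)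
    qed
    show ?thesis
    proof (intro set_eqI iffI)
      fix f assume f: "f \<in> {f. finite f \<and> f \<subseteq> S \<and> (\<forall>x\<in>f. \<forall>y. (x, y) \<in> ?r \<longrightarrow> y \<in> f)}"
      have "x \<in> f \<longrightarrow> y \<in> f" if e: "e \<in> edges S" "x \<in> ends e" "y \<in> ends e" for e x y
      proof (cases "x = y")
        case False
        have "ends e = {x, y}" using e False by (cases e) (auto split: if_splits)
        then have "(x, y) \<in> hexadj" using adj e unfolding edges_def by blast
        then have "(x, y) \<in> ?r" using e unfolding edges_def by (intro reach_step) auto
        then show ?thesis using f by blast
      qed simp
      then show "f \<in> {f \<in> Pow S. \<forall>e\<in>edges S. even (card {v\<in>f. v \<in> ends e})}"
        using f unfolding par by blast
    next
      fix f assume f: "f \<in> {f \<in> Pow S. \<forall>e\<in>edges S. even (card {v\<in>f. v \<in> ends e})}"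
      have "y \<in> f" if x: "x \<in> f" and xy: "(x, y) \<in> ?r" for x y
      proof -
        have "(x, y) \<in> (restr hexadj S)\<^sup>*" using xy by (simp add: reach_def)
        then show ?thesis
        proof (induction rule: rtrancl_induct)
          case (step y y')
          then have yy: "(y, y') \<in> hexadj" "y \<in> S" "y' \<in> S" by (auto simp: restr_def)
          then obtain e where e: "fst e < 3" "ends e = {y, y'}" using adj by blast
          then have "e \<in> edges S" using yy by (auto simp: edges_def)
          then show ?case using f e step unfolding par by auto
        qed (rule x)
      qed
      then show "f \<in> {f. finite f \<and> f \<subseteq> S \<and> (\<forall>x\<in>f. \<forall>y. (x, y) \<in> ?r \<longrightarrow> y \<in> f)}"
        using f S finite_subset by blast
    qed
  qed
  ultimately show ?thesis by simp
qed

text \<open>\<open>cycles_cuts\<close> for the graph of \<open>S\<close>, with both cardinalities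
  evaluated as powers of 2; the formula compares exponents.\<close>

theorem discrete_euler:
  assumes "finite S"
  shows "card S + card (triangles S) + card {\<kappa> \<in> (- S) // reach hexadj (- S). finite \<kappa>} =
     card (edges S) + card (S // reach hexadj S)"
proof -
  have "(2::nat) ^ (card (triangles S) + card {\<kappa> \<in> (- S) // reach hexadj (- S). finite \<kappa>} + card S) =
      2 ^ (card (edges S) + card (S // reach hexadj S))"
    using cycles_cuts[OF assms finite_faces(1)[OF assms], of "\<lambda>v e. v \<in> ends e"]
    unfolding card_cycles[OF assms] card_cuts[OF assms] by (simp add: power_add)
  then show ?thesis by (simp add: power_inject_exp)
qed

section \<open>Expected pair counts\<close>

lemma Complex_measurable[measurable]:
  assumes "f \<in> borel_measurable M" "g \<in> borel_measurable M"
  shows "(\<lambda>x. Complex (f x) (g x)) \<in> borel_measurable M"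
  unfolding Complex_eq using assms by measurable

lemma lborel_complex: "distr (lborel \<Otimes>\<^sub>M lborel) borel (\<lambda>(x, y). Complex x y) = lborel"
proof (rule lborel_eqI[symmetric])
  fix l u :: complex assume *: "\<And>b. b \<in> Basis \<Longrightarrow> l \<bullet> b \<le> u \<bullet> b"
  have le: "Re l \<le> Re u" "Im l \<le> Im u" using *[of 1] *[of \<i>] by (auto simp: Basis_complex_def)
  have "(\<lambda>(x, y). Complex x y) -` box l u \<inter> space (lborel \<Otimes>\<^sub>M lborel) = box (Re l) (Re u) \<times> box (Im l) (Im u)"
    by (auto simp: space_pair_measure box_def Basis_complex_def)
  then show "emeasure (distr (lborel \<Otimes>\<^sub>M lborel) borel (\<lambda>(x, y). Complex x y)) (box l u) = ennreal (\<Prod>b\<in>Basis. (u - l) \<bullet> b)"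
    using le by (simp add: emeasure_distr lborel.emeasure_pair_measure_Times Basis_complex_def ennreal_mult)
qed simp

lemma nn_integral_complex:
  fixes f :: "complex \<Rightarrow> ennreal"
  assumes [measurable]: "f \<in> borel_measurable borel"
  shows "(\<integral>\<^sup>+z. f z \<partial>lborel) = (\<integral>\<^sup>+x. \<integral>\<^sup>+y. f (Complex x y) \<partial>lborel \<partial>lborel)"
  by (subst lborel_complex[symmetric]) (simp add: nn_integral_distr lborel.nn_integral_fst[symmetric])

lemma nn_integral_complex_swap:
  fixes f :: "complex \<Rightarrow> ennreal"
  assumes [measurable]: "f \<in> borel_measurable borel"
  shows "(\<integral>\<^sup>+z. f z \<partial>lborel) = (\<integral>\<^sup>+y. \<integral>\<^sup>+x. f (Complex x y) \<partial>lborel \<partial>lborel)"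
  unfolding nn_integral_complex[OF assms] by (rule lborel_pair.Fubini'[symmetric]) measurable

lemma nn_integral_lborel_translate:
  fixes f :: "'a::euclidean_space \<Rightarrow> ennreal"
  assumes [measurable]: "f \<in> borel_measurable borel"
  shows "(\<integral>\<^sup>+z. f (c + z) \<partial>lborel) = (\<integral>\<^sup>+z. f z \<partial>lborel)"
  by (subst (2) lborel_distr_plus[of c, symmetric]) (simp add: nn_integral_distr)

text \<open>A rotation other than \<open>-1\<close> is a product of three shears.\<close>

lemma nn_integral_rotate:
  fixes f :: "complex \<Rightarrow> ennreal"
  assumes f[measurable]: "f \<in> borel_measurable borel" and e: "norm e = 1"
  shows "(\<integral>\<^sup>+z. f (e * z) \<partial>lborel) = (\<integral>\<^sup>+z. f z \<partial>lborel)"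
proof -
  have sh1: "(\<integral>\<^sup>+z. f (Complex (Re z) (Im z + t * Re z)) \<partial>lborel) = (\<integral>\<^sup>+z. f z \<partial>lborel)"
    if [measurable]: "f \<in> borel_measurable borel" for f :: "complex \<Rightarrow> ennreal" and t
  proof -
    have "(\<integral>\<^sup>+z. f (Complex (Re z) (Im z + t * Re z)) \<partial>lborel) = (\<integral>\<^sup>+x. \<integral>\<^sup>+y. f (Complex x (t * x + y)) \<partial>lborel \<partial>lborel)"
      by (subst nn_integral_complex) (simp_all add: add.commute)
    also have "\<dots> = (\<integral>\<^sup>+z. f z \<partial>lborel)"
      by (subst nn_integral_lborel_translate[where f = "\<lambda>y. f (Complex _ y)"])
        (simp_all add: nn_integral_complex)
    finally show ?thesis .
  qed
  have sh2: "(\<integral>\<^sup>+z. f (Complex (Re z + t * Im z) (Im z)) \<partial>lborel) = (\<integral>\<^sup>+z. f z \<partial>lborel)"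
    if [measurable]: "f \<in> borel_measurable borel" for f :: "complex \<Rightarrow> ennreal" and t
  proof -
    have "(\<integral>\<^sup>+z. f (Complex (Re z + t * Im z) (Im z)) \<partial>lborel) = (\<integral>\<^sup>+y. \<integral>\<^sup>+x. f (Complex (t * y + x) y) \<partial>lborel \<partial>lborel)"
      by (subst nn_integral_complex_swap) (simp_all add: add.commute)
    also have "\<dots> = (\<integral>\<^sup>+z. f z \<partial>lborel)"
      by (subst nn_integral_lborel_translate[where f = "\<lambda>x. f (Complex x _)"])
        (simp_all add: nn_integral_complex_swap)
    finally show ?thesis .
  qed
  have rot: "(\<integral>\<^sup>+z. f (e * z) \<partial>lborel) = (\<integral>\<^sup>+z. f z \<partial>lborel)"
    if f[measurable]: "f \<in> borel_measurable borel" and e: "norm e = 1" "Re e \<noteq> -1" for f :: "complex \<Rightarrow> ennreal" and e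
  proof -
    \<comment> \<open>For \<open>e = cis \<theta>\<close> these are \<open>sin \<theta>\<close> and
      \<open>- tan (\<theta> / 2)\<close>, the shear parameters of the decomposition verified in
      \<open>AB\<close>; the excluded case is the pole of the tangent.\<close>
    define s t where "s = Im e" and "t = - Im e / (1 + Re e)"
    define A B where "A z = Complex (Re z + t * Im z) (Im z)" and "B z = Complex (Re z) (Im z + s * Re z)" for z
    have [measurable]: "A \<in> borel_measurable borel" "B \<in> borel_measurable borel"
      unfolding A_def B_def by measurable
    have n: "Im e * Im e = (1 - Re e) * (1 + Re e)"
      using e by (simp add: cmod_def power2_eq_square algebra_simps)
    have e1: "1 + Re e \<noteq> 0" using e by (simp add: add_eq_0_iff)
    have ts: "t * s = Re e - 1"
    proof -
      have "t * s = - (Im e * Im e) / (1 + Re e)" by (simp add: s_def t_def)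
      also have "\<dots> = Re e - 1" unfolding n using e1 by simp
      finally show ?thesis .
    qed
    have tt: "2 * t + t * (t * s) = - Im e"
    proof -
      have "2 * t + t * (t * s) = t * (1 + Re e)" unfolding ts by (simp add: algebra_simps)
      then show ?thesis using e1 by (simp add: t_def)
    qed
    have AB: "A (B (A z)) = e * z" for z
    proof -
      have "Re z + t * Im z + t * (Im z + s * (Re z + t * Im z)) = (1 + t * s) * Re z + (2 * t + t * (t * s)) * Im z"
        by (simp add: algebra_simps)
      moreover have "Im z + s * (Re z + t * Im z) = s * Re z + (1 + t * s) * Im z"
        by (simp add: algebra_simps)
      ultimately have "Re z + t * Im z + t * (Im z + s * (Re z + t * Im z)) = Re e * Re z - Im e * Im z"
        "Im z + s * (Re z + t * Im z) = Im e * Re z + Re e * Im z"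
        unfolding tt unfolding ts by (simp_all add: s_def)
      then show ?thesis by (simp add: complex_eq_iff A_def B_def)
    qed
    have "(\<integral>\<^sup>+z. f (e * z) \<partial>lborel) = (\<integral>\<^sup>+z. f (A (B (A z))) \<partial>lborel)" by (simp add: AB)
    also have "\<dots> = (\<integral>\<^sup>+z. f (A (B z)) \<partial>lborel)"
      unfolding A_def[of "_::complex"] using sh2[of "\<lambda>z. f (A (B z))" t] by (simp add: A_def)
    also have "\<dots> = (\<integral>\<^sup>+z. f (A z) \<partial>lborel)"
      using sh1[of "\<lambda>z. f (A z)" s] by (simp add: B_def)
    also have "\<dots> = (\<integral>\<^sup>+z. f z \<partial>lborel)"
      using sh2[of f t] by (simp add: A_def)
    finally show ?thesis .
  qed
  show ?thesis
  proof (cases "Re e = -1")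
    case False
    then show ?thesis using rot[OF f e] by simp
  next
    case True
    then have "Im e = 0" using e by (simp add: cmod_def power2_eq_square)
    then have "e = -1" using True by (simp add: complex_eq_iff)
    then have "(\<integral>\<^sup>+z. f (e * z) \<partial>lborel) = (\<integral>\<^sup>+z. f (\<i> * (\<i> * z)) \<partial>lborel)"
      by (simp add: mult.assoc[symmetric])
    also have "\<dots> = (\<integral>\<^sup>+z. f (\<i> * z) \<partial>lborel)"
      by (rule rot[where f = "\<lambda>z. f (\<i> * z)"]) auto
    also have "\<dots> = (\<integral>\<^sup>+z. f z \<partial>lborel)" by (rule rot) auto
    finally show ?thesis .
  qed
qed

lemma nn_integral_similarity:
  fixes f :: "complex \<Rightarrow> ennreal"
  assumes f[measurable]: "f \<in> borel_measurable borel" and e: "norm e = 1" and a: "a > 0"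
  shows "(\<integral>\<^sup>+z. f z \<partial>lborel) = ennreal (a\<^sup>2) * (\<integral>\<^sup>+z. f (of_real a * e * z) \<partial>lborel)"
proof -
  have "(\<integral>\<^sup>+z. f z \<partial>lborel) = (\<integral>\<^sup>+z. f (e * z) \<partial>lborel)" using nn_integral_rotate[OF f e] by simp
  also have "\<dots> = (\<integral>\<^sup>+x. \<integral>\<^sup>+y. f (e * Complex x y) \<partial>lborel \<partial>lborel)"
    by (rule nn_integral_complex) measurable
  also have "\<dots> = ennreal a * (\<integral>\<^sup>+x. \<integral>\<^sup>+y. f (e * Complex (a * x) y) \<partial>lborel \<partial>lborel)"
    using nn_integral_real_affine[of "\<lambda>x. \<integral>\<^sup>+y. f (e * Complex x y) \<partial>lborel" a 0] a by simp
  also have "(\<lambda>x. \<integral>\<^sup>+y. f (e * Complex (a * x) y) \<partial>lborel) = (\<lambda>x. ennreal a * (\<integral>\<^sup>+y. f (e * Complex (a * x) (a * y)) \<partial>lborel))"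
    using nn_integral_real_affine[of "\<lambda>y. f (e * Complex (a * x) y)" a 0 for x] a by (intro ext) simp
  also have "ennreal a * (\<integral>\<^sup>+x. ennreal a * (\<integral>\<^sup>+y. f (e * Complex (a * x) (a * y)) \<partial>lborel) \<partial>lborel) =
      ennreal (a\<^sup>2) * (\<integral>\<^sup>+x. \<integral>\<^sup>+y. f (e * Complex (a * x) (a * y)) \<partial>lborel \<partial>lborel)"
    using a by (simp add: nn_integral_cmult mult.assoc[symmetric] ennreal_mult[symmetric] power2_eq_square)
  also have "(\<integral>\<^sup>+x. \<integral>\<^sup>+y. f (e * Complex (a * x) (a * y)) \<partial>lborel \<partial>lborel) = (\<integral>\<^sup>+z. f (of_real a * e * z) \<partial>lborel)"
  proof -
    have "of_real a * e * Complex x y = e * Complex (a * x) (a * y)" for x y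
      by (simp add: complex_eq_iff algebra_simps)
    moreover have "(\<lambda>z. f (of_real a * e * z)) \<in> borel_measurable borel" by measurable
    ultimately show ?thesis by (simp only: nn_integral_complex)
  qed
  finally show ?thesis .
qed

lemma emeasure_slices:
  assumes Z[measurable]: "Z \<in> sets borel" and e: "norm e = 1"
  shows "emeasure lborel Z = (\<integral>\<^sup>+x. emeasure lborel {y. p + e * Complex x y \<in> Z} \<partial>lborel)"
proof -
  have "emeasure lborel Z = (\<integral>\<^sup>+z. indicator Z z \<partial>lborel)" by simp
  also have "\<dots> = (\<integral>\<^sup>+z. indicator Z (p + z) \<partial>lborel)"
    by (rule nn_integral_lborel_translate[symmetric]) measurable
  also have "\<dots> = (\<integral>\<^sup>+z. indicator Z (p + e * z) \<partial>lborel)"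
    by (rule nn_integral_rotate[symmetric, OF _ e]) measurable
  also have "\<dots> = (\<integral>\<^sup>+x. \<integral>\<^sup>+y. indicator Z (p + e * Complex x y) \<partial>lborel \<partial>lborel)"
    by (rule nn_integral_complex) measurable
  also have "\<dots> = (\<integral>\<^sup>+x. \<integral>\<^sup>+y. indicator {y. p + e * Complex x y \<in> Z} y \<partial>lborel \<partial>lborel)"
    by (simp add: indicator_def)
  also have "\<dots> = (\<integral>\<^sup>+x. emeasure lborel {y. p + e * Complex x y \<in> Z} \<partial>lborel)"
    by (intro nn_integral_cong nn_integral_indicator) measurable
  finally show ?thesis .
qed

text \<open>The points of \<open>grid.lat\<close>, with the offset and the angle as arguments
  because both are integrated over.\<close>

definition rlat :: "real \<Rightarrow> complex \<Rightarrow> real \<Rightarrow> int \<times> int \<Rightarrow> complex" where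
  "rlat a c v x = of_real a * cis v * (of_int (fst x) + \<i> * of_int (snd x) + c)"

definition npairs :: "complex set \<Rightarrow> complex \<Rightarrow> real \<Rightarrow> complex \<Rightarrow> real \<Rightarrow> real" where
  "npairs X d a c v = real (card {x. rlat a c v x \<in> X \<and> rlat a c v x + of_real a * cis v * d \<in> X})"

definition covar :: "complex set \<Rightarrow> complex \<Rightarrow> real" where
  "covar X w = measure lborel {z \<in> X. z + w \<in> X}"

lemma cis_measurable[measurable]: "cis \<in> borel_measurable borel"
  by (intro borel_measurable_continuous_onI continuous_intros)

lemma finite_measure_bounded:
  fixes Z :: "complex set"
  assumes "bounded Z" "Z \<in> sets borel"
  shows "emeasure lborel Z = ennreal (measure lborel Z)"
proof -
  have "emeasure lborel Z \<noteq> \<infinity>"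
    using emeasure_bounded_finite[OF assms(1)] by (simp add: less_top)
  then show ?thesis by (simp add: emeasure_eq_ennreal_measure)
qed

context
  fixes X :: "complex set" and d :: complex and a :: real
  assumes X: "closed X" "bounded X" and a: "a > 0"
begin

lemma X_borel[measurable]: "X \<in> sets borel" using X by simp

text \<open>One finite index set serves all offsets in the closed unit square and all angles at
  once, so sums and integrals can be exchanged.\<close>

lemma window: obtains K :: "(int \<times> int) set" where "finite K"
  "\<forall>c v x. Re c \<in> {0..1} \<longrightarrow> Im c \<in> {0..1} \<longrightarrow> rlat a c v x \<in> X \<longrightarrow> x \<in> K"
proof -
  obtain R where R: "\<And>z. z \<in> X \<Longrightarrow> norm z \<le> R" using X bounded_iff by blast
  define M where "M = \<lceil>R / a + 2\<rceil>"
  have "x \<in> {-M..M} \<times> {-M..M}" if c: "Re c \<in> {0..1}" "Im c \<in> {0..1}" and x: "rlat a c v x \<in> X" for c v x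
  proof -
    have nc: "norm c \<le> 2" using cmod_le[of c] c by auto
    have "norm (rlat a c v x) \<le> R" using R x by auto
    then have "a * norm (of_int (fst x) + \<i> * of_int (snd x) + c) \<le> R"
      using a by (simp add: rlat_def norm_mult)
    then have "norm (of_int (fst x) + \<i> * of_int (snd x) + c) \<le> R / a" using a by (simp add: field_simps)
    then have "norm (Complex (of_int (fst x)) (of_int (snd x))) \<le> R / a + 2"
      using norm_triangle_ineq4[of "of_int (fst x) + \<i> * of_int (snd x) + c" c] nc by (simp add: Complex_eq)
    then have "\<bar>of_int (fst x)\<bar> \<le> R / a + 2" "\<bar>of_int (snd x)\<bar> \<le> R / a + 2"
      using abs_Re_le_cmod[of "Complex (of_int (fst x)) (of_int (snd x))"]
        abs_Im_le_cmod[of "Complex (of_int (fst x)) (of_int (snd x))"] by auto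
    then have "\<bar>fst x\<bar> \<le> M" "\<bar>snd x\<bar> \<le> M" unfolding M_def by linarith+
    then show ?thesis by (cases x) auto
  qed
  then show thesis using that[of "{-M..M} \<times> {-M..M}"] by blast
qed

definition Bset :: "(complex \<times> real) set" where
  "Bset = {p. fst p \<in> X \<and> fst p + of_real a * cis (snd p) * d \<in> X}"

lemma Bset_measurable[measurable]: "Bset \<in> sets (borel \<Otimes>\<^sub>M borel)"
proof -
  have "{p \<in> space (borel \<Otimes>\<^sub>M borel). fst p \<in> X \<and> fst p + of_real a * cis (snd p) * d \<in> X} \<in> sets (borel \<Otimes>\<^sub>M borel)"
    by measurable
  then show ?thesis by (simp add: Bset_def space_pair_measure)
qed

text \<open>Unfolding: the unit squares translated by the window tile the relevant part of the plane.\<close>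

lemma unfold_squares:
  "(\<integral>\<^sup>+c. (ennreal (npairs X d a c v)) * indicator (cbox 0 (1 + \<i>)) c \<partial>lborel) =
     ennreal (covar X (of_real a * cis v * d) / a\<^sup>2)"
proof -
  obtain K :: "(int \<times> int) set" where K: "finite K"
    "\<forall>c v x. Re c \<in> {0..1} \<longrightarrow> Im c \<in> {0..1} \<longrightarrow> rlat a c v x \<in> X \<longrightarrow> x \<in> K"
    by (rule window) (rule that)
  \<comment> \<open>The half-open square, whose integer translates partition the plane; it differs
    from the closed box of the uniform distribution by a null set.\<close>
  define Q where "Q = {c::complex. 0 \<le> Re c \<and> Re c < 1 \<and> 0 \<le> Im c \<and> Im c < 1}"
  have [measurable]: "Q \<in> sets borel" unfolding Q_def by measurable
  define sh where "sh x = (of_int (fst x) + \<i> * of_int (snd x) :: complex)" for x :: "int \<times> int"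
  define g :: "complex \<Rightarrow> ennreal" where "g w = indicator Bset (of_real a * cis v * w, v)" for w
  have [measurable]: "g \<in> borel_measurable borel" unfolding g_def by measurable
  have np: "ennreal (npairs X d a c v) = (\<Sum>x\<in>K. g (sh x + c))" if "c \<in> Q" for c
  proof -
    have "{x. rlat a c v x \<in> X \<and> rlat a c v x + of_real a * cis v * d \<in> X} = {x\<in>K. (rlat a c v x, v) \<in> Bset}"
      using K(2)[rule_format, of c v] that by (auto simp: Bset_def Q_def)
    then have "npairs X d a c v = (\<Sum>x\<in>K. if (rlat a c v x, v) \<in> Bset then 1 else 0)"
      unfolding npairs_def using K(1) by (simp add: sum.inter_filter[symmetric])
    also have "ennreal \<dots> = (\<Sum>x\<in>K. ennreal (if (rlat a c v x, v) \<in> Bset then 1 else 0))"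
      by (rule sum_ennreal[symmetric]) simp
    also have "\<dots> = (\<Sum>x\<in>K. g (sh x + c))"
      by (intro sum.cong refl) (simp add: g_def sh_def rlat_def indicator_def)
    finally show ?thesis .
  qed
  have Qbox: "AE c in lborel. indicator (cbox 0 (1 + \<i>)) c = (indicator Q c :: ennreal)"
  proof -
    have "AE c in lborel. c \<notin> {z. Re z = 1} \<and> c \<notin> {z. Im z = 1}"
    proof -
      have "negligible {z::complex. z \<bullet> 1 = 1}" "negligible {z::complex. z \<bullet> \<i> = 1}"
        by (rule negligible_standard_hyperplane; simp add: Basis_complex_def)+
      then have "{z::complex. Re z = 1} \<in> null_sets lebesgue" "{z::complex. Im z = 1} \<in> null_sets lebesgue"
        by (simp_all add: negligible_iff_null_sets)
      then have "AE c in lebesgue. c \<notin> {z. Re z = 1} \<and> c \<notin> {z. Im z = 1}"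
        by (intro AE_conjI AE_not_in)
      then show ?thesis by (simp add: AE_completion_iff)
    qed
    then show ?thesis
      by eventually_elim (auto simp: Q_def indicator_def in_cbox_complex_iff)
  qed
  have "(\<integral>\<^sup>+c. (ennreal (npairs X d a c v)) * indicator (cbox 0 (1 + \<i>)) c \<partial>lborel) =
      (\<integral>\<^sup>+c. (ennreal (npairs X d a c v)) * indicator Q c \<partial>lborel)"
    by (rule nn_integral_cong_AE) (use Qbox in \<open>eventually_elim, simp\<close>)
  also have "\<dots> = (\<integral>\<^sup>+c. (\<Sum>x\<in>K. g (sh x + c) * indicator Q c) \<partial>lborel)"
    by (intro nn_integral_cong) (auto simp: np indicator_def)
  also have "\<dots> = (\<Sum>x\<in>K. \<integral>\<^sup>+c. g (sh x + c) * indicator Q c \<partial>lborel)"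
    by (rule nn_integral_sum) measurable
  also have "\<dots> = (\<Sum>x\<in>K. \<integral>\<^sup>+w. g w * indicator Q (w - sh x) \<partial>lborel)"
  proof (rule sum.cong[OF refl])
    fix x
    show "(\<integral>\<^sup>+c. g (sh x + c) * indicator Q c \<partial>lborel) = (\<integral>\<^sup>+w. g w * indicator Q (w - sh x) \<partial>lborel)"
      using nn_integral_lborel_translate[of "\<lambda>w. g w * indicator Q (w - sh x)" "sh x"] by simp
  qed
  also have "\<dots> = (\<integral>\<^sup>+w. (\<Sum>x\<in>K. g w * indicator Q (w - sh x)) \<partial>lborel)"
    by (rule nn_integral_sum[symmetric]) measurable
  also have "\<dots> = (\<integral>\<^sup>+w. g w \<partial>lborel)"
  proof (rule nn_integral_cong)
    fix w
    define x0 where "x0 = (\<lfloor>Re w\<rfloor>, \<lfloor>Im w\<rfloor>)"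
    have Q: "w - sh x \<in> Q \<longleftrightarrow> x = x0" for x
    proof -
      have "w - sh x \<in> Q \<longleftrightarrow> \<lfloor>Re w\<rfloor> = fst x \<and> \<lfloor>Im w\<rfloor> = snd x"
        unfolding Q_def sh_def floor_eq_iff by (simp, linarith)
      then show ?thesis by (auto simp: x0_def prod_eq_iff)
    qed
    show "(\<Sum>x\<in>K. g w * indicator Q (w - sh x)) = g w"
    proof (cases "g w = 0")
      case False
      then have "of_real a * cis v * w \<in> X" by (auto simp: g_def Bset_def indicator_def split: if_splits)
      moreover have "rlat a (w - sh x0) v x0 = of_real a * cis v * w" by (simp add: rlat_def sh_def)
      moreover have "w - sh x0 \<in> Q" using Q by simp
      ultimately have "x0 \<in> K" using K(2)[rule_format, of "w - sh x0" v x0] by (simp add: Q_def)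
      have "(\<Sum>x\<in>K. g w * indicator Q (w - sh x)) = (\<Sum>x\<in>K. if x = x0 then g w else 0)"
        by (intro sum.cong refl) (simp add: indicator_def Q)
      then show ?thesis using \<open>x0 \<in> K\<close> K(1) by simp
    qed simp
  qed
  also have "\<dots> = ennreal (covar X (of_real a * cis v * d) / a\<^sup>2)"
  proof -
    let ?Z = "{z \<in> X. z + of_real a * cis v * d \<in> X}"
    have [measurable]: "?Z \<in> sets borel"
    proof -
      have "{z \<in> space borel. z \<in> X \<and> z + of_real a * cis v * d \<in> X} \<in> sets borel" by measurable
      then show ?thesis by simp
    qed
    have b: "bounded ?Z" using X by (auto intro: bounded_subset)
    have "ennreal (covar X (of_real a * cis v * d)) = (\<integral>\<^sup>+z. indicator ?Z z \<partial>lborel)"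
      unfolding covar_def using finite_measure_bounded[OF b] by simp
    also have "\<dots> = ennreal (a\<^sup>2) * (\<integral>\<^sup>+z. indicator ?Z (of_real a * cis v * z) \<partial>lborel)"
      by (rule nn_integral_similarity) (use a in auto)
    also have "(\<lambda>z. indicator ?Z (of_real a * cis v * z)) = g"
      by (auto simp: fun_eq_iff g_def Bset_def indicator_def)
    finally have "ennreal (1 / a\<^sup>2) * ennreal (covar X (of_real a * cis v * d)) = ennreal (1 / a\<^sup>2) * ennreal (a\<^sup>2) * (\<integral>\<^sup>+w. g w \<partial>lborel)"
      by (simp add: mult.assoc)
    moreover have "ennreal (1 / a\<^sup>2) * ennreal (a\<^sup>2) = 1" using a by (simp add: ennreal_mult[symmetric])
    ultimately show ?thesis
      by (simp add: ennreal_mult[symmetric] covar_def)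
  qed
  finally show ?thesis .
qed

lemma covar_measurable: "(\<lambda>v. covar X (of_real a * cis v * d)) \<in> borel_measurable borel"
proof -
  have "(\<lambda>v. emeasure lborel ((\<lambda>z. (z, v)) -` Bset)) \<in> borel_measurable lborel"
    by (rule lborel_pair.measurable_emeasure_Pair2) measurable
  moreover have "(\<lambda>z. (z, v)) -` Bset = {z \<in> X. z + of_real a * cis v * d \<in> X}" for v
    by (auto simp: Bset_def)
  ultimately show ?thesis by (simp add: covar_def measure_def)
qed

lemma npairs_measurable: "(\<lambda>(c, v). npairs X d a c v) \<in> borel_measurable lattice_measure"
  and npairs_integral: "integrable lattice_measure (\<lambda>(c, v). npairs X d a c v)"
    "lattice_expect (npairs X d a) =
       (LINT v:{0..2*pi}|lborel. covar X (of_real a * cis v * d)) / (2 * pi * a\<^sup>2)"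
proof -
  let ?U = "uniform_measure lborel (cbox 0 (1 + \<i>)) :: complex measure"
  let ?V = "uniform_measure lborel {0..2*pi} :: real measure"
  have eU: "emeasure lborel (cbox 0 (1 + \<i>)) = 1"
    by (subst emeasure_lborel_cbox) (auto simp: Basis_complex_def)
  interpret U: prob_space ?U by (rule prob_space_uniform_measure) (auto simp: eU)
  interpret V: prob_space ?V by (rule prob_space_uniform_measure) auto
  interpret UV: pair_sigma_finite ?U ?V ..
  obtain K :: "(int \<times> int) set" where K: "finite K"
    "\<forall>c v x. Re c \<in> {0..1} \<longrightarrow> Im c \<in> {0..1} \<longrightarrow> rlat a c v x \<in> X \<longrightarrow> x \<in> K"
    by (rule window) (rule that)
  define h where "h c v = (\<Sum>x\<in>K. indicator Bset (rlat a c v x, v) :: real)" for c v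
  have sets_eq: "sets lattice_measure = sets (borel \<Otimes>\<^sub>M borel)"
    unfolding lattice_measure_def by (intro sets_pair_measure_cong) auto
  have fin: "finite {x. rlat a c v x \<in> X}" for c v
  proof -
    interpret grid a "cis v" c by standard (use a in auto)
    have "rlat a c v = lat" by (auto simp: rlat_def lat_def)
    then show ?thesis using finite_lat_bounded[OF X(2)] by simp
  qed
  show meas: "(\<lambda>(c, v). npairs X d a c v) \<in> borel_measurable lattice_measure"
  proof -
    \<comment> \<open>The finite window is valid only for offsets in the unit square, while
      measurability concerns all offsets. Hence the count is written as an integral over counting
      measure on all indices.\<close>
    have eq: "npairs X d a c v = (\<integral>\<^sup>+x. indicator Bset (rlat a c v x, v) \<partial>count_space UNIV)" for c v
    proof -
      have "(\<integral>\<^sup>+x. indicator Bset (rlat a c v x, v) \<partial>count_space UNIV) =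
          (\<integral>\<^sup>+x. indicator {x. (rlat a c v x, v) \<in> Bset} x \<partial>count_space UNIV)"
        by (intro nn_integral_cong) (simp add: indicator_def)
      also have "\<dots> = emeasure (count_space UNIV) {x. (rlat a c v x, v) \<in> Bset}" by simp
      also have "\<dots> = of_nat (card {x. (rlat a c v x, v) \<in> Bset})"
        by (rule emeasure_count_space_finite) (use fin[of c v] in \<open>auto simp: Bset_def intro: rev_finite_subset\<close>)
      finally show ?thesis by (simp add: npairs_def Bset_def ennreal_of_nat_eq_real_of_nat)
    qed
    have [measurable]: "(\<lambda>p. rlat a (fst p) (snd p) x) \<in> borel_measurable (borel \<Otimes>\<^sub>M borel)" for x
      unfolding rlat_def by measurable
    have "(\<lambda>p. npairs X d a (fst p) (snd p)) = (\<lambda>p. enn2real (\<integral>\<^sup>+x. indicator Bset (rlat a (fst p) (snd p) x, snd p) \<partial>count_space UNIV))"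
      by (simp add: eq[symmetric] npairs_def)
    moreover have "(\<lambda>p. enn2real (\<integral>\<^sup>+x. indicator Bset (rlat a (fst p) (snd p) x, snd p) \<partial>count_space UNIV)) \<in> borel_measurable (borel \<Otimes>\<^sub>M borel)"
    proof -
      have "(\<lambda>(p, x). indicator Bset (rlat a (fst p) (snd p) x, snd p) :: ennreal) \<in> borel_measurable ((borel \<Otimes>\<^sub>M borel) \<Otimes>\<^sub>M count_space UNIV)"
        unfolding measurable_pair_swap_iff[of _ "borel \<Otimes>\<^sub>M borel"]
        by (rule measurable_pair_measure_countable1) simp_all
      then show ?thesis
        by (intro borel_measurable_enn2real sigma_finite_measure.borel_measurable_nn_integral
            sigma_finite_measure_count_space_countable) auto
    qed
    ultimately show ?thesis
      unfolding measurable_cong_sets[OF sets_eq refl] case_prod_unfold by simp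
  qed
  have "(\<integral>\<^sup>+p. ennreal (case p of (c, v) \<Rightarrow> npairs X d a c v) \<partial>lattice_measure) =
      (\<integral>\<^sup>+v. \<integral>\<^sup>+c. ennreal (npairs X d a c v) \<partial>?U \<partial>?V)"
    unfolding lattice_measure_def
    using UV.nn_integral_snd[of "\<lambda>p. ennreal (case p of (c, v) \<Rightarrow> npairs X d a c v)"] meas
    by (simp add: lattice_measure_def)
  also have "\<dots> = (\<integral>\<^sup>+v. ennreal (covar X (of_real a * cis v * d) / a\<^sup>2) \<partial>?V)"
  proof (rule nn_integral_cong)
    fix v
    have "(\<lambda>c. npairs X d a c v) \<in> borel_measurable ?U"
      using measurable_Pair1[OF meas[unfolded lattice_measure_def], of v] by simp
    then have "(\<lambda>c. npairs X d a c v) \<in> borel_measurable lborel" by simp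
    then have "(\<integral>\<^sup>+c. ennreal (npairs X d a c v) \<partial>?U) =
        (\<integral>\<^sup>+c. ennreal (npairs X d a c v) * indicator (cbox 0 (1 + \<i>)) c \<partial>lborel) / emeasure lborel (cbox 0 (1 + \<i>))"
      by (intro nn_integral_uniform_measure) auto
    then show "(\<integral>\<^sup>+c. ennreal (npairs X d a c v) \<partial>?U) = ennreal (covar X (of_real a * cis v * d) / a\<^sup>2)"
      unfolding eU unfold_squares by (simp add: divide_ennreal_def)
  qed
  also have "\<dots> = (\<integral>\<^sup>+v. ennreal (covar X (of_real a * cis v * d) / a\<^sup>2) * indicator {0..2*pi} v \<partial>lborel) / emeasure lborel {0..2*pi}"
    by (rule nn_integral_uniform_measure) (use covar_measurable in auto)
  also have "(\<lambda>v. ennreal (covar X (of_real a * cis v * d) / a\<^sup>2) * indicator {0..2*pi} v) =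
      (\<lambda>v. ennreal (indicator {0..2*pi} v * covar X (of_real a * cis v * d) / a\<^sup>2))"
    by (auto simp: indicator_def)
  also have "(\<integral>\<^sup>+v. ennreal (indicator {0..2*pi} v * covar X (of_real a * cis v * d) / a\<^sup>2) \<partial>lborel) =
      ennreal (LINT v|lborel. indicator {0..2*pi} v * covar X (of_real a * cis v * d) / a\<^sup>2)"
  proof (rule nn_integral_eq_integral)
    have bound: "covar X w \<le> measure lborel X" for w
      unfolding covar_def using X finite_measure_bounded[of X]
      by (intro measure_mono_fmeasurable) (auto simp: fmeasurable_def)
    have "integrable lborel (\<lambda>v. indicator {0..2*pi} v *\<^sub>R (covar X (of_real a * cis v * d) / a\<^sup>2))"
    proof (rule integrableI_bounded_set_indicator[where B = "measure lborel X / a\<^sup>2"])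
      show "AE x in lborel. x \<in> {0..2*pi} \<longrightarrow> norm (covar X (of_real a * cis x * d) / a\<^sup>2) \<le> measure lborel X / a\<^sup>2"
        using bound by (intro AE_I2) (auto simp: covar_def divide_right_mono)
    qed (use covar_measurable in auto)
    then show "integrable lborel (\<lambda>v. indicator {0..2*pi} v * covar X (of_real a * cis v * d) / a\<^sup>2)" by simp
  qed (auto simp: covar_def)
  also have "ennreal (LINT v|lborel. indicator {0..2*pi} v * covar X (of_real a * cis v * d) / a\<^sup>2) / emeasure lborel {0..2*pi}
      = ennreal ((LINT v:{0..2*pi}|lborel. covar X (of_real a * cis v * d)) / (2 * pi * a\<^sup>2))"
    by (simp add: set_lebesgue_integral_def divide_ennreal[symmetric] divide_ennreal covar_def mult.commute
        integral_nonneg_AE)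
  finally have nn: "(\<integral>\<^sup>+p. ennreal (case p of (c, v) \<Rightarrow> npairs X d a c v) \<partial>lattice_measure) =
      ennreal ((LINT v:{0..2*pi}|lborel. covar X (of_real a * cis v * d)) / (2 * pi * a\<^sup>2))" .
  have I: "integrable lattice_measure (\<lambda>(c, v). npairs X d a c v) \<and>
    (\<integral>p. (case p of (c, v) \<Rightarrow> npairs X d a c v) \<partial>lattice_measure) =
      (LINT v:{0..2*pi}|lborel. covar X (of_real a * cis v * d)) / (2 * pi * a\<^sup>2)"
  proof (rule nn_integral_eq_integrable[THEN iffD1])
    show "0 \<le> (LINT v:{0..2*pi}|lborel. covar X (of_real a * cis v * d)) / (2 * pi * a\<^sup>2)"
      unfolding set_lebesgue_integral_def
      by (intro divide_nonneg_nonneg integral_nonneg_AE AE_I2) (auto simp: covar_def)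
  qed (use meas nn in \<open>auto simp: npairs_def\<close>)
  then show "integrable lattice_measure (\<lambda>(c, v). npairs X d a c v)" by blast
  show "lattice_expect (npairs X d a) =
       (LINT v:{0..2*pi}|lborel. covar X (of_real a * cis v * d)) / (2 * pi * a\<^sup>2)"
    using I unfolding lattice_expect_def by blast
qed

end

section \<open>Integration over directions\<close>

lemma nn_integral_periodic:
  fixes h :: "real \<Rightarrow> ennreal"
  assumes [measurable]: "h \<in> borel_measurable borel" and per: "\<And>v. h (v + 2*pi) = h v"
    and \<psi>: "0 \<le> \<psi>" "\<psi> \<le> 2*pi"
  shows "(\<integral>\<^sup>+v. h (v + \<psi>) * indicator {0..2*pi} v \<partial>lborel) = (\<integral>\<^sup>+v. h v * indicator {0..2*pi} v \<partial>lborel)"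
proof -
  have AE: "(\<integral>\<^sup>+v. k v * indicator {0..2*pi} v \<partial>lborel) = (\<integral>\<^sup>+v. k v * indicator {0<..2*pi} v \<partial>lborel)"
    for k :: "real \<Rightarrow> ennreal"
  proof (rule nn_integral_cong_AE)
    show "AE v in lborel. k v * indicator {0..2*pi} v = k v * indicator {0<..2*pi} v"
      using AE_lborel_singleton[of 0] by eventually_elim (auto simp: indicator_def)
  qed
  have "(\<integral>\<^sup>+v. h (v + \<psi>) * indicator {0<..2*pi} v \<partial>lborel) = (\<integral>\<^sup>+v. h v * indicator {\<psi><..2*pi + \<psi>} v \<partial>lborel)"
    using nn_integral_lborel_translate[of "\<lambda>v. h v * indicator {\<psi><..2*pi + \<psi>} v" \<psi>]
    by (simp add: add.commute indicator_def)
  also have "\<dots> = (\<integral>\<^sup>+v. h v * indicator {\<psi><..2*pi} v + h v * indicator {2*pi<..2*pi + \<psi>} v \<partial>lborel)"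
    using \<psi> by (intro nn_integral_cong) (auto simp: indicator_def)
  also have "\<dots> = (\<integral>\<^sup>+v. h v * indicator {\<psi><..2*pi} v \<partial>lborel) + (\<integral>\<^sup>+v. h v * indicator {2*pi<..2*pi + \<psi>} v \<partial>lborel)"
    by (rule nn_integral_add) measurable
  also have "(\<integral>\<^sup>+v. h v * indicator {2*pi<..2*pi + \<psi>} v \<partial>lborel) = (\<integral>\<^sup>+v. h v * indicator {0<..\<psi>} v \<partial>lborel)"
    using nn_integral_lborel_translate[of "\<lambda>v. h v * indicator {2*pi<..2*pi + \<psi>} v" "2*pi"] per
    by (simp add: add.commute indicator_def)
  also have "(\<integral>\<^sup>+v. h v * indicator {\<psi><..2*pi} v \<partial>lborel) + (\<integral>\<^sup>+v. h v * indicator {0<..\<psi>} v \<partial>lborel)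
      = (\<integral>\<^sup>+v. h v * indicator {\<psi><..2*pi} v + h v * indicator {0<..\<psi>} v \<partial>lborel)"
    by (rule nn_integral_add[symmetric]) measurable
  also have "\<dots> = (\<integral>\<^sup>+v. h v * indicator {0<..2*pi} v \<partial>lborel)"
    using \<psi> by (intro nn_integral_cong) (auto simp: indicator_def)
  finally show ?thesis by (simp only: AE)
qed

lemma inner_cis_sin:
  assumes "norm n = 1" "norm e = 1"
  obtains \<psi> where "0 \<le> \<psi>" "\<psi> \<le> 2*pi" "\<And>v. n \<bullet> (cis v * e) = sin (v + \<psi>)"
proof -
  define w where "w = \<i> * cnj n * e"
  have "norm w = 1" using assms by (simp add: w_def norm_mult)
  then have "(Re w)\<^sup>2 + (Im w)\<^sup>2 = 1" by (metis cmod_power2 one_power2)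
  then obtain \<psi> where \<psi>: "0 \<le> \<psi>" "\<psi> < 2*pi" "Re w = cos \<psi>" "Im w = sin \<psi>"
    using sincos_total_2pi by blast
  have "n \<bullet> (cis v * e) = Im (cis v * w)" for v
    by (simp add: w_def inner_complex_def algebra_simps)
  also have "Im (cis v * w) = sin (v + \<psi>)" for v
    by (simp add: \<psi> sin_add)
  finally show thesis using that[of \<psi>] \<psi> by simp
qed

text \<open>Because \<open>ennreal\<close> truncates at 0, this is the integral of the positive part
  of a shifted sine over a period. It is the origin of the 2 in \<open>2 * L\<close>.\<close>

lemma nn_integral_inner_cis:
  assumes "norm n = 1" "norm e = 1"
  shows "(\<integral>\<^sup>+v. ennreal (n \<bullet> (cis v * e)) * indicator {0..2*pi} v \<partial>lborel) = 2"
proof -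
  obtain \<psi> where \<psi>: "0 \<le> \<psi>" "\<psi> \<le> 2*pi" "\<And>v. n \<bullet> (cis v * e) = sin (v + \<psi>)"
    using inner_cis_sin[OF assms] by metis
  have "(\<integral>\<^sup>+v. ennreal (n \<bullet> (cis v * e)) * indicator {0..2*pi} v \<partial>lborel) =
      (\<integral>\<^sup>+v. ennreal (sin v) * indicator {0..2*pi} v \<partial>lborel)"
    unfolding \<psi>(3) by (rule nn_integral_periodic) (use \<psi> in auto)
  also have "\<dots> = (\<integral>\<^sup>+v. ennreal (sin v) * indicator {0..pi} v \<partial>lborel)"
  proof (rule nn_integral_cong)
    fix v
    have "sin v \<le> 0" if "pi < v" "v \<le> 2*pi"
      using sin_ge_zero[of "v - pi"] that by (simp add: sin_diff)
    then show "ennreal (sin v) * indicator {0..2*pi} v = ennreal (sin v) * indicator {0..pi} v"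
      by (auto simp: indicator_def ennreal_neg)
  qed
  also have "\<dots> = ennreal ((- cos pi) - (- cos 0))"
    by (rule nn_integral_FTC_Icc[of sin 0 pi "\<lambda>x. - cos x"])
      (auto intro!: derivative_eq_intros sin_ge_zero)
  finally show ?thesis by simp
qed

text \<open>Angular measure of the directions that make an angle with sine at most \<open>s\<close>
  with a fixed line; it is the small factor in the second-order estimate.\<close>

definition \<omega> :: "real \<Rightarrow> real" where
  "\<omega> s = measure lborel {v\<in>{0..2*pi}. \<bar>sin v\<bar> \<le> s}"

lemma sin_small_fmeasurable: "{v\<in>{0..2*pi}. \<bar>sin v\<bar> \<le> s} \<in> fmeasurable lborel"
proof (rule fmeasurableI2)
  show "{0..2*pi} \<in> fmeasurable lborel" by (simp add: fmeasurable_def)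
  have "{v \<in> space borel. v \<in> {0..2*pi} \<and> \<bar>sin v\<bar> \<le> s} \<in> sets borel" by measurable
  then show "{v\<in>{0..2*pi}. \<bar>sin v\<bar> \<le> s} \<in> sets lborel" by simp
qed auto

lemma emeasure_inner_cis_small:
  assumes "norm n = 1" "norm e = 1"
  shows "(\<integral>\<^sup>+v. indicator {v. \<bar>n \<bullet> (cis v * e)\<bar> \<le> s} v * indicator {0..2*pi} v \<partial>lborel) = ennreal (\<omega> s)"
proof -
  obtain \<psi> where \<psi>: "0 \<le> \<psi>" "\<psi> \<le> 2*pi" "\<And>v. n \<bullet> (cis v * e) = sin (v + \<psi>)"
    using inner_cis_sin[OF assms] by metis
  have "{v \<in> space borel. \<bar>sin v\<bar> \<le> s} \<in> sets borel" by measurable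
  then have [measurable]: "{v. \<bar>sin v\<bar> \<le> s} \<in> sets borel" by simp
  have "(\<integral>\<^sup>+v. indicator {v. \<bar>n \<bullet> (cis v * e)\<bar> \<le> s} v * indicator {0..2*pi} v \<partial>lborel) =
      (\<integral>\<^sup>+v. indicator {v. \<bar>sin v\<bar> \<le> s} (v + \<psi>) * indicator {0..2*pi} v \<partial>lborel)"
    by (simp add: \<psi>(3) indicator_def)
  also have "\<dots> = (\<integral>\<^sup>+v. indicator {v. \<bar>sin v\<bar> \<le> s} v * indicator {0..2*pi} v \<partial>lborel)"
    by (rule nn_integral_periodic) (use \<psi> in \<open>auto simp: indicator_def\<close>)
  also have "\<dots> = (\<integral>\<^sup>+v. indicator {v\<in>{0..2*pi}. \<bar>sin v\<bar> \<le> s} v \<partial>lborel)"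
    by (intro nn_integral_cong) (auto simp: indicator_def)
  also have "\<dots> = ennreal (\<omega> s)"
    using sin_small_fmeasurable[of s] unfolding \<omega>_def
    by (subst nn_integral_indicator) (auto simp: fmeasurable_def emeasure_eq_ennreal_measure top.not_eq_extremum)
  finally show ?thesis .
qed

lemma \<omega>_nonneg: "0 \<le> \<omega> s" by (simp add: \<omega>_def)

lemma \<omega>_mono: "s \<le> s' \<Longrightarrow> \<omega> s \<le> \<omega> s'"
  unfolding \<omega>_def by (rule measure_mono_fmeasurable) (use sin_small_fmeasurable in \<open>auto simp: fmeasurable_def\<close>)

text \<open>Continuity of the measure from above along \<open>s = 1 / n\<close>: the intersection
  contains only zeros of the sine, a countable set. Monotonicity extends this to real
  \<open>s\<close>.\<close>

lemma \<omega>_tendsto: "(\<omega> \<longlongrightarrow> 0) (at_right 0)"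
proof (rule tendstoI)
  fix \<epsilon> :: real assume \<epsilon>: "\<epsilon> > 0"
  define A where "A n = {v\<in>{0..2*pi}. \<bar>sin v\<bar> \<le> 1 / real (Suc n)}" for n
  have "(\<lambda>n. measure lborel (A n)) \<longlonglongrightarrow> measure lborel (\<Inter>n. A n)"
  proof (rule Lim_measure_decseq)
    show "range A \<subseteq> sets lborel" using sin_small_fmeasurable by (auto simp: A_def fmeasurable_def)
    have "1 / real (Suc n) \<le> 1 / real (Suc m)" if "m \<le> n" for m n
      using that by (intro divide_left_mono) auto
    then show "decseq A" unfolding decseq_def A_def by (smt (verit, best) Collect_mono order_trans)
    show "emeasure lborel (A i) \<noteq> \<infinity>" for i
      using sin_small_fmeasurable[of "1 / real (Suc i)"] by (auto simp: A_def fmeasurable_def)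
  qed
  moreover have "measure lborel (\<Inter>n. A n) = 0"
  proof -
    have "sin v = 0" if "v \<in> (\<Inter>n. A n)" for v
    proof (rule ccontr)
      assume "sin v \<noteq> 0"
      then obtain n where "inverse (real (Suc n)) < \<bar>sin v\<bar>"
        using reals_Archimedean[of "\<bar>sin v\<bar>"] by auto
      moreover have "\<bar>sin v\<bar> \<le> 1 / real (Suc n)" using that by (auto simp: A_def)
      ultimately show False by (simp add: inverse_eq_divide)
    qed
    then have "(\<Inter>n. A n) \<subseteq> range (\<lambda>i::int. real_of_int i * pi)"
      unfolding sin_zero_iff_int2 by blast
    then have "countable (\<Inter>n. A n)" by (rule countable_subset) auto
    then show ?thesis by (simp add: countable_imp_null_set_lborel measure_eq_0_null_sets)
  qed
  ultimately have "(\<lambda>n. measure lborel (A n)) \<longlonglongrightarrow> 0" by simp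
  then have "\<forall>\<^sub>F n in sequentially. measure lborel (A n) < \<epsilon>"
    using \<epsilon> by (rule order_tendstoD(2))
  then obtain n where n: "measure lborel (A n) < \<epsilon>"
    using eventually_happens'[OF sequentially_bot] by blast
  have "\<forall>\<^sub>F s in at_right 0. s < 1 / real (Suc n)"
    by (rule order_tendstoD(2)[OF tendsto_ident_at]) simp
  then show "\<forall>\<^sub>F s in at_right 0. dist (\<omega> s) 0 < \<epsilon>"
  proof eventually_elim
    case (elim s)
    then have "\<omega> s \<le> \<omega> (1 / real (Suc n))" by (intro \<omega>_mono) simp
    then show ?case using n \<omega>_nonneg[of s] by (simp add: A_def \<omega>_def)
  qed
qed

section \<open>Chart coordinates and strips below a graph\<close>

definition crd :: "complex \<Rightarrow> complex \<Rightarrow> complex \<Rightarrow> complex" where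
  "crd f p z = cnj f * (z - p)"

lemma continuous_on_crd[continuous_intros]: "continuous_on A h \<Longrightarrow> continuous_on A (\<lambda>x. crd f p (h x))"
  unfolding crd_def by (intro continuous_intros)

lemma crd_measurable[measurable]: "crd f p \<in> borel_measurable borel"
  by (intro borel_measurable_continuous_onI continuous_intros)

lemma chart_coords:
  assumes "norm f = 1"
  shows "p + f * Complex (Re (crd f p z)) (Im (crd f p z)) = z"
    "crd f p (p + f * Complex x y) = Complex x y"
proof -
  have c: "f * cnj f = 1" using assms by (simp add: complex_norm_square[symmetric])
  show "p + f * Complex (Re (crd f p z)) (Im (crd f p z)) = z"
    unfolding complex_surj crd_def by (simp add: mult.assoc[symmetric] c)
  show "crd f p (p + f * Complex x y) = Complex x y"
    using c by (simp add: crd_def mult.assoc[symmetric] mult.commute)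
qed

definition strip :: "complex \<Rightarrow> complex \<Rightarrow> (real \<Rightarrow> real) \<Rightarrow> real set \<Rightarrow> real \<Rightarrow> complex set" where
  "strip p f g C h = {z. Re (crd f p z) \<in> C \<and> g (Re (crd f p z)) - h < Im (crd f p z) \<and>
     Im (crd f p z) \<le> g (Re (crd f p z))}"

lemma strip_iff:
  "norm f = 1 \<Longrightarrow> p + f * Complex x y \<in> strip p f g C h \<longleftrightarrow> x \<in> C \<and> g x - h < y \<and> y \<le> g x"
  unfolding strip_def by (simp only: mem_Collect_eq chart_coords(2) complex.sel)

lemma strip_measurable:
  assumes [measurable]: "C \<in> sets borel" "g \<in> borel_measurable borel"
  shows "strip p f g C h \<in> sets borel"
proof -
  have "{z \<in> space borel. Re (crd f p z) \<in> C \<and> g (Re (crd f p z)) - h < Im (crd f p z) \<and>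
     Im (crd f p z) \<le> g (Re (crd f p z))} \<in> sets borel" by measurable
  then show ?thesis by (simp only: strip_def space_borel UNIV_I simp_thms)
qed

text \<open>Cavalieri's principle: all vertical slices over \<open>C\<close> have length
  \<open>h\<close>, whatever \<open>g\<close> is. For negative \<open>h\<close> the strip is empty,
  in agreement with \<open>ennreal h = 0\<close>.\<close>

lemma emeasure_strip:
  assumes C: "C \<in> sets borel" and g: "g \<in> borel_measurable borel" and f: "norm f = 1"
  shows "emeasure lborel (strip p f g C h) = emeasure lborel C * ennreal h"
proof -
  have "emeasure lborel {y. p + f * Complex x y \<in> strip p f g C h} = ennreal h * indicator C x" for x
  proof -
    have "{y. p + f * Complex x y \<in> strip p f g C h} = (if x \<in> C then {g x - h<..g x} else {})"
      by (auto simp: strip_iff[OF f])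
    moreover have "emeasure lborel {g x - h<..g x} = ennreal h"
      by (cases "h \<ge> 0") (auto simp: ennreal_neg)
    ultimately show ?thesis by (simp add: indicator_def)
  qed
  then have "emeasure lborel (strip p f g C h) = (\<integral>\<^sup>+x. ennreal h * indicator C x \<partial>lborel)"
    by (simp only: emeasure_slices[OF strip_measurable[OF C g, of p f h] f, of p])
  also have "\<dots> = ennreal h * emeasure lborel C"
    by (rule nn_integral_cmult_indicator) (use C in simp)
  finally show ?thesis by (simp add: mult.commute)
qed

lemma chart_g_measurable: "chart \<epsilon> s X p f g \<Longrightarrow> g \<in> borel_measurable borel" and
  chart_g_continuous: "chart \<epsilon> s X p f g \<Longrightarrow> continuous_on UNIV g"
proof -
  assume c: "chart \<epsilon> s X p f g"
  have "\<bar>\<epsilon>\<bar>-lipschitz_on UNIV g"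
  proof (rule lipschitz_onI)
    show "dist (g x) (g y) \<le> \<bar>\<epsilon>\<bar> * dist x y" for x y
      using c mult_right_mono[of \<epsilon> "\<bar>\<epsilon>\<bar>" "\<bar>x - y\<bar>"] unfolding chart_def dist_real_def
      by (meson abs_ge_self abs_ge_zero order_trans)
  qed simp
  then show cont: "continuous_on UNIV g" by (rule lipschitz_on_continuous_on)
  then show "g \<in> borel_measurable borel" by (rule borel_measurable_continuous_onI)
qed

lemma unit_coords:
  assumes f: "norm f = 1" and u: "norm u = 1"
  obtains cx where "u = f * Complex cx ((\<i> * f) \<bullet> u)" "\<bar>cx\<bar> \<le> 1" "\<bar>(\<i> * f) \<bullet> u\<bar> \<le> 1"
proof -
  define w where "w = cnj f * u"
  have "f * cnj f = 1" using f by (simp add: complex_norm_square[symmetric])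
  then have u': "u = f * Complex (Re w) (Im w)" unfolding complex_surj by (simp add: w_def mult.assoc[symmetric])
  have "(\<i> * f) \<bullet> u = Im w" by (simp add: w_def inner_complex_def algebra_simps)
  moreover have "norm w = 1" using f u by (simp add: w_def norm_mult)
  ultimately show thesis
    using that[of "Re w"] u' abs_Re_le_cmod[of w] abs_Im_le_cmod[of w] by simp
qed

text \<open>A step \<open>t * u\<close> raises the point by \<open>t\<close> times the normal part
  of \<open>u\<close>, while the graph above it drops by at most \<open>\<epsilon> * t\<close>. Only
  points at most this far below the graph can leave \<open>X\<close>.\<close>

lemma chart_exit_strip:
  assumes c: "chart \<epsilon> s X p f g" and \<epsilon>: "0 \<le> \<epsilon>" and t: "0 \<le> t" and u: "norm u = 1"
    and xy: "\<bar>x\<bar> \<le> s - t" "\<bar>y\<bar> \<le> s - t"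
    and z: "p + f * Complex x y \<in> X" "p + f * Complex x y + of_real t * u \<notin> X"
  shows "g x - t * ((\<i> * f) \<bullet> u + \<epsilon>) < y" "y \<le> g x"
proof -
  have f: "norm f = 1" using c by (simp add: chart_def)
  define cy where "cy = (\<i> * f) \<bullet> u"
  obtain cx where u': "u = f * Complex cx cy" and cx: "\<bar>cx\<bar> \<le> 1" "\<bar>cy\<bar> \<le> 1"
    unfolding cy_def using unit_coords[OF f u] by metis
  have eq: "p + f * Complex x y + of_real t * u = p + f * Complex (x + t * cx) (y + t * cy)"
    unfolding u' by (simp add: complex_eq_iff algebra_simps)
  have tc: "\<bar>t * cx\<bar> \<le> t" "\<bar>t * cy\<bar> \<le> t" using cx t by (auto simp: abs_mult intro: mult_left_le)
  have "\<bar>x + t * cx\<bar> \<le> s" "\<bar>y + t * cy\<bar> \<le> s" using tc xy by linarith+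
  then have 1: "g (x + t * cx) < y + t * cy"
    using c z(2) unfolding chart_def eq by (meson not_less)
  have "\<bar>g (x + t * cx) - g x\<bar> \<le> \<epsilon> * \<bar>t * cx\<bar>" using c unfolding chart_def by (metis add_diff_cancel_left')
  also have "\<dots> \<le> \<epsilon> * t" using tc \<epsilon> by (intro mult_left_mono)
  finally have "g x - \<epsilon> * t \<le> g (x + t * cx)" by linarith
  then show "g x - t * ((\<i> * f) \<bullet> u + \<epsilon>) < y"
    using 1 unfolding cy_def[symmetric] by (simp add: algebra_simps)
  have "\<bar>x\<bar> \<le> s" "\<bar>y\<bar> \<le> s" using xy t by auto
  then show "y \<le> g x" using c z(1) unfolding chart_def by blast
qed

text \<open>Counterpart of \<open>chart_exit_strip\<close>, with the depth reduced by
  \<open>\<epsilon> * t\<close> instead of increased. The last claim, closeness to the graph over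
  \<open>C\<close>, serves to keep strips of different charts disjoint.\<close>

lemma strip_exits:
  assumes c: "chart \<epsilon> s X p f g" and \<epsilon>: "0 \<le> \<epsilon>" and t: "0 \<le> t" "4 * t \<le> s" and u: "norm u = 1"
    and C: "C \<subseteq> {- s / 2..s / 2}" and z: "z \<in> strip p f g C (t * ((\<i> * f) \<bullet> u - \<epsilon>))"
  shows "z \<in> X" "z + of_real t * u \<notin> X" "\<exists>x\<in>C. norm (z - (p + f * Complex x (g x))) \<le> t"
proof -
  have f: "norm f = 1" using c by (simp add: chart_def)
  define cy where "cy = (\<i> * f) \<bullet> u"
  obtain cx where u': "u = f * Complex cx cy" and cx: "\<bar>cx\<bar> \<le> 1" "\<bar>cy\<bar> \<le> 1"
    unfolding cy_def using unit_coords[OF f u] by metis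
  define x y where "x = Re (crd f p z)" and "y = Im (crd f p z)"
  have zz: "z = p + f * Complex x y" unfolding x_def y_def using chart_coords(1)[OF f] by simp
  have xy: "x \<in> C" "g x - t * (cy - \<epsilon>) < y" "y \<le> g x"
    using z unfolding zz strip_iff[OF f] cy_def[symmetric] by auto
  have gx: "\<bar>g x\<bar> \<le> s / 2" using c by (simp add: chart_def)
  have "x \<in> {- s / 2..s / 2}" using xy C by blast
  then have "- s / 2 \<le> x" "x \<le> s / 2" by auto
  then have x: "\<bar>x\<bar> \<le> s / 2" by linarith
  have tc: "\<bar>t * cx\<bar> \<le> t" "\<bar>t * cy\<bar> \<le> t" using cx t by (auto simp: abs_mult intro: mult_left_le)
  have "t * (cy - \<epsilon>) \<le> t * 1" using cx \<epsilon> t by (intro mult_left_mono) auto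
  then have y: "g x - t < y" using xy by simp
  have b: "\<bar>x\<bar> \<le> s" "\<bar>y\<bar> \<le> s" "\<bar>x + t * cx\<bar> \<le> s" "\<bar>y + t * cy\<bar> \<le> s"
    using x y gx xy t tc by linarith+
  show "z \<in> X" using c b xy unfolding chart_def zz by blast
  have eq: "z + of_real t * u = p + f * Complex (x + t * cx) (y + t * cy)"
    unfolding u' zz by (simp add: complex_eq_iff algebra_simps)
  have "\<bar>g (x + t * cx) - g x\<bar> \<le> \<epsilon> * \<bar>t * cx\<bar>" using c unfolding chart_def by (metis add_diff_cancel_left')
  also have "\<dots> \<le> \<epsilon> * t" using tc \<epsilon> by (intro mult_left_mono)
  finally have "g (x + t * cx) < y + t * cy" using xy by (simp add: algebra_simps)
  then show "z + of_real t * u \<notin> X" using c b unfolding chart_def eq by (meson not_less)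
  have "z - (p + f * Complex x (g x)) = f * Complex 0 (y - g x)"
    unfolding zz by (simp add: complex_eq_iff algebra_simps)
  then have "norm (z - (p + f * Complex x (g x))) = \<bar>y - g x\<bar>"
    using f by (simp add: norm_mult complex_norm)
  then show "\<exists>x\<in>C. norm (z - (p + f * Complex x (g x))) \<le> t" using xy y by (intro bexI[of _ x]) auto
qed

lemma chart_frontier:
  assumes c: "chart \<epsilon> s X p f g" and X: "closed X"
    and q: "p + f * Complex x y \<in> frontier X" "\<bar>x\<bar> < s" "\<bar>y\<bar> < s"
  shows "y = g x"
proof (rule ccontr)
  assume ne: "y \<noteq> g x"
  have f: "norm f = 1" using c by (simp add: chart_def)
  have "p + f * Complex x y \<in> X" using q X by (simp add: frontier_def)
  then have "y < g x" using c q ne unfolding chart_def by (metis less_le)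
  define O' where "O' = {z. \<bar>Re (crd f p z)\<bar> < s \<and> \<bar>Im (crd f p z)\<bar> < s \<and>
     Im (crd f p z) < g (Re (crd f p z))}"
  have "open O'" unfolding O'_def
    by (intro open_Collect_conj open_Collect_less continuous_intros
        continuous_on_compose2[OF chart_g_continuous[OF c]]) auto
  moreover have "O' \<subseteq> X"
  proof
    fix z assume z: "z \<in> O'"
    have "\<bar>Re (crd f p z)\<bar> \<le> s" "\<bar>Im (crd f p z)\<bar> \<le> s" "Im (crd f p z) \<le> g (Re (crd f p z))"
      using z by (auto simp: O'_def)
    then have "p + f * Complex (Re (crd f p z)) (Im (crd f p z)) \<in> X"
      using c unfolding chart_def by blast
    then show "z \<in> X" unfolding chart_coords(1)[OF f] .
  qed
  moreover have "p + f * Complex x y \<in> O'"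
    using q \<open>y < g x\<close> unfolding O'_def mem_Collect_eq chart_coords(2)[OF f] by simp
  ultimately have "p + f * Complex x y \<in> interior X" unfolding interior_def by blast
  then show False using q by (simp add: frontier_def)
qed

lemma chart_bounds:
  assumes "norm f = 1" "norm (z - p) \<le> d"
  shows "\<bar>Re (crd f p z)\<bar> \<le> d" "\<bar>Im (crd f p z)\<bar> \<le> d"
proof -
  have "norm (crd f p z) \<le> d" using assms by (simp add: crd_def norm_mult)
  then show "\<bar>Re (crd f p z)\<bar> \<le> d" "\<bar>Im (crd f p z)\<bar> \<le> d"
    using abs_Re_le_cmod[of "crd f p z"] abs_Im_le_cmod[of "crd f p z"] by linarith+
qed

lemma chart_diff:
  assumes "norm f = 1" "norm (z - w) \<le> d"
  shows "\<bar>Re (crd f p z) - Re (crd f p w)\<bar> \<le> d" "\<bar>Im (crd f p z) - Im (crd f p w)\<bar> \<le> d"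
proof -
  have "crd f p z - crd f p w = crd f w z" by (simp add: crd_def algebra_simps)
  then show "\<bar>Re (crd f p z) - Re (crd f p w)\<bar> \<le> d" "\<bar>Im (crd f p z) - Im (crd f p w)\<bar> \<le> d"
    using chart_bounds[OF assms] by (metis minus_complex.sel)+
qed

section \<open>First order expansion\<close>

context smooth_domain
begin

definition exitset :: "real \<Rightarrow> complex \<Rightarrow> complex set" where
  "exitset t u = {z\<in>X. z + of_real t * u \<notin> X}"

text \<open>The unit vector \<open>e\<close> is the direction of a lattice displacement before the
  random rotation, along an axis or a diagonal.\<close>

definition G :: "complex \<Rightarrow> real \<Rightarrow> ennreal" where
  "G e t = (\<integral>\<^sup>+v. emeasure lborel (exitset t (cis v * e)) * indicator {0..2*pi} v \<partial>lborel)"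

lemma X_sets[measurable]: "X \<in> sets borel" using closed by simp

lemma exitset_sets[measurable]: "exitset t u \<in> sets borel"
proof -
  have "{z \<in> space borel. z \<in> X \<and> z + of_real t * u \<notin> X} \<in> sets borel" by measurable
  then show ?thesis by (simp add: exitset_def)
qed

lemma cross_frontier:
  assumes "z \<in> X" "z + w \<notin> X"
  obtains q where "q \<in> frontier X" "norm (q - z) \<le> norm w"
proof -
  have "closed_segment z (z + w) \<inter> frontier X \<noteq> {}"
    using assms by (intro connected_Int_frontier) auto
  then obtain q where "q \<in> closed_segment z (z + w)" "q \<in> frontier X" by blast
  then show thesis using that segment_bound(1)[of q z "z + w"] by auto
qed

text \<open>A point that leaves \<open>X\<close> in a step \<open>t\<close> is within
  \<open>t\<close> of a frontier point, hence of some \<open>V k\<close>, and lies in a strip over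
  an interval of length \<open>D k + 2 * t\<close> in the chart of that piece. Averaging the depth
  \<open>t * (c k v + \<epsilon>)\<close> over directions gives
  \<open>t * (2 + 2 * pi * \<epsilon>)\<close>.\<close>

lemma cover_bound:
  assumes I: "finite I" and \<epsilon>: "0 < \<epsilon>" and t: "0 < t" "4 * t \<le> s" and e: "norm e = 1"
    and ch: "\<And>k. k \<in> I \<Longrightarrow> chart \<epsilon> s X (p k) (f k) (g k)"
    and cover: "frontier X \<subseteq> (\<Union>k\<in>I. V k)"
    and V: "\<And>k. k \<in> I \<Longrightarrow> V k \<inter> frontier X \<noteq> {}"
      "\<And>k q. k \<in> I \<Longrightarrow> q \<in> V k \<inter> frontier X \<Longrightarrow> norm (q - p k) \<le> s / 2"
      "\<And>k q q'. k \<in> I \<Longrightarrow> q \<in> V k \<inter> frontier X \<Longrightarrow> q' \<in> V k \<inter> frontier X \<Longrightarrow> norm (q - q') \<le> D k"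
  shows "G e t \<le> ennreal (\<Sum>k\<in>I. (D k + 2 * t) * t * (2 + 2 * pi * \<epsilon>))"
proof -
  have f: "norm (f k) = 1" if "k \<in> I" for k using ch[OF that] by (simp add: chart_def)
  define R where "R k = (\<lambda>q. Re (crd (f k) (p k) q)) ` (V k \<inter> frontier X)" for k
  \<comment> \<open>An interval containing the projection of the piece, enlarged by \<open>t\<close>
    on both sides; unlike the projection itself it is evidently measurable and has a length bounded
    through \<open>D k\<close>.\<close>
  define C where "C k = {Inf (R k) - t..Inf (R k) + D k + t}" for k
  have D0: "0 \<le> D k" if k: "k \<in> I" for k
  proof -
    obtain q where "q \<in> V k \<inter> frontier X" using V(1)[OF k] by blast
    then show ?thesis using V(3)[OF k, of q q] by simp
  qed
  define c where "c k v = (\<i> * f k) \<bullet> (cis v * e)" for k v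
  have [measurable]: "c k \<in> borel_measurable borel" for k unfolding c_def by measurable
  have sub: "exitset t (cis v * e) \<subseteq> (\<Union>k\<in>I. strip (p k) (f k) (g k) (C k) (t * (c k v + \<epsilon>)))" for v
  proof
    fix z assume "z \<in> exitset t (cis v * e)"
    then have z: "z \<in> X" "z + of_real t * (cis v * e) \<notin> X" by (auto simp: exitset_def)
    have u: "norm (cis v * e) = 1" using e by (simp add: norm_mult)
    obtain q where q: "q \<in> frontier X" "norm (q - z) \<le> norm (of_real t * (cis v * e))"
      using cross_frontier[OF z] .
    then have qz: "norm (q - z) \<le> t" using t e by (simp add: norm_mult)
    obtain k where k: "k \<in> I" "q \<in> V k" using cover q by blast
    let ?x = "Re (crd (f k) (p k) z)" and ?y = "Im (crd (f k) (p k) z)"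
    let ?x' = "Re (crd (f k) (p k) q)" and ?y' = "Im (crd (f k) (p k) q)"
    have zz: "p k + f k * Complex ?x ?y = z" by (rule chart_coords(1)[OF f[OF k(1)]])
    have dx: "\<bar>?x' - ?x\<bar> \<le> t" "\<bar>?y' - ?y\<bar> \<le> t" by (rule chart_diff[OF f[OF k(1)] qz])+
    have bq: "\<bar>?x'\<bar> \<le> s / 2" "\<bar>?y'\<bar> \<le> s / 2"
      using chart_bounds[OF f[OF k(1)] V(2)[OF k(1)]] k q by auto
    have b: "\<bar>?x\<bar> \<le> s - t" "\<bar>?y\<bar> \<le> s - t" using bq dx t by linarith+
    have ys: "g k ?x - t * (c k v + \<epsilon>) < ?y" "?y \<le> g k ?x"
      using chart_exit_strip[OF ch[OF k(1)] _ _ u b] z \<epsilon> t unfolding zz c_def by auto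
    have low: "Inf (R k) \<le> ?x'" "?x' \<le> Inf (R k) + D k"
    proof -
      have d: "\<bar>a - b\<bar> \<le> D k" if "a \<in> R k" "b \<in> R k" for a b
        using that chart_diff(1)[OF f[OF k(1)] V(3)[OF k(1)]] unfolding R_def by blast
      have x': "?x' \<in> R k" using k q by (auto simp: R_def)
      have "bdd_below (R k)"
        by (rule bdd_belowI[of _ "?x' - D k"]) (use d[OF x'] in \<open>fastforce simp: abs_le_iff\<close>)
      then show "Inf (R k) \<le> ?x'" using x' by (rule cInf_lower[rotated])
      have "?x' - D k \<le> Inf (R k)"
        by (rule cInf_greatest) (use x' d[OF x'] in \<open>auto simp: abs_le_iff, fastforce\<close>)
      then show "?x' \<le> Inf (R k) + D k" by simp
    qed
    have "?x \<in> C k" unfolding C_def using dx low by auto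
    then have "z \<in> strip (p k) (f k) (g k) (C k) (t * (c k v + \<epsilon>))" using ys by (simp add: strip_def)
    then show "z \<in> (\<Union>k\<in>I. strip (p k) (f k) (g k) (C k) (t * (c k v + \<epsilon>)))" using k by blast
  qed
  have ind: "(\<integral>\<^sup>+v. indicator {0..2*pi} v \<partial>lborel) = ennreal (2 * pi)" by simp
  have eC: "emeasure lborel (C k) = ennreal (D k + 2 * t)" if "k \<in> I" for k
    using D0[OF that] t by (simp add: C_def)
  have le: "emeasure lborel (exitset t (cis v * e)) \<le> (\<Sum>k\<in>I. ennreal ((D k + 2 * t) * t) * (ennreal (c k v) + ennreal \<epsilon>))" for v
  proof -
    have st: "strip (p k) (f k) (g k) (C k) h \<in> sets lborel" if "k \<in> I" for k h
      using strip_measurable[OF _ chart_g_measurable[OF ch[OF that]], of "C k"] by (simp add: C_def)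
    have "emeasure lborel (exitset t (cis v * e)) \<le> emeasure lborel (\<Union>k\<in>I. strip (p k) (f k) (g k) (C k) (t * (c k v + \<epsilon>)))"
      by (rule emeasure_mono[OF sub]) (use I st in auto)
    also have "\<dots> \<le> (\<Sum>k\<in>I. emeasure lborel (strip (p k) (f k) (g k) (C k) (t * (c k v + \<epsilon>))))"
      by (rule emeasure_subadditive_finite[OF I]) (use st in blast)
    also have "\<dots> \<le> (\<Sum>k\<in>I. ennreal ((D k + 2 * t) * t) * (ennreal (c k v) + ennreal \<epsilon>))"
    proof (rule sum_mono)
      fix k assume k: "k \<in> I"
      have "emeasure lborel (strip (p k) (f k) (g k) (C k) (t * (c k v + \<epsilon>))) = ennreal (D k + 2 * t) * ennreal (t * (c k v + \<epsilon>))"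
        using emeasure_strip[OF _ chart_g_measurable[OF ch[OF k]] f[OF k], of "C k"] eC[OF k] by (simp add: C_def)
      also have "ennreal (t * (c k v + \<epsilon>)) = ennreal t * ennreal (c k v + \<epsilon>)" using t by (simp add: ennreal_mult')
      also have "ennreal (c k v + \<epsilon>) \<le> ennreal (c k v) + ennreal \<epsilon>"
        by (cases "0 \<le> c k v") (use \<epsilon> in \<open>auto simp: ennreal_plus[symmetric] ennreal_neg simp del: ennreal_plus intro!: ennreal_leI\<close>)
      finally show "emeasure lborel (strip (p k) (f k) (g k) (C k) (t * (c k v + \<epsilon>))) \<le> ennreal ((D k + 2 * t) * t) * (ennreal (c k v) + ennreal \<epsilon>)"
        using t D0[OF k] by (simp add: ennreal_mult mult.assoc mult_left_mono)
    qed
    finally show ?thesis .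
  qed
  have "G e t \<le> (\<integral>\<^sup>+v. (\<Sum>k\<in>I. ennreal ((D k + 2 * t) * t) * (ennreal (c k v) * indicator {0..2*pi} v + ennreal \<epsilon> * indicator {0..2*pi} v)) \<partial>lborel)"
    unfolding G_def by (rule nn_integral_mono) (use le in \<open>auto simp: indicator_def\<close>)
  also have "\<dots> = (\<Sum>k\<in>I. \<integral>\<^sup>+v. ennreal ((D k + 2 * t) * t) * (ennreal (c k v) * indicator {0..2*pi} v + ennreal \<epsilon> * indicator {0..2*pi} v) \<partial>lborel)"
    by (rule nn_integral_sum) measurable
  also have "\<dots> = (\<Sum>k\<in>I. ennreal ((D k + 2 * t) * t) * (2 + ennreal \<epsilon> * ennreal (2 * pi)))"
  proof (rule sum.cong[OF refl])
    fix k assume "k \<in> I"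
    then have "(\<integral>\<^sup>+v. ennreal (c k v) * indicator {0..2*pi} v \<partial>lborel) = 2"
      unfolding c_def by (intro nn_integral_inner_cis) (use f e in \<open>auto simp: norm_mult\<close>)
    then show "(\<integral>\<^sup>+v. ennreal ((D k + 2 * t) * t) * (ennreal (c k v) * indicator {0..2*pi} v + ennreal \<epsilon> * indicator {0..2*pi} v) \<partial>lborel) =
        ennreal ((D k + 2 * t) * t) * (2 + ennreal \<epsilon> * ennreal (2 * pi))"
      by (simp add: nn_integral_cmult nn_integral_add)
  qed
  also have "\<dots> = (\<Sum>k\<in>I. ennreal ((D k + 2 * t) * t * (2 + 2 * pi * \<epsilon>)))"
  proof (rule sum.cong[OF refl])
    fix k assume k: "k \<in> I"
    have "(2::ennreal) + ennreal \<epsilon> * ennreal (2 * pi) = ennreal (2 + 2 * pi * \<epsilon>)"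
      using \<epsilon> by (simp add: ennreal_mult[symmetric] ennreal_plus[symmetric] mult.commute del: ennreal_plus flip: ennreal_numeral)
    then show "ennreal ((D k + 2 * t) * t) * (2 + ennreal \<epsilon> * ennreal (2 * pi)) = ennreal ((D k + 2 * t) * t * (2 + 2 * pi * \<epsilon>))"
      using D0[OF k] t \<epsilon> by (simp add: ennreal_mult)
  qed
  also have "\<dots> = ennreal (\<Sum>k\<in>I. (D k + 2 * t) * t * (2 + 2 * pi * \<epsilon>))"
    by (rule sum_ennreal) (use D0 t \<epsilon> in auto)
  finally show ?thesis .
qed

text \<open>Disjoint compact pieces of graphs have a positive distance. Once \<open>t\<close> is
  below a quarter of it, the strips under different pieces are disjoint, so their areas add up
  inside the exit set.\<close>

lemma strips_bound:
  assumes I: "finite I" and \<epsilon>: "0 < \<epsilon>" "\<epsilon> \<le> 1/8" and s: "0 < s" and e: "norm e = 1"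
    and ch: "\<And>k. k \<in> I \<Longrightarrow> chart \<epsilon> s X (p k) (f k) (g k)"
    and C: "\<And>k. k \<in> I \<Longrightarrow> compact (C k)" "\<And>k. k \<in> I \<Longrightarrow> C k \<subseteq> {- s / 2..s / 2}"
    and disj: "\<And>k l. k \<in> I \<Longrightarrow> l \<in> I \<Longrightarrow> k \<noteq> l \<Longrightarrow>
       (\<lambda>x. p k + f k * Complex x (g k x)) ` C k \<inter> (\<lambda>x. p l + f l * Complex x (g l x)) ` C l = {}"
  shows "\<exists>t0>0. \<forall>t. 0 < t \<longrightarrow> t < t0 \<longrightarrow> ennreal (t * (\<Sum>k\<in>I. measure lborel (C k)) * (2 - 2 * pi * \<epsilon>)) \<le> G e t"
proof -
  have f: "norm (f k) = 1" if "k \<in> I" for k using ch[OF that] by (simp add: chart_def)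
  define \<Gamma> where "\<Gamma> k x = p k + f k * Complex x (g k x)" for k x
  have K: "compact (\<Gamma> k ` C k)" if "k \<in> I" for k
  proof (rule compact_continuous_image[OF _ C(1)[OF that]])
    show "continuous_on (C k) (\<Gamma> k)"
      unfolding \<Gamma>_def Complex_eq
      by (intro continuous_intros continuous_on_subset[OF chart_g_continuous[OF ch[OF that]]]) auto
  qed
  have "\<exists>\<delta>>0. \<forall>a\<in>\<Gamma> k ` C k. \<forall>b\<in>\<Gamma> l ` C l. \<delta> \<le> dist a b" if "k \<in> I" "l \<in> I" "k \<noteq> l" for k l
    using separate_compact_closed[OF K compact_imp_closed[OF K]] disj that unfolding \<Gamma>_def by blast
  then obtain \<delta> where \<delta>: "\<And>k l. k \<in> I \<Longrightarrow> l \<in> I \<Longrightarrow> k \<noteq> l \<Longrightarrow> \<delta> k l > 0 \<and> (\<forall>a\<in>\<Gamma> k ` C k. \<forall>b\<in>\<Gamma> l ` C l. \<delta> k l \<le> dist a b)"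
    by metis
  define \<eta> where "\<eta> = Min (insert s ((\<lambda>(k, l). \<delta> k l) ` {(k, l). k \<in> I \<and> l \<in> I \<and> k \<noteq> l}))"
  have fin: "finite {(k, l). k \<in> I \<and> l \<in> I \<and> k \<noteq> l}"
    by (rule finite_subset[of _ "I \<times> I"]) (use I in auto)
  have \<eta>: "\<eta> > 0" "\<eta> \<le> s" unfolding \<eta>_def using fin \<delta> s by (auto simp: Min_gr_iff intro: Min_le)
  have sep: "\<eta> \<le> dist a b" if "k \<in> I" "l \<in> I" "k \<noteq> l" "a \<in> \<Gamma> k ` C k" "b \<in> \<Gamma> l ` C l" for k l a b
  proof -
    have "\<eta> \<le> \<delta> k l" unfolding \<eta>_def using fin that by (intro Min_le) auto
    also have "\<dots> \<le> dist a b" using \<delta> that by blast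
    finally show ?thesis .
  qed
  define c where "c k v = (\<i> * f k) \<bullet> (cis v * e)" for k v
  have [measurable]: "c k \<in> borel_measurable borel" for k unfolding c_def by measurable
  have Cm: "emeasure lborel (C k) = ennreal (measure lborel (C k))" if "k \<in> I" for k
    using emeasure_compact_finite[OF C(1)[OF that]] by (simp add: emeasure_eq_ennreal_measure less_top)
  have Cb: "C k \<in> sets borel" if "k \<in> I" for k using compact_imp_closed[OF C(1)[OF that]] by simp
  have "ennreal (t * (\<Sum>k\<in>I. measure lborel (C k)) * (2 - 2 * pi * \<epsilon>)) \<le> G e t"
    if t: "0 < t" "t < \<eta> / 4" for t
  proof -
    have ge: "(\<Sum>k\<in>I. ennreal (measure lborel (C k) * t) * ennreal (c k v - \<epsilon>)) \<le> emeasure lborel (exitset t (cis v * e))" for v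
    proof -
      have u: "norm (cis v * e) = 1" using e by (simp add: norm_mult)
      let ?S = "\<lambda>k. strip (p k) (f k) (g k) (C k) (t * (c k v - \<epsilon>))"
      have st: "?S k \<in> sets lborel" if "k \<in> I" for k
        using strip_measurable[OF Cb[OF that] chart_g_measurable[OF ch[OF that]]] by simp
      have ex: "z \<in> exitset t (cis v * e) \<and> (\<exists>w\<in>\<Gamma> k ` C k. norm (z - w) \<le> t)" if "k \<in> I" "z \<in> ?S k" for k z
        using strip_exits[OF ch[OF that(1)] _ _ _ u C(2)[OF that(1)] that(2)[unfolded c_def]] t \<epsilon> \<eta>
        unfolding exitset_def \<Gamma>_def by auto
      have "disjoint_family_on ?S I" unfolding disjoint_family_on_def
      proof (intro ballI impI)
        fix k l assume kl: "k \<in> I" "l \<in> I" "k \<noteq> l"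
        show "?S k \<inter> ?S l = {}"
        proof (rule ccontr)
          assume "?S k \<inter> ?S l \<noteq> {}"
          then obtain z where z: "z \<in> ?S k" "z \<in> ?S l" by blast
          obtain a where a: "a \<in> \<Gamma> k ` C k" "norm (z - a) \<le> t" using ex[OF kl(1) z(1)] by blast
          obtain b where b: "b \<in> \<Gamma> l ` C l" "norm (z - b) \<le> t" using ex[OF kl(2) z(2)] by blast
          have "dist a b \<le> dist z a + dist z b" by (rule dist_triangle3)
          then show False using sep[OF kl a(1) b(1)] a b t by (simp add: dist_norm)
        qed
      qed
      then have "(\<Sum>k\<in>I. emeasure lborel (?S k)) = emeasure lborel (\<Union>k\<in>I. ?S k)"
        using st I by (intro sum_emeasure) auto
      also have "\<dots> \<le> emeasure lborel (exitset t (cis v * e))"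
        by (rule emeasure_mono) (use ex in blast, simp)
      also have "(\<Sum>k\<in>I. emeasure lborel (?S k)) = (\<Sum>k\<in>I. ennreal (measure lborel (C k) * t) * ennreal (c k v - \<epsilon>))"
      proof (rule sum.cong[OF refl])
        fix k assume k: "k \<in> I"
        show "emeasure lborel (?S k) = ennreal (measure lborel (C k) * t) * ennreal (c k v - \<epsilon>)"
          unfolding emeasure_strip[OF Cb[OF k] chart_g_measurable[OF ch[OF k]] f[OF k]] Cm[OF k]
          using t by (simp add: ennreal_mult' ennreal_mult mult.assoc)
      qed
      finally show ?thesis .
    qed
    have J: "ennreal (2 - 2 * pi * \<epsilon>) \<le> (\<integral>\<^sup>+v. ennreal (c k v - \<epsilon>) * indicator {0..2*pi} v \<partial>lborel)" if "k \<in> I" for k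
    proof -
      have "2 = (\<integral>\<^sup>+v. ennreal (c k v) * indicator {0..2*pi} v \<partial>lborel)"
        unfolding c_def by (intro nn_integral_inner_cis[symmetric]) (use f that e in \<open>auto simp: norm_mult\<close>)
      also have "\<dots> \<le> (\<integral>\<^sup>+v. ennreal (c k v - \<epsilon>) * indicator {0..2*pi} v + ennreal \<epsilon> * indicator {0..2*pi} v \<partial>lborel)"
      proof (rule nn_integral_mono)
        fix v
        have "ennreal (c k v) \<le> ennreal (c k v - \<epsilon>) + ennreal \<epsilon>"
          by (cases "0 \<le> c k v - \<epsilon>") (use \<epsilon> in \<open>auto simp: ennreal_plus[symmetric] ennreal_neg simp del: ennreal_plus intro!: ennreal_leI\<close>)
        then show "ennreal (c k v) * indicator {0..2*pi} v \<le> ennreal (c k v - \<epsilon>) * indicator {0..2*pi} v + ennreal \<epsilon> * indicator {0..2*pi} v"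
          by (auto simp: indicator_def)
      qed
      also have "\<dots> = (\<integral>\<^sup>+v. ennreal (c k v - \<epsilon>) * indicator {0..2*pi} v \<partial>lborel) + ennreal \<epsilon> * ennreal (2 * pi)"
        by (simp add: nn_integral_add nn_integral_cmult)
      finally have "ennreal 2 - ennreal (\<epsilon> * (2 * pi)) \<le> (\<integral>\<^sup>+v. ennreal (c k v - \<epsilon>) * indicator {0..2*pi} v \<partial>lborel)"
        using \<epsilon> by (subst ennreal_minus_le_iff) (auto simp: ennreal_mult add.commute)
      moreover have "ennreal 2 - ennreal (\<epsilon> * (2 * pi)) = ennreal (2 - 2 * pi * \<epsilon>)"
        using \<epsilon> by (subst ennreal_minus) (auto simp: mult_ac)
      ultimately show ?thesis by simp
    qed
    have pos: "0 \<le> 2 - 2 * pi * \<epsilon>"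
      using mult_mono[of "2 * pi" 8 \<epsilon> "1/8"] \<epsilon> pi_less_4 by simp
    have "ennreal (t * (\<Sum>k\<in>I. measure lborel (C k)) * (2 - 2 * pi * \<epsilon>)) =
        (\<Sum>k\<in>I. ennreal (measure lborel (C k) * t) * ennreal (2 - 2 * pi * \<epsilon>))"
      using t pos by (simp add: sum_distrib_left sum_distrib_right ennreal_mult[symmetric] mult.commute mult.left_commute flip: sum_ennreal)
    also have "\<dots> \<le> (\<Sum>k\<in>I. ennreal (measure lborel (C k) * t) * (\<integral>\<^sup>+v. ennreal (c k v - \<epsilon>) * indicator {0..2*pi} v \<partial>lborel))"
      by (intro sum_mono mult_left_mono J) auto
    also have "\<dots> = (\<Sum>k\<in>I. \<integral>\<^sup>+v. ennreal (measure lborel (C k) * t) * (ennreal (c k v - \<epsilon>) * indicator {0..2*pi} v) \<partial>lborel)"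
      by (intro sum.cong refl nn_integral_cmult[symmetric]) measurable
    also have "\<dots> = (\<integral>\<^sup>+v. (\<Sum>k\<in>I. ennreal (measure lborel (C k) * t) * (ennreal (c k v - \<epsilon>) * indicator {0..2*pi} v)) \<partial>lborel)"
      by (rule nn_integral_sum[symmetric]) measurable
    also have "\<dots> \<le> G e t"
      unfolding G_def by (rule nn_integral_mono) (use ge in \<open>auto simp: indicator_def\<close>)
    finally show ?thesis .
  qed
  then show ?thesis using \<eta> by (intro exI[of _ "\<eta> / 4"]) auto
qed

end

section \<open>Hausdorff length and covers by intervals\<close>

lemma hausdorff1_le:
  fixes B :: ennreal
  assumes "\<And>\<delta>. \<delta> > 0 \<Longrightarrow> \<exists>(I :: 'i set) U. countable I \<and> A \<subseteq> (\<Union>i\<in>I. U i) \<and>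
    (\<forall>i\<in>I. bounded (U i) \<and> diameter (U i) \<le> \<delta>) \<and> (\<integral>\<^sup>+i. ennreal (diameter (U i)) \<partial>count_space I) \<le> B"
  shows "hausdorff1 A \<le> B"
  unfolding hausdorff1_def
proof (rule SUP_least)
  fix \<delta> :: real assume "\<delta> \<in> {0<..}"
  then obtain I :: "'i set" and U where I: "countable I" "A \<subseteq> (\<Union>i\<in>I. U i)"
    "\<And>i. i \<in> I \<Longrightarrow> bounded (U i) \<and> diameter (U i) \<le> \<delta>" "(\<integral>\<^sup>+i. ennreal (diameter (U i)) \<partial>count_space I) \<le> B"
    using assms[of \<delta>] by auto
  define J where "J = to_nat_on I ` I"
  have inv: "from_nat_into I (to_nat_on I i) = i" if "i \<in> I" for i using I(1) that by simp
  \<comment> \<open>The definition of \<open>hausdorff1\<close> asks for sequences; a countable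
    family is turned into one by padding with empty sets, whose diameter is 0.\<close>
  define W where "W n = (if n \<in> J then U (from_nat_into I n) else {})" for n
  have "A \<subseteq> (\<Union>n. W n)"
  proof
    fix x assume "x \<in> A"
    then obtain i where "i \<in> I" "x \<in> U i" using I(2) by blast
    then have "x \<in> W (to_nat_on I i)" by (simp add: W_def J_def inv)
    then show "x \<in> (\<Union>n. W n)" by blast
  qed
  moreover have "\<forall>n. bounded (W n) \<and> diameter (W n) \<le> \<delta>"
    using I(3) inv \<open>\<delta> \<in> {0<..}\<close> by (auto simp: W_def J_def diameter_empty)
  ultimately have "(INF U \<in> {U :: nat \<Rightarrow> complex set. A \<subseteq> (\<Union>i. U i) \<and> (\<forall>i. bounded (U i) \<and> diameter (U i) \<le> \<delta>)}.
      (\<Sum>i. ennreal (diameter (U i)))) \<le> (\<Sum>n. ennreal (diameter (W n)))"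
    by (intro INF_lower) simp
  also have "\<dots> = (\<integral>\<^sup>+n. ennreal (diameter (W n)) \<partial>count_space UNIV)"
    by (rule nn_integral_count_space_nat[symmetric])
  also have "\<dots> = (\<integral>\<^sup>+n. ennreal (diameter (W n)) * indicator J n \<partial>count_space UNIV)"
    by (intro nn_integral_cong) (auto simp: W_def indicator_def diameter_empty)
  also have "\<dots> = (\<integral>\<^sup>+n. ennreal (diameter (W n)) \<partial>count_space J)"
    by (simp add: nn_integral_count_space_indicator)
  also have "\<dots> = (\<integral>\<^sup>+i. ennreal (diameter (W (to_nat_on I i))) \<partial>count_space I)"
    by (rule nn_integral_bij_count_space[symmetric]) (use I(1) in \<open>auto simp: J_def intro!: inj_on_imp_bij_betw\<close>)
  also have "\<dots> = (\<integral>\<^sup>+i. ennreal (diameter (U i)) \<partial>count_space I)"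
    by (intro nn_integral_cong) (auto simp: W_def J_def inv)
  finally show "(INF U \<in> {U :: nat \<Rightarrow> complex set. A \<subseteq> (\<Union>i. U i) \<and> (\<forall>i. bounded (U i) \<and> diameter (U i) \<le> \<delta>)}.
      (\<Sum>i. ennreal (diameter (U i)))) \<le> B" using I(4) by simp
qed

lemma nn_integral_count_space_Sigma_le:
  fixes h :: "'a \<times> 'b \<Rightarrow> ennreal"
  assumes "finite F"
  shows "(\<integral>\<^sup>+x. h x \<partial>count_space (Sigma F D)) \<le> (\<Sum>i\<in>F. \<integral>\<^sup>+y. h (i, y) \<partial>count_space (D i))"
proof -
  have "(\<integral>\<^sup>+x. h x \<partial>count_space (Sigma F D)) = (\<integral>\<^sup>+x. h x * indicator (Sigma F D) x \<partial>count_space UNIV)"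
    by (simp add: nn_integral_count_space_indicator)
  also have "\<dots> \<le> (\<integral>\<^sup>+x. (\<Sum>i\<in>F. h x * indicator ({i} \<times> D i) x) \<partial>count_space UNIV)"
  proof (rule nn_integral_mono)
    fix x :: "'a \<times> 'b"
    show "h x * indicator (Sigma F D) x \<le> (\<Sum>i\<in>F. h x * indicator ({i} \<times> D i) x)"
    proof (cases "x \<in> Sigma F D")
      case True
      then have "h x * indicator ({fst x} \<times> D (fst x)) x \<le> (\<Sum>i\<in>F. h x * indicator ({i} \<times> D i) x)"
        using assms by (intro member_le_sum) auto
      then show ?thesis using True by (auto simp: indicator_def)
    qed simp
  qed
  also have "\<dots> = (\<Sum>i\<in>F. \<integral>\<^sup>+x. h x * indicator ({i} \<times> D i) x \<partial>count_space UNIV)"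
    by (rule nn_integral_sum) simp
  also have "\<dots> = (\<Sum>i\<in>F. \<integral>\<^sup>+y. h (i, y) \<partial>count_space (D i))"
  proof (rule sum.cong[OF refl])
    fix i
    have "(\<integral>\<^sup>+y. h (i, y) \<partial>count_space (D i)) = (\<integral>\<^sup>+x. h x \<partial>count_space ({i} \<times> D i))"
      by (rule nn_integral_bij_count_space) (auto simp: bij_betw_def inj_on_def)
    then show "(\<integral>\<^sup>+x. h x * indicator ({i} \<times> D i) x \<partial>count_space UNIV) = (\<integral>\<^sup>+y. h (i, y) \<partial>count_space (D i))"
      by (simp add: nn_integral_count_space_indicator)
  qed
  finally show ?thesis .
qed

text \<open>Lebesgue measure bounds one-dimensional covering sums: the intervals have disjoint
  interiors and lie in an open set exceeding \<open>S\<close> by less than \<gamma>.\<close>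

lemma interval_cover:
  fixes S :: "real set"
  assumes S: "S \<in> sets borel" "S \<subseteq> {- b..b}" and b: "b > 0" and \<delta>: "\<delta> > 0" and \<gamma>: "\<gamma> > 0"
  obtains \<D> where "countable \<D>" "S \<subseteq> \<Union>\<D>" "\<And>K. K \<in> \<D> \<Longrightarrow> \<exists>c d. K = {c..d} \<and> c \<le> d \<and> d - c \<le> \<delta>"
    "(\<integral>\<^sup>+K. emeasure lborel K \<partial>count_space \<D>) \<le> ennreal (measure lborel S + \<gamma>)"
proof -
  obtain O' where O': "open O'" "S \<subseteq> O'" "emeasure lborel (O' - S) < ennreal \<gamma>"
    using outer_regular_lborel[OF S(1) \<gamma>] by metis
  \<comment> \<open>The gauge forces each interval to be shorter than \<delta> and to stay inside
    the open set.\<close>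
  define gg where "gg x = ball x (\<delta> / 2) \<inter> (if x \<in> O' then O' else UNIV)" for x
  have "gauge gg" unfolding gauge_def gg_def using \<delta> O' by auto
  have "box (- b) b \<noteq> {}" using b by (auto simp: box_real)
  then obtain \<D> where \<D>: "countable \<D>" "\<And>K. K \<in> \<D> \<Longrightarrow> interior K \<noteq> {} \<and> (\<exists>c d. K = cbox c d)"
    "pairwise (\<lambda>A B. interior A \<inter> interior B = {}) \<D>" "\<And>K. K \<in> \<D> \<Longrightarrow> \<exists>x \<in> S \<inter> K. K \<subseteq> gg x" "S \<subseteq> \<Union>\<D>"
    using covering_lemma[of S "- b" b gg] S \<open>gauge gg\<close> by (metis cbox_interval)
  have K: "\<exists>c d. K = {c..d} \<and> c \<le> d \<and> d - c \<le> \<delta>" "K \<subseteq> O'" if KD: "K \<in> \<D>" for K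
  proof -
    obtain c d where cd: "K = {c..d}" "c < d"
      using \<D>(2)[OF KD] by (metis cbox_interval interior_atLeastAtMost_real box_real(2) greaterThanLessThan_empty_iff not_less)
    obtain x where x: "x \<in> S" "K \<subseteq> gg x" using \<D>(4)[OF KD] by blast
    have "x \<in> O'" using x O' by blast
    then show "K \<subseteq> O'" using x by (simp add: gg_def)
    have "c \<in> K" "d \<in> K" using cd by auto
    then have "c \<in> ball x (\<delta> / 2)" "d \<in> ball x (\<delta> / 2)" using x by (auto simp: gg_def)
    then have "d - c \<le> \<delta>" unfolding mem_ball dist_real_def by linarith
    then show "\<exists>c d. K = {c..d} \<and> c \<le> d \<and> d - c \<le> \<delta>" using cd by auto
  qed
  have eK: "emeasure lborel K = emeasure lborel (interior K)" if "K \<in> \<D>" for K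
    using K(1)[OF that] by auto
  have "(\<integral>\<^sup>+K. emeasure lborel K \<partial>count_space \<D>) = (\<integral>\<^sup>+K. emeasure lborel (interior K) \<partial>count_space \<D>)"
    by (intro nn_integral_cong) (use eK in auto)
  also have "\<dots> = emeasure lborel (\<Union>K\<in>\<D>. interior K)"
    by (rule emeasure_UN_countable[symmetric]) (use \<D>(1,3) in \<open>auto simp: disjoint_family_on_def pairwise_def\<close>)
  also have "\<dots> \<le> emeasure lborel O'"
  proof (rule emeasure_mono)
    show "(\<Union>K\<in>\<D>. interior K) \<subseteq> O'" using K(2) interior_subset by blast
  qed (use O'(1) in simp)
  also have "\<dots> \<le> emeasure lborel S + emeasure lborel (O' - S)"
  proof -
    have "O' = S \<union> (O' - S)" using O'(2) by blast
    then show ?thesis using O'(1) S(1) emeasure_subadditive[of S lborel "O' - S"] by simp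
  qed
  also have "\<dots> \<le> ennreal (measure lborel S) + ennreal \<gamma>"
  proof (rule add_mono)
    have "bounded S" using S(2) by (rule bounded_subset[rotated]) simp
    then have "emeasure lborel S \<noteq> \<infinity>" using emeasure_bounded_finite by (simp add: less_top)
    then show "emeasure lborel S \<le> ennreal (measure lborel S)" by (simp add: emeasure_eq_ennreal_measure)
  qed (use O'(3) in auto)
  finally have "(\<integral>\<^sup>+K. emeasure lborel K \<partial>count_space \<D>) \<le> ennreal (measure lborel S + \<gamma>)"
    using \<gamma> by (simp add: ennreal_plus)
  then show thesis using that[of \<D>] \<D>(1,5) K(1) by blast
qed

lemma compact_inner:
  fixes S :: "real set"
  assumes S: "S \<in> sets borel" "S \<subseteq> {- b..b}" and \<gamma>: "\<gamma> > 0"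
  obtains C where "compact C" "C \<subseteq> S" "measure lborel S - \<gamma> \<le> measure lborel C"
proof -
  let ?B = "{- b..b}"
  obtain O' where O': "open O'" "?B - S \<subseteq> O'" "emeasure lborel (O' - (?B - S)) < ennreal \<gamma>"
    using outer_regular_lborel[of "?B - S" \<gamma>] S \<gamma> by auto
  define C where "C = ?B - O'"
  have "compact C" unfolding C_def using O'(1) by (intro compact_diff) auto
  moreover have CS: "C \<subseteq> S" using O'(2) by (auto simp: C_def)
  moreover have "measure lborel S - \<gamma> \<le> measure lborel C"
  proof -
    have Cb: "C \<in> sets borel" by (rule borel_closed[OF compact_imp_closed[OF \<open>compact C\<close>]])
    have fB: "?B \<in> fmeasurable lborel" 
      using emeasure_compact_finite[of ?B] by (simp add: fmeasurable_def top.not_eq_extremum)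
    have CB: "C \<subseteq> ?B" by (auto simp: C_def)
    have finS: "S \<in> fmeasurable lborel" by (rule fmeasurableI2[OF fB S(2)]) (simp add: S(1))
    have finC: "C \<in> fmeasurable lborel" by (rule fmeasurableI2[OF fB CB]) (simp add: Cb)
    have "measure lborel S - measure lborel C = measure lborel (S - C)"
      using measurable_measure_Diff[OF finS _ CS] Cb by simp
    also have "\<dots> \<le> \<gamma>"
    proof -
      have "emeasure lborel (S - C) \<le> emeasure lborel (O' - (?B - S))"
        using S O'(1) by (intro emeasure_mono) (auto simp: C_def)
      also have "\<dots> \<le> ennreal \<gamma>" using O'(3) by simp
      finally show ?thesis using \<gamma> by (simp add: measure_def enn2real_leI)
    qed
    finally show ?thesis by simp
  qed
  ultimately show thesis using that by blast
qed

context smooth_domain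
begin

lemma finite_charts:
  assumes \<epsilon>: "0 < \<epsilon>" "\<epsilon> \<le> 1/8"
  obtains s N p f g where "s > 0" "\<forall>i<N. p i \<in> frontier X"
    "\<forall>i<(N::nat). chart \<epsilon> s X (p i) (f i) (g i)" "frontier X \<subseteq> (\<Union>i<N. ball (p i) (s / 2))"
proof -
  obtain s where s: "s > 0" "\<And>p. p \<in> frontier X \<Longrightarrow> \<exists>e g. chart \<epsilon> s X p e g"
    using chart_exists[OF \<epsilon>] by metis
  obtain P where P: "P \<subseteq> frontier X" "finite P" "frontier X \<subseteq> (\<Union>p\<in>P. ball p (s / 2))"
  proof (rule compactE_image[OF compact_frontier_X])
    show "frontier X \<subseteq> (\<Union>p\<in>frontier X. ball p (s / 2))" using s(1) by force
  qed (auto intro: that)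
  define N where "N = card P"
  obtain p where "bij_betw p {..<N} P"
    using ex_bij_betw_nat_finite[OF P(2)] by (auto simp: atLeast0LessThan N_def)
  then have pP: "p ` {..<N} = P" by (simp add: bij_betw_def)
  have pf: "\<forall>i<N. p i \<in> frontier X" using pP P(1) by blast
  have "\<forall>i. \<exists>e g. i < N \<longrightarrow> chart \<epsilon> s X (p i) e g" using s(2) pf by blast
  then obtain f g where fg: "\<forall>i<N. chart \<epsilon> s X (p i) (f i) (g i)" by metis
  have "frontier X \<subseteq> (\<Union>i<N. ball (p i) (s / 2))" using P(3) pP by blast
  then show thesis using that[OF s(1) pf fg] by blast
qed

text \<open>A crude bound from the fixed slope \<open>1/8\<close>. Besides finiteness of
  \<open>G\<close> it yields, together with \<open>G_lower\<close>, finiteness of the boundary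
  length.\<close>

lemma G_linear_bound:
  assumes e: "norm e = 1"
  shows "\<exists>K t1. K \<ge> 0 \<and> t1 > 0 \<and> (\<forall>t. 0 < t \<longrightarrow> t < t1 \<longrightarrow> G e t \<le> ennreal (K * t))"
proof -
  have e8: "0 < (1/8::real)" "1/8 \<le> (1/8::real)" by auto
  obtain s N p f g where c': "s > 0" "\<forall>i<N. p i \<in> frontier X"
    "\<forall>i<(N::nat). chart (1/8) s X (p i) (f i) (g i)" "frontier X \<subseteq> (\<Union>i<N. ball (p i) (s / 2))"
    by (rule finite_charts[OF e8]) (rule that)
  note c = c'(1) c'(2)[rule_format] c'(3)[rule_format] c'(4)
  have "G e t \<le> ennreal (real N * (s + s) * 4 * t)" if t: "0 < t" "t < s / 4" for t
  proof -
    have "G e t \<le> ennreal (\<Sum>k\<in>{..<N}. (s + 2 * t) * t * (2 + 2 * pi * (1/8)))"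
    proof (rule cover_bound[where V = "\<lambda>i. ball (p i) (s / 2)" and s = s and p = p and f = f and g = g])
      show "ball (p k) (s / 2) \<inter> frontier X \<noteq> {}" if "k \<in> {..<N}" for k
      proof -
        have "p k \<in> ball (p k) (s / 2) \<inter> frontier X" using c(1,2) that by simp
        then show ?thesis by blast
      qed
      show "norm (q - q') \<le> s" if "q \<in> ball (p k) (s / 2) \<inter> frontier X" "q' \<in> ball (p k) (s / 2) \<inter> frontier X" for k q q'
        using that dist_triangle[of q q' "p k"] by (simp add: dist_norm norm_minus_commute)
    qed (use c t e in \<open>auto simp: dist_norm norm_minus_commute\<close>)
    also have "\<dots> \<le> ennreal (real N * (s + s) * 4 * t)"
    proof (rule ennreal_leI)
      have "(s + 2 * t) * t * (2 + 2 * pi * (1/8)) \<le> (s + s) * t * 4"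
        using t c(1) pi_less_4 by (intro mult_mono) auto
      then have "(\<Sum>k\<in>{..<N}. (s + 2 * t) * t * (2 + 2 * pi * (1/8))) \<le> real N * ((s + s) * t * 4)"
        by (simp add: mult_left_mono)
      then show "(\<Sum>k\<in>{..<N}. (s + 2 * t) * t * (2 + 2 * pi * (1/8))) \<le> real N * (s + s) * 4 * t"
        by (simp add: mult_ac)
    qed
    finally show ?thesis .
  qed
  then show ?thesis using c(1) by (intro exI[of _ "real N * (s + s) * 4"] exI[of _ "s / 4"]) auto
qed

text \<open>A finite union \<open>T\<close> of strips encloses the \<delta>-neighbourhood of the
  frontier, so its measurability and its area can be read off directly.\<close>

lemma tube_bound:
  "\<exists>K \<delta>0. K \<ge> 0 \<and> \<delta>0 > 0 \<and> (\<forall>\<delta>. 0 < \<delta> \<longrightarrow> \<delta> < \<delta>0 \<longrightarrow>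
     (\<exists>T\<in>sets borel. {z. \<exists>q\<in>frontier X. norm (z - q) \<le> \<delta>} \<subseteq> T \<and> emeasure lborel T \<le> ennreal (K * \<delta>)))"
proof -
  have e8: "0 < (1/8::real)" "1/8 \<le> (1/8::real)" by auto
  obtain s N p f g where c': "s > 0" "\<forall>i<N. p i \<in> frontier X"
    "\<forall>i<(N::nat). chart (1/8) s X (p i) (f i) (g i)" "frontier X \<subseteq> (\<Union>i<N. ball (p i) (s / 2))"
    by (rule finite_charts[OF e8]) (rule that)
  note c = c'(1) c'(2)[rule_format] c'(3)[rule_format] c'(4)
  have f: "norm (f i) = 1" if "i < N" for i using c(3)[OF that] by (simp add: chart_def)
  have "\<exists>T\<in>sets borel. {z. \<exists>q\<in>frontier X. norm (z - q) \<le> \<delta>} \<subseteq> T \<and> emeasure lborel T \<le> ennreal (real N * (3 * s) * 5 * \<delta>)"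
    if \<delta>: "0 < \<delta>" "\<delta> < s / 4" for \<delta>
  proof (intro bexI conjI)
    \<comment> \<open>A point within \<delta> of the graph is vertically at most
      \<open>\<delta> + \<delta> / 8\<close> away from it. Raising the graph by
      \<open>2 * \<delta>\<close> and taking depth \<open>5 * \<delta>\<close> covers this on both
      sides.\<close>
    let ?S = "\<lambda>i. strip (p i) (f i) (\<lambda>x. g i x + 2 * \<delta>) {- s / 2 - \<delta>..s / 2 + \<delta>} (5 * \<delta>)"
    have gm: "(\<lambda>x. g i x + 2 * \<delta>) \<in> borel_measurable borel" if "i < N" for i
      using chart_g_measurable[OF c(3)[OF that]] by simp
    have Sb: "?S i \<in> sets borel" if "i < N" for i
      by (rule strip_measurable[OF _ gm[OF that]]) simp
    show "(\<Union>i<N. ?S i) \<in> sets borel" using Sb by blast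
    show "{z. \<exists>q\<in>frontier X. norm (z - q) \<le> \<delta>} \<subseteq> (\<Union>i<N. ?S i)"
    proof clarify
      fix z q assume q: "q \<in> frontier X" "norm (z - q) \<le> \<delta>"
      then obtain i where i: "i < N" "q \<in> ball (p i) (s / 2)" using c(4) by blast
      let ?x = "Re (crd (f i) (p i) z)" and ?y = "Im (crd (f i) (p i) z)"
      let ?x' = "Re (crd (f i) (p i) q)" and ?y' = "Im (crd (f i) (p i) q)"
      have d: "\<bar>?x - ?x'\<bar> \<le> \<delta>" "\<bar>?y - ?y'\<bar> \<le> \<delta>" by (rule chart_diff[OF f[OF i(1)] q(2)])+
      have b: "\<bar>?x'\<bar> \<le> s / 2" "\<bar>?y'\<bar> \<le> s / 2"
        using chart_bounds[OF f[OF i(1)], of q "p i" "s / 2"] i(2) by (auto simp: dist_norm norm_minus_commute)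
      have "?y' = g i ?x'"
        by (rule chart_frontier[OF c(3)[OF i(1)] closed])
          (unfold chart_coords(1)[OF f[OF i(1)]], use q b c(1) in auto)
      moreover have "\<bar>g i ?x' - g i ?x\<bar> \<le> 1/8 * \<bar>?x' - ?x\<bar>"
        using c(3)[OF i(1)] unfolding chart_def by blast
      moreover have "\<bar>y - gx\<bar> \<le> 2 * \<delta>" if "y' = gx'" "\<bar>gx' - gx\<bar> \<le> 1/8 * \<bar>x' - x\<bar>" "\<bar>x - x'\<bar> \<le> \<delta>" "\<bar>y - y'\<bar> \<le> \<delta>"
        for x y x' y' gx gx' :: real
      proof -
        have "\<bar>gx' - gx\<bar> \<le> \<delta>" using that(2,3) \<delta>(1) by (simp add: abs_minus_commute)
        then show ?thesis using that(1,4) by linarith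
      qed
      ultimately have "\<bar>?y - g i ?x\<bar> \<le> 2 * \<delta>" using d by blast
      then have "z \<in> ?S i" unfolding strip_def using d b \<delta> by auto
      then show "z \<in> (\<Union>i<N. ?S i)" using i by blast
    qed
    have "emeasure lborel (\<Union>i<N. ?S i) \<le> (\<Sum>i<N. emeasure lborel (?S i))"
      by (rule emeasure_subadditive_finite) (use Sb in auto)
    also have "\<dots> \<le> (\<Sum>i<N. ennreal (3 * s) * ennreal (5 * \<delta>))"
    proof (rule sum_mono)
      fix i assume "i \<in> {..<N}"
      then have "emeasure lborel (?S i) = emeasure lborel {- s / 2 - \<delta>..s / 2 + \<delta>} * ennreal (5 * \<delta>)"
        by (intro emeasure_strip gm f) auto
      also have "emeasure lborel {- s / 2 - \<delta>..s / 2 + \<delta>} = ennreal (s + 2 * \<delta>)"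
        using \<delta> c(1) by simp
      also have "\<dots> \<le> ennreal (3 * s)" using \<delta> by (intro ennreal_leI) auto
      finally show "emeasure lborel (?S i) \<le> ennreal (3 * s) * ennreal (5 * \<delta>)"
        by (simp add: mult_right_mono)
    qed
    also have "\<dots> = ennreal (real N * (3 * s) * 5 * \<delta>)"
    proof -
      have "ennreal (3 * s) * ennreal (5 * \<delta>) = ennreal (3 * s * (5 * \<delta>))"
        using c(1) \<delta> by (intro ennreal_mult[symmetric]) auto
      then have "(\<Sum>i<N. ennreal (3 * s) * ennreal (5 * \<delta>)) = (\<Sum>i<N. ennreal (3 * s * (5 * \<delta>)))" by (simp only:)
      also have "\<dots> = ennreal (\<Sum>i<N. 3 * s * (5 * \<delta>))" using c(1) \<delta> by (intro sum_ennreal) auto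
      finally show ?thesis by (simp add: mult_ac)
    qed
    finally show "emeasure lborel (\<Union>i<N. ?S i) \<le> ennreal (real N * (3 * s) * 5 * \<delta>)" .
  qed
  then show ?thesis using c(1) by (intro exI[of _ "real N * (3 * s) * 5"] exI[of _ "s / 4"]) auto
qed

text \<open>An almost optimal cover from the definition of \<open>hausdorff1\<close> is fattened to
  open sets, reduced to a finite one by compactness, and each piece is studied in a chart centred at
  one of its own frontier points.\<close>

lemma G_upper:
  assumes \<epsilon>: "0 < \<epsilon>" "\<epsilon> \<le> 1/8" and L: "0 \<le> L" "hausdorff1 (frontier X) \<le> ennreal L" and e: "norm e = 1"
  shows "\<exists>K t0. t0 > 0 \<and> (\<forall>t. 0 < t \<longrightarrow> t < t0 \<longrightarrow>
     G e t \<le> ennreal (t * (L + 2 * \<epsilon>) * (2 + 2 * pi * \<epsilon>) + K * t\<^sup>2))"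
proof -
  obtain s where s: "s > 0" "\<And>p. p \<in> frontier X \<Longrightarrow> \<exists>e g. chart \<epsilon> s X p e g"
    using chart_exists[OF \<epsilon>] by metis
  have "(INF U \<in> {U :: nat \<Rightarrow> complex set. frontier X \<subseteq> (\<Union>i. U i) \<and> (\<forall>i. bounded (U i) \<and> diameter (U i) \<le> s / 8)}.
      (\<Sum>i. ennreal (diameter (U i)))) \<le> hausdorff1 (frontier X)"
    unfolding hausdorff1_def by (rule SUP_upper) (use s in simp)
  also have "\<dots> < ennreal (L + \<epsilon>)" using L \<epsilon> by (intro le_less_trans[OF L(2)] ennreal_lessI) auto
  finally obtain U :: "nat \<Rightarrow> complex set" where U: "frontier X \<subseteq> (\<Union>i. U i)"
    "\<And>i. bounded (U i)" "\<And>i. diameter (U i) \<le> s / 8" "(\<Sum>i. ennreal (diameter (U i))) < ennreal (L + \<epsilon>)"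
    unfolding INF_less_iff by auto
  \<comment> \<open>The fattening adds \<open>2 * \<rho> k\<close> to the k-th diameter, in total at
    most \<epsilon>; the bound \<open>s / 16\<close> keeps each piece inside its chart.\<close>
  define \<rho> where "\<rho> k = min \<epsilon> (s / 16) * (1/2) ^ (k + 2)" for k :: nat
  have \<rho>: "\<rho> k > 0" "\<rho> k \<le> s / 16" for k
  proof -
    show "\<rho> k > 0" using \<epsilon> s by (simp add: \<rho>_def)
    have "min \<epsilon> (s / 16) * (1/2) ^ (k + 2) \<le> s / 16 * 1"
      using \<epsilon> s by (intro mult_mono power_le_one) auto
    then show "\<rho> k \<le> s / 16" by (simp add: \<rho>_def)
  qed
  define V where "V k = (\<Union>w\<in>U k. ball w (\<rho> k))" for k
  define D where "D k = diameter (U k) + 2 * \<rho> k" for k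
  have D: "0 \<le> D k" "D k \<le> s / 2" for k
    using \<rho>[of k] U(3)[of k] diameter_ge_0[OF U(2)[of k]] s by (auto simp: D_def)
  have VD: "norm (q - q') \<le> D k" if qq: "q \<in> V k" "q' \<in> V k" for q q' k
  proof -
    obtain w w' where w: "w \<in> U k" "dist w q < \<rho> k" "w' \<in> U k" "dist w' q' < \<rho> k"
      using qq by (auto simp: V_def)
    have "dist w w' \<le> diameter (U k)" using diameter_bounded_bound[OF U(2) w(1,3)] .
    moreover have "dist q q' \<le> dist w q + dist w w' + dist w' q'"
      using dist_triangle[of q q' w] dist_triangle[of w q' w'] by (simp add: dist_commute)
    ultimately show ?thesis using w by (simp add: D_def dist_norm)
  qed
  obtain I0 where I0: "finite I0" "frontier X \<subseteq> (\<Union>k\<in>I0. V k)"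
  proof (rule compactE_image[OF compact_frontier_X, of UNIV V])
    show "open (V k)" for k by (auto simp: V_def)
    show "frontier X \<subseteq> (\<Union>k\<in>UNIV. V k)"
    proof
      fix q assume "q \<in> frontier X"
      then obtain i where "q \<in> U i" using U(1) by blast
      then show "q \<in> (\<Union>k\<in>UNIV. V k)" using \<rho>(1)[of i] by (auto simp: V_def intro!: exI[of _ i] bexI[of _ q])
    qed
  qed (auto intro: that)
  define I where "I = {k\<in>I0. V k \<inter> frontier X \<noteq> {}}"
  have I: "finite I" "frontier X \<subseteq> (\<Union>k\<in>I. V k)" 
  proof -
    show "finite I" using I0(1) by (simp add: I_def)
    show "frontier X \<subseteq> (\<Union>k\<in>I. V k)"
    proof
      fix q assume q: "q \<in> frontier X"
      then obtain k where "k \<in> I0" "q \<in> V k" using I0(2) by blast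
      then show "q \<in> (\<Union>k\<in>I. V k)" using q unfolding I_def by blast
    qed
  qed
  have "\<exists>p. k \<in> I \<longrightarrow> p \<in> V k \<inter> frontier X" for k unfolding I_def by blast
  then obtain p where p: "\<And>k. k \<in> I \<Longrightarrow> p k \<in> V k \<inter> frontier X" by metis
  have "\<exists>f g. k \<in> I \<longrightarrow> chart \<epsilon> s X (p k) f g" for k using s(2) p by blast
  then obtain f g where fg: "\<And>k. k \<in> I \<Longrightarrow> chart \<epsilon> s X (p k) (f k) (g k)" by metis
  have sumD: "(\<Sum>k\<in>I. D k) \<le> L + 2 * \<epsilon>"
  proof -
    have "ennreal (\<Sum>k\<in>I. diameter (U k)) = (\<Sum>k\<in>I. ennreal (diameter (U k)))"
      by (rule sum_ennreal[symmetric]) (rule diameter_ge_0[OF U(2)])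
    also have "\<dots> \<le> (\<Sum>i. ennreal (diameter (U i)))"
      using I(1) by (intro sum_le_suminf) auto
    also have "\<dots> \<le> ennreal (L + \<epsilon>)" using U(4) by simp
    finally have 1: "(\<Sum>k\<in>I. diameter (U k)) \<le> L + \<epsilon>" using L \<epsilon> by (subst (asm) ennreal_le_iff) auto
    have sums: "(\<lambda>k. \<epsilon> * (1/2) ^ Suc k) sums (\<epsilon> * 1)" by (intro sums_mult power_half_series)
    have "(\<Sum>k\<in>I. 2 * \<rho> k) \<le> (\<Sum>k\<in>I. \<epsilon> * (1/2) ^ Suc k)"
    proof (rule sum_mono)
      fix k
      have "2 * \<rho> k = min \<epsilon> (s / 16) * (1/2) ^ Suc k" by (simp add: \<rho>_def)
      also have "\<dots> \<le> \<epsilon> * (1/2) ^ Suc k" by (intro mult_right_mono) auto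
      finally show "2 * \<rho> k \<le> \<epsilon> * (1/2) ^ Suc k" .
    qed
    also have "\<dots> \<le> (\<Sum>k. \<epsilon> * (1/2) ^ Suc k)"
      using sums \<epsilon> I(1) by (intro sum_le_suminf) (auto simp: sums_iff)
    also have "\<dots> = \<epsilon>" using sums by (simp add: sums_iff)
    finally show ?thesis using 1 by (simp add: D_def sum.distrib)
  qed
  \<comment> \<open>The enlargement by \<open>2 * t\<close> of every piece costs only a term in
    \<open>t\<^sup>2\<close>, since the number of pieces is fixed before \<open>t\<close>.\<close>
  define K where "K = real (card I) * 2 * (2 + 2 * pi * \<epsilon>)"
  have "G e t \<le> ennreal (t * (L + 2 * \<epsilon>) * (2 + 2 * pi * \<epsilon>) + K * t\<^sup>2)" if t: "0 < t" "t < s / 4" for t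
  proof -
    have "G e t \<le> ennreal (\<Sum>k\<in>I. (D k + 2 * t) * t * (2 + 2 * pi * \<epsilon>))"
    proof (rule cover_bound[OF I(1) \<epsilon>(1) _ _ e fg I(2)])
      show "V k \<inter> frontier X \<noteq> {}" if "k \<in> I" for k using that by (simp add: I_def)
      show "norm (q - p k) \<le> s / 2" if "k \<in> I" "q \<in> V k \<inter> frontier X" for k q
        using VD[of q k "p k"] p[OF that(1)] that(2) D(2)[of k] by auto
      show "norm (q - q') \<le> D k" if "k \<in> I" "q \<in> V k \<inter> frontier X" "q' \<in> V k \<inter> frontier X" for k q q'
        using VD that by auto
    qed (use t in auto)
    also have "(\<Sum>k\<in>I. (D k + 2 * t) * t * (2 + 2 * pi * \<epsilon>)) = (\<Sum>k\<in>I. D k) * (t * (2 + 2 * pi * \<epsilon>)) + K * t\<^sup>2"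
    proof -
      have "(\<Sum>k\<in>I. (D k + 2 * t) * t * (2 + 2 * pi * \<epsilon>)) = (\<Sum>k\<in>I. D k * (t * (2 + 2 * pi * \<epsilon>)) + 2 * t\<^sup>2 * (2 + 2 * pi * \<epsilon>))"
        by (intro sum.cong refl) (simp add: algebra_simps power2_eq_square)
      then show ?thesis by (simp add: sum.distrib sum_distrib_right K_def)
    qed
    also have "\<dots> \<le> (L + 2 * \<epsilon>) * (t * (2 + 2 * pi * \<epsilon>)) + K * t\<^sup>2"
      using sumD t \<epsilon> by (intro add_right_mono mult_right_mono) auto
    finally show ?thesis by (simp add: mult_ac ennreal_leI)
  qed
  then show ?thesis using s(1) by (intro exI[of _ K] exI[of _ "s / 4"]) auto
qed

text \<open>The frontier is cut into disjoint graph pieces. Graph maps are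
  \<open>(1 + \<epsilon>)\<close>-Lipschitz, so the base sets have total measure almost
  \<open>l / (1 + \<epsilon>)\<close>, and compact subsets of them carry disjoint strips. The number
  \<open>l\<close> is any value strictly below the length because finiteness of the length is still
  open at this point.\<close>

lemma G_lower:
  assumes \<epsilon>: "0 < \<epsilon>" "\<epsilon> \<le> 1/8" and l: "0 \<le> l" "ennreal l < hausdorff1 (frontier X)" and e: "norm e = 1"
  shows "\<exists>t0>0. \<forall>t. 0 < t \<longrightarrow> t < t0 \<longrightarrow> ennreal (t * (l / (1 + \<epsilon>) - \<epsilon>) * (2 - 2 * pi * \<epsilon>)) \<le> G e t"
proof -
  obtain s N p f g where c': "s > 0" "\<forall>i<N. p i \<in> frontier X"
    "\<forall>i<(N::nat). chart \<epsilon> s X (p i) (f i) (g i)" "frontier X \<subseteq> (\<Union>i<N. ball (p i) (s / 2))"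
    by (rule finite_charts[OF \<epsilon>]) (rule that)
  note c = c'(1) c'(2)[rule_format] c'(3)[rule_format] c'(4)
  have f: "norm (f i) = 1" if "i < N" for i using c(3)[OF that] by (simp add: chart_def)
  define \<Gamma> where "\<Gamma> i x = p i + f i * Complex x (g i x)" for i x
  have \<Gamma>_cont: "continuous_on UNIV (\<Gamma> i)" if "i < N" for i
    unfolding \<Gamma>_def Complex_eq by (intro continuous_intros chart_g_continuous[OF c(3)[OF that]])
  have \<Gamma>_lip: "dist (\<Gamma> i x) (\<Gamma> i y) \<le> (1 + \<epsilon>) * \<bar>x - y\<bar>" if "i < N" for i x y
  proof -
    have "\<Gamma> i x - \<Gamma> i y = f i * Complex (x - y) (g i x - g i y)"
      by (simp add: \<Gamma>_def complex_eq_iff algebra_simps)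
    then have "dist (\<Gamma> i x) (\<Gamma> i y) = norm (f i * Complex (x - y) (g i x - g i y))" by (simp add: dist_norm)
    also have "\<dots> \<le> \<bar>x - y\<bar> + \<bar>g i x - g i y\<bar>" by (rule inner_rotated(2)[OF f[OF that]])
    also have "\<bar>g i x - g i y\<bar> \<le> \<epsilon> * \<bar>x - y\<bar>" using c(3)[OF that] unfolding chart_def by blast
    finally show ?thesis by (simp add: algebra_simps)
  qed
  \<comment> \<open>A frontier point is assigned to the first ball containing it, which makes the
    pieces disjoint.\<close>
  define S where "S i = {x\<in>{- s / 2..s / 2}. \<Gamma> i x \<in> ball (p i) (s / 2) \<and> (\<forall>j\<in>{..<i}. \<Gamma> i x \<notin> ball (p j) (s / 2))}" for i
  have Sb: "S i \<in> sets borel" if "i < N" for i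
  proof -
    have o: "open (\<Gamma> i -` ball c r)" for c r
      by (rule open_vimage[OF open_ball \<Gamma>_cont[OF that]])
    have "S i = {- s / 2..s / 2} \<inter> (\<Gamma> i -` ball (p i) (s / 2)) \<inter> - (\<Union>j<i. \<Gamma> i -` ball (p j) (s / 2))"
      by (auto simp: S_def)
    also have "\<dots> \<in> sets borel"
      using o by (intro sets.Int borel_closed borel_open closed_Compl open_UN) auto
    finally show ?thesis .
  qed
  have Ss: "S i \<subseteq> {- (s / 2)..s / 2}" for i by (auto simp: S_def)
  have cover: "frontier X \<subseteq> (\<Union>i<N. \<Gamma> i ` S i)"
  proof
    fix q assume q: "q \<in> frontier X"
    define i where "i = (LEAST i. i < N \<and> q \<in> ball (p i) (s / 2))"
    have ex: "\<exists>i. i < N \<and> q \<in> ball (p i) (s / 2)" using c(4) q by blast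
    have i: "i < N" "q \<in> ball (p i) (s / 2)" using LeastI_ex[OF ex] by (auto simp: i_def)
    have least: "q \<notin> ball (p j) (s / 2)" if "j < i" for j
      using not_less_Least[of j "\<lambda>i. i < N \<and> q \<in> ball (p i) (s / 2)"] that i(1) by (auto simp: i_def)
    let ?x = "Re (crd (f i) (p i) q)" and ?y = "Im (crd (f i) (p i) q)"
    have b: "\<bar>?x\<bar> \<le> s / 2" "\<bar>?y\<bar> \<le> s / 2"
      using chart_bounds[OF f[OF i(1)], of q "p i" "s / 2"] i(2) by (auto simp: dist_norm norm_minus_commute)
    have y: "?y = g i ?x"
      by (rule chart_frontier[OF c(3)[OF i(1)] closed])
        (unfold chart_coords(1)[OF f[OF i(1)]], use q b c(1) in auto)
    have "\<Gamma> i ?x = q" using chart_coords(1)[OF f[OF i(1)], of "p i" q] unfolding \<Gamma>_def y .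
    moreover from this have "?x \<in> S i" unfolding S_def using b i least by (auto simp: abs_le_iff)
    ultimately show "q \<in> (\<Union>i<N. \<Gamma> i ` S i)" using i by (metis UN_I imageI lessThan_iff)
  qed
  \<comment> \<open>The slack is spent twice in each chart, once for the interval covers and once
    for the compact subsets; both together cost at most \<epsilon>.\<close>
  define \<gamma> where "\<gamma> = \<epsilon> / (2 * real N + 2)"
  have \<gamma>: "\<gamma> > 0" "2 * (real N * \<gamma>) \<le> \<epsilon>"
    using \<epsilon> by (auto simp: \<gamma>_def field_simps)
  have "hausdorff1 (frontier X) \<le> ennreal ((1 + \<epsilon>) * (\<Sum>i<N. measure lborel (S i) + \<gamma>))"
  proof (rule hausdorff1_le)
    fix \<delta> :: real assume \<delta>: "\<delta> > 0"
    have "\<exists>\<D>. countable \<D> \<and> S i \<subseteq> \<Union>\<D> \<and> (\<forall>K\<in>\<D>. \<exists>c d. K = {c..d} \<and> c \<le> d \<and> d - c \<le> \<delta> / 2) \<and>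
        (\<integral>\<^sup>+K. emeasure lborel K \<partial>count_space \<D>) \<le> ennreal (measure lborel (S i) + \<gamma>)" if i: "i < N" for i
    proof -
      have "s / 2 > 0" "\<delta> / 2 > 0" using c(1) \<delta> by auto
      from interval_cover[OF Sb[OF i] Ss this \<gamma>(1)] show ?thesis by metis
    qed
    then obtain \<D> where \<D>: "\<And>i. i < N \<Longrightarrow> countable (\<D> i)" "\<And>i. i < N \<Longrightarrow> S i \<subseteq> \<Union>(\<D> i)"
      "\<And>i K. i < N \<Longrightarrow> K \<in> \<D> i \<Longrightarrow> \<exists>c d. K = {c..d} \<and> c \<le> d \<and> d - c \<le> \<delta> / 2"
      "\<And>i. i < N \<Longrightarrow> (\<integral>\<^sup>+K. emeasure lborel K \<partial>count_space (\<D> i)) \<le> ennreal (measure lborel (S i) + \<gamma>)"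
      by metis
    let ?I = "Sigma {..<N} \<D>"
    define W where "W = (\<lambda>(i, K). \<Gamma> i ` K)"
    have W: "bounded (W (i, K)) \<and> diameter (W (i, K)) \<le> \<delta> \<and> ennreal (diameter (W (i, K))) \<le> ennreal (1 + \<epsilon>) * emeasure lborel K"
      if iK: "i < N" "K \<in> \<D> i" for i K
    proof -
      obtain a b where K: "K = {a..b}" "a \<le> b" "b - a \<le> \<delta> / 2" using \<D>(3)[OF iK] by blast
      have d: "dist x y \<le> (1 + \<epsilon>) * (b - a)" if xyW: "x \<in> W (i, K)" "y \<in> W (i, K)" for x y
      proof -
        obtain x' y' where xy: "x = \<Gamma> i x'" "y = \<Gamma> i y'" "x' \<in> {a..b}" "y' \<in> {a..b}"
          using xyW K by (auto simp: W_def)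
        have "dist x y \<le> (1 + \<epsilon>) * \<bar>x' - y'\<bar>" unfolding xy by (rule \<Gamma>_lip[OF iK(1)])
        also have "\<dots> \<le> (1 + \<epsilon>) * (b - a)" using xy \<epsilon> by (intro mult_left_mono) auto
        finally show ?thesis .
      qed
      have "bounded (W (i, K))" using d unfolding bounded_two_points by blast
      moreover have dia: "diameter (W (i, K)) \<le> (1 + \<epsilon>) * (b - a)"
        by (rule diameter_le) (use d \<epsilon> K in \<open>auto simp: dist_norm W_def\<close>)
      moreover have "(1 + \<epsilon>) * (b - a) \<le> 2 * (\<delta> / 2)" using K \<epsilon> by (intro mult_mono) auto
      moreover have "ennreal (diameter (W (i, K))) \<le> ennreal ((1 + \<epsilon>) * (b - a))" by (rule ennreal_leI[OF dia])
      ultimately show ?thesis using K \<epsilon> by (auto simp: ennreal_mult)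
    qed
    show "\<exists>(I :: (nat \<times> real set) set) U. countable I \<and> frontier X \<subseteq> (\<Union>i\<in>I. U i) \<and>
      (\<forall>i\<in>I. bounded (U i) \<and> diameter (U i) \<le> \<delta>) \<and>
      (\<integral>\<^sup>+i. ennreal (diameter (U i)) \<partial>count_space I) \<le> ennreal ((1 + \<epsilon>) * (\<Sum>i<N. measure lborel (S i) + \<gamma>))"
    proof (intro exI conjI)
      show "countable ?I" using \<D>(1) by (intro countable_SIGMA) auto
      show "frontier X \<subseteq> (\<Union>i\<in>?I. W i)"
      proof
        fix q assume "q \<in> frontier X"
        then obtain i x where ix: "i < N" "x \<in> S i" "q = \<Gamma> i x" using cover by blast
        then obtain K where "K \<in> \<D> i" "x \<in> K" using \<D>(2) by blast
        then show "q \<in> (\<Union>i\<in>?I. W i)" using ix by (intro UN_I[of "(i, K)"]) (auto simp: W_def)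
      qed
      show "\<forall>i\<in>?I. bounded (W i) \<and> diameter (W i) \<le> \<delta>" using W by auto
      have "(\<integral>\<^sup>+i. ennreal (diameter (W i)) \<partial>count_space ?I) \<le> (\<Sum>i<N. \<integral>\<^sup>+K. ennreal (diameter (W (i, K))) \<partial>count_space (\<D> i))"
        by (rule nn_integral_count_space_Sigma_le) simp
      also have "\<dots> \<le> (\<Sum>i<N. ennreal (1 + \<epsilon>) * ennreal (measure lborel (S i) + \<gamma>))"
      proof (rule sum_mono)
        fix i assume "i \<in> {..<N}"
        then have i: "i < N" by simp
        have "(\<integral>\<^sup>+K. ennreal (diameter (W (i, K))) \<partial>count_space (\<D> i)) \<le> (\<integral>\<^sup>+K. ennreal (1 + \<epsilon>) * emeasure lborel K \<partial>count_space (\<D> i))"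
          by (rule nn_integral_mono) (use W[OF i] in auto)
        also have "\<dots> = ennreal (1 + \<epsilon>) * (\<integral>\<^sup>+K. emeasure lborel K \<partial>count_space (\<D> i))"
          by (rule nn_integral_cmult) simp
        also have "\<dots> \<le> ennreal (1 + \<epsilon>) * ennreal (measure lborel (S i) + \<gamma>)"
          by (rule mult_left_mono[OF \<D>(4)[OF i]]) simp
        finally show "(\<integral>\<^sup>+K. ennreal (diameter (W (i, K))) \<partial>count_space (\<D> i)) \<le> ennreal (1 + \<epsilon>) * ennreal (measure lborel (S i) + \<gamma>)" .
      qed
      also have "\<dots> = (\<Sum>i<N. ennreal ((1 + \<epsilon>) * (measure lborel (S i) + \<gamma>)))"
        using \<epsilon> \<gamma> by (simp add: ennreal_mult)
      also have "\<dots> = ennreal (\<Sum>i<N. (1 + \<epsilon>) * (measure lborel (S i) + \<gamma>))"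
        by (rule sum_ennreal) (use \<epsilon> \<gamma> in auto)
      also have "\<dots> = ennreal ((1 + \<epsilon>) * (\<Sum>i<N. measure lborel (S i) + \<gamma>))"
        by (simp only: sum_distrib_left)
      finally show "(\<integral>\<^sup>+i. ennreal (diameter (W i)) \<partial>count_space ?I) \<le> ennreal ((1 + \<epsilon>) * (\<Sum>i<N. measure lborel (S i) + \<gamma>))" .
    qed
  qed
  then have "ennreal l < ennreal ((1 + \<epsilon>) * (\<Sum>i<N. measure lborel (S i) + \<gamma>))" using l(2) by simp
  then have "l < (1 + \<epsilon>) * (\<Sum>i<N. measure lborel (S i) + \<gamma>)" using l(1) by (simp add: ennreal_less_iff)
  then have lS: "l / (1 + \<epsilon>) < (\<Sum>i<N. measure lborel (S i)) + real N * \<gamma>"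
    using \<epsilon> by (simp add: field_simps sum.distrib)
  have "\<exists>C. i < N \<longrightarrow> compact C \<and> C \<subseteq> S i \<and> measure lborel (S i) - \<gamma> \<le> measure lborel C" for i
    using compact_inner[OF Sb Ss \<gamma>(1), of i] by metis
  then obtain C where C: "\<And>i. i < N \<Longrightarrow> compact (C i)" "\<And>i. i < N \<Longrightarrow> C i \<subseteq> S i"
    "\<And>i. i < N \<Longrightarrow> measure lborel (S i) - \<gamma> \<le> measure lborel (C i)" by metis
  have "\<exists>t0>0. \<forall>t. 0 < t \<longrightarrow> t < t0 \<longrightarrow> ennreal (t * (\<Sum>k\<in>{..<N}. measure lborel (C k)) * (2 - 2 * pi * \<epsilon>)) \<le> G e t"
  proof (rule strips_bound[OF _ \<epsilon> c(1) e, of "{..<N}" p f g C])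
    have lt: "(\<lambda>x. p k + f k * Complex x (g k x)) ` C k \<inter> (\<lambda>x. p l + f l * Complex x (g l x)) ` C l = {}"
      if "k < l" "l < N" for k l
    proof -
      have "\<Gamma> k x \<in> ball (p k) (s / 2)" if "x \<in> C k" for x using C(2)[of k] that \<open>k < l\<close> \<open>l < N\<close> by (auto simp: S_def)
      moreover have "\<Gamma> l x \<notin> ball (p k) (s / 2)" if "x \<in> C l" for x using C(2)[of l] that \<open>k < l\<close> \<open>l < N\<close> by (auto simp: S_def)
      ultimately show ?thesis unfolding \<Gamma>_def by fastforce
    qed
    then show "(\<lambda>x. p k + f k * Complex x (g k x)) ` C k \<inter> (\<lambda>x. p l + f l * Complex x (g l x)) ` C l = {}"
      if "k \<in> {..<N}" "l \<in> {..<N}" "k \<noteq> l" for k l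
      using that lt[of k l] lt[of l k] by (cases "k < l") (auto simp: Int_commute)
    show "C k \<subseteq> {- s / 2..s / 2}" if "k \<in> {..<N}" for k using C(2)[of k] that by (auto simp: S_def)
  qed (use c(3) C(1) in auto)
  then obtain t0 where t0: "t0 > 0" "\<And>t. 0 < t \<Longrightarrow> t < t0 \<Longrightarrow>
      ennreal (t * (\<Sum>k\<in>{..<N}. measure lborel (C k)) * (2 - 2 * pi * \<epsilon>)) \<le> G e t" by blast
  have "l / (1 + \<epsilon>) - \<epsilon> \<le> (\<Sum>k<N. measure lborel (C k))"
  proof -
    have "(\<Sum>i<N. measure lborel (S i) - \<gamma>) \<le> (\<Sum>i<N. measure lborel (C i))"
      by (rule sum_mono) (use C in auto)
    then show ?thesis using lS \<gamma>(2) by (simp add: sum_subtractf)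
  qed
  moreover have pos: "0 \<le> 2 - 2 * pi * \<epsilon>"
    using mult_mono[of "2 * pi" 8 \<epsilon> "1/8"] \<epsilon> pi_less_4 by simp
  ultimately have "ennreal (t * (l / (1 + \<epsilon>) - \<epsilon>) * (2 - 2 * pi * \<epsilon>)) \<le> G e t" if "0 < t" "t < t0" for t
    using that by (intro order_trans[OF _ t0(2)[OF that]] ennreal_leI mult_right_mono mult_left_mono) auto
  then show ?thesis using t0(1) by blast
qed

end

section \<open>Second order expansion\<close>

text \<open>The n-th halving changes \<open>f\<close> by at most
  \<open>s * (1/2) ^ n * \<Omega> s\<close>, using monotonicity of \<Omega>. The geometric series
  bounds the distance from \<open>f s\<close> to the limit by
  \<open>2 * s * \<Omega> s\<close>.\<close>

lemma telescoping:
  fixes f \<Omega> :: "real \<Rightarrow> real"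
  assumes lim: "(f \<longlongrightarrow> l) (at_right 0)" and b: "b > 0"
    and step: "\<And>s. 0 < s \<Longrightarrow> s < b \<Longrightarrow> \<bar>f (s / 2) - f s\<bar> \<le> s * \<Omega> s"
    and \<Omega>: "\<And>s s'. s \<le> s' \<Longrightarrow> \<Omega> s \<le> \<Omega> s'" "\<And>s. 0 \<le> \<Omega> s" "(\<Omega> \<longlongrightarrow> 0) (at_right 0)"
  shows "((\<lambda>s. (f s - l) / s) \<longlongrightarrow> 0) (at_right 0)"
proof -
  have bound: "\<bar>(f s - l) / s\<bar> \<le> 2 * \<Omega> s" if s: "0 < s" "s < b" for s
  proof -
    have tel: "\<bar>f (s * (1/2) ^ n) - f s\<bar> \<le> s * \<Omega> s * (2 - 2 * (1/2) ^ n)" for n :: nat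
    proof (induction n)
      case (Suc n)
      let ?x = "s * (1/2) ^ n"
      have x: "0 < ?x" "?x \<le> s * 1" using s by (auto intro!: mult_left_mono power_le_one)
      then have xb: "?x < b" using s by linarith
      have "\<bar>f (s * (1/2) ^ Suc n) - f s\<bar> \<le> \<bar>f (?x / 2) - f ?x\<bar> + \<bar>f ?x - f s\<bar>" by simp
      also have "\<dots> \<le> ?x * \<Omega> ?x + s * \<Omega> s * (2 - 2 * (1/2) ^ n)"
        by (intro add_mono step[OF x(1) xb] Suc)
      also have "?x * \<Omega> ?x \<le> ?x * \<Omega> s" using x \<Omega>(1)[of ?x s] by (intro mult_left_mono) auto
      also have "?x * \<Omega> s + s * \<Omega> s * (2 - 2 * (1/2) ^ n) = s * \<Omega> s * (2 - 2 * (1/2) ^ Suc n)"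
        by (simp add: algebra_simps)
      finally show ?case by simp
    qed simp
    have "(\<lambda>n. s * (1/2) ^ n) \<longlonglongrightarrow> s * 0"
      by (intro tendsto_mult tendsto_const LIMSEQ_power_zero) simp
    then have "filterlim (\<lambda>n. s * (1/2) ^ n) (at_right 0) sequentially"
      using s by (intro filterlim_at_withinI) auto
    then have "(\<lambda>n. f (s * (1/2) ^ n)) \<longlonglongrightarrow> l" by (rule filterlim_compose[OF lim])
    then have "(\<lambda>n. \<bar>f (s * (1/2) ^ n) - f s\<bar>) \<longlonglongrightarrow> \<bar>l - f s\<bar>"
      by (intro tendsto_rabs tendsto_diff tendsto_const)
    moreover have "\<bar>f (s * (1/2) ^ n) - f s\<bar> \<le> s * \<Omega> s * 2" for n
    proof (rule order_trans[OF tel])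
      show "s * \<Omega> s * (2 - 2 * (1/2) ^ n) \<le> s * \<Omega> s * 2"
        using s \<Omega>(2)[of s] by (intro mult_left_mono) auto
    qed
    ultimately have "\<bar>l - f s\<bar> \<le> s * \<Omega> s * 2" by (intro LIMSEQ_le_const2) auto
    then show ?thesis using s by (simp add: abs_divide abs_minus_commute field_simps)
  qed
  have "((\<lambda>s. 2 * \<Omega> s) \<longlongrightarrow> 0) (at_right 0)" using tendsto_mult[OF tendsto_const \<Omega>(3), of 2] by simp
  moreover have "\<forall>\<^sub>F s in at_right 0. norm ((f s - l) / s) \<le> 2 * \<Omega> s"
    using b bound by (auto simp: eventually_at_right_field intro!: exI[of _ b])
  ultimately show ?thesis by (rule Lim_null_comparison[rotated])
qed

context smooth_domain
begin

lemma G_finite_near_0: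
  assumes "norm e = 1"
  shows "\<forall>\<^sub>F t in at_right 0. G e t \<noteq> \<top>"
proof -
  obtain K t1 where "t1 > 0" "\<forall>t. 0 < t \<longrightarrow> t < t1 \<longrightarrow> G e t \<le> ennreal (K * t)"
    using G_linear_bound[OF assms] by blast
  then show ?thesis by (auto simp: eventually_at_right_field top_unique intro!: exI[of _ t1])
qed

lemma boundary_length_finite: "hausdorff1 (frontier X) \<noteq> \<top>"
proof
  assume inf: "hausdorff1 (frontier X) = \<top>"
  have e: "norm (1::complex) = 1" by simp
  obtain K t1 where K: "K \<ge> 0" "t1 > 0" "\<forall>t. 0 < t \<longrightarrow> t < t1 \<longrightarrow> G 1 t \<le> ennreal (K * t)"
    using G_linear_bound[OF e] by blast
  \<comment> \<open>With this \<open>l\<close> and slope \<open>1/8\<close> the lower bound for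
    \<open>G 1 t\<close> is at least \<open>t * (K + 1)\<close>, beyond the linear bound
    \<open>K * t\<close>.\<close>
  define l where "l = (K + 2) * 2"
  have "\<exists>t0>0. \<forall>t. 0 < t \<longrightarrow> t < t0 \<longrightarrow> ennreal (t * (l / (1 + 1/8) - 1/8) * (2 - 2 * pi * (1/8))) \<le> G 1 t"
    by (rule G_lower) (use inf K in \<open>auto simp: l_def\<close>)
  then obtain t0 where t0: "t0 > 0" "\<And>t. 0 < t \<Longrightarrow> t < t0 \<Longrightarrow> ennreal (t * (l / (1 + 1/8) - 1/8) * (2 - 2 * pi * (1/8))) \<le> G 1 t"
    by blast
  define t where "t = min t0 t1 / 2"
  have t: "0 < t" "t < t0" "t < t1" using t0(1) K(2) by (auto simp: t_def)
  have "ennreal (t * (l / (1 + 1/8) - 1/8) * (2 - 2 * pi * (1/8))) \<le> ennreal (K * t)"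
    using t0(2)[OF t(1,2)] K(3) t by (meson order_trans)
  then have "t * (l / (1 + 1/8) - 1/8) * (2 - 2 * pi * (1/8)) \<le> K * t"
    using K t by (subst (asm) ennreal_le_iff) auto
  moreover have "t * (K + 1) * 1 \<le> t * (l / (1 + 1/8) - 1/8) * (2 - 2 * pi * (1/8))"
    using K t pi_less_4 by (intro mult_mono mult_left_mono) (auto simp: l_def field_simps)
  ultimately show False using t by (simp add: algebra_simps)
qed

definition L :: real where "L = enn2real (hausdorff1 (frontier X))"

lemma L: "0 \<le> L" "hausdorff1 (frontier X) = ennreal L"
  using boundary_length_finite by (auto simp: L_def ennreal_enn2real_if)

lemma G_limit:
  assumes e: "norm e = 1"
  shows "((\<lambda>t. enn2real (G e t) / t) \<longlongrightarrow> 2 * L) (at_right 0)"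
proof (rule order_tendstoI)
  fix y assume y: "2 * L < y"
  have "((\<lambda>\<epsilon>. (L + 2 * \<epsilon>) * (2 + 2 * pi * \<epsilon>)) \<longlongrightarrow> (L + 2 * 0) * (2 + 2 * pi * 0)) (at_right 0)"
    by (intro tendsto_intros)
  moreover have "(L + 2 * 0) * (2 + 2 * pi * 0) < y" using y by simp
  ultimately have "\<forall>\<^sub>F \<epsilon> in at_right 0. (L + 2 * \<epsilon>) * (2 + 2 * pi * \<epsilon>) < y"
    by (rule order_tendstoD(2))
  moreover have "\<forall>\<^sub>F \<epsilon> in at_right (0::real). 0 < \<epsilon> \<and> \<epsilon> \<le> 1/8"
    by (auto simp: eventually_at_right_field intro!: exI[of _ "1/8"])
  ultimately obtain \<epsilon> where \<epsilon>: "(L + 2 * \<epsilon>) * (2 + 2 * pi * \<epsilon>) < y" "0 < \<epsilon>" "\<epsilon> \<le> 1/8"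
    using eventually_happens[OF eventually_conj] trivial_limit_at_right_real by (metis (mono_tags, lifting))
  obtain K t0 where K: "t0 > 0" "\<And>t. 0 < t \<Longrightarrow> t < t0 \<Longrightarrow>
     G e t \<le> ennreal (t * (L + 2 * \<epsilon>) * (2 + 2 * pi * \<epsilon>) + K * t\<^sup>2)"
    using G_upper[OF \<epsilon>(2,3) L(1) _ e] L(2) by auto
  have "((\<lambda>t. (L + 2 * \<epsilon>) * (2 + 2 * pi * \<epsilon>) + \<bar>K\<bar> * t) \<longlongrightarrow> (L + 2 * \<epsilon>) * (2 + 2 * pi * \<epsilon>) + \<bar>K\<bar> * 0) (at_right 0)"
    by (intro tendsto_intros)
  then have "\<forall>\<^sub>F t in at_right 0. (L + 2 * \<epsilon>) * (2 + 2 * pi * \<epsilon>) + \<bar>K\<bar> * t < y"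
    using \<epsilon>(1) by (intro order_tendstoD(2)) auto
  moreover have "\<forall>\<^sub>F t in at_right 0. 0 < t \<and> t < t0"
    using K(1) by (auto simp: eventually_at_right_field)
  ultimately show "\<forall>\<^sub>F t in at_right 0. enn2real (G e t) / t < y"
  proof eventually_elim
    case (elim t)
    have "G e t \<le> ennreal (t * (L + 2 * \<epsilon>) * (2 + 2 * pi * \<epsilon>) + K * t\<^sup>2)" using K(2) elim by blast
    also have "\<dots> \<le> ennreal (t * ((L + 2 * \<epsilon>) * (2 + 2 * pi * \<epsilon>) + \<bar>K\<bar> * t))"
    proof (rule ennreal_leI)
      have "K * t\<^sup>2 \<le> \<bar>K\<bar> * t\<^sup>2" by (intro mult_right_mono) auto
      then show "t * (L + 2 * \<epsilon>) * (2 + 2 * pi * \<epsilon>) + K * t\<^sup>2 \<le> t * ((L + 2 * \<epsilon>) * (2 + 2 * pi * \<epsilon>) + \<bar>K\<bar> * t)"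
        by (simp add: algebra_simps power2_eq_square)
    qed
    finally have "enn2real (G e t) \<le> t * ((L + 2 * \<epsilon>) * (2 + 2 * pi * \<epsilon>) + \<bar>K\<bar> * t)"
      using elim L(1) \<epsilon> by (intro enn2real_leI) auto
    then have "enn2real (G e t) / t \<le> (L + 2 * \<epsilon>) * (2 + 2 * pi * \<epsilon>) + \<bar>K\<bar> * t"
      using elim by (simp add: pos_divide_le_eq mult.commute)
    then show ?case using elim by linarith
  qed
next
  fix y assume y: "y < 2 * L"
  show "\<forall>\<^sub>F t in at_right 0. y < enn2real (G e t) / t"
  \<comment> \<open>\<open>G_lower\<close> wants a nonnegative \<open>l\<close> strictly below the
    length; there is none for \<open>L = 0\<close>, where nonnegativity of the quotient
    suffices.\<close>
  proof (cases "L = 0")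
    case True
    have "y < enn2real (G e t) / t" if "0 < t" for t
    proof -
      have "0 \<le> enn2real (G e t) / t" using that by simp
      then show ?thesis using y True by linarith
    qed
    then show ?thesis by (auto simp: eventually_at_right_field intro!: exI[of _ 1])
  next
    case False
    then have Lp: "L > 0" using L(1) by simp
    have "((\<lambda>\<epsilon>. (L * (1 - \<epsilon>) / (1 + \<epsilon>) - \<epsilon>) * (2 - 2 * pi * \<epsilon>)) \<longlongrightarrow> (L * (1 - 0) / (1 + 0) - 0) * (2 - 2 * pi * 0)) (at_right 0)"
      by (intro tendsto_intros) auto
    moreover have "y < (L * (1 - 0) / (1 + 0) - 0) * (2 - 2 * pi * 0)" using y by simp
    ultimately have "\<forall>\<^sub>F \<epsilon> in at_right 0. y < (L * (1 - \<epsilon>) / (1 + \<epsilon>) - \<epsilon>) * (2 - 2 * pi * \<epsilon>)"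
      by (rule order_tendstoD(1))
    moreover have "\<forall>\<^sub>F \<epsilon> in at_right (0::real). 0 < \<epsilon> \<and> \<epsilon> \<le> 1/8"
      by (auto simp: eventually_at_right_field intro!: exI[of _ "1/8"])
    ultimately obtain \<epsilon> where \<epsilon>: "y < (L * (1 - \<epsilon>) / (1 + \<epsilon>) - \<epsilon>) * (2 - 2 * pi * \<epsilon>)" "0 < \<epsilon>" "\<epsilon> \<le> 1/8"
      using eventually_happens[OF eventually_conj] trivial_limit_at_right_real by (metis (mono_tags, lifting))
    have l: "0 \<le> L * (1 - \<epsilon>)" "ennreal (L * (1 - \<epsilon>)) < hausdorff1 (frontier X)"
      using Lp \<epsilon> by (auto simp: L(2) ennreal_less_iff)
    obtain t0 where t0: "t0 > 0" "\<And>t. 0 < t \<Longrightarrow> t < t0 \<Longrightarrow>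
        ennreal (t * (L * (1 - \<epsilon>) / (1 + \<epsilon>) - \<epsilon>) * (2 - 2 * pi * \<epsilon>)) \<le> G e t"
      using G_lower[OF \<epsilon>(2,3) l e] by blast
    have "\<forall>\<^sub>F t in at_right 0. 0 < t \<and> t < t0"
      using t0(1) by (auto simp: eventually_at_right_field)
    with G_finite_near_0[OF e] show ?thesis
    proof eventually_elim
      case (elim t)
      have "enn2real (ennreal (t * (L * (1 - \<epsilon>) / (1 + \<epsilon>) - \<epsilon>) * (2 - 2 * pi * \<epsilon>))) \<le> enn2real (G e t)"
        using t0(2)[of t] elim by (intro enn2real_mono) (auto simp: less_top)
      moreover have "x \<le> enn2real (ennreal x)" for x by (cases "x \<ge> 0") (auto simp: ennreal_neg)
      ultimately have "t * (L * (1 - \<epsilon>) / (1 + \<epsilon>) - \<epsilon>) * (2 - 2 * pi * \<epsilon>) \<le> enn2real (G e t)"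
        by (meson order_trans)
      then have "(L * (1 - \<epsilon>) / (1 + \<epsilon>) - \<epsilon>) * (2 - 2 * pi * \<epsilon>) \<le> enn2real (G e t) / t"
        using elim by (simp add: pos_le_divide_eq mult_ac)
      then show ?case using \<epsilon>(1) by linarith
    qed
  qed
qed

definition pat :: "real \<Rightarrow> complex \<Rightarrow> complex set" where
  "pat t u = {z. (z \<in> X \<longleftrightarrow> z + of_real (2 * t) * u \<in> X) \<and> (z \<in> X \<longleftrightarrow> z + of_real t * u \<notin> X)}"

lemma exit_pair_measurable: "(\<lambda>v. emeasure lborel (exitset t (cis v * e))) \<in> borel_measurable borel"
proof -
  let ?Q = "{p. fst p \<in> X \<and> fst p + of_real t * (cis (snd p) * e) \<notin> X}"
  have "{p \<in> space (borel \<Otimes>\<^sub>M borel). fst p \<in> X \<and> fst p + of_real t * (cis (snd p) * e) \<notin> X} \<in> sets (borel \<Otimes>\<^sub>M borel)"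
    by measurable
  then have "?Q \<in> sets (lborel \<Otimes>\<^sub>M lborel)" by (simp add: space_pair_measure)
  then have "(\<lambda>v. emeasure lborel ((\<lambda>z. (z, v)) -` ?Q)) \<in> borel_measurable lborel"
    by (rule lborel_pair.measurable_emeasure_Pair2)
  moreover have "(\<lambda>z. (z, v)) -` ?Q = exitset t (cis v * e)" for v by (auto simp: exitset_def)
  ultimately have "(\<lambda>v. emeasure lborel (exitset t (cis v * e))) \<in> borel_measurable lborel" by (simp only:)
  then show ?thesis by simp
qed

lemma pat_measurable: "(\<lambda>(z, v). indicator (pat t (cis v * e)) z :: ennreal) \<in> borel_measurable (lborel \<Otimes>\<^sub>M lborel)"
proof -
  let ?Q = "{p. (fst p \<in> X \<longleftrightarrow> fst p + of_real (2 * t) * (cis (snd p) * e) \<in> X) \<and> (fst p \<in> X \<longleftrightarrow> fst p + of_real t * (cis (snd p) * e) \<notin> X)}"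
  have "{p \<in> space (borel \<Otimes>\<^sub>M borel). (fst p \<in> X \<longleftrightarrow> fst p + of_real (2 * t) * (cis (snd p) * e) \<in> X) \<and> (fst p \<in> X \<longleftrightarrow> fst p + of_real t * (cis (snd p) * e) \<notin> X)} \<in> sets (borel \<Otimes>\<^sub>M borel)"
    by measurable
  then have "?Q \<in> sets (lborel \<Otimes>\<^sub>M lborel)" by (simp add: space_pair_measure)
  then have "indicator ?Q \<in> borel_measurable (lborel \<Otimes>\<^sub>M (lborel :: real measure))" by (rule borel_measurable_indicator)
  moreover have "(\<lambda>(z, v). indicator (pat t (cis v * e)) z :: ennreal) = indicator ?Q"
    by (auto simp: pat_def indicator_def fun_eq_iff)
  ultimately show ?thesis by simp
qed

lemma pat_sets: "pat t u \<in> sets borel"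
proof -
  have "{z \<in> space borel. (z \<in> X \<longleftrightarrow> z + of_real (2 * t) * u \<in> X) \<and> (z \<in> X \<longleftrightarrow> z + of_real t * u \<notin> X)} \<in> sets borel"
    by measurable
  then show ?thesis by (simp add: pat_def)
qed

text \<open>After translating one copy of the exit set by \<open>t * u\<close> this is a pointwise
  identity in the membership of \<open>z\<close>, \<open>z + t * u\<close> and
  \<open>z + 2 * t * u\<close>: an exit at either of the two steps is an exit over the double step,
  except for the alternating patterns, which count once on both sides.\<close>

lemma exit_double:
  "emeasure lborel (exitset t u) + emeasure lborel (exitset t u) = emeasure lborel (exitset (2 * t) u) + emeasure lborel (pat t u)"
proof -
  have [measurable]: "pat t u \<in> sets borel" by (rule pat_sets)
  have "emeasure lborel (exitset t u) = (\<integral>\<^sup>+z. indicator (exitset t u) (of_real t * u + z) \<partial>lborel)"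
    by (subst nn_integral_lborel_translate) auto
  then have "emeasure lborel (exitset t u) + emeasure lborel (exitset t u) =
      (\<integral>\<^sup>+z. indicator (exitset t u) z + indicator (exitset t u) (of_real t * u + z) \<partial>lborel)"
    by (subst nn_integral_add) auto
  also have "\<dots> = (\<integral>\<^sup>+z. indicator (exitset (2 * t) u) z + indicator (pat t u) z \<partial>lborel)"
  proof (rule nn_integral_cong)
    fix z
    have eq: "z + of_real t * u + of_real t * u = z + of_real (2 * t) * u" "of_real t * u + z = z + of_real t * u"
      by (simp_all add: algebra_simps)
    define p0 p1 p2 where "p0 \<longleftrightarrow> z \<in> X" and "p1 \<longleftrightarrow> z + of_real t * u \<in> X" and "p2 \<longleftrightarrow> z + of_real (2 * t) * u \<in> X"
    have "z \<in> exitset t u \<longleftrightarrow> p0 \<and> \<not> p1" "of_real t * u + z \<in> exitset t u \<longleftrightarrow> p1 \<and> \<not> p2"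
      "z \<in> exitset (2 * t) u \<longleftrightarrow> p0 \<and> \<not> p2" "z \<in> pat t u \<longleftrightarrow> (p0 \<longleftrightarrow> p2) \<and> (p0 \<longleftrightarrow> \<not> p1)"
      unfolding exitset_def pat_def mem_Collect_eq eq p0_def p1_def p2_def by (rule refl)+
    then show "(indicator (exitset t u) z + indicator (exitset t u) (of_real t * u + z) :: ennreal) =
        indicator (exitset (2 * t) u) z + indicator (pat t u) z"
      unfolding indicator_def by (cases p0; cases p1; cases p2; simp)
  qed
  also have "\<dots> = emeasure lborel (exitset (2 * t) u) + emeasure lborel (pat t u)"
    by (subst nn_integral_add) auto
  finally show ?thesis .
qed

definition B :: "complex \<Rightarrow> real \<Rightarrow> ennreal" where
  "B e t = (\<integral>\<^sup>+v. emeasure lborel (pat t (cis v * e)) * indicator {0..2*pi} v \<partial>lborel)"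

lemma G_double: "G e t + G e t = G e (2 * t) + B e t"
proof -
  have [measurable]: "(\<lambda>v. emeasure lborel (exitset t (cis v * e))) \<in> borel_measurable borel" for t
    by (rule exit_pair_measurable)
  have [measurable]: "(\<lambda>v. emeasure lborel (pat t (cis v * e))) \<in> borel_measurable borel"
  proof -
    have "(\<lambda>(v, z). indicator (pat t (cis v * e)) z :: ennreal) \<in> borel_measurable (lborel \<Otimes>\<^sub>M lborel)"
      using pat_measurable[of t e] by (subst measurable_pair_swap_iff) simp
    from lborel.borel_measurable_nn_integral_fst[OF this] show ?thesis using pat_sets by simp
  qed
  have "G e t + G e t = (\<integral>\<^sup>+v. (emeasure lborel (exitset t (cis v * e)) + emeasure lborel (exitset t (cis v * e))) * indicator {0..2*pi} v \<partial>lborel)"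
    unfolding G_def by (subst nn_integral_add[symmetric]) (auto simp: distrib_right)
  also have "\<dots> = G e (2 * t) + B e t"
    unfolding exit_double G_def B_def by (subst nn_integral_add[symmetric]) (auto simp: distrib_right)
  finally show ?thesis .
qed

text \<open>Heights are measured along the normal at a frontier point \<open>q\<close> near
  \<open>z\<close>. By the tangent balls, points of \<open>X\<close> near \<open>q\<close> have
  height at most \<open>k\<close> and other points at least \<open>- k\<close>, with
  \<open>k\<close> of order \<open>t\<^sup>2\<close>. Three equally spaced heights that alternate
  must then all be small, and so must their increment.\<close>

lemma pat_near:
  assumes z: "z \<in> pat t u" and u: "norm u = 1" and t: "0 < t" "12 * t \<le> r"
  obtains q n where "q \<in> frontier X" "tball r X q n" "norm (z - q) \<le> 2 * t" "\<bar>n \<bullet> u\<bar> \<le> 16 * t / r"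
    "\<exists>q'\<in>frontier X. norm (z - q') \<le> 80 * t\<^sup>2 / r"
proof -
  define z1 z2 where "z1 = z + of_real t * u" and "z2 = z + of_real (2 * t) * u"
  have nt: "norm (of_real t * u) = t" "norm (of_real (2 * t) * u) = 2 * t" using u t by (auto simp: norm_mult)
  have pat: "z \<in> X \<longleftrightarrow> z2 \<in> X" "z \<in> X \<longleftrightarrow> z1 \<notin> X" using z by (auto simp: pat_def z1_def z2_def)
  obtain q where q: "q \<in> frontier X" "norm (z - q) \<le> 2 * t"
  proof (cases "z \<in> X")
    case True
    then have "z + of_real t * u \<notin> X" using pat by (simp add: z1_def)
    then obtain q where "q \<in> frontier X" "norm (q - z) \<le> t" using cross_frontier[OF True] nt by metis
    then show thesis using that[of q] t by (simp add: norm_minus_commute)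
  next
    case False
    then have "z1 \<in> X" "z1 + - (of_real t * u) \<notin> X" using pat by (auto simp: z1_def)
    then obtain q where q: "q \<in> frontier X" "norm (q - z1) \<le> t" using cross_frontier nt by (metis norm_minus_cancel)
    have "norm (z - q) \<le> norm (z - z1) + norm (z1 - q)" by (rule norm_triangle_sub[of "z - q" "z - z1", THEN order_trans]) (simp add: add.commute)
    then show thesis using that[of q] q nt by (simp add: z1_def norm_minus_commute)
  qed
  obtain n where n: "tball r X q n" using tball q(1) by blast
  have n1: "norm n = 1" and nn: "n \<bullet> n = 1" using n by (auto simp: tball_def dot_square_norm)
  \<comment> \<open>All three points are within \<open>4 * t\<close> of \<open>q\<close>, and
    \<open>(4 * t)\<^sup>2 = 2 * r * k\<close> is the height at which a tangent ball stops being
    decisive.\<close>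
  define k where "k = 8 * t\<^sup>2 / r"
  have k: "r * k = 8 * t\<^sup>2" using r by (simp add: k_def)
  have near: "norm (z - q) \<le> 4 * t" "norm (z1 - q) \<le> 4 * t" "norm (z2 - q) \<le> 4 * t"
    using q(2) t norm_triangle_ineq[of "z - q" "of_real t * u"] norm_triangle_ineq[of "z - q" "of_real (2 * t) * u"] nt
    by (auto simp: z1_def z2_def algebra_simps)
  have sq: "(norm (x - q))\<^sup>2 \<le> 2 * r * k" if "norm (x - q) \<le> 4 * t" for x
    using power_mono[OF that, of 2] k by (simp add: power_mult_distrib)
  have inX: "n \<bullet> (x - q) \<le> k" if "x \<in> X" "norm (x - q) \<le> 4 * t" for x
  proof -
    have "2 * r * (n \<bullet> (x - q)) \<le> 2 * r * k"
      using n that(1) sq[OF that(2)] unfolding tball_def by (meson not_less order_trans)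
    then show ?thesis using r by simp
  qed
  have outX: "- k \<le> n \<bullet> (x - q)" if "x \<notin> X" "norm (x - q) \<le> 4 * t" for x
  proof -
    have "- (2 * r * (n \<bullet> (x - q))) \<le> 2 * r * k"
      using n that(1) sq[OF that(2)] unfolding tball_def by (meson not_less order_trans)
    moreover have "- k \<le> N" if "- (2 * r * N) \<le> 2 * r * k" for N
    proof -
      have "2 * r * (- N) \<le> 2 * r * k" using that by simp
      then have "- N \<le> k" by (rule mult_left_le_imp_le) (use r in simp)
      then show ?thesis by simp
    qed
    ultimately show ?thesis by blast
  qed
  define y where "y = n \<bullet> (z - q)"
  define c where "c = n \<bullet> u"
  have y1: "n \<bullet> (z1 - q) = y + t * c" "n \<bullet> (z2 - q) = y + 2 * t * c"
    by (simp_all add: y_def c_def z1_def z2_def inner_complex_def algebra_simps)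
  \<comment> \<open>The last two inequalities of either pattern bound the increment
    \<open>t * c\<close> on one side and the first two on the other; inserting this into the middle
    one bounds \<open>y\<close>.\<close>
  have yc: "\<bar>y\<bar> \<le> 3 * k" "\<bar>t * c\<bar> \<le> 2 * k"
  proof -
    have "(y \<le> k \<and> - k \<le> y + t * c \<and> y + 2 * t * c \<le> k) \<or> (- k \<le> y \<and> y + t * c \<le> k \<and> - k \<le> y + 2 * t * c)"
    proof (cases "z \<in> X")
      case True
      then show ?thesis using inX[of z] outX[of z1] inX[of z2] pat near y1 by (simp add: y_def)
    next
      case False
      then show ?thesis using outX[of z] inX[of z1] outX[of z2] pat near y1 by (simp add: y_def)
    qed
    then show "\<bar>y\<bar> \<le> 3 * k" "\<bar>t * c\<bar> \<le> 2 * k" by (auto simp: abs_le_iff)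
  qed
  have cb: "\<bar>n \<bullet> u\<bar> \<le> 16 * t / r"
  proof -
    have "\<bar>t * c\<bar> = t * \<bar>c\<bar>" using t by (simp add: abs_mult)
    moreover have "2 * k = t * (16 * t / r)" by (simp add: k_def power2_eq_square)
    ultimately have "t * \<bar>c\<bar> \<le> t * (16 * t / r)" using yc(2) by linarith
    then have "\<bar>c\<bar> \<le> 16 * t / r" by (rule mult_left_le_imp_le) (use t in simp)
    then show ?thesis by (simp only: c_def)
  qed
  \<comment> \<open>Shifted by \<open>h\<close> along the normal, \<open>z\<close> has height at
    least \<open>2 * k\<close> in absolute value, so the tangent ball contains it if the squared
    distance stays below \<open>2 * r * (2 * k) = 32 * t\<^sup>2\<close>. Of this,
    \<open>4 * t\<^sup>2\<close> is the distance of \<open>z\<close> itself and \<open>small\<close>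
    bounds the rest.\<close>
  define h where "h = 5 * k"
  have kp: "k > 0" using t r by (simp add: k_def)
  have hr: "h * r = 40 * t\<^sup>2" using k by (simp add: h_def mult.commute)
  have kr: "18 * k \<le> r"
  proof -
    have "(12 * t) * (12 * t) \<le> r * r" using t by (intro mult_mono) auto
    then have "r * (18 * k) \<le> r * r" using k by (simp add: power2_eq_square algebra_simps)
    then show ?thesis using r by simp
  qed
  have sqz: "(norm (z - q))\<^sup>2 \<le> 4 * t\<^sup>2"
    using power_mono[OF q(2), of 2] by (simp add: power_mult_distrib)
  have small: "h * (6 * k) + h\<^sup>2 < 28 * t\<^sup>2"
  proof -
    have "h * (6 * k) + h\<^sup>2 = 55 * k * k" by (simp add: h_def power2_eq_square)
    also have "\<dots> \<le> 55 * k * (r / 18)" using kr kp by (intro mult_left_mono) auto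
    also have "\<dots> = 55 * 8 / 18 * t\<^sup>2" using k by (simp add: mult.commute)
    also have "\<dots> < 28 * t\<^sup>2" using t by simp
    finally show ?thesis .
  qed
  have up: "z + h *\<^sub>R n \<notin> X"
  proof -
    have "(norm (z + h *\<^sub>R n - q))\<^sup>2 = (norm (z - q))\<^sup>2 + 2 * h * y + h\<^sup>2"
    proof -
      have "z + h *\<^sub>R n - q = (z - q) + h *\<^sub>R n" by simp
      then show ?thesis
        by (simp only: power2_norm_eq_inner) (simp add: inner_add_left inner_add_right inner_commute nn y_def power2_eq_square)
    qed
    also have "\<dots> < 2 * r * (y + h)"
    proof -
      have "2 * h * y \<le> 2 * h * (3 * k)" using yc(1) kp by (intro mult_left_mono) (auto simp: h_def)
      moreover have "2 * r * (- (3 * k)) \<le> 2 * r * y" using yc(1) r by (intro mult_left_mono) auto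
      ultimately show ?thesis using small sqz hr k by (simp add: algebra_simps)
    qed
    also have "y + h = n \<bullet> (z + h *\<^sub>R n - q)" by (simp add: y_def inner_add_right inner_diff_right nn)
    finally show ?thesis using n unfolding tball_def by blast
  qed
  have down: "z - h *\<^sub>R n \<in> X"
  proof -
    have "(norm (z - h *\<^sub>R n - q))\<^sup>2 = (norm (z - q))\<^sup>2 - 2 * h * y + h\<^sup>2"
    proof -
      have "z - h *\<^sub>R n - q = (z - q) - h *\<^sub>R n" by simp
      then show ?thesis
        by (simp only: power2_norm_eq_inner) (simp add: inner_diff_left inner_diff_right inner_commute nn y_def power2_eq_square)
    qed
    also have "\<dots> < - (2 * r * (y - h))"
    proof -
      have "2 * h * (- y) \<le> 2 * h * (3 * k)" using yc(1) kp by (intro mult_left_mono) (auto simp: h_def)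
      moreover have "2 * r * y \<le> 2 * r * (3 * k)" using yc(1) r by (intro mult_left_mono) auto
      ultimately show ?thesis using small sqz hr k by (simp add: algebra_simps)
    qed
    also have "y - h = n \<bullet> (z - h *\<^sub>R n - q)" by (simp add: y_def inner_diff_right nn)
    finally show ?thesis using n unfolding tball_def by blast
  qed
  have nh: "norm (h *\<^sub>R n) = h" using n1 kp by (simp add: h_def)
  have h2: "2 * h = 80 * t\<^sup>2 / r" by (simp add: h_def k_def)
  have "\<exists>q'\<in>frontier X. norm (z - q') \<le> 2 * h"
  proof (cases "z \<in> X")
    case True
    obtain q' where "q' \<in> frontier X" "norm (q' - z) \<le> h" using cross_frontier[OF True up] nh by metis
    then show ?thesis using kp by (intro bexI[of _ q']) (auto simp: norm_minus_commute h_def)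
  next
    case False
    then have "(z - h *\<^sub>R n) + h *\<^sub>R n \<notin> X" by simp
    then obtain q' where q': "q' \<in> frontier X" "norm (q' - (z - h *\<^sub>R n)) \<le> h" using cross_frontier[OF down] nh by metis
    have "norm (z - q') \<le> norm (h *\<^sub>R n) + norm (q' - (z - h *\<^sub>R n))"
      using norm_triangle_ineq4[of "h *\<^sub>R n" "q' - (z - h *\<^sub>R n)"] by simp
    then show ?thesis using q' nh by (intro bexI[of _ q']) auto
  qed
  then show thesis using that[OF q(1) n q(2) cb] unfolding h2 by blast
qed

text \<open>Fubini in the order points first: the relevant \<open>z\<close> fill a tube of area
  \<open>O(t\<^sup>2)\<close>, and for each of them the directions are nearly tangent. The normal
  from \<open>pat_near\<close> depends on the direction, so it is compared with one normal
  \<open>n0\<close> per point; this adds \<open>4 * t / r\<close> to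
  \<open>16 * t / r\<close>.\<close>

lemma B_bound:
  assumes e: "norm e = 1"
  shows "\<exists>K t0. K \<ge> 0 \<and> t0 > 0 \<and> (\<forall>t. 0 < t \<longrightarrow> t < t0 \<longrightarrow> B e t \<le> ennreal (K * t\<^sup>2 * \<omega> (20 * t / r)))"
proof -
  obtain K \<delta>0 where K: "K \<ge> 0" "\<delta>0 > 0" "\<And>\<delta>. 0 < \<delta> \<Longrightarrow> \<delta> < \<delta>0 \<Longrightarrow>
     \<exists>T\<in>sets borel. {z. \<exists>q\<in>frontier X. norm (z - q) \<le> \<delta>} \<subseteq> T \<and> emeasure lborel T \<le> ennreal (K * \<delta>)"
    using tube_bound by blast
  define t0 where "t0 = min (r / 12) (min 1 (\<delta>0 * r / 80))"
  have t0: "t0 > 0" using r K(2) by (simp add: t0_def)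
  have "B e t \<le> ennreal (K * 80 / r * t\<^sup>2 * \<omega> (20 * t / r))" if t: "0 < t" "t < t0" for t
  proof -
    have t1: "12 * t \<le> r" "t < 1" "80 * t < \<delta>0 * r" using t by (auto simp: t0_def)
    have "t * t \<le> t * 1" using t t1 by (intro mult_left_mono) auto
    then have "80 * t\<^sup>2 < \<delta>0 * r" using t1 by (simp add: power2_eq_square)
    then have \<delta>: "0 < 80 * t\<^sup>2 / r" "80 * t\<^sup>2 / r < \<delta>0" using t r by (auto simp: field_simps)
    obtain T where T: "T \<in> sets borel" "{z. \<exists>q\<in>frontier X. norm (z - q) \<le> 80 * t\<^sup>2 / r} \<subseteq> T"
      "emeasure lborel T \<le> ennreal (K * (80 * t\<^sup>2 / r))"
      using K(3)[OF \<delta>] by blast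
    have u: "norm (cis v * e) = 1" for v using e by (simp add: norm_mult)
    have inner: "(\<integral>\<^sup>+v. indicator (pat t (cis v * e)) z * indicator {0..2*pi} v \<partial>lborel) \<le> indicator T z * ennreal (\<omega> (20 * t / r))" for z
    proof (cases "\<exists>v. z \<in> pat t (cis v * e)")
      case False
      then show ?thesis by simp
    next
      case True
      then obtain v0 where v0: "z \<in> pat t (cis v0 * e)" by blast
      obtain q0 n0 where q0: "q0 \<in> frontier X" "tball r X q0 n0" "norm (z - q0) \<le> 2 * t"
        "\<exists>q'\<in>frontier X. norm (z - q') \<le> 80 * t\<^sup>2 / r"
        using pat_near[OF v0 u t(1) t1(1)] by metis
      have zT: "z \<in> T" using q0(4) T(2) by blast
      have "(\<integral>\<^sup>+v. indicator (pat t (cis v * e)) z * indicator {0..2*pi} v \<partial>lborel) \<le>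
          (\<integral>\<^sup>+v. indicator {v. \<bar>n0 \<bullet> (cis v * e)\<bar> \<le> 20 * t / r} v * indicator {0..2*pi} v \<partial>lborel)"
      proof (rule nn_integral_mono)
        fix v
        have "\<bar>n0 \<bullet> (cis v * e)\<bar> \<le> 20 * t / r" if zv: "z \<in> pat t (cis v * e)"
        proof -
          obtain q n where q: "q \<in> frontier X" "tball r X q n" "norm (z - q) \<le> 2 * t" "\<bar>n \<bullet> (cis v * e)\<bar> \<le> 16 * t / r"
            using pat_near[OF zv u t(1) t1(1)] by metis
          have "norm (n0 - n) \<le> norm (q0 - q) / r" by (rule tball_normal_lipschitz[OF q0(2) q(2) r])
          also have "norm (q0 - q) \<le> 4 * t"
            using norm_triangle_ineq4[of "z - q" "z - q0"] q(3) q0(3) by simp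
          finally have d: "norm (n0 - n) \<le> 4 * t / r" using r by (simp add: divide_right_mono)
          have "\<bar>(n0 - n) \<bullet> (cis v * e)\<bar> \<le> 4 * t / r"
            using Cauchy_Schwarz_ineq2[of "n0 - n" "cis v * e"] d u by simp
          then show ?thesis using q(4) by (simp add: inner_diff_left abs_le_iff)
        qed
        then show "indicator (pat t (cis v * e)) z * indicator {0..2*pi} v \<le>
            (indicator {v. \<bar>n0 \<bullet> (cis v * e)\<bar> \<le> 20 * t / r} v * indicator {0..2*pi} v :: ennreal)"
          by (auto simp: indicator_def)
      qed
      also have "\<dots> = ennreal (\<omega> (20 * t / r))"
        by (rule emeasure_inner_cis_small) (use q0(2) e in \<open>auto simp: tball_def\<close>)
      finally show ?thesis using zT by simp
    qed
    have [measurable]: "(\<lambda>(z, v). indicator (pat t (cis v * e)) z :: ennreal) \<in> borel_measurable (lborel \<Otimes>\<^sub>M lborel)"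
      by (rule pat_measurable)
    have "B e t = (\<integral>\<^sup>+v. \<integral>\<^sup>+z. indicator (pat t (cis v * e)) z * indicator {0..2*pi} v \<partial>lborel \<partial>lborel)"
      unfolding B_def by (intro nn_integral_cong) (simp add: nn_integral_multc pat_sets)
    also have "\<dots> = (\<integral>\<^sup>+z. \<integral>\<^sup>+v. indicator (pat t (cis v * e)) z * indicator {0..2*pi} v \<partial>lborel \<partial>lborel)"
      by (rule lborel_pair.Fubini') measurable
    also have "\<dots> \<le> (\<integral>\<^sup>+z. indicator T z * ennreal (\<omega> (20 * t / r)) \<partial>lborel)"
      by (rule nn_integral_mono) (rule inner)
    also have "\<dots> = emeasure lborel T * ennreal (\<omega> (20 * t / r))"
      using T(1) by (simp add: nn_integral_multc)
    also have "\<dots> \<le> ennreal (K * (80 * t\<^sup>2 / r)) * ennreal (\<omega> (20 * t / r))"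
      by (rule mult_right_mono[OF T(3)]) simp
    also have "\<dots> = ennreal (K * 80 / r * t\<^sup>2 * \<omega> (20 * t / r))"
      using K(1) r \<omega>_nonneg by (simp add: ennreal_mult'[symmetric])
    finally show ?thesis .
  qed
  then show ?thesis using t0 K(1) r by (intro exI[of _ "K * 80 / r"] exI[of _ t0]) auto
qed

theorem G_second_order:
  assumes e: "norm e = 1"
  shows "((\<lambda>t. (enn2real (G e t) / t - 2 * L) / t) \<longlongrightarrow> 0) (at_right 0)"
proof -
  obtain K t0 where K: "K \<ge> 0" "t0 > 0" "\<And>t. 0 < t \<Longrightarrow> t < t0 \<Longrightarrow> B e t \<le> ennreal (K * t\<^sup>2 * \<omega> (20 * t / r))"
    using B_bound[OF e] by blast
  obtain t1 where t1: "t1 > 0" "\<And>t. 0 < t \<Longrightarrow> t < t1 \<Longrightarrow> G e t \<noteq> \<top>"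
    using G_finite_near_0[OF e] by (auto simp: eventually_at_right_field)
  \<comment> \<open>The increment of \<open>G e t / t\<close> under halving is
    \<open>B e (s / 2) / s\<close>; this \<Omega> is the bound of \<open>B_bound\<close> at
    \<open>s / 2\<close>, divided by \<open>s\<^sup>2\<close>.\<close>
  define \<Omega> where "\<Omega> s = K / 4 * \<omega> (10 * s / r)" for s
  show ?thesis
  proof (rule telescoping[OF G_limit[OF e], where \<Omega> = \<Omega> and b = "min t0 t1"])
    show "min t0 t1 > 0" using K t1 by simp
    show "\<Omega> s \<le> \<Omega> s'" if "s \<le> s'" for s s'
      unfolding \<Omega>_def using K(1) r that by (intro mult_left_mono \<omega>_mono divide_right_mono) auto
    show "0 \<le> \<Omega> s" for s unfolding \<Omega>_def using K(1) \<omega>_nonneg by simp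
    have "filterlim (\<lambda>s. 10 * s / r) (at_right 0) (at_right 0)"
    proof (rule filterlim_at_withinI)
      have "((\<lambda>s. 10 * s / r) \<longlongrightarrow> 10 * 0 / r) (at_right 0)" using r by (intro tendsto_intros) auto
      then show "((\<lambda>s. 10 * s / r) \<longlongrightarrow> 0) (at_right 0)" by simp
      show "\<forall>\<^sub>F s in at_right 0. 10 * s / r \<in> {0<..} - {0}"
        using r by (auto simp: eventually_at_right_field intro!: exI[of _ 1])
    qed
    then have "((\<lambda>s. \<omega> (10 * s / r)) \<longlongrightarrow> 0) (at_right 0)" by (rule filterlim_compose[OF \<omega>_tendsto])
    then have "((\<lambda>s. K / 4 * \<omega> (10 * s / r)) \<longlongrightarrow> K / 4 * 0) (at_right 0)" by (intro tendsto_mult tendsto_const)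
    then show "(\<Omega> \<longlongrightarrow> 0) (at_right 0)" by (simp add: \<Omega>_def[abs_def])
    fix s assume s: "0 < s" "s < min t0 t1"
    have eq: "G e (s / 2) + G e (s / 2) = G e s + B e (s / 2)" using G_double[of e "s / 2"] by simp
    have Bs: "B e (s / 2) \<le> ennreal (K * (s / 2)\<^sup>2 * \<omega> (10 * s / r))" using K(3)[of "s / 2"] s by simp
    have fin: "G e (s / 2) < \<top>" "G e s < \<top>" using t1(2)[of s] t1(2)[of "s / 2"] s by (auto simp: less_top)
    have finB: "B e (s / 2) < \<top>" using Bs by (metis ennreal_less_top le_less_trans)
    have "2 * enn2real (G e (s / 2)) = enn2real (G e s) + enn2real (B e (s / 2))"
      using arg_cong[OF eq, of enn2real] fin finB by (simp add: enn2real_plus)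
    moreover have b: "0 \<le> enn2real (B e (s / 2))" "enn2real (B e (s / 2)) \<le> s * (s * \<Omega> s)"
    proof -
      have "enn2real (B e (s / 2)) \<le> K * (s / 2)\<^sup>2 * \<omega> (10 * s / r)"
        using Bs K(1) \<omega>_nonneg by (intro enn2real_leI) auto
      then show "enn2real (B e (s / 2)) \<le> s * (s * \<Omega> s)" by (simp add: \<Omega>_def power2_eq_square mult_ac)
    qed simp
    ultimately have "enn2real (G e (s / 2)) / (s / 2) - enn2real (G e s) / s = enn2real (B e (s / 2)) / s"
      using s by (simp add: field_simps)
    then have "\<bar>enn2real (G e (s / 2)) / (s / 2) - enn2real (G e s) / s\<bar> = enn2real (B e (s / 2)) / s"
      using s b(1) by simp
    also have "\<dots> \<le> s * \<Omega> s" using b(2) s by (simp add: pos_divide_le_eq mult.commute)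
    finally show "\<bar>enn2real (G e (s / 2)) / (s / 2) - enn2real (G e s) / s\<bar> \<le> s * \<Omega> s" .
  qed
qed

end

section \<open>Configuration counts\<close>

definition cnt :: "(int \<times> int) set \<Rightarrow> (int \<times> int) set \<Rightarrow> nat" where
  "cnt S D = card {x. \<forall>\<delta>\<in>D. x + \<delta> \<in> S}"

lemma cnt_shift: "cnt S ((+) \<delta> ` D) = cnt S D"
proof -
  have "bij_betw (\<lambda>x. x + \<delta>) {x. \<forall>\<epsilon>\<in>(+) \<delta> ` D. x + \<epsilon> \<in> S} {x. \<forall>\<epsilon>\<in>D. x + \<epsilon> \<in> S}"
    by (rule bij_betw_byWitness[where f' = "\<lambda>x. x - \<delta>"])
      (simp_all add: image_subset_iff add.assoc[symmetric])
  then show ?thesis unfolding cnt_def by (rule bij_betw_same_card)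
qed

lemma card_edges: "finite S \<Longrightarrow> card (edges S) = cnt S {(0, 0), (1, 0)} + cnt S {(0, 0), (0, 1)} + cnt S {(1, 0), (0, 1)}"
  and card_triangles: "finite S \<Longrightarrow> card (triangles S) = cnt S {(0, 0), (1, 0), (0, 1)} + cnt S {(1, 0), (0, 1), (1, 1)}"
proof -
  assume S: "finite S"
  define E where "E k = {x. (k, x) \<in> edges S}" for k
  define T where "T k = {x. (k, x) \<in> triangles S}" for k
  have fE: "finite (E k)" for k
    using finite_imageI[OF finite_faces(1)[OF S], of snd] by (rule rev_finite_subset) (force simp: E_def)
  have fT: "finite (T k)" for k
    using finite_imageI[OF finite_faces(2)[OF S], of snd] by (rule rev_finite_subset) (force simp: T_def)
  have "edges S = {0} \<times> E 0 \<union> {1} \<times> E 1 \<union> {2} \<times> E 2"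
    by (auto simp: E_def edges_def less_3_cases)
  then have "card (edges S) = card (E 0) + card (E 1) + card (E 2)"
    using fE by (simp add: card_Un_disjoint card_cartesian_product_singleton Int_Un_distrib2 disjoint_iff)
  moreover have "E 0 = {x. \<forall>\<delta>\<in>{(0, 0), (1, 0)}. x + \<delta> \<in> S}" "E 1 = {x. \<forall>\<delta>\<in>{(0, 0), (0, 1)}. x + \<delta> \<in> S}"
    "E 2 = {x. \<forall>\<delta>\<in>{(1, 0), (0, 1)}. x + \<delta> \<in> S}"
    by (auto simp: E_def edges_def)
  ultimately show "card (edges S) = cnt S {(0, 0), (1, 0)} + cnt S {(0, 0), (0, 1)} + cnt S {(1, 0), (0, 1)}"
    by (simp only: cnt_def)
  have "triangles S = {0} \<times> T 0 \<union> {1} \<times> T 1"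
    by (auto simp: T_def triangles_def less_2_cases)
  then have "card (triangles S) = card (T 0) + card (T 1)"
    using fT by (simp add: card_Un_disjoint card_cartesian_product_singleton disjoint_iff)
  moreover have "T 0 = {x. \<forall>\<delta>\<in>{(0, 0), (1, 0), (0, 1)}. x + \<delta> \<in> S}" "T 1 = {x. \<forall>\<delta>\<in>{(1, 0), (0, 1), (1, 1)}. x + \<delta> \<in> S}"
    by (auto simp: T_def triangles_def)
  ultimately show "card (triangles S) = cnt S {(0, 0), (1, 0), (0, 1)} + cnt S {(1, 0), (0, 1), (1, 1)}"
    by (simp only: cnt_def)
qed

definition cells :: "(int \<times> int) set \<Rightarrow> (bool \<Rightarrow> bool \<Rightarrow> bool \<Rightarrow> bool \<Rightarrow> bool) \<Rightarrow> nat" where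
  "cells S P = card {x. P (x \<in> S) (x + (1, 0) \<in> S) (x + (0, 1) \<in> S) (x + (1, 1) \<in> S)}"

definition pt2 :: "bool \<Rightarrow> bool \<Rightarrow> bool \<Rightarrow> bool \<Rightarrow> bool" where
  "pt2 a b c d \<longleftrightarrow> (a \<and> \<not> b \<and> \<not> c \<and> \<not> d) \<or> (\<not> a \<and> b \<and> \<not> c \<and> \<not> d) \<or> (\<not> a \<and> \<not> b \<and> c \<and> \<not> d) \<or> (\<not> a \<and> \<not> b \<and> \<not> c \<and> d)"

definition pt3 :: "bool \<Rightarrow> bool \<Rightarrow> bool \<Rightarrow> bool \<Rightarrow> bool" where
  "pt3 a b c d \<longleftrightarrow> (a \<and> b \<and> \<not> c \<and> \<not> d) \<or> (a \<and> \<not> b \<and> c \<and> \<not> d) \<or> (\<not> a \<and> b \<and> \<not> c \<and> d) \<or> (\<not> a \<and> \<not> b \<and> c \<and> d)"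

definition pt4 :: "bool \<Rightarrow> bool \<Rightarrow> bool \<Rightarrow> bool \<Rightarrow> bool" where
  "pt4 a b c d \<longleftrightarrow> (a \<and> \<not> b \<and> \<not> c \<and> d) \<or> (\<not> a \<and> b \<and> c \<and> \<not> d)"

definition pt5 :: "bool \<Rightarrow> bool \<Rightarrow> bool \<Rightarrow> bool \<Rightarrow> bool" where
  "pt5 a b c d \<longleftrightarrow> pt2 (\<not> a) (\<not> b) (\<not> c) (\<not> d)"

text \<open>Each configuration indicator is a polynomial in the four corner indicators. Summed over
  all cells, a monomial depends only on its corner pattern up to translation; parallel sides of a
  cell give the same count, hence the doubled \<open>eh\<close> and \<open>ew\<close>.\<close>

lemma cell_counts:
  fixes S :: "(int \<times> int) set"
  assumes S: "finite S"
  defines "C \<equiv> \<lambda>D. int (cnt S D)"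
  defines "V \<equiv> C {(0, 0)}" and "eh \<equiv> C {(0, 0), (1, 0)}" and "ew \<equiv> C {(0, 0), (0, 1)}"
    and "d1 \<equiv> C {(0, 0), (1, 1)}" and "d2 \<equiv> C {(1, 0), (0, 1)}"
    and "t \<equiv> C {(0, 0), (1, 0), (0, 1)} + C {(0, 0), (1, 0), (1, 1)} + C {(0, 0), (0, 1), (1, 1)} + C {(1, 0), (0, 1), (1, 1)}"
    and "Q \<equiv> C {(0, 0), (1, 0), (0, 1), (1, 1)}"
  shows "int (cells S pt2) = 4 * V - 2 * (2 * eh + 2 * ew + d1 + d2) + 3 * t - 4 * Q"
    "int (cells S pt3) = 2 * eh + 2 * ew - 2 * t + 4 * Q"
    "int (cells S pt4) = d1 + d2 - t + 2 * Q"
    "int (cells S pt5) = t - 4 * Q"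
proof -
  \<comment> \<open>All cells with at least one corner in \<open>S\<close>: a common finite range
    for the sums, containing every cell that contributes.\<close>
  define B where "B = (\<Union>\<delta>\<in>{(0, 0), (1, 0), (0, 1), (1, 1)}. (\<lambda>x. x - \<delta>) ` S)"
  have fB: "finite B" using S by (simp add: B_def)
  have B: "x \<in> B" if "x + \<delta> \<in> S" "\<delta> \<in> {(0, 0), (1, 0), (0, 1), (1, 1)}" for x \<delta>
  proof -
    have "x = (x + \<delta>) - \<delta>" by simp
    then show ?thesis using that unfolding B_def by blast
  qed
  define p0 p1 p2 p3 where "p0 x \<longleftrightarrow> x + (0, 0) \<in> S" and "p1 x \<longleftrightarrow> x + (1, 0) \<in> S" and "p2 x \<longleftrightarrow> x + (0, 1) \<in> S"
    and "p3 x \<longleftrightarrow> x + (1, 1) \<in> S" for x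
  have sum: "int (card {x. R x}) = (\<Sum>x\<in>B. of_bool (R x))" if "\<And>x. R x \<Longrightarrow> x \<in> B" for R
  proof -
    have "{x. R x} = {x\<in>B. R x}" using that by auto
    then show ?thesis using fB by (simp add: Int_def)
  qed
  have C: "C D = (\<Sum>x\<in>B. of_bool (\<forall>\<delta>\<in>D. x + \<delta> \<in> S))" if "D \<noteq> {}" "D \<subseteq> {(0, 0), (1, 0), (0, 1), (1, 1)}" for D
    unfolding C_def cnt_def by (rule sum) (use that B in blast)
  have cells: "int (cells S P) = (\<Sum>x\<in>B. of_bool (P (p0 x) (p1 x) (p2 x) (p3 x)))" if "\<not> P False False False False" for P
  proof -
    have p0: "p0 x \<longleftrightarrow> x \<in> S" for x by (simp add: p0_def flip: zero_prod_def)
    show ?thesis unfolding cells_def p1_def[symmetric] p2_def[symmetric] p3_def[symmetric]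
      unfolding p0[symmetric]
    proof (rule sum)
      fix x assume "P (p0 x) (p1 x) (p2 x) (p3 x)"
      then have "p0 x \<or> p1 x \<or> p2 x \<or> p3 x" using that by (cases "p0 x"; cases "p1 x"; cases "p2 x"; cases "p3 x"; simp)
      then show "x \<in> B" unfolding p0_def p1_def p2_def p3_def using B by blast
    qed
  qed
  have sh: "C D' = C D" if "D' = (+) \<delta> ` D" for D D' \<delta> unfolding that C_def cnt_shift ..
  have s1: "C {(1, 0)} = V" "C {(0, 1)} = V" "C {(1, 1)} = V" "C {(0, 1), (1, 1)} = eh" "C {(1, 0), (1, 1)} = ew"
    unfolding V_def eh_def ew_def
    by (rule sh[of _ "(1, 0)"], simp) (rule sh[of _ "(0, 1)"], simp, rule sh[of _ "(1, 1)"], simp,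
      rule sh[of _ "(0, 1)"], simp, rule sh[of _ "(1, 0)"], simp)
  let ?b = "\<lambda>P x. of_bool (P x) :: int"
  have c: "C {(0, 0)} = (\<Sum>x\<in>B. ?b p0 x)" "C {(1, 0)} = (\<Sum>x\<in>B. ?b p1 x)" "C {(0, 1)} = (\<Sum>x\<in>B. ?b p2 x)" "C {(1, 1)} = (\<Sum>x\<in>B. ?b p3 x)"
    "C {(0, 0), (1, 0)} = (\<Sum>x\<in>B. ?b p0 x * ?b p1 x)" "C {(0, 0), (0, 1)} = (\<Sum>x\<in>B. ?b p0 x * ?b p2 x)"
    "C {(0, 0), (1, 1)} = (\<Sum>x\<in>B. ?b p0 x * ?b p3 x)" "C {(1, 0), (0, 1)} = (\<Sum>x\<in>B. ?b p1 x * ?b p2 x)"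
    "C {(1, 0), (1, 1)} = (\<Sum>x\<in>B. ?b p1 x * ?b p3 x)" "C {(0, 1), (1, 1)} = (\<Sum>x\<in>B. ?b p2 x * ?b p3 x)"
    "C {(0, 0), (1, 0), (0, 1)} = (\<Sum>x\<in>B. ?b p0 x * ?b p1 x * ?b p2 x)" "C {(0, 0), (1, 0), (1, 1)} = (\<Sum>x\<in>B. ?b p0 x * ?b p1 x * ?b p3 x)"
    "C {(0, 0), (0, 1), (1, 1)} = (\<Sum>x\<in>B. ?b p0 x * ?b p2 x * ?b p3 x)" "C {(1, 0), (0, 1), (1, 1)} = (\<Sum>x\<in>B. ?b p1 x * ?b p2 x * ?b p3 x)"
    "Q = (\<Sum>x\<in>B. ?b p0 x * ?b p1 x * ?b p2 x * ?b p3 x)"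
    unfolding Q_def p0_def p1_def p2_def p3_def of_bool_conj[symmetric]
    by (subst C; simp add: conj_assoc)+
  note distr = sum.distrib sum_subtractf sum_distrib_left[symmetric]
  have "int (cells S pt2) = (\<Sum>x\<in>B. (?b p0 x + ?b p1 x + ?b p2 x + ?b p3 x)
      - 2 * (?b p0 x * ?b p1 x + ?b p0 x * ?b p2 x + ?b p1 x * ?b p3 x + ?b p2 x * ?b p3 x + ?b p0 x * ?b p3 x + ?b p1 x * ?b p2 x)
      + 3 * (?b p0 x * ?b p1 x * ?b p2 x + ?b p0 x * ?b p1 x * ?b p3 x + ?b p0 x * ?b p2 x * ?b p3 x + ?b p1 x * ?b p2 x * ?b p3 x)
      - 4 * (?b p0 x * ?b p1 x * ?b p2 x * ?b p3 x))"
    unfolding cells[of pt2, unfolded pt2_def, simplified]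
    by (subst cells) (simp add: pt2_def, rule sum.cong[OF refl], simp add: pt2_def of_bool_def)
  then show "int (cells S pt2) = 4 * V - 2 * (2 * eh + 2 * ew + d1 + d2) + 3 * t - 4 * Q"
    unfolding distr c[symmetric] s1 by (simp add: V_def eh_def ew_def d1_def d2_def t_def)
  have "int (cells S pt3) = (\<Sum>x\<in>B. (?b p0 x * ?b p1 x + ?b p0 x * ?b p2 x + ?b p1 x * ?b p3 x + ?b p2 x * ?b p3 x)
      - 2 * (?b p0 x * ?b p1 x * ?b p2 x + ?b p0 x * ?b p1 x * ?b p3 x + ?b p0 x * ?b p2 x * ?b p3 x + ?b p1 x * ?b p2 x * ?b p3 x)
      + 4 * (?b p0 x * ?b p1 x * ?b p2 x * ?b p3 x))"
    by (subst cells) (simp add: pt3_def, rule sum.cong[OF refl], simp add: pt3_def of_bool_def)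
  then show "int (cells S pt3) = 2 * eh + 2 * ew - 2 * t + 4 * Q"
    unfolding distr c[symmetric] s1 by (simp add: V_def eh_def ew_def d1_def d2_def t_def)
  have "int (cells S pt4) = (\<Sum>x\<in>B. (?b p0 x * ?b p3 x + ?b p1 x * ?b p2 x)
      - (?b p0 x * ?b p1 x * ?b p2 x + ?b p0 x * ?b p1 x * ?b p3 x + ?b p0 x * ?b p2 x * ?b p3 x + ?b p1 x * ?b p2 x * ?b p3 x)
      + 2 * (?b p0 x * ?b p1 x * ?b p2 x * ?b p3 x))"
    by (subst cells) (simp add: pt4_def, rule sum.cong[OF refl], simp add: pt4_def of_bool_def)
  then show "int (cells S pt4) = d1 + d2 - t + 2 * Q"
    unfolding distr c[symmetric] s1 by (simp add: V_def eh_def ew_def d1_def d2_def t_def)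
  have "int (cells S pt5) = (\<Sum>x\<in>B. (?b p0 x * ?b p1 x * ?b p2 x + ?b p0 x * ?b p1 x * ?b p3 x + ?b p0 x * ?b p2 x * ?b p3 x + ?b p1 x * ?b p2 x * ?b p3 x)
      - 4 * (?b p0 x * ?b p1 x * ?b p2 x * ?b p3 x))"
    by (subst cells) (simp add: pt5_def pt2_def, rule sum.cong[OF refl], simp add: pt5_def pt2_def of_bool_def)
  then show "int (cells S pt5) = t - 4 * Q"
    unfolding distr c[symmetric] s1 by (simp add: V_def eh_def ew_def d1_def d2_def t_def)
qed

context smooth_domain
begin

text \<open>The factor is \<open>1600 = 16 * 100\<close>: \<open>cone_cond\<close> holds at scale
  \<open>r / 16\<close>, and \<open>digit\<close> asks for 100 lattice distances. Digitising
  \<open>X\<close> and its complement on the same lattice turns components and holes into the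
  classes counted by \<open>discrete_euler\<close>.\<close>

lemma euler_digit:
  fixes a :: real and u c :: complex
  assumes "0 < a" "norm u = 1" "1600 * a \<le> r"
  defines "S \<equiv> {x. grid.lat a u c x \<in> X}"
  shows "finite S" "int (card S) - int (card (edges S)) + int (card (triangles S)) = \<lfloor>V0 X\<rfloor>" "V0 X \<in> \<int>"
proof -
  interpret D: digit a u c hexadj X "r / 16"
    by unfold_locales (use assms cone_cond sym_hexadj in \<open>auto simp: hexadj_def\<close>)
  interpret D': digit a u c hexadj "- X" "r / 16"
    by unfold_locales (use assms cone_cond in auto)
  have S: "S = D.T" "- S = D'.T" by (auto simp: S_def D.T_def D'.T_def)
  show fin: "finite S" unfolding S_def by (rule D.finite_lat_bounded[OF bounded])
  have "card (components X) = card (S // reach hexadj S)"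
    unfolding S by (rule bij_betw_same_card[OF D.bij_components])
  moreover have "card {C\<in>components (- X). bounded C} = card {\<kappa> \<in> (- S) // reach hexadj (- S). finite \<kappa>}"
  proof (rule bij_betw_same_card)
    have b: "bij_betw (\<lambda>K. {x. D.lat x \<in> K}) (components (- X)) ((- S) // reach hexadj (- S))"
      unfolding S(2) by (rule D'.bij_components)
    show "bij_betw (\<lambda>K. {x. D.lat x \<in> K}) {C\<in>components (- X). bounded C} {\<kappa> \<in> (- S) // reach hexadj (- S). finite \<kappa>}"
    proof (rule bij_betw_subset[OF b])
      show "(\<lambda>K. {x. D.lat x \<in> K}) ` {C\<in>components (- X). bounded C} = {\<kappa> \<in> (- S) // reach hexadj (- S). finite \<kappa>}"
      proof (intro equalityI subsetI)
        fix \<kappa> assume "\<kappa> \<in> (\<lambda>K. {x. D.lat x \<in> K}) ` {C\<in>components (- X). bounded C}"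
        then obtain K where "K \<in> components (- X)" "bounded K" "\<kappa> = {x. D.lat x \<in> K}" by blast
        then show "\<kappa> \<in> {\<kappa> \<in> (- S) // reach hexadj (- S). finite \<kappa>}"
          using b D'.bounded_iff_finite[of K] by (auto simp: bij_betw_def)
      next
        fix \<kappa> assume \<kappa>: "\<kappa> \<in> {\<kappa> \<in> (- S) // reach hexadj (- S). finite \<kappa>}"
        then have "\<kappa> \<in> (\<lambda>K. {x. D.lat x \<in> K}) ` components (- X)" using b by (simp add: bij_betw_def)
        then obtain K where K: "K \<in> components (- X)" "\<kappa> = {x. D.lat x \<in> K}" by blast
        then show "\<kappa> \<in> (\<lambda>K. {x. D.lat x \<in> K}) ` {C\<in>components (- X). bounded C}"
          using \<kappa> D'.bounded_iff_finite[of K] by blast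
      qed
    qed blast
  qed
  moreover define z where "z = int (card (S // reach hexadj S)) - int (card {\<kappa> \<in> (- S) // reach hexadj (- S). finite \<kappa>})"
  ultimately have V: "V0 X = of_int z" by (simp add: V0_def)
  then show "V0 X \<in> \<int>" by simp
  have "int (card S) - int (card (edges S)) + int (card (triangles S)) = z"
    unfolding z_def using discrete_euler[OF fin] by linarith
  then show "int (card S) - int (card (edges S)) + int (card (triangles S)) = \<lfloor>V0 X\<rfloor>"
    unfolding V by simp
qed

text \<open>The Euler characteristic for the triangulation with the other diagonals is obtained by
  rotating the lattice by a right angle.\<close>

lemma euler_counts:
  fixes a :: real and u c :: complex
  assumes "0 < a" "norm u = 1" "1600 * a \<le> r"
  defines "S \<equiv> {x. grid.lat a u c x \<in> X}"
  shows "real (cnt S {(0, 0)}) - real (cnt S {(0, 0), (1, 0)}) - real (cnt S {(0, 0), (0, 1)}) - real (cnt S {(1, 0), (0, 1)})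
      + real (cnt S {(0, 0), (1, 0), (0, 1)}) + real (cnt S {(1, 0), (0, 1), (1, 1)}) = V0 X"
    "real (cnt S {(0, 0)}) - real (cnt S {(0, 0), (1, 0)}) - real (cnt S {(0, 0), (0, 1)}) - real (cnt S {(0, 0), (1, 1)})
      + real (cnt S {(0, 0), (1, 0), (1, 1)}) + real (cnt S {(0, 0), (0, 1), (1, 1)}) = V0 X"
proof -
  have c0: "card S = cnt S {(0, 0)}" for S :: "(int \<times> int) set" by (simp add: cnt_def flip: zero_prod_def)
  have E: "real (cnt S {(0, 0)}) - real (cnt S {(0, 0), (1, 0)}) - real (cnt S {(0, 0), (0, 1)}) - real (cnt S {(1, 0), (0, 1)})
      + real (cnt S {(0, 0), (1, 0), (0, 1)}) + real (cnt S {(1, 0), (0, 1), (1, 1)}) = V0 X"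
    if "S = {x. grid.lat a u c x \<in> X}" "norm u = 1" for S u c
  proof -
    note eu = euler_digit(1)[OF assms(1) that(2) assms(3), of c, folded that(1)]
      euler_digit(2)[OF assms(1) that(2) assms(3), of c, folded that(1)] euler_digit(3)[OF assms(1) that(2) assms(3)]
    have "V0 X = real_of_int \<lfloor>V0 X\<rfloor>" using eu(3) by simp
    also have "\<dots> = real_of_int (int (card S) - int (card (edges S)) + int (card (triangles S)))" using eu(2) by simp
    finally show ?thesis using card_edges[OF eu(1)] card_triangles[OF eu(1)] c0[of S] by simp
  qed
  show "real (cnt S {(0, 0)}) - real (cnt S {(0, 0), (1, 0)}) - real (cnt S {(0, 0), (0, 1)}) - real (cnt S {(1, 0), (0, 1)})
      + real (cnt S {(0, 0), (1, 0), (0, 1)}) + real (cnt S {(1, 0), (0, 1), (1, 1)}) = V0 X"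
    by (rule E[of S u c]) (auto simp: S_def assms)
  define S' where "S' = {x. grid.lat a (\<i> * u) (- \<i> * c) x \<in> X}"
  interpret g: grid a u c by standard (use assms in auto)
  interpret g': grid a "\<i> * u" "- \<i> * c" by standard (use assms in \<open>auto simp: norm_mult\<close>)
  have lat: "g'.lat (m, n) = g.lat (- n, m)" for m n
    unfolding g.lat_def g'.lat_def by (simp add: algebra_simps)
  have S': "(m, n) \<in> S' \<longleftrightarrow> (- n, m) \<in> S" for m n
    by (simp only: S'_def S_def mem_Collect_eq lat)
  \<comment> \<open>A pattern in the turned lattice is the turned pattern in the old one; the
    translation \<delta> brings it back into the unit cell.\<close>
  have rot: "cnt S' D' = cnt S D" if eq: "(\<lambda>(m, n). (- n, m)) ` D' = (+) \<delta> ` D" for D D' \<delta>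
  proof -
    have "bij_betw (\<lambda>(m, n). (- n, m)) {x. \<forall>\<epsilon>\<in>D'. x + \<epsilon> \<in> S'} {x. \<forall>\<epsilon>\<in>(\<lambda>(m, n). (- n, m)) ` D'. x + \<epsilon> \<in> S}"
      by (rule bij_betw_byWitness[where f' = "\<lambda>(m, n). (n, - m)"]) (auto simp: S' split_beta)
    then have "cnt S' D' = cnt S ((\<lambda>(m, n). (- n, m)) ` D')" unfolding cnt_def by (rule bij_betw_same_card)
    then show ?thesis unfolding eq cnt_shift .
  qed
  have r: "cnt S' {(0, 0)} = cnt S {(0, 0)}" "cnt S' {(0, 0), (1, 0)} = cnt S {(0, 0), (0, 1)}"
    "cnt S' {(0, 0), (0, 1)} = cnt S {(0, 0), (1, 0)}" "cnt S' {(1, 0), (0, 1)} = cnt S {(0, 0), (1, 1)}"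
    "cnt S' {(0, 0), (1, 0), (0, 1)} = cnt S {(0, 0), (1, 0), (1, 1)}"
    "cnt S' {(1, 0), (0, 1), (1, 1)} = cnt S {(0, 0), (0, 1), (1, 1)}"
    by (rule rot[of _ "(0, 0)"], simp, rule rot[of _ "(0, 0)"], simp, rule rot[of _ "(-1, 0)"], simp, blast,
      rule rot[of _ "(-1, 0)"], simp, blast, rule rot[of _ "(-1, 0)"], simp, blast, rule rot[of _ "(-1, 0)"], simp, blast)
  have "norm (\<i> * u) = 1" using assms by (simp add: norm_mult)
  from E[OF S'_def this] show "real (cnt S {(0, 0)}) - real (cnt S {(0, 0), (1, 0)}) - real (cnt S {(0, 0), (0, 1)}) - real (cnt S {(0, 0), (1, 1)})
      + real (cnt S {(0, 0), (1, 0), (1, 1)}) + real (cnt S {(0, 0), (0, 1), (1, 1)}) = V0 X"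
    unfolding r by linarith
qed

text \<open>The height argument of \<open>pat_near\<close> in two directions: an alternating cell
  makes both lattice directions almost tangent to the boundary, with normal parts at most
  \<open>4 * k / a\<close>. They are orthogonal, so the squares of their normal parts sum to 1, a
  contradiction since \<open>k \<le> a / 200\<close>.\<close>

lemma no_diagonal:
  assumes a: "0 < a" "1600 * a \<le> r" and u: "norm u = 1"
    and io: "z \<in> X \<longleftrightarrow> z + of_real a * u * (1 + \<i>) \<in> X" "z + of_real a * u \<in> X \<longleftrightarrow> z + of_real a * u * \<i> \<in> X"
      "z \<in> X \<longleftrightarrow> z + of_real a * u \<notin> X"
  shows False
proof -
  define z1 z2 z3 where "z1 = z + of_real a * u" and "z2 = z + of_real a * u * \<i>" and "z3 = z + of_real a * u * (1 + \<i>)"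
  have nu: "norm (of_real a * u) = a" "norm (of_real a * u * \<i>) = a" using a u by (auto simp: norm_mult)
  obtain q where q: "q \<in> frontier X" "norm (z - q) \<le> 2 * a"
  proof (cases "z \<in> X")
    case True
    then obtain q where "q \<in> frontier X" "norm (q - z) \<le> a" using cross_frontier[OF True, of "of_real a * u"] io nu by metis
    then show thesis using that[of q] a by (simp add: norm_minus_commute)
  next
    case False
    then have "z1 \<in> X" "z1 + - (of_real a * u) \<notin> X" using io by (auto simp: z1_def)
    then obtain q where q: "q \<in> frontier X" "norm (q - z1) \<le> a" using cross_frontier nu by (metis norm_minus_cancel)
    have "norm (z - q) \<le> norm (z - z1) + norm (z1 - q)"
      using norm_triangle_ineq[of "z - z1" "z1 - q"] by simp
    then show thesis using that[of q] q nu by (simp add: z1_def norm_minus_commute)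
  qed
  obtain n where n: "tball r X q n" using tball q(1) by blast
  have n1: "norm n = 1" using n by (simp add: tball_def)
  define k where "k = 8 * a\<^sup>2 / r"
  have k: "r * k = 8 * a\<^sup>2" using r by (simp add: k_def)
  have nb: "norm (z + w - q) \<le> 4 * a" if "norm w \<le> 2 * a" for w
    using norm_triangle_ineq[of "z - q" w] q(2) that by (simp add: algebra_simps)
  have "norm (1 + \<i>) \<le> 2" using norm_triangle_ineq[of 1 \<i>] by simp
  then have "norm (of_real a * u * (1 + \<i>)) \<le> 2 * a" using a u by (simp add: norm_mult mult.commute)
  then have near: "norm (z - q) \<le> 4 * a" "norm (z1 - q) \<le> 4 * a" "norm (z2 - q) \<le> 4 * a" "norm (z3 - q) \<le> 4 * a"
    using nb[of 0] nb[of "of_real a * u"] nb[of "of_real a * u * \<i>"] nb[of "of_real a * u * (1 + \<i>)"] nu a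
    by (auto simp: z1_def z2_def z3_def)
  have sq: "(norm (x - q))\<^sup>2 \<le> 2 * r * k" if "norm (x - q) \<le> 4 * a" for x
    using power_mono[OF that, of 2] k by (simp add: power_mult_distrib)
  have inX: "n \<bullet> (x - q) \<le> k" if "x \<in> X" "norm (x - q) \<le> 4 * a" for x
  proof -
    have "2 * r * (n \<bullet> (x - q)) \<le> 2 * r * k"
      using n that(1) sq[OF that(2)] unfolding tball_def by (meson not_less order_trans)
    then show ?thesis using r by simp
  qed
  have outX: "- k \<le> n \<bullet> (x - q)" if "x \<notin> X" "norm (x - q) \<le> 4 * a" for x
  proof -
    have "- (2 * r * (n \<bullet> (x - q))) \<le> 2 * r * k"
      using n that(1) sq[OF that(2)] unfolding tball_def by (meson not_less order_trans)
    moreover have "- k \<le> N" if "- (2 * r * N) \<le> 2 * r * k" for N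
    proof -
      have "2 * r * (- N) \<le> 2 * r * k" using that by simp
      then have "- N \<le> k" by (rule mult_left_le_imp_le) (use r in simp)
      then show ?thesis by simp
    qed
    ultimately show ?thesis by blast
  qed
  define y where "y = n \<bullet> (z - q)"
  define p where "p = n \<bullet> u"
  define s where "s = n \<bullet> (\<i> * u)"
  have yy: "n \<bullet> (z1 - q) = y + a * p" "n \<bullet> (z2 - q) = y + a * s" "n \<bullet> (z3 - q) = y + a * p + a * s"
    by (simp_all add: y_def p_def s_def z1_def z2_def z3_def inner_complex_def algebra_simps)
  have "(y \<le> k \<and> - k \<le> y + a * p \<and> - k \<le> y + a * s \<and> y + a * p + a * s \<le> k) \<or>
      (- k \<le> y \<and> y + a * p \<le> k \<and> y + a * s \<le> k \<and> - k \<le> y + a * p + a * s)"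
  proof (cases "z \<in> X")
    case True
    then show ?thesis using inX[of z] outX[of z1] outX[of z2] inX[of z3] io near yy
      by (simp add: y_def z1_def z2_def z3_def)
  next
    case False
    then show ?thesis using outX[of z] inX[of z1] inX[of z2] outX[of z3] io near yy
      by (simp add: y_def z1_def z2_def z3_def)
  qed
  then have b: "\<bar>a * p\<bar> \<le> 4 * k" "\<bar>a * s\<bar> \<le> 4 * k" by (auto simp: abs_le_iff)
  have "p\<^sup>2 + s\<^sup>2 = ((Re n)\<^sup>2 + (Im n)\<^sup>2) * ((Re u)\<^sup>2 + (Im u)\<^sup>2)"
    unfolding p_def s_def by (simp add: inner_complex_def power2_eq_square algebra_simps)
  also have "\<dots> = 1" using n1 u by (metis cmod_power2 one_power2 mult_1)
  finally have ps: "p\<^sup>2 + s\<^sup>2 = 1" .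
  have "a\<^sup>2 = (a * p)\<^sup>2 + (a * s)\<^sup>2" using ps by (simp add: power_mult_distrib flip: distrib_left)
  also have "\<dots> \<le> (4 * k)\<^sup>2 + (4 * k)\<^sup>2"
    using power_mono[OF b(1), of 2] power_mono[OF b(2), of 2] by (intro add_mono) auto
  finally have "a\<^sup>2 \<le> 32 * k\<^sup>2" by (simp add: power_mult_distrib)
  moreover have "200 * k \<le> a"
  proof -
    have "a * (1600 * a) \<le> a * r" using a by (intro mult_left_mono) auto
    moreover have "r * (200 * k) = 200 * (r * k)" by simp
    moreover have "200 * (r * k) = a * (1600 * a)" unfolding k by (simp add: power2_eq_square)
    ultimately have "r * (200 * k) \<le> r * a" by (simp only: mult.commute[of a r])
    then show ?thesis using r by simp
  qed
  moreover have "k > 0" using a r by (simp add: k_def)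
  moreover have "(200 * k)\<^sup>2 \<le> a\<^sup>2" using calculation by (intro power_mono) auto
  moreover have "0 < k\<^sup>2" using \<open>k > 0\<close> by simp
  moreover have "(200 * k)\<^sup>2 = 40000 * k\<^sup>2" by (simp add: power_mult_distrib)
  ultimately show False by linarith
qed

end

section \<open>Expected configuration counts\<close>

text \<open>Subsets of \<open>C0\<close> as four bits, in the corner order of \<open>cells\<close>,
  so that membership in each \<open>eta j\<close> becomes a case distinction on truth
  values.\<close>

definition cfg :: "bool \<Rightarrow> bool \<Rightarrow> bool \<Rightarrow> bool \<Rightarrow> complex set" where
  "cfg a b c d = (if a then {0} else {}) \<union> (if b then {1} else {}) \<union> (if c then {\<i>} else {}) \<union> (if d then {1 + \<i>} else {})"

lemma corner_neq: "(1::complex) \<noteq> \<i>" "(1::complex) \<noteq> 1 + \<i>" "\<i> \<noteq> 1 + \<i>" "0 \<noteq> 1 + \<i>" "0 \<noteq> \<i>"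
  by (auto simp: complex_eq_iff)

lemma cfg_mem: "0 \<in> cfg a b c d \<longleftrightarrow> a" "1 \<in> cfg a b c d \<longleftrightarrow> b" "\<i> \<in> cfg a b c d \<longleftrightarrow> c" "1 + \<i> \<in> cfg a b c d \<longleftrightarrow> d"
  using corner_neq corner_neq[symmetric] by (auto simp: cfg_def)

lemma cfg_eq_iff: "cfg a b c d = cfg a' b' c' d' \<longleftrightarrow> a = a' \<and> b = b' \<and> c = c' \<and> d = d'"
proof
  assume e: "cfg a b c d = cfg a' b' c' d'"
  show "a = a' \<and> b = b' \<and> c = c' \<and> d = d'"
    using cfg_mem[of a b c d] cfg_mem[of a' b' c' d'] unfolding e by blast
qed simp

lemma card_cfg: "card (cfg a b c d) = of_bool a + of_bool b + of_bool c + of_bool d"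
  using corner_neq corner_neq[symmetric]
  by (cases a; cases b; cases c; cases d) (simp_all add: cfg_def)

lemma cfg_C0: "cfg a b c d \<subseteq> C0"
  by (auto simp: cfg_def C0_def split: if_splits)

lemma eta_cfg:
  "cfg a b c d \<in> eta 2 \<longleftrightarrow> pt2 a b c d" "cfg a b c d \<in> eta 3 \<longleftrightarrow> pt3 a b c d"
  "cfg a b c d \<in> eta 4 \<longleftrightarrow> pt4 a b c d" "cfg a b c d \<in> eta 5 \<longleftrightarrow> pt5 a b c d"
proof -
  have s: "{0} = cfg True False False False" "{1} = cfg False True False False" "{\<i>} = cfg False False True False" "{1 + \<i>} = cfg False False False True"
    by (auto simp: cfg_def)
  have s2: "{0, 1} = cfg True True False False" "{0, \<i>} = cfg True False True False" "{1, 1 + \<i>} = cfg False True False True"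
    "{\<i>, 1 + \<i>} = cfg False False True True" "{0, 1 + \<i>} = cfg True False False True" "{1, \<i>} = cfg False True True False"
    by (auto simp: cfg_def)
  have e2: "eta 2 = {{0}, {1}, {\<i>}, {1 + \<i>}}" by (auto simp: eta_def C0_def)
  show "cfg a b c d \<in> eta 2 \<longleftrightarrow> pt2 a b c d" unfolding e2 s insert_iff cfg_eq_iff empty_iff pt2_def
    by (cases a; cases b; cases c; cases d) simp_all
  have e3: "eta 3 = {{0, 1}, {0, \<i>}, {1, 1 + \<i>}, {\<i>, 1 + \<i>}}" by (simp add: eta_def)
  show "cfg a b c d \<in> eta 3 \<longleftrightarrow> pt3 a b c d" unfolding e3 s2 insert_iff cfg_eq_iff empty_iff pt3_def
    by (cases a; cases b; cases c; cases d) simp_all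
  have e4: "eta 4 = {{0, 1 + \<i>}, {1, \<i>}}" by (simp add: eta_def)
  show "cfg a b c d \<in> eta 4 \<longleftrightarrow> pt4 a b c d" unfolding e4 s2 insert_iff cfg_eq_iff empty_iff pt4_def
    by (cases a; cases b; cases c; cases d) simp_all
  have "cfg a b c d \<in> eta 5 \<longleftrightarrow> card (cfg a b c d) = 3" using cfg_C0 by (simp add: eta_def)
  then show "cfg a b c d \<in> eta 5 \<longleftrightarrow> pt5 a b c d"
    unfolding card_cfg pt5_def pt2_def by (cases a; cases b; cases c; cases d) simp_all
qed

lemma prob_space_lattice: "prob_space lattice_measure"
proof -
  have "emeasure lborel (cbox 0 (1 + \<i>)) = 1"
    by (subst emeasure_lborel_cbox) (auto simp: Basis_complex_def)
  then interpret U: prob_space "uniform_measure lborel (cbox 0 (1 + \<i>)) :: complex measure"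
    by (intro prob_space_uniform_measure) auto
  interpret V: prob_space "uniform_measure lborel {0..2*pi} :: real measure"
    by (rule prob_space_uniform_measure) auto
  interpret UV: pair_prob_space "uniform_measure lborel (cbox 0 (1 + \<i>)) :: complex measure" "uniform_measure lborel {0..2*pi} :: real measure" ..
  show ?thesis unfolding lattice_measure_def by (rule UV.prob_space_axioms)
qed

text \<open>Elimination of triples \<open>A\<close>, \<open>B\<close>, \<open>C\<close>,
  \<open>D\<close> and quadruples \<open>q\<close>: the vanishing of \<open>n4\<close> expresses the
  sum of the triples by \<open>d\<close>, \<open>d'\<close> and \<open>q\<close>, and the sum of the
  two Euler relations then determines \<open>q\<close>.\<close>

lemma counts_arith:
  fixes V e f d d' A B C D q n2 n3 n4 n5 h :: real
  assumes "n2 = 4 * V - 2 * (2 * e + 2 * f + d + d') + 3 * (A + B + C + D) - 4 * q"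
    "n3 = 2 * e + 2 * f - 2 * (A + B + C + D) + 4 * q"
    "n4 = d + d' - (A + B + C + D) + 2 * q"
    "n5 = A + B + C + D - 4 * q"
    "n4 = 0" "V - e - f - d' + A + D = h" "V - e - f - d + B + C = h"
  shows "n2 = 2 * V - 2 * (e + f) + (d + d') + 2 * h" "n3 = 2 * (e + f) - 2 * (d + d')" "n5 = 2 * V - 2 * (e + f) + (d + d') - 2 * h"
proof -
  have t: "A + B + C + D = d + d' + 2 * q" using assms(3,5) by simp
  have h: "2 * h = 2 * V - 2 * e - 2 * f + 2 * q" using assms(6,7) t by simp
  show "n2 = 2 * V - 2 * (e + f) + (d + d') + 2 * h" unfolding assms(1) t h by simp
  show "n3 = 2 * (e + f) - 2 * (d + d')" unfolding assms(2) t by simp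
  show "n5 = 2 * V - 2 * (e + f) + (d + d') - 2 * h" unfolding assms(4) t h by simp
qed

context smooth_domain
begin

context
  fixes a v :: real and c :: complex
  assumes a_pos: "0 < a" and a_small: "1600 * a \<le> r"
begin

interpretation grid a "cis v" c by standard (use a_pos in auto)

definition S where "S = {x. rlat a c v x \<in> X}"

lemma rlat_lat: "rlat a c v = lat" by (auto simp: rlat_def lat_def)

lemma rlat_add: "rlat a c v (x + (i, j)) = rlat a c v x + of_real a * cis v * (of_int i + \<i> * of_int j)"
  by (simp add: rlat_def algebra_simps)

lemma npairs_cnt: "npairs X (of_int i + \<i> * of_int j) a c v = real (cnt S {(0, 0), (i, j)})"
proof -
  have "x \<in> S \<and> x + (i, j) \<in> S \<longleftrightarrow> rlat a c v x \<in> X \<and> rlat a c v x + of_real a * cis v * (of_int i + \<i> * of_int j) \<in> X" for x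
    unfolding S_def mem_Collect_eq rlat_add ..
  then show ?thesis by (simp add: npairs_def cnt_def flip: zero_prod_def)
qed

lemma Ncount_cells:
  "Ncount 2 X a c v = real (cells S pt2)" "Ncount 3 X a c v = real (cells S pt3)"
  "Ncount 4 X a c v = real (cells S pt4)" "Ncount 5 X a c v = real (cells S pt5)"
proof -
  have sl: "scaled_lattice a c v = range (rlat a c v)"
    unfolding scaled_lattice_def
  proof (intro subset_antisym subsetI)
    fix z assume "z \<in> {of_real a * cis v * (of_int m + \<i> * of_int n + c) |m n. True}"
    then obtain m n where "z = of_real a * cis v * (of_int m + \<i> * of_int n + c)" by blast
    then have "z = rlat a c v (m, n)" by (simp add: rlat_def)
    then show "z \<in> range (rlat a c v)" by blast
  next
    fix z assume "z \<in> range (rlat a c v)"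
    then obtain x where "z = rlat a c v x" by blast
    then have "z = of_real a * cis v * (of_int (fst x) + \<i> * of_int (snd x) + c)" by (simp add: rlat_def)
    then show "z \<in> {of_real a * cis v * (of_int m + \<i> * of_int n + c) |m n. True}" by blast
  qed
  have cf: "config X a v (rlat a c v x) = cfg (x \<in> S) (x + (1, 0) \<in> S) (x + (0, 1) \<in> S) (x + (1, 1) \<in> S)" for x
  proof -
    have m: "x \<in> S \<longleftrightarrow> rlat a c v x + of_real a * cis v * 0 \<in> X" "x + (1, 0) \<in> S \<longleftrightarrow> rlat a c v x + of_real a * cis v * 1 \<in> X"
      "x + (0, 1) \<in> S \<longleftrightarrow> rlat a c v x + of_real a * cis v * \<i> \<in> X" "x + (1, 1) \<in> S \<longleftrightarrow> rlat a c v x + of_real a * cis v * (1 + \<i>) \<in> X"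
      unfolding S_def mem_Collect_eq rlat_add by simp_all
    show ?thesis unfolding m by (auto simp only: config_def C0_def cfg_def split: if_splits)
  qed
  have N: "Ncount j X a c v = real (cells S P)" if "\<And>p q r s. cfg p q r s \<in> eta j \<longleftrightarrow> P p q r s" for j P
  proof -
    have "{z \<in> scaled_lattice a c v. config X a v z \<in> eta j} = rlat a c v ` {x. config X a v (rlat a c v x) \<in> eta j}"
      unfolding sl by auto
    also have "card \<dots> = card {x. config X a v (rlat a c v x) \<in> eta j}"
      by (rule card_image) (use inj_lat rlat_lat in \<open>auto intro: inj_on_subset\<close>)
    finally show ?thesis unfolding Ncount_def cells_def cf that by simp
  qed
  show "Ncount 2 X a c v = real (cells S pt2)" "Ncount 3 X a c v = real (cells S pt3)"
    "Ncount 4 X a c v = real (cells S pt4)" "Ncount 5 X a c v = real (cells S pt5)"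
    by (rule N eta_cfg)+
qed

lemma Ncount_npairs:
  fixes np
  defines "np \<equiv> \<lambda>d. npairs X d a c v"
  shows "Ncount 2 X a c v = 2 * np 0 - 2 * (np 1 + np \<i>) + (np (1 + \<i>) + np (- 1 + \<i>)) + 2 * V0 X"
    "Ncount 3 X a c v = 2 * (np 1 + np \<i>) - 2 * (np (1 + \<i>) + np (- 1 + \<i>))"
    "Ncount 4 X a c v = 0"
    "Ncount 5 X a c v = 2 * np 0 - 2 * (np 1 + np \<i>) + (np (1 + \<i>) + np (- 1 + \<i>)) - 2 * V0 X"
proof -
  have u: "norm (cis v) = 1" by simp
  have S: "S = {x. lat x \<in> X}" by (simp add: S_def rlat_lat)
  have fin: "finite S" unfolding S by (rule finite_lat_bounded[OF bounded])
  note E = euler_counts[OF a_pos u a_small, of c, folded S]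
  note C = cell_counts[OF fin]
  have np: "np 0 = real (cnt S {(0, 0)})" "np 1 = real (cnt S {(0, 0), (1, 0)})" "np \<i> = real (cnt S {(0, 0), (0, 1)})"
    "np (1 + \<i>) = real (cnt S {(0, 0), (1, 1)})" "np (- 1 + \<i>) = real (cnt S {(1, 0), (0, 1)})"
  proof -
    show "np 0 = real (cnt S {(0, 0)})" using npairs_cnt[of 0 0] by (simp add: np_def)
    show "np 1 = real (cnt S {(0, 0), (1, 0)})" using npairs_cnt[of 1 0] by (simp add: np_def)
    show "np \<i> = real (cnt S {(0, 0), (0, 1)})" using npairs_cnt[of 0 1] by (simp add: np_def)
    show "np (1 + \<i>) = real (cnt S {(0, 0), (1, 1)})" using npairs_cnt[of 1 1] by (simp add: np_def)
    have "cnt S {(1, 0), (0, 1)} = cnt S {(0, 0), (-1, 1)}"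
      using cnt_shift[of S "(1, 0)" "{(0, 0), (-1, 1)}"] by simp
    then show "np (- 1 + \<i>) = real (cnt S {(1, 0), (0, 1)})" using npairs_cnt[of "-1" 1] by (simp add: np_def)
  qed
  have "cells S pt4 = 0"
  proof -
    have "\<not> pt4 (x \<in> S) (x + (1, 0) \<in> S) (x + (0, 1) \<in> S) (x + (1, 1) \<in> S)" for x
    proof
      assume p: "pt4 (x \<in> S) (x + (1, 0) \<in> S) (x + (0, 1) \<in> S) (x + (1, 1) \<in> S)"
      have m: "x \<in> S \<longleftrightarrow> rlat a c v x \<in> X" "x + (1, 0) \<in> S \<longleftrightarrow> rlat a c v x + of_real a * cis v \<in> X"
        "x + (0, 1) \<in> S \<longleftrightarrow> rlat a c v x + of_real a * cis v * \<i> \<in> X" "x + (1, 1) \<in> S \<longleftrightarrow> rlat a c v x + of_real a * cis v * (1 + \<i>) \<in> X"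
        unfolding S_def mem_Collect_eq rlat_add by simp_all
      show False
        using no_diagonal[OF a_pos a_small u, of "rlat a c v x"] p unfolding m pt4_def by blast
    qed
    then show ?thesis by (simp add: cells_def)
  qed
  then have C4: "int (cells S pt4) = 0" by simp
  note CR = C[THEN arg_cong[where f = real_of_int], unfolded of_int_add of_int_diff of_int_mult of_int_numeral of_int_of_nat_eq]
    C4[THEN arg_cong[where f = real_of_int], unfolded of_int_of_nat_eq of_int_0]
  show "Ncount 4 X a c v = 0" unfolding Ncount_cells using C4 by simp
  show "Ncount 2 X a c v = 2 * np 0 - 2 * (np 1 + np \<i>) + (np (1 + \<i>) + np (- 1 + \<i>)) + 2 * V0 X" unfolding Ncount_cells np by (rule counts_arith(1)[OF CR E])
  show "Ncount 3 X a c v = 2 * (np 1 + np \<i>) - 2 * (np (1 + \<i>) + np (- 1 + \<i>))" unfolding Ncount_cells np by (rule counts_arith(2)[OF CR E])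
  show "Ncount 5 X a c v = 2 * np 0 - 2 * (np 1 + np \<i>) + (np (1 + \<i>) + np (- 1 + \<i>)) - 2 * V0 X" unfolding Ncount_cells np by (rule counts_arith(3)[OF CR E])
qed

end

text \<open>\<open>X\<close> is the disjoint union of the points that stay in \<open>X\<close> under
  the displacement and those that leave it, so the averaged covariogram is the full area minus
  \<open>G\<close>. Allowing \<open>s = 0\<close> lets the number of lattice points in
  \<open>X\<close> be treated as a pair count.\<close>

lemma expect_npairs:
  assumes a: "0 < a" and e: "norm e = 1" and d: "d = of_real s * e"
  shows "integrable lattice_measure (\<lambda>(c, v). npairs X d a c v)"
    "lattice_expect (npairs X d a) = (2 * pi * measure lborel X - enn2real (G e (a * s))) / (2 * pi * a\<^sup>2)"
proof -
  show "integrable lattice_measure (\<lambda>(c, v). npairs X d a c v)" by (rule npairs_integral(1)[OF closed bounded a])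
  let ?cv = "\<lambda>v. covar X (of_real a * cis v * d)"
  have m: "?cv \<in> borel_measurable borel" by (rule covar_measurable[OF closed bounded a])
  have split: "ennreal (?cv v) + emeasure lborel (exitset (a * s) (cis v * e)) = ennreal (measure lborel X)" for v
  proof -
    let ?Z = "{z \<in> X. z + of_real a * cis v * d \<in> X}"
    have "{z \<in> space borel. z \<in> X \<and> z + of_real a * cis v * d \<in> X} \<in> sets borel" by measurable
    then have Zm: "?Z \<in> sets lborel" by simp
    have "bounded ?Z" by (rule bounded_subset[OF bounded]) auto
    then have Z: "ennreal (?cv v) = emeasure lborel ?Z"
      unfolding covar_def using finite_measure_bounded[of ?Z] Zm by simp
    have ex: "exitset (a * s) (cis v * e) = X - ?Z"
      unfolding exitset_def d by (auto simp: mult_ac)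
    have "emeasure lborel ?Z + emeasure lborel (X - ?Z) = emeasure lborel (?Z \<union> (X - ?Z))"
      using Zm by (intro plus_emeasure) auto
    also have "?Z \<union> (X - ?Z) = X" by auto
    finally show ?thesis unfolding Z ex using finite_measure_bounded[OF bounded] by simp
  qed
  have eqn: "(\<integral>\<^sup>+v. ennreal (?cv v) * indicator {0..2*pi} v \<partial>lborel) + G e (a * s) = ennreal (2 * pi * measure lborel X)"
  proof -
    have [measurable]: "(\<lambda>v. emeasure lborel (exitset (a * s) (cis v * e))) \<in> borel_measurable borel"
      by (rule exit_pair_measurable)
    have "(\<integral>\<^sup>+v. ennreal (?cv v) * indicator {0..2*pi} v \<partial>lborel) + G e (a * s) =
        (\<integral>\<^sup>+v. (ennreal (?cv v) + emeasure lborel (exitset (a * s) (cis v * e))) * indicator {0..2*pi} v \<partial>lborel)"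
      unfolding G_def using m by (subst nn_integral_add[symmetric]) (auto simp: distrib_right)
    also have "\<dots> = ennreal (2 * pi * measure lborel X)"
      unfolding split by (simp add: nn_integral_cmult ennreal_mult mult.commute)
    finally show ?thesis .
  qed
  have I: "(LINT v:{0..2*pi}|lborel. ?cv v) = enn2real (\<integral>\<^sup>+v. ennreal (?cv v) * indicator {0..2*pi} v \<partial>lborel)"
  proof -
    have "(LINT v:{0..2*pi}|lborel. ?cv v) = enn2real (\<integral>\<^sup>+v. ennreal (indicator {0..2*pi} v *\<^sub>R ?cv v) \<partial>lborel)"
      unfolding set_lebesgue_integral_def
      by (rule integral_eq_nn_integral) (use m in \<open>auto simp: covar_def\<close>)
    also have "(\<lambda>v. ennreal (indicator {0..2*pi} v *\<^sub>R ?cv v)) = (\<lambda>v. ennreal (?cv v) * indicator {0..2*pi} v)"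
      by (auto simp: indicator_def)
    finally show ?thesis .
  qed
  have fin: "(\<integral>\<^sup>+v. ennreal (?cv v) * indicator {0..2*pi} v \<partial>lborel) < \<top>" "G e (a * s) < \<top>"
    using eqn by (metis ennreal_add_less_top ennreal_less_top)+
  have "2 * pi * measure lborel X = enn2real (\<integral>\<^sup>+v. ennreal (?cv v) * indicator {0..2*pi} v \<partial>lborel) + enn2real (G e (a * s))"
    using arg_cong[OF eqn, of enn2real] fin by (simp add: enn2real_plus)
  then show "lattice_expect (npairs X d a) = (2 * pi * measure lborel X - enn2real (G e (a * s))) / (2 * pi * a\<^sup>2)"
    unfolding npairs_integral(2)[OF closed bounded a] I by simp
qed

lemma G_expansion:
  assumes e: "norm e = 1" and s: "s > 0"
  shows "((\<lambda>a. enn2real (G e (a * s)) / (2 * pi * a\<^sup>2) - s * L / (pi * a)) \<longlongrightarrow> 0) (at_right 0)"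
proof -
  let ?\<delta> = "\<lambda>t. (enn2real (G e t) / t - 2 * L) / t"
  have "filterlim (\<lambda>a. a * s) (at_right 0) (at_right 0)"
  proof (rule filterlim_at_withinI)
    have "((\<lambda>a. a * s) \<longlongrightarrow> 0 * s) (at_right 0)" by (intro tendsto_intros)
    then show "((\<lambda>a. a * s) \<longlongrightarrow> 0) (at_right 0)" by simp
    show "\<forall>\<^sub>F a in at_right 0. a * s \<in> {0<..} - {0}"
      using s by (auto simp: eventually_at_right_field intro!: exI[of _ 1])
  qed
  then have "((\<lambda>a. ?\<delta> (a * s)) \<longlongrightarrow> 0) (at_right 0)" by (rule filterlim_compose[OF G_second_order[OF e]])
  then have "((\<lambda>a. s\<^sup>2 / (2 * pi) * ?\<delta> (a * s)) \<longlongrightarrow> s\<^sup>2 / (2 * pi) * 0) (at_right 0)"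
    by (intro tendsto_mult tendsto_const)
  then have lim: "((\<lambda>a. s\<^sup>2 / (2 * pi) * ?\<delta> (a * s)) \<longlongrightarrow> 0) (at_right 0)" by simp
  show ?thesis
  proof (rule Lim_transform_eventually[OF lim])
    show "\<forall>\<^sub>F a in at_right 0. s\<^sup>2 / (2 * pi) * ?\<delta> (a * s) = enn2real (G e (a * s)) / (2 * pi * a\<^sup>2) - s * L / (pi * a)"
      unfolding eventually_at_right_field
    proof (intro exI[of _ 1] conjI allI impI)
      fix a :: real assume "0 < a" "a < 1"
      then show "s\<^sup>2 / (2 * pi) * ?\<delta> (a * s) = enn2real (G e (a * s)) / (2 * pi * a\<^sup>2) - s * L / (pi * a)"
        using s by (simp add: field_simps power2_eq_square)
    qed simp
  qed
qed

lemma expected_counts: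
  "((\<lambda>a. lattice_expect (\<lambda>c v. \<alpha> * Ncount 2 X a c v + \<beta> * Ncount 3 X a c v + \<delta> * Ncount 4 X a c v + \<gamma> * Ncount 5 X a c v)
      - (1 / a) * (((4 - 2 * sqrt 2) * (\<alpha> + \<gamma>) + (4 * sqrt 2 - 4) * \<beta>) * L / pi)) \<longlongrightarrow> 2 * (\<alpha> - \<gamma>) * V0 X) (at_right 0)"
proof -
  interpret P: prob_space lattice_measure by (rule prob_space_lattice)
  \<comment> \<open>Unit vectors along the two diagonals; the factor \<open>sqrt 2\<close> moves
    into the argument of \<open>G\<close>.\<close>
  define e3 e4 where "e3 = (1 + \<i>) / of_real (sqrt 2)" and "e4 = (- 1 + \<i>) / of_real (sqrt 2)"
  have n3: "norm e3 = 1" "norm e4 = 1" by (simp_all add: e3_def e4_def norm_divide cmod_def power_divide)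
  have d: "0 = of_real 0 * (1::complex)" "1 = of_real 1 * (1::complex)" "\<i> = of_real 1 * \<i>" "1 + \<i> = of_real (sqrt 2) * e3" "- 1 + \<i> = of_real (sqrt 2) * e4"
    by (simp_all add: e3_def e4_def)
  define D where "D e s a = enn2real (G e (a * s)) / (2 * pi * a\<^sup>2)" for e s a
  define H where "H a = 2 * D 1 1 a + 2 * D \<i> 1 a - D e3 (sqrt 2) a - D e4 (sqrt 2) a" for a
  define H' where "H' a = - 2 * D 1 1 a - 2 * D \<i> 1 a + 2 * D e3 (sqrt 2) a + 2 * D e4 (sqrt 2) a" for a
  have n1: "norm (1::complex) = 1" "norm \<i> = 1" by auto
  have ex: "lattice_expect (\<lambda>c v. \<alpha> * Ncount 2 X a c v + \<beta> * Ncount 3 X a c v + \<delta> * Ncount 4 X a c v + \<gamma> * Ncount 5 X a c v)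
      = (\<alpha> + \<gamma>) * H a + \<beta> * H' a + 2 * (\<alpha> - \<gamma>) * V0 X" if a: "0 < a" "1600 * a \<le> r" for a
  proof -
    let ?np = "\<lambda>d c v. npairs X d a c v"
    let ?E = "\<lambda>d. lattice_expect (npairs X d a)"
    note I = expect_npairs(1)[OF a(1) n1(1) d(1)] expect_npairs(1)[OF a(1) n1(1) d(2)] expect_npairs(1)[OF a(1) n1(2) d(3)]
      expect_npairs(1)[OF a(1) n3(1) d(4)] expect_npairs(1)[OF a(1) n3(2) d(5)]
    note J = I[unfolded case_prod_beta']
    have "lattice_expect (\<lambda>c v. \<alpha> * Ncount 2 X a c v + \<beta> * Ncount 3 X a c v + \<delta> * Ncount 4 X a c v + \<gamma> * Ncount 5 X a c v) =
        lattice_expect (\<lambda>c v. (2 * (\<alpha> + \<gamma>)) * ?np 0 c v + (2 * \<beta> - 2 * (\<alpha> + \<gamma>)) * ?np 1 c v + (2 * \<beta> - 2 * (\<alpha> + \<gamma>)) * ?np \<i> c v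
          + (\<alpha> + \<gamma> - 2 * \<beta>) * ?np (1 + \<i>) c v + (\<alpha> + \<gamma> - 2 * \<beta>) * ?np (- 1 + \<i>) c v + 2 * (\<alpha> - \<gamma>) * V0 X)"
      unfolding Ncount_npairs[OF a] by (intro arg_cong[of _ _ lattice_expect] ext) (simp add: algebra_simps)
    also have "\<dots> = (2 * (\<alpha> + \<gamma>)) * ?E 0 + (2 * \<beta> - 2 * (\<alpha> + \<gamma>)) * ?E 1 + (2 * \<beta> - 2 * (\<alpha> + \<gamma>)) * ?E \<i>
          + (\<alpha> + \<gamma> - 2 * \<beta>) * ?E (1 + \<i>) + (\<alpha> + \<gamma> - 2 * \<beta>) * ?E (- 1 + \<i>) + 2 * (\<alpha> - \<gamma>) * V0 X"
      unfolding lattice_expect_def case_prod_beta'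
      using J by (simp add: P.prob_space)
    also have "\<dots> = (\<alpha> + \<gamma>) * H a + \<beta> * H' a + 2 * (\<alpha> - \<gamma>) * V0 X"
    proof -
      have G0: "G 1 (a * 0) = 0" by (simp add: G_def exitset_def)
      \<comment> \<open>The area term is of order \<open>1 / a\<^sup>2\<close> and has to disappear:
        the coefficients of the five pair counts sum to 0.\<close>
      define A where "A = measure lborel X / a\<^sup>2"
      have E: "?E 0 = A" "?E 1 = A - D 1 1 a" "?E \<i> = A - D \<i> 1 a" "?E (1 + \<i>) = A - D e3 (sqrt 2) a" "?E (- 1 + \<i>) = A - D e4 (sqrt 2) a"
        unfolding expect_npairs(2)[OF a(1) n1(1) d(1)] expect_npairs(2)[OF a(1) n1(1) d(2)] expect_npairs(2)[OF a(1) n1(2) d(3)]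
          expect_npairs(2)[OF a(1) n3(1) d(4)] expect_npairs(2)[OF a(1) n3(2) d(5)] G0 D_def A_def
        using a by (simp_all add: diff_divide_distrib)
      show ?thesis unfolding E H_def H'_def by (simp add: algebra_simps)
    qed
    finally show ?thesis .
  qed
  have lim: "((\<lambda>a. D e s a - s * L / (pi * a)) \<longlongrightarrow> 0) (at_right 0)" if "norm e = 1" "s > 0" for e s
    unfolding D_def by (rule G_expansion[OF that])
  have s2: "sqrt 2 > (0::real)" by simp
  have "((\<lambda>a. (\<alpha> + \<gamma>) * (2 * (D 1 1 a - 1 * L / (pi * a)) + 2 * (D \<i> 1 a - 1 * L / (pi * a))
        - (D e3 (sqrt 2) a - sqrt 2 * L / (pi * a)) - (D e4 (sqrt 2) a - sqrt 2 * L / (pi * a)))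
      + \<beta> * (- 2 * (D 1 1 a - 1 * L / (pi * a)) - 2 * (D \<i> 1 a - 1 * L / (pi * a))
        + 2 * (D e3 (sqrt 2) a - sqrt 2 * L / (pi * a)) + 2 * (D e4 (sqrt 2) a - sqrt 2 * L / (pi * a))) + 2 * (\<alpha> - \<gamma>) * V0 X)
      \<longlongrightarrow> (\<alpha> + \<gamma>) * (2 * 0 + 2 * 0 - 0 - 0) + \<beta> * (- 2 * 0 - 2 * 0 + 2 * 0 + 2 * 0) + 2 * (\<alpha> - \<gamma>) * V0 X) (at_right 0)"
    by (intro tendsto_intros lim n1 n3 s2 zero_less_one)
  then have main: "((\<lambda>a. (\<alpha> + \<gamma>) * (2 * (D 1 1 a - 1 * L / (pi * a)) + 2 * (D \<i> 1 a - 1 * L / (pi * a))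
        - (D e3 (sqrt 2) a - sqrt 2 * L / (pi * a)) - (D e4 (sqrt 2) a - sqrt 2 * L / (pi * a)))
      + \<beta> * (- 2 * (D 1 1 a - 1 * L / (pi * a)) - 2 * (D \<i> 1 a - 1 * L / (pi * a))
        + 2 * (D e3 (sqrt 2) a - sqrt 2 * L / (pi * a)) + 2 * (D e4 (sqrt 2) a - sqrt 2 * L / (pi * a))) + 2 * (\<alpha> - \<gamma>) * V0 X)
      \<longlongrightarrow> 2 * (\<alpha> - \<gamma>) * V0 X) (at_right 0)" by simp
  show ?thesis
  proof (rule Lim_transform_eventually[OF main], unfold eventually_at_right_field, intro exI[of _ "r / 1600"] conjI allI impI)
    show "0 < r / 1600" using r by simp
    fix a :: real assume a: "0 < a" "a < r / 1600"
    then have a': "1600 * a \<le> r" by simp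
    show "(\<alpha> + \<gamma>) * (2 * (D 1 1 a - 1 * L / (pi * a)) + 2 * (D \<i> 1 a - 1 * L / (pi * a))
        - (D e3 (sqrt 2) a - sqrt 2 * L / (pi * a)) - (D e4 (sqrt 2) a - sqrt 2 * L / (pi * a)))
      + \<beta> * (- 2 * (D 1 1 a - 1 * L / (pi * a)) - 2 * (D \<i> 1 a - 1 * L / (pi * a))
        + 2 * (D e3 (sqrt 2) a - sqrt 2 * L / (pi * a)) + 2 * (D e4 (sqrt 2) a - sqrt 2 * L / (pi * a))) + 2 * (\<alpha> - \<gamma>) * V0 X =
      lattice_expect (\<lambda>c v. \<alpha> * Ncount 2 X a c v + \<beta> * Ncount 3 X a c v + \<delta> * Ncount 4 X a c v + \<gamma> * Ncount 5 X a c v)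
      - (1 / a) * (((4 - 2 * sqrt 2) * (\<alpha> + \<gamma>) + (4 * sqrt 2 - 4) * \<beta>) * L / pi)"
      unfolding ex[OF a(1) a'] H_def H'_def
    proof -
      define l where "l = L / (pi * a)"
      have l: "sqrt 2 * L / (pi * a) = sqrt 2 * l" "1 * L / (pi * a) = l" "(1 / a) * (((4 - 2 * sqrt 2) * (\<alpha> + \<gamma>) + (4 * sqrt 2 - 4) * \<beta>) * L / pi) = ((4 - 2 * sqrt 2) * (\<alpha> + \<gamma>) + (4 * sqrt 2 - 4) * \<beta>) * l"
        by (simp_all add: l_def)
      show "(\<alpha> + \<gamma>) * (2 * (D 1 1 a - 1 * L / (pi * a)) + 2 * (D \<i> 1 a - 1 * L / (pi * a))
        - (D e3 (sqrt 2) a - sqrt 2 * L / (pi * a)) - (D e4 (sqrt 2) a - sqrt 2 * L / (pi * a)))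
      + \<beta> * (- 2 * (D 1 1 a - 1 * L / (pi * a)) - 2 * (D \<i> 1 a - 1 * L / (pi * a))
        + 2 * (D e3 (sqrt 2) a - sqrt 2 * L / (pi * a)) + 2 * (D e4 (sqrt 2) a - sqrt 2 * L / (pi * a))) + 2 * (\<alpha> - \<gamma>) * V0 X =
      (\<alpha> + \<gamma>) * (2 * D 1 1 a + 2 * D \<i> 1 a - D e3 (sqrt 2) a - D e4 (sqrt 2) a) + \<beta> * (- 2 * D 1 1 a - 2 * D \<i> 1 a + 2 * D e3 (sqrt 2) a + 2 * D e4 (sqrt 2) a) + 2 * (\<alpha> - \<gamma>) * V0 X
      - (1 / a) * (((4 - 2 * sqrt 2) * (\<alpha> + \<gamma>) + (4 * sqrt 2 - 4) * \<beta>) * L / pi)"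
        unfolding l by (simp add: algebra_simps)
    qed
  qed
qed

end

lemma C2_domain_expected_counts:
  assumes "C2_domain X"
  shows "((\<lambda>a. lattice_expect (\<lambda>c v. \<alpha> * Ncount 2 X a c v + \<beta> * Ncount 3 X a c v + \<delta> * Ncount 4 X a c v + \<gamma> * Ncount 5 X a c v)
      - (1 / a) * (4 * ((2 - sqrt 2) * \<alpha> + (-2 + 2 * sqrt 2) * \<beta> + (2 - sqrt 2) * \<gamma>) * V1 X / pi)) \<longlongrightarrow> 2 * (\<alpha> - \<gamma>) * V0 X) (at_right 0)"
proof -
  obtain r where r: "r > 0" "\<And>p. p \<in> frontier X \<Longrightarrow> \<exists>n. tball r X p n"
    using C2_domain_tball[OF assms] by metis
  have "compact X" using assms by (simp add: C2_domain_def)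
  then interpret smooth_domain X r
    by unfold_locales (use r compact_imp_closed compact_imp_bounded in auto)
  have "L = 2 * V1 X" by (simp add: L_def V1_def)
  then have "((4 - 2 * sqrt 2) * (\<alpha> + \<gamma>) + (4 * sqrt 2 - 4) * \<beta>) * L / pi =
      4 * ((2 - sqrt 2) * \<alpha> + (-2 + 2 * sqrt 2) * \<beta> + (2 - sqrt 2) * \<gamma>) * V1 X / pi"
    by (simp add: algebra_simps)
  then show ?thesis using expected_counts[of \<alpha> \<beta> \<delta> \<gamma>] by simp
qed

section \<open>The unit disk as a domain with nonzero Euler characteristic and boundary
  length\<close>

lemma C2_domain_disk: "C2_domain (cball 0 1)"
  unfolding C2_domain_def
proof (intro conjI ballI)
  fix p :: complex assume "p \<in> frontier (cball 0 1)"
  then have p: "norm p = 1" by simp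
  let ?f = "\<lambda>z::complex. z \<bullet> z - 1"
  have der: "(?f has_derivative blinfun_apply (2 *\<^sub>R blinfun_inner_right x)) (at x)" for x
    by (auto intro!: derivative_eq_intros simp: blinfun.scaleR_left inner_commute)
  have bl: "bounded_linear (\<lambda>x::complex. 2 *\<^sub>R blinfun_inner_right x)"
    by (rule bounded_linear_compose[OF bounded_linear_scaleR_right bounded_linear_blinfun_inner_right])
  \<comment> \<open>The origin is left out because the derivative of the defining function vanishes
    there.\<close>
  have C2: "C2_on ?f (- {0})"
    unfolding C2_on_def
  proof (intro exI[of _ "\<lambda>x. 2 *\<^sub>R blinfun_inner_right x"] exI[of _ "\<lambda>_. Blinfun (\<lambda>x. 2 *\<^sub>R blinfun_inner_right x)"] conjI ballI)
    show "(?f has_derivative blinfun_apply (2 *\<^sub>R blinfun_inner_right x)) (at x)" for x by (rule der)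
    show "((\<lambda>x::complex. 2 *\<^sub>R blinfun_inner_right x) has_derivative
        blinfun_apply (Blinfun (\<lambda>x. 2 *\<^sub>R blinfun_inner_right x))) (at x)" for x
      unfolding bounded_linear_Blinfun_apply[OF bl] by (rule bounded_linear_imp_has_derivative[OF bl])
  qed (rule continuous_on_const)
  show "\<exists>U f. open U \<and> p \<in> U \<and> C2_on f U \<and> (\<forall>x\<in>U. \<exists>D. (f has_derivative D) (at x) \<and> D \<noteq> (\<lambda>_. 0)) \<and>
      cball 0 1 \<inter> U = {x \<in> U. f x \<le> 0}"
  proof (rule exI[of _ "- {0}"], rule exI[of _ ?f], intro conjI ballI C2)
    show "open (- {0::complex})" by (rule open_Compl) simp
    show "p \<in> - {0}" using p by auto
    fix x :: complex assume x: "x \<in> - {0}"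
    have "blinfun_apply (2 *\<^sub>R blinfun_inner_right x) x \<noteq> 0" using x by (simp add: blinfun.scaleR_left)
    then show "\<exists>D. (?f has_derivative D) (at x) \<and> D \<noteq> (\<lambda>_. 0)"
      using der[of x] by (intro exI[of _ "blinfun_apply (2 *\<^sub>R blinfun_inner_right x)"]) (auto simp: fun_eq_iff)
  next
    show "cball 0 1 \<inter> - {0} = {x \<in> - {0}. ?f x \<le> 0}"
      by (auto simp: dot_square_norm abs_square_le_1)
  qed
qed simp

lemma V0_disk: "V0 (cball 0 1) = 1"
proof -
  have k1: "components (cball 0 1 :: complex set) = {cball 0 1}"
    unfolding components_eq_sing_iff using convex_connected[OF convex_cball] by auto
  have k2: "{C\<in>components (- cball 0 1 :: complex set). bounded C} = {}"
  proof -
    have "connected (- cball 0 1 :: complex set)"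
      by (rule connected_complement_bounded_convex) auto
    moreover have "\<not> bounded (- cball 0 1 :: complex set)"
      by (rule cobounded_imp_unbounded) simp
    moreover from this have "- cball 0 1 \<noteq> ({} :: complex set)" by auto
    ultimately have "components (- cball 0 1 :: complex set) = {- cball 0 1}"
      unfolding components_eq_sing_iff by blast
    then show ?thesis using \<open>\<not> bounded (- cball 0 1 :: complex set)\<close> by auto
  qed
  show ?thesis unfolding V0_def k1 k2 by simp
qed

text \<open>Orthogonal projection to the real axis maps the circle onto an interval of length 2.\<close>

lemma V1_disk_pos: "V1 (cball 0 1) > 0"
proof -
  obtain r where r: "r > 0" "\<And>p. p \<in> frontier (cball 0 1) \<Longrightarrow> \<exists>n. tball r (cball 0 1) p n"
    using C2_domain_tball[OF C2_domain_disk] by metis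
  \<comment> \<open>Since \<open>enn2real\<close> sends infinity to 0, a lower bound for the
    Hausdorff measure must be paired with its finiteness, which \<open>L\<close> provides.\<close>
  interpret smooth_domain "cball 0 1" r
    by unfold_locales (use r in auto)
  have "2 \<le> (\<Sum>i. ennreal (diameter (U i)))"
    if U: "frontier (cball 0 1) \<subseteq> (\<Union>i. U i)" "\<And>i. bounded (U i)" for U :: "nat \<Rightarrow> complex set"
  proof -
    \<comment> \<open>An interval as long as the diameter of \<open>U i\<close>, starting at the
      infimum of its projection, contains that projection. Empty sets are treated apart because
      their infimum is meaningless.\<close>
    define J where "J i = (if U i = {} then {} else {Inf (Re ` U i)..Inf (Re ` U i) + diameter (U i)})" for i
    have bd: "bdd_below (Re ` U i)" for i
      by (rule bounded_imp_bdd_below, rule bounded_linear_image[OF U(2) bounded_linear_Re])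
    have "{-1..1} \<subseteq> (\<Union>i. J i)"
    proof
      fix x :: real assume "x \<in> {-1..1}"
      then have "x\<^sup>2 \<le> 1" by (simp add: abs_square_le_1 abs_le_iff)
      then have "Complex x (sqrt (1 - x\<^sup>2)) \<in> frontier (cball 0 1)" by (simp add: cmod_def)
      then obtain i where i: "Complex x (sqrt (1 - x\<^sup>2)) \<in> U i" using U(1) by blast
      then have xi: "x \<in> Re ` U i" by force
      have "x - diameter (U i) \<le> Inf (Re ` U i)"
      proof (rule cInf_greatest)
        fix y assume "y \<in> Re ` U i"
        then obtain w where w: "w \<in> U i" "y = Re w" by blast
        have "\<bar>x - y\<bar> \<le> dist (Complex x (sqrt (1 - x\<^sup>2))) w"
          using abs_Re_le_cmod[of "Complex x (sqrt (1 - x\<^sup>2)) - w"] w by (simp add: dist_norm)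
        also have "\<dots> \<le> diameter (U i)" by (rule diameter_bounded_bound[OF U(2) i w(1)])
        finally show "x - diameter (U i) \<le> y" by linarith
      qed (use xi in auto)
      then have "x \<in> J i" using cInf_lower[OF xi bd] i by (auto simp: J_def)
      then show "x \<in> (\<Union>i. J i)" by blast
    qed
    then have "emeasure lborel {-1..1::real} \<le> emeasure lborel (\<Union>i. J i)"
      by (rule emeasure_mono) (auto simp: J_def)
    also have "\<dots> \<le> (\<Sum>i. emeasure lborel (J i))" by (rule emeasure_subadditive_countably) (auto simp: J_def)
    also have "\<dots> \<le> (\<Sum>i. ennreal (diameter (U i)))"
      by (intro suminf_le) (auto simp: J_def diameter_ge_0[OF U(2)])
    finally show ?thesis by simp
  qed
  then have "2 \<le> (INF U \<in> {U :: nat \<Rightarrow> complex set. frontier (cball 0 1) \<subseteq> (\<Union>i. U i) \<and> (\<forall>i. bounded (U i) \<and> diameter (U i) \<le> 1)}.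
      (\<Sum>i. ennreal (diameter (U i))))" by (intro INF_greatest) auto
  also have "\<dots> \<le> hausdorff1 (frontier (cball 0 1))"
    unfolding hausdorff1_def by (rule SUP_upper) simp
  finally have "ennreal 2 \<le> ennreal L" unfolding L(2) by simp
  then have "L > 0" by (subst (asm) ennreal_le_iff) (use L(1) in auto)
  then show ?thesis by (simp add: V1_def L_def)
qed

theorem theorem8p1:
  fixes w :: "nat \<Rightarrow> real"
  assumes w1: "w 1 = 0" and w6: "w 6 = 0"
  shows
    \<comment> \<open>(i)\<close>
    "(\<forall>X. C2_domain X \<longrightarrow>
        ((\<lambda>b. b * EV0hat w X b) \<longlongrightarrow> c3 w * V1 X / pi) (at_right 0) \<and>
        ((\<lambda>a. EV0hat w X a - (1 / a) * (c3 w * V1 X / pi)) \<longlongrightarrow> c4 w * V0 X) (at_right 0))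
     \<and>
     \<comment> \<open>(ii)\<close>
     ((\<forall>X. C2_domain X \<longrightarrow> (\<exists>L. (EV0hat w X \<longlongrightarrow> L) (at_right 0)))
        \<longleftrightarrow> (2 - sqrt 2) * w 2 + (-2 + 2 * sqrt 2) * w 3 + (2 - sqrt 2) * w 5 = 0)
     \<and>
     ((2 - sqrt 2) * w 2 + (-2 + 2 * sqrt 2) * w 3 + (2 - sqrt 2) * w 5 = 0 \<longrightarrow>
        ((\<forall>X. C2_domain X \<longrightarrow> (EV0hat w X \<longlongrightarrow> V0 X) (at_right 0))
          \<longleftrightarrow> 2 * w 2 - 2 * w 5 = 1))
     \<and>
     \<comment> \<open>(iii)\<close>
     ((2 - sqrt 2) * w 2 + (-2 + 2 * sqrt 2) * w 3 + (2 - sqrt 2) * w 5 = 0 \<longrightarrow>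
      2 * w 2 - 2 * w 5 = 1 \<longrightarrow>
      (\<forall>X. C2_domain X \<longrightarrow>
        ((\<lambda>a. lattice_expect (\<lambda>c v. w 2 * Ncount 5 X a c v + w 3 * Ncount 3 X a c v
                + w 4 * Ncount 4 X a c v + w 5 * Ncount 2 X a c v))
          \<longlongrightarrow> - V0 X) (at_right 0)))
     \<and>
     \<comment> \<open>(iv)\<close>
     (\<forall>X. C2_domain X \<longrightarrow>
        (\<lambda>a. lattice_expect (\<lambda>c v. a * (\<Sum>j\<in>{1..6}. w j * Ncount j X a c v)) - c3 w * V1 X / pi)
          \<in> O[at_right 0](\<lambda>a. a) \<and>
        (w 2 = w 5 \<longrightarrow>
          (\<lambda>a. lattice_expect (\<lambda>c v. a * (\<Sum>j\<in>{1..6}. w j * Ncount j X a c v)) - c3 w * V1 X / pi)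
            \<in> o[at_right 0](\<lambda>a. a)))"
proof -
  define W where "W = (2 - sqrt 2) * w 2 + (-2 + 2 * sqrt 2) * w 3 + (2 - sqrt 2) * w 5"
  have c3: "c3 w = 4 * W" by (simp add: c3_def W_def)
  have sum: "(\<Sum>j\<in>{1..6}. w j * Ncount j X a c v) =
      w 2 * Ncount 2 X a c v + w 3 * Ncount 3 X a c v + w 4 * Ncount 4 X a c v + w 5 * Ncount 5 X a c v" for X a c v
  proof -
    have "{1..6::nat} = {1, 2, 3, 4, 5, 6}" by auto
    then show ?thesis using w1 w6 by simp
  qed
  have main: "((\<lambda>a. EV0hat w X a - (1 / a) * (c3 w * V1 X / pi)) \<longlongrightarrow> c4 w * V0 X) (at_right 0)"
    if "C2_domain X" for X
    using C2_domain_expected_counts[OF that, of "w 2" "w 3" "w 4" "w 5"]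
    unfolding EV0hat_def sum c3_def c4_def by (simp add: algebra_simps)
  have pos: "\<forall>\<^sub>F a in at_right 0. a > (0::real)" by (rule eventually_at_right_less)
  have id0: "((\<lambda>a::real. a) \<longlongrightarrow> 0) (at_right 0)" by (rule tendsto_ident_at)
  have mul: "((\<lambda>b. b * EV0hat w X b) \<longlongrightarrow> c3 w * V1 X / pi) (at_right 0)" if "C2_domain X" for X
  proof -
    let ?K = "c3 w * V1 X / pi"
    have "((\<lambda>b. b * (EV0hat w X b - (1 / b) * ?K) + ?K) \<longlongrightarrow> 0 * (c4 w * V0 X) + ?K) (at_right 0)"
      by (intro tendsto_intros id0 main that)
    then have "((\<lambda>b. b * (EV0hat w X b - (1 / b) * ?K) + ?K) \<longlongrightarrow> ?K) (at_right 0)" by simp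
    then show ?thesis
      by (rule Lim_transform_eventually) (use pos in eventually_elim, simp add: right_diff_distrib)
  qed
  have lim: "(EV0hat w X \<longlongrightarrow> c4 w * V0 X) (at_right 0)" if "C2_domain X" "W = 0" for X
    using main[OF that(1)] that(2) by (simp add: c3)
  \<comment> \<open>A finite limit on the disk forces \<open>b * EV0hat\<close> to tend to 0, so the
    coefficient of the \<open>1 / a\<close> term vanishes; the positive boundary length leaves
    \<open>W = 0\<close>.\<close>
  have "W = 0" if "(EV0hat w (cball 0 1) \<longlongrightarrow> l) (at_right 0)" for l
  proof -
    have "((\<lambda>b. b * EV0hat w (cball 0 1) b) \<longlongrightarrow> 0 * l) (at_right 0)"
      by (intro tendsto_mult id0 that)
    then have "0 * l = c3 w * V1 (cball 0 1) / pi"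
      using mul[OF C2_domain_disk] by (rule tendsto_unique[OF trivial_limit_at_right_real])
    then show ?thesis using V1_disk_pos c3 by simp
  qed
  then have ii: "(\<forall>X. C2_domain X \<longrightarrow> (\<exists>L. (EV0hat w X \<longlongrightarrow> L) (at_right 0))) \<longleftrightarrow> W = 0"
    using lim C2_domain_disk by blast
  have ii': "(\<forall>X. C2_domain X \<longrightarrow> (EV0hat w X \<longlongrightarrow> V0 X) (at_right 0)) \<longleftrightarrow> c4 w = 1" if "W = 0"
  proof
    assume "\<forall>X. C2_domain X \<longrightarrow> (EV0hat w X \<longlongrightarrow> V0 X) (at_right 0)"
    then have "(EV0hat w (cball 0 1) \<longlongrightarrow> 1) (at_right 0)" using C2_domain_disk V0_disk by metis
    then have "1 = c4 w * V0 (cball 0 1)"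
      using lim[OF C2_domain_disk \<open>W = 0\<close>] by (rule tendsto_unique[OF trivial_limit_at_right_real])
    then show "c4 w = 1" by (simp add: V0_disk)
  next
    assume "c4 w = 1"
    then show "\<forall>X. C2_domain X \<longrightarrow> (EV0hat w X \<longlongrightarrow> V0 X) (at_right 0)" using lim \<open>W = 0\<close> by fastforce
  qed
  have iii: "((\<lambda>a. lattice_expect (\<lambda>c v. w 2 * Ncount 5 X a c v + w 3 * Ncount 3 X a c v
      + w 4 * Ncount 4 X a c v + w 5 * Ncount 2 X a c v)) \<longlongrightarrow> - V0 X) (at_right 0)"
    if "W = 0" "2 * w 2 - 2 * w 5 = 1" "C2_domain X" for X
  proof -
    \<comment> \<open>Passing to the complement exchanges \<open>w 2\<close> and \<open>w 5\<close>;
      this fixes the first condition and reverses the sign of the coefficient of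
      \<open>V0 X\<close>.\<close>
    have "(2 - sqrt 2) * w 5 + (-2 + 2 * sqrt 2) * w 3 + (2 - sqrt 2) * w 2 = 0" using that(1) by (simp add: W_def)
    moreover have "2 * (w 5 - w 2) = -1" using that(2) by simp
    ultimately have "((\<lambda>a. lattice_expect (\<lambda>c v. w 5 * Ncount 2 X a c v + w 3 * Ncount 3 X a c v
        + w 4 * Ncount 4 X a c v + w 2 * Ncount 5 X a c v)) \<longlongrightarrow> - V0 X) (at_right 0)"
      using C2_domain_expected_counts[OF that(3), of "w 5" "w 3" "w 4" "w 2"] by simp
    then show ?thesis by (simp add: add_ac)
  qed
  \<comment> \<open>The estimator of \<open>V1\<close> is \<open>a\<close> times that of
    \<open>V0\<close>, so its error divided by \<open>a\<close> is exactly the difference in (i),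
    which has the limit \<open>c4 w * V0 X\<close>; both Landau estimates follow.\<close>
  have q: "\<forall>\<^sub>F a in at_right 0. EV0hat w X a - (1 / a) * (c3 w * V1 X / pi) =
      (lattice_expect (\<lambda>c v. a * (\<Sum>j\<in>{1..6}. w j * Ncount j X a c v)) - c3 w * V1 X / pi) / a" for X
    using pos
  proof eventually_elim
    fix a :: real assume "a > 0"
    have "lattice_expect (\<lambda>c v. a * (\<Sum>j\<in>{1..6}. w j * Ncount j X a c v)) = a * EV0hat w X a"
      unfolding EV0hat_def lattice_expect_def case_prod_beta' by (rule integral_mult_right_zero)
    then show "EV0hat w X a - (1 / a) * (c3 w * V1 X / pi) =
      (lattice_expect (\<lambda>c v. a * (\<Sum>j\<in>{1..6}. w j * Ncount j X a c v)) - c3 w * V1 X / pi) / a"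
      using \<open>a > 0\<close> by (simp add: diff_divide_distrib)
  qed
  have iv: "((\<lambda>a. (lattice_expect (\<lambda>c v. a * (\<Sum>j\<in>{1..6}. w j * Ncount j X a c v)) - c3 w * V1 X / pi) / a)
      \<longlongrightarrow> c4 w * V0 X) (at_right 0)" if "C2_domain X" for X
    by (rule Lim_transform_eventually[OF main[OF that] q])
  have nz: "\<forall>\<^sub>F a in at_right 0. a \<noteq> (0::real)" using pos by eventually_elim simp
  have bigO: "(\<lambda>a. lattice_expect (\<lambda>c v. a * (\<Sum>j\<in>{1..6}. w j * Ncount j X a c v)) - c3 w * V1 X / pi)
      \<in> O[at_right 0](\<lambda>a. a)" if "C2_domain X" for X
    by (rule bigoI_tendsto[OF iv[OF that] nz])
  have smallo: "(\<lambda>a. lattice_expect (\<lambda>c v. a * (\<Sum>j\<in>{1..6}. w j * Ncount j X a c v)) - c3 w * V1 X / pi)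
      \<in> o[at_right 0](\<lambda>a. a)" if "C2_domain X" "w 2 = w 5" for X
    by (rule smalloI_tendsto[OF _ nz]) (use iv[OF that(1)] that(2) in \<open>simp add: c4_def\<close>)
  show ?thesis
    using main mul ii ii' iii bigO smallo unfolding W_def c4_def[of w] by blast
qed

end
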